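(* Using assumption (A1) and the ELISE filter of the context, one obtains the `virtual' equivalent system $$\dot x_e=A_ex_e+u_e+w_e,\qquad y_e=C_2x_e+v_2,$$ with $A_e:=\overline A+G_2M_2\grave R_2^\top R_2^{-1}C_2$, $\overline A:=(I-G_2M_2\overline C_2)\hat A-G_2M_2\overline T_2\overline{\overline C}$, $u_e=-G_2M_2\grave R_2^\top R_2^{-1}y_e$, $w_e=G_2M_2\grave R_2^\top R_2^{-1}v_2+\overline w$, $\overline w:=(I-G_2M_2\overline C_2)Ww-(I-G_2M_2\overline C_2)G_1M_1v_1-G_2M_2\overline v_2$, and equivalent noise covariances $\mathbb E[w_e(t)w_e^\top(t')]=Q_e(t)\delta(t-t')$, $\mathbb E[\overline w(t)\overline w^\top(t')]=\overline Q(t)\delta(t-t')$, $Q_e:=\overline Q-G_2M_2\grave R_2^\top R_2^{-1}\grave R_2M_2^\top G_2^\top$. If this equivalent system is such that (A2) it is uniformly completely observable (pair $(A_e,C_2)$), (A3) it is uniformly completely controllable (pair $(A_e,Q_e^{1/2})$), (A4) $\|Q_e\|$ and $\|R_2\|$ are bounded below and above by positive constants, (A5) $\|A_e\|$ is bounded above, then the optimal (ELISE) filter is uniformly asymptotically stable. Moreover, every solution to the variance equation given by the differential Riccati equation $\dot P^x=\overline AP^x+P^x\overline A^\top+\overline Q-LR_2L^\top$ starting at $\mathcal P_0^x\succ0$ converges to a unique $P^x$ as $t\to\infty$.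
   Context: **System.** All matrices and signals depend on time $t\ge t_0$ (argument omitted). $\dot x=Ax+Bu+Gd+Ww$, $y=Cx+Du+Hd+v$, with state $x\in\mathbb R^n$, known input $u\in\mathbb R^m$, unknown input $d\in\mathbb R^p$, output $y\in\mathbb R^l$, noises $w\in\mathbb R^q$, $v\in\mathbb R^l$; $A,B,G,C,D,W$ smooth, bounded, known; $H$ analytic, known, of constant rank $p_H$; $n\ge l\ge1$, $l\ge p\ge0$, $m\ge0$. $x(t_0)$ is independent of $v,w$, and an initial estimate $\hat x_0$ with covariance $\mathcal P_0^x$ is given. **Decoupling.** $H=[U_1\ U_2]\begin{bmatrix}\Sigma&0\\0&0\end{bmatrix}[V_1\ V_2]^\top$ is a singular value decomposition with $\Sigma\in\mathbb R^{p_H\times p_H}$ diagonal of full rank, $[U_1\ U_2]$, $[V_1\ V_2]$ unitary. $d_i=V_i^\top d$, $G_i=GV_i$; $T_1=U_1^\top-U_1^\top RU_2(U_2^\top RU_2)^{-1}U_2^\top$, $T_2=U_2^\top$; $z_i=T_iy$, $C_i=T_iC$, $D_i=T_iD$, $v_i=T_iv$, $R_i=T_iRT_i^\top$ ($i=1,2$). **Assumption (A1).** $w,v$ are mutually uncorrelated zero-mean white noises, $\mathbb E[w(t)w(t')^\top]=Q\delta(t-t')$, $\mathbb E[v(t)v(t')^\top]=R\delta(t-t')$, $\mathbb E[w(t)v(t')^\top]=0$, $Q\succeq0$, $R\succ0$. An additional measurement $\overline y=\overline C\dot x+\overline{\overline C}x+\overline D\dot u+\overline{\overline D}u+\overline H\dot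 d+\overline{\overline H}d+\overline v$ is available, with $\mathbb E[\overline v]=0$, $\mathbb E[w(t)\overline v(t')^\top]=0$, $\mathbb E[v(t)\overline v(t')^\top]=\grave R\delta(t-t')$, $\mathbb E[\overline v(t)\overline v(t')^\top]=\overline R\delta(t-t')$, $\overline R\succ0$, $\grave R$ known. With singular value decomposition $\overline H=[\overline U_1\ \overline U_2]\begin{bmatrix}\overline\Sigma&0\\0&0\end{bmatrix}[\overline V_1\ \overline V_2]^\top$ put $\overline T_2=\overline U_2^\top$ (so $\overline T_2\overline H=0$); also $\overline T_2\overline{\overline H}=0$ is assumed. $\overline z_2=\overline T_2\overline y$, $\overline C_2=\overline T_2\overline C$, $\overline D_2=\overline T_2\overline D$, $\overline v_2=\overline T_2\overline v$, $\overline R_2=\overline T_2\overline R\,\overline T_2^\top$, $\grave R_2=T_2\grave R\,\overline T_2^\top$, $\grave R_{12}=T_1\grave R\,\overline T_2^\top$. It is assumed ${\rm rk}(\overline C_2G_2)=p-p_H$. **ELISE filter.** $\hat d_1=M_1(z_1-C_1\hat x-D_1u)$, $\hat d_2=M_2(\overline z_2-(\overline C_2A+\overline T_2\overline{\overline C})\hat x-\overline C_2Bu-\overline C_2G_1\hat d_1-\overline D_2\dot u-\overline T_2\overline{\overline D}u)$, $\hat d=V_1\hat d_1+V_2\hat d_2$, $\dot{\hat x}=A\hat x+Bu+G_1\hat d_1+G_2\hat d_2+L(z_2-C_2\hat x-D_2u)$, $\hat x(t_0)=\hat x_0$, with $M_1=\Sigma^{-1}$, $\hat A=A-G_1M_1C_1$,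 $\hat Q=WQW^\top+G_1M_1R_1M_1^\top G_1^\top$, $\tilde R_2=(\overline C_2\hat A+\overline T_2\overline{\overline C})P^x(\overline C_2\hat A+\overline T_2\overline{\overline C})^\top+\overline C_2\hat Q\overline C_2^\top+\overline R_2-\grave R_{12}^\top M_1^\top G_1^\top\overline C_2^\top-\overline C_2G_1M_1\grave R_{12}$, $M_2=(G_2^\top\overline C_2^\top\tilde R_2^{-1}\overline C_2G_2)^{-1}G_2^\top\overline C_2^\top\tilde R_2^{-1}$, $\overline Q=(I-G_2M_2\overline C_2)\hat Q(I-G_2M_2\overline C_2)^\top+G_2M_2\overline R_2M_2^\top G_2^\top$, $L=(P^xC_2^\top-G_2M_2\grave R_2^\top)R_2^{-1}$, and $P^x$ solving the Riccati equation of the claim with $P^x(t_0)=\mathcal P_0^x$. **Stability.** The filter is called uniformly asymptotically stable if the linear system $\dot\xi=(\overline A-LC_2)\xi$ is uniformly asymptotically stable. **Uniform complete controllability/observability.** For bounded $X(t)$, the pair $(X,Y)$ is uniformly completely controllable if there exist $\epsilon>0$ and $\mu_1(\epsilon),\mu_2(\epsilon)>0$ such that for all $t\ge t_0$, $\mu_1(\epsilon)I\preceq\int_{t-\epsilon}^t\Phi_X(t,s)Y(s)Y(s)^\top\Phi_X^\top(t,s)ds\preceq\mu_2(\epsilon)I$, where $\Phi_X$ is the transition matrix of $\dot x=Xx$. The pair $(X,Z)$ is uniformly completely observable if its dual pair $(X^\top,Z^\top)$ is uniformly completely controllable.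
   Formalization: The noise covariances gain the omitted cross term of v1 and v̄2; (A4) also requires R2 ⪰ ρI for some ρ>0; observability uses the dual pair in reversed time; in the variance equation M2, Ā, Q̄ are those of the filter's P^x; Q, R and the other data are taken continuous in time. *)

theory Defs
  imports
    "HOL-Probability.Probability"
    "HOL-Library.Function_Algebras"
    "Jordan_Normal_Form.Matrix"
    "Jordan_Normal_Form.Gauss_Jordan_Elimination"
    "Jordan_Normal_Form.DL_Rank"
begin

unbundle no vec_syntax
unbundle no inner_syntax

section \<open>Matrices\<close>

text \<open>Matrices and vectors carry their dimensions as natural numbers, since several blocks of the
  decoupling may be empty (no unknown input, \<open>H = 0\<close>, \<open>H\<close> of full column rank, ...).\<close>

definition minv :: "real mat \<Rightarrow> real mat" where
  "minv A = (case mat_inverse A of Some B \<Rightarrow> B | None \<Rightarrow> 0\<^sub>m (dim_col A) (dim_row A))"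

definition mrank :: "real mat \<Rightarrow> nat" where
  "mrank A = vec_space.rank (dim_row A) A"

definition vnorm :: "real vec \<Rightarrow> real" where
  "vnorm x = sqrt (x \<bullet> x)"

definition mnorm :: "real mat \<Rightarrow> real" where
  "mnorm A = Sup {vnorm (A *\<^sub>v x) | x. x \<in> carrier_vec (dim_col A) \<and> vnorm x \<le> 1}"

definition psd :: "nat \<Rightarrow> real mat \<Rightarrow> bool" where
  "psd n A \<longleftrightarrow> A \<in> carrier_mat n n \<and> A\<^sup>T = A \<and> (\<forall>x \<in> carrier_vec n. 0 \<le> x \<bullet> (A *\<^sub>v x))"

definition pd :: "nat \<Rightarrow> real mat \<Rightarrow> bool" where
  "pd n A \<longleftrightarrow> A \<in> carrier_mat n n \<and> A\<^sup>T = A \<and>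
     (\<forall>x \<in> carrier_vec n. x \<noteq> 0\<^sub>v n \<longrightarrow> 0 < x \<bullet> (A *\<^sub>v x))"

definition loewner_le :: "nat \<Rightarrow> real mat \<Rightarrow> real mat \<Rightarrow> bool" where
  "loewner_le n A B \<longleftrightarrow> psd n (B - A)"

definition is_psd_sqrt :: "nat \<Rightarrow> real mat \<Rightarrow> real mat \<Rightarrow> bool" where
  "is_psd_sqrt n A S \<longleftrightarrow> psd n S \<and> S * S = A"

definition orthogonal_square :: "nat \<Rightarrow> real mat \<Rightarrow> bool" where
  "orthogonal_square n A \<longleftrightarrow> A \<in> carrier_mat n n \<and> A * A\<^sup>T = 1\<^sub>m n \<and> A\<^sup>T * A = 1\<^sub>m n"

definition hcat :: "real mat \<Rightarrow> real mat \<Rightarrow> real mat" where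
  "hcat A B = four_block_mat A B (0\<^sub>m 0 (dim_col A)) (0\<^sub>m 0 (dim_col B))"

text \<open>Singular value decomposition of an \<open>a \<times> b\<close> matrix with \<open>r\<close> nonzero singular values.  The
  singular values are not required to be sorted: along an analytic curve of matrices a
  decomposition depending continuously on time need not keep them in order.\<close>

definition is_svd ::
  "nat \<Rightarrow> nat \<Rightarrow> nat \<Rightarrow> real mat \<Rightarrow> real mat \<Rightarrow> real mat \<Rightarrow> real mat \<Rightarrow> real mat \<Rightarrow> real mat \<Rightarrow> bool" where
  "is_svd a b r N Ua Ub S Va Vb \<longleftrightarrow> r \<le> a \<and> r \<le> b \<and>
     Ua \<in> carrier_mat a r \<and> Ub \<in> carrier_mat a (a - r) \<and> S \<in> carrier_mat r r \<and>
     Va \<in> carrier_mat b r \<and> Vb \<in> carrier_mat b (b - r) \<and>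
     orthogonal_square a (hcat Ua Ub) \<and> orthogonal_square b (hcat Va Vb) \<and>
     diagonal_mat S \<and> (\<forall>i<r. 0 < S $$ (i, i)) \<and>
     N = hcat Ua Ub * four_block_mat S (0\<^sub>m r (b - r)) (0\<^sub>m (a - r) r) (0\<^sub>m (a - r) (b - r))
           * (hcat Va Vb)\<^sup>T"


section \<open>Matrix functions of time\<close>

definition mcarrier :: "(real \<Rightarrow> real mat) \<Rightarrow> nat \<Rightarrow> nat \<Rightarrow> bool" where
  "mcarrier F a b \<longleftrightarrow> (\<forall>t. F t \<in> carrier_mat a b)"

definition mcont :: "real set \<Rightarrow> (real \<Rightarrow> real mat) \<Rightarrow> nat \<Rightarrow> nat \<Rightarrow> bool" where
  "mcont T F a b \<longleftrightarrow> mcarrier F a b \<and> (\<forall>i<a. \<forall>j<b. continuous_on T (\<lambda>t. F t $$ (i, j)))"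

definition smooth_fn :: "real set \<Rightarrow> (real \<Rightarrow> real) \<Rightarrow> bool" where
  "smooth_fn T f \<longleftrightarrow> (\<exists>D :: nat \<Rightarrow> real \<Rightarrow> real. D 0 = f \<and>
     (\<forall>k. \<forall>t\<in>T. (D k has_real_derivative D (Suc k) t) (at t within T)))"

definition msmooth_bounded :: "real set \<Rightarrow> (real \<Rightarrow> real mat) \<Rightarrow> nat \<Rightarrow> nat \<Rightarrow> bool" where
  "msmooth_bounded T F a b \<longleftrightarrow> mcarrier F a b \<and>
     (\<forall>i<a. \<forall>j<b. smooth_fn T (\<lambda>t. F t $$ (i, j))) \<and> (\<exists>K. \<forall>t\<in>T. mnorm (F t) \<le> K)"

definition analytic_fn :: "real set \<Rightarrow> (real \<Rightarrow> real) \<Rightarrow> bool" where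
  "analytic_fn T f \<longleftrightarrow> (\<forall>t\<in>T. \<exists>r>0. \<exists>c :: nat \<Rightarrow> real.
     \<forall>s\<in>T. \<bar>s - t\<bar> < r \<longrightarrow> (\<lambda>k. c k * (s - t) ^ k) sums f s)"

definition manalytic :: "real set \<Rightarrow> (real \<Rightarrow> real mat) \<Rightarrow> nat \<Rightarrow> nat \<Rightarrow> bool" where
  "manalytic T F a b \<longleftrightarrow> mcarrier F a b \<and> (\<forall>i<a. \<forall>j<b. analytic_fn T (\<lambda>t. F t $$ (i, j)))"

definition mat_has_deriv :: "(real \<Rightarrow> real mat) \<Rightarrow> real mat \<Rightarrow> real \<Rightarrow> real set \<Rightarrow> bool" where
  "mat_has_deriv F D t T \<longleftrightarrow> (\<forall>i < dim_row D. \<forall>j < dim_col D.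
     ((\<lambda>s. F s $$ (i, j)) has_real_derivative D $$ (i, j)) (at t within T))"

definition mat_integral :: "nat \<Rightarrow> real set \<Rightarrow> (real \<Rightarrow> real mat) \<Rightarrow> real mat" where
  "mat_integral n I F = mat n n (\<lambda>(i, j). integral I (\<lambda>s. F s $$ (i, j)))"


section \<open>Linear time-varying systems on a time interval\<close>

definition is_transition ::
  "nat \<Rightarrow> real set \<Rightarrow> (real \<Rightarrow> real mat) \<Rightarrow> (real \<Rightarrow> real \<Rightarrow> real mat) \<Rightarrow> bool" where
  "is_transition n T X \<Phi> \<longleftrightarrow> (\<forall>s\<in>T. \<Phi> s s = 1\<^sub>m n \<and>
     (\<forall>t\<in>T. \<Phi> t s \<in> carrier_mat n n \<and> mat_has_deriv (\<lambda>r. \<Phi> r s) (X t * \<Phi> t s) t T))"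

text \<open>Only windows inside the time interval on which the matrices live are considered.\<close>

definition ucc ::
  "nat \<Rightarrow> real set \<Rightarrow> (real \<Rightarrow> real mat) \<Rightarrow> (real \<Rightarrow> real mat) \<Rightarrow> bool" where
  "ucc n T X Y \<longleftrightarrow> (\<exists>\<Phi>. is_transition n T X \<Phi> \<and>
     (\<exists>\<epsilon>>0. \<exists>\<mu>1>0. \<exists>\<mu>2>0. \<forall>t. {t - \<epsilon>..t} \<subseteq> T \<longrightarrow>
        (let W = mat_integral n {t - \<epsilon>..t} (\<lambda>s. \<Phi> t s * Y s * (Y s)\<^sup>T * (\<Phi> t s)\<^sup>T)
         in loewner_le n (\<mu>1 \<cdot>\<^sub>m 1\<^sub>m n) W \<and> loewner_le n W (\<mu>2 \<cdot>\<^sub>m 1\<^sub>m n))))"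

text \<open>The dual of \<open>(X, Z)\<close> is \<open>(X\<^sup>T, Z\<^sup>T)\<close> run in reversed time \<open>\<tau> = -t\<close> (Kalman and Bucy).  Its
  transition matrix is \<open>\<Phi>\<^sub>X(-\<sigma>, -\<tau>)\<^sup>T\<close>, so the controllability Gramian of the dual is the
  observability Gramian of \<open>(X, Z)\<close>.  Without the time reversal this fails for time-varying
  systems.\<close>

definition uco ::
  "nat \<Rightarrow> real set \<Rightarrow> (real \<Rightarrow> real mat) \<Rightarrow> (real \<Rightarrow> real mat) \<Rightarrow> bool" where
  "uco n T X Z \<longleftrightarrow> ucc n (uminus ` T) (\<lambda>\<tau>. (X (- \<tau>))\<^sup>T) (\<lambda>\<tau>. (Z (- \<tau>))\<^sup>T)"

definition lin_solution ::
  "nat \<Rightarrow> (real \<Rightarrow> real mat) \<Rightarrow> real \<Rightarrow> (real \<Rightarrow> real vec) \<Rightarrow> bool" where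
  "lin_solution n F s \<xi> \<longleftrightarrow> (\<forall>t\<ge>s. \<xi> t \<in> carrier_vec n \<and>
     (\<forall>i<n. ((\<lambda>r. \<xi> r $ i) has_real_derivative (F t *\<^sub>v \<xi> t) $ i) (at t within {s..})))"

text \<open>Uniform stability and uniform attractivity of the origin of \<open>\<xi>' = F \<xi>\<close>, \<open>t \<ge> t\<^sub>0\<close>.\<close>

definition uas :: "nat \<Rightarrow> real \<Rightarrow> (real \<Rightarrow> real mat) \<Rightarrow> bool" where
  "uas n t\<^sub>0 F \<longleftrightarrow>
     (\<forall>\<epsilon>>0. \<exists>\<delta>>0. \<forall>s\<ge>t\<^sub>0. \<forall>\<xi>. lin_solution n F s \<xi> \<and> vnorm (\<xi> s) < \<delta> \<longrightarrow>
        (\<forall>t\<ge>s. vnorm (\<xi> t) < \<epsilon>)) \<and>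
     (\<exists>c>0. \<forall>\<eta>>0. \<exists>\<theta>>0. \<forall>s\<ge>t\<^sub>0. \<forall>\<xi>. lin_solution n F s \<xi> \<and> vnorm (\<xi> s) < c \<longrightarrow>
        (\<forall>t\<ge>s + \<theta>. vnorm (\<xi> t) < \<eta>))"


section \<open>Generalized stochastic processes\<close>

text \<open>White noise has no sample functions, so signals are generalized processes on \<open>[t\<^sub>0, \<infinity>)\<close>: a
  process \<open>X\<close> with values in \<open>\<real>\<^sup>a\<close> assigns to each continuous compactly supported test function
  \<open>\<phi>\<close> the random variable \<open>X \<phi>\<close>, to be read as the integral of \<open>\<phi>(t)\<^sup>T X(t)\<close>.\<close>

type_synonym 'w gproc = "(real \<Rightarrow> real vec) \<Rightarrow> 'w \<Rightarrow> real"

definition test :: "real \<Rightarrow> nat \<Rightarrow> (real \<Rightarrow> real vec) set" where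
  "test t\<^sub>0 a = {\<phi>. (\<forall>t. \<phi> t \<in> carrier_vec a) \<and> (\<forall>i<a. continuous_on {t\<^sub>0..} (\<lambda>t. \<phi> t $ i)) \<and>
     (\<exists>b. \<forall>t. t < t\<^sub>0 \<or> b < t \<longrightarrow> \<phi> t = 0\<^sub>v a)}"

definition gproc :: "'w measure \<Rightarrow> real \<Rightarrow> nat \<Rightarrow> 'w gproc \<Rightarrow> bool" where
  "gproc M t\<^sub>0 a X \<longleftrightarrow> (\<forall>\<phi>\<in>test t\<^sub>0 a. X \<phi> \<in> borel_measurable M) \<and>
     (\<forall>\<phi>\<in>test t\<^sub>0 a. \<forall>\<psi>\<in>test t\<^sub>0 a. \<forall>c d.
        AE \<omega> in M. X (\<lambda>t. c \<cdot>\<^sub>v \<phi> t + d \<cdot>\<^sub>v \<psi> t) \<omega> = c * X \<phi> \<omega> + d * X \<psi> \<omega>)"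

definition gp_eq :: "'w measure \<Rightarrow> real \<Rightarrow> nat \<Rightarrow> 'w gproc \<Rightarrow> 'w gproc \<Rightarrow> bool" where
  "gp_eq M t\<^sub>0 a X Y \<longleftrightarrow> (\<forall>\<phi>\<in>test t\<^sub>0 a. AE \<omega> in M. X \<phi> \<omega> = Y \<phi> \<omega>)"

text \<open>Multiplication by a matrix function acts on the test function through the transpose.\<close>

definition gp_mult :: "(real \<Rightarrow> real mat) \<Rightarrow> 'w gproc \<Rightarrow> 'w gproc" (infixr "*\<^sub>g" 75) where
  "F *\<^sub>g X = (\<lambda>\<phi>. X (\<lambda>t. (F t)\<^sup>T *\<^sub>v \<phi> t))"

text \<open>\<open>X\<close> has derivative \<open>DX\<close> and initial value \<open>x\<^sub>0\<close> at \<open>t\<^sub>0\<close>, by partial integration against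
  continuously differentiable test functions that need not vanish at \<open>t\<^sub>0\<close>.\<close>

definition gp_deriv ::
  "'w measure \<Rightarrow> real \<Rightarrow> nat \<Rightarrow> 'w gproc \<Rightarrow> ('w \<Rightarrow> real vec) \<Rightarrow> 'w gproc \<Rightarrow> bool" where
  "gp_deriv M t\<^sub>0 a X x\<^sub>0 DX \<longleftrightarrow> (\<forall>\<phi>\<in>test t\<^sub>0 a. \<forall>\<phi>'\<in>test t\<^sub>0 a.
     (\<forall>i<a. \<forall>t\<ge>t\<^sub>0. ((\<lambda>s. \<phi> s $ i) has_real_derivative \<phi>' t $ i) (at t within {t\<^sub>0..})) \<longrightarrow>
     (AE \<omega> in M. DX \<phi> \<omega> = - X \<phi>' \<omega> - x\<^sub>0 \<omega> \<bullet> \<phi> t\<^sub>0))"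

definition random_vec :: "'w measure \<Rightarrow> nat \<Rightarrow> ('w \<Rightarrow> real vec) \<Rightarrow> bool" where
  "random_vec M a X \<longleftrightarrow> (\<forall>\<omega>. X \<omega> \<in> carrier_vec a) \<and> (\<forall>i<a. (\<lambda>\<omega>. X \<omega> $ i) \<in> borel_measurable M)"

definition zero_mean :: "'w measure \<Rightarrow> real \<Rightarrow> nat \<Rightarrow> 'w gproc \<Rightarrow> bool" where
  "zero_mean M t\<^sub>0 a X \<longleftrightarrow>
     (\<forall>\<phi>\<in>test t\<^sub>0 a. integrable M (X \<phi>) \<and> (\<integral>\<omega>. X \<phi> \<omega> \<partial>M) = 0)"

text \<open>\<open>E[X(t) Y(t')\<^sup>T] = K(t) \<delta>(t - t')\<close>, tested against \<open>\<phi>(t)\<close> on the left and \<open>\<psi>(t')\<close> on the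
  right.\<close>

definition delta_cov ::
  "'w measure \<Rightarrow> real \<Rightarrow> nat \<Rightarrow> nat \<Rightarrow> 'w gproc \<Rightarrow> 'w gproc \<Rightarrow> (real \<Rightarrow> real mat) \<Rightarrow> bool" where
  "delta_cov M t\<^sub>0 a b X Y K \<longleftrightarrow> (\<forall>\<phi>\<in>test t\<^sub>0 a. \<forall>\<psi>\<in>test t\<^sub>0 b.
     integrable M (\<lambda>\<omega>. X \<phi> \<omega> * Y \<psi> \<omega>) \<and>
     (\<integral>\<omega>. X \<phi> \<omega> * Y \<psi> \<omega> \<partial>M) = integral {t\<^sub>0..} (\<lambda>t. \<phi> t \<bullet> (K t *\<^sub>v \<psi> t)))"

definition sigma_of :: "'w measure \<Rightarrow> ('w \<Rightarrow> real) set \<Rightarrow> 'w set set" where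
  "sigma_of M \<F> = sigma_sets (space M) {f -` B \<inter> space M | f B. f \<in> \<F> \<and> B \<in> sets borel}"


section \<open>Model data\<close>

text \<open>Suffix \<open>b\<close> refers to the additional measurement: \<open>Cb\<close>, \<open>Db\<close>, \<open>Hb\<close> multiply the derivatives of
  state and inputs (single bar), \<open>Cbb\<close>, \<open>Dbb\<close>, \<open>Hbb\<close> the undifferentiated signals (double bar).
  \<open>Rb\<close> is the covariance of its noise and \<open>Rg\<close> (grave accent) the cross covariance with the
  output noise.\<close>

record elise_model =
  t0 :: real
  nx :: nat
  nu :: nat
  nd :: nat
  ny :: nat
  nw :: nat
  nyb :: nat
  rH :: nat
  rHb :: nat
  Am :: "real \<Rightarrow> real mat"
  Bm :: "real \<Rightarrow> real mat"
  Gm :: "real \<Rightarrow> real mat"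
  Cm :: "real \<Rightarrow> real mat"
  Dm :: "real \<Rightarrow> real mat"
  Hm :: "real \<Rightarrow> real mat"
  Wm :: "real \<Rightarrow> real mat"
  Qm :: "real \<Rightarrow> real mat"
  Rm :: "real \<Rightarrow> real mat"
  Cb :: "real \<Rightarrow> real mat"
  Cbb :: "real \<Rightarrow> real mat"
  Db :: "real \<Rightarrow> real mat"
  Dbb :: "real \<Rightarrow> real mat"
  Hb :: "real \<Rightarrow> real mat"
  Hbb :: "real \<Rightarrow> real mat"
  Rb :: "real \<Rightarrow> real mat"
  Rg :: "real \<Rightarrow> real mat"
  U1 :: "real \<Rightarrow> real mat"
  U2 :: "real \<Rightarrow> real mat"
  Sig :: "real \<Rightarrow> real mat"
  V1 :: "real \<Rightarrow> real mat"
  V2 :: "real \<Rightarrow> real mat"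
  Ub1 :: "real \<Rightarrow> real mat"
  Ub2 :: "real \<Rightarrow> real mat"
  Sigb :: "real \<Rightarrow> real mat"
  Vb1 :: "real \<Rightarrow> real mat"
  Vb2 :: "real \<Rightarrow> real mat"

abbreviation horizon :: "'m elise_model_scheme \<Rightarrow> real set" where
  "horizon E \<equiv> {t0 E..}"

definition G1 where "G1 E t = Gm E t * V1 E t"
definition G2 where "G2 E t = Gm E t * V2 E t"
definition T1 where
  "T1 E t = (U1 E t)\<^sup>T -
     (U1 E t)\<^sup>T * Rm E t * U2 E t * minv ((U2 E t)\<^sup>T * Rm E t * U2 E t) * (U2 E t)\<^sup>T"
definition T2 where "T2 E t = (U2 E t)\<^sup>T"
definition C1 where "C1 E t = T1 E t * Cm E t"
definition C2 where "C2 E t = T2 E t * Cm E t"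
definition D1 where "D1 E t = T1 E t * Dm E t"
definition D2 where "D2 E t = T2 E t * Dm E t"
definition R1 where "R1 E t = T1 E t * Rm E t * (T1 E t)\<^sup>T"
definition R2 where "R2 E t = T2 E t * Rm E t * (T2 E t)\<^sup>T"

definition Tb2 where "Tb2 E t = (Ub2 E t)\<^sup>T"
definition Cb2 where "Cb2 E t = Tb2 E t * Cb E t"
definition Db2 where "Db2 E t = Tb2 E t * Db E t"
definition Rb2 where "Rb2 E t = Tb2 E t * Rb E t * (Tb2 E t)\<^sup>T"
definition Rg2 where "Rg2 E t = T2 E t * Rg E t * (Tb2 E t)\<^sup>T"
definition Rg12 where "Rg12 E t = T1 E t * Rg E t * (Tb2 E t)\<^sup>T"

definition standing_assms :: "'m elise_model_scheme \<Rightarrow> bool" where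
  "standing_assms E \<longleftrightarrow>
     1 \<le> ny E \<and> ny E \<le> nx E \<and> nd E \<le> ny E \<and>
     msmooth_bounded (horizon E) (Am E) (nx E) (nx E) \<and>
     msmooth_bounded (horizon E) (Bm E) (nx E) (nu E) \<and>
     msmooth_bounded (horizon E) (Gm E) (nx E) (nd E) \<and>
     msmooth_bounded (horizon E) (Cm E) (ny E) (nx E) \<and>
     msmooth_bounded (horizon E) (Dm E) (ny E) (nu E) \<and>
     msmooth_bounded (horizon E) (Wm E) (nx E) (nw E) \<and>
     manalytic (horizon E) (Hm E) (ny E) (nd E) \<and>
     (\<forall>t\<ge>t0 E. mrank (Hm E t) = rH E) \<and>
     (\<forall>t\<ge>t0 E. is_svd (ny E) (nd E) (rH E) (Hm E t) (U1 E t) (U2 E t) (Sig E t) (V1 E t) (V2 E t)) \<and>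
     mcont (horizon E) (U1 E) (ny E) (rH E) \<and>
     mcont (horizon E) (U2 E) (ny E) (ny E - rH E) \<and>
     mcont (horizon E) (Sig E) (rH E) (rH E) \<and>
     mcont (horizon E) (V1 E) (nd E) (rH E) \<and>
     mcont (horizon E) (V2 E) (nd E) (nd E - rH E)"

definition noise_and_measurement_assms :: "'m elise_model_scheme \<Rightarrow> bool" where
  "noise_and_measurement_assms E \<longleftrightarrow>
     mcont (horizon E) (Qm E) (nw E) (nw E) \<and>
     mcont (horizon E) (Rm E) (ny E) (ny E) \<and>
     mcont (horizon E) (Rb E) (nyb E) (nyb E) \<and>
     mcont (horizon E) (Rg E) (ny E) (nyb E) \<and>
     (\<forall>t\<ge>t0 E. psd (nw E) (Qm E t) \<and> pd (ny E) (Rm E t) \<and> pd (nyb E) (Rb E t)) \<and>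
     mcont (horizon E) (Cb E) (nyb E) (nx E) \<and>
     mcont (horizon E) (Cbb E) (nyb E) (nx E) \<and>
     mcont (horizon E) (Db E) (nyb E) (nu E) \<and>
     mcont (horizon E) (Dbb E) (nyb E) (nu E) \<and>
     mcont (horizon E) (Hb E) (nyb E) (nd E) \<and>
     mcont (horizon E) (Hbb E) (nyb E) (nd E) \<and>
     (\<forall>t\<ge>t0 E. is_svd (nyb E) (nd E) (rHb E) (Hb E t)
        (Ub1 E t) (Ub2 E t) (Sigb E t) (Vb1 E t) (Vb2 E t)) \<and>
     mcont (horizon E) (Ub2 E) (nyb E) (nyb E - rHb E) \<and>
     (\<forall>t\<ge>t0 E. Tb2 E t * Hbb E t = 0\<^sub>m (nyb E - rHb E) (nd E)) \<and>
     (\<forall>t\<ge>t0 E. mrank (Cb2 E t * G2 E t) = nd E - rH E)"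

definition noise_processes ::
  "'m elise_model_scheme \<Rightarrow> 'w measure \<Rightarrow> 'w gproc \<Rightarrow> 'w gproc \<Rightarrow> 'w gproc \<Rightarrow> bool" where
  "noise_processes E M w v vb \<longleftrightarrow>
     gproc M (t0 E) (nw E) w \<and> gproc M (t0 E) (ny E) v \<and> gproc M (t0 E) (nyb E) vb \<and>
     zero_mean M (t0 E) (nw E) w \<and> zero_mean M (t0 E) (ny E) v \<and> zero_mean M (t0 E) (nyb E) vb \<and>
     delta_cov M (t0 E) (nw E) (nw E) w w (Qm E) \<and>
     delta_cov M (t0 E) (ny E) (ny E) v v (Rm E) \<and>
     delta_cov M (t0 E) (nw E) (ny E) w v (\<lambda>t. 0\<^sub>m (nw E) (ny E)) \<and>
     delta_cov M (t0 E) (nw E) (nyb E) w vb (\<lambda>t. 0\<^sub>m (nw E) (nyb E)) \<and>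
     delta_cov M (t0 E) (ny E) (nyb E) v vb (Rg E) \<and>
     delta_cov M (t0 E) (nyb E) (nyb E) vb vb (Rb E)"

definition initial_state ::
  "'m elise_model_scheme \<Rightarrow> 'w measure \<Rightarrow> 'w gproc \<Rightarrow> 'w gproc \<Rightarrow>
   ('w \<Rightarrow> real vec) \<Rightarrow> ('w \<Rightarrow> real vec) \<Rightarrow> real mat \<Rightarrow> bool" where
  "initial_state E M w v x\<^sub>0 xh\<^sub>0 P\<^sub>0 \<longleftrightarrow>
     random_vec M (nx E) x\<^sub>0 \<and> random_vec M (nx E) xh\<^sub>0 \<and>
     prob_space.indep_set M
       (sigma_of M {\<lambda>\<omega>. x\<^sub>0 \<omega> $ i | i. i < nx E})
       (sigma_of M ({w \<phi> | \<phi>. \<phi> \<in> test (t0 E) (nw E)} \<union> {v \<phi> | \<phi>. \<phi> \<in> test (t0 E) (ny E)})) \<and>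
     P\<^sub>0 \<in> carrier_mat (nx E) (nx E) \<and>
     (\<forall>i<nx E. \<forall>j<nx E.
        integrable M (\<lambda>\<omega>. (x\<^sub>0 \<omega> - xh\<^sub>0 \<omega>) $ i * (x\<^sub>0 \<omega> - xh\<^sub>0 \<omega>) $ j) \<and>
        (\<integral>\<omega>. (x\<^sub>0 \<omega> - xh\<^sub>0 \<omega>) $ i * (x\<^sub>0 \<omega> - xh\<^sub>0 \<omega>) $ j \<partial>M) = P\<^sub>0 $$ (i, j))"

definition plant ::
  "'m elise_model_scheme \<Rightarrow> 'w measure \<Rightarrow> 'w gproc \<Rightarrow> 'w gproc \<Rightarrow> 'w gproc \<Rightarrow>
   'w gproc \<Rightarrow> ('w \<Rightarrow> real vec) \<Rightarrow> 'w gproc \<Rightarrow> 'w gproc \<Rightarrow> 'w gproc \<Rightarrow> 'w gproc \<Rightarrow> 'w gproc \<Rightarrow>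
   'w gproc \<Rightarrow> 'w gproc \<Rightarrow> bool" where
  "plant E M w v vb x x\<^sub>0 dx u du d dd y yb \<longleftrightarrow>
     gproc M (t0 E) (nx E) x \<and> gproc M (t0 E) (nx E) dx \<and>
     gproc M (t0 E) (nu E) u \<and> gproc M (t0 E) (nu E) du \<and>
     gproc M (t0 E) (nd E) d \<and> gproc M (t0 E) (nd E) dd \<and>
     gproc M (t0 E) (ny E) y \<and> gproc M (t0 E) (nyb E) yb \<and>
     gp_deriv M (t0 E) (nx E) x x\<^sub>0 dx \<and>
     (\<exists>u\<^sub>0. random_vec M (nu E) u\<^sub>0 \<and> gp_deriv M (t0 E) (nu E) u u\<^sub>0 du) \<and>
     (\<exists>d\<^sub>0. random_vec M (nd E) d\<^sub>0 \<and> gp_deriv M (t0 E) (nd E) d d\<^sub>0 dd) \<and>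
     gp_eq M (t0 E) (nx E) dx (Am E *\<^sub>g x + Bm E *\<^sub>g u + Gm E *\<^sub>g d + Wm E *\<^sub>g w) \<and>
     gp_eq M (t0 E) (ny E) y (Cm E *\<^sub>g x + Dm E *\<^sub>g u + Hm E *\<^sub>g d + v) \<and>
     gp_eq M (t0 E) (nyb E) yb
       (Cb E *\<^sub>g dx + Cbb E *\<^sub>g x + Db E *\<^sub>g du + Dbb E *\<^sub>g u + Hb E *\<^sub>g dd + Hbb E *\<^sub>g d + vb)"


section \<open>The filter\<close>

text \<open>\<open>Px\<close> is the covariance trajectory that the filter propagates; the gain \<open>M2\<close> depends on it,
  and through \<open>M2\<close> so do \<open>Abar\<close>, \<open>Qbar\<close>, \<open>Ae\<close> and \<open>Qe\<close>.\<close>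

definition M1 where "M1 E t = minv (Sig E t)"
definition Ahat where "Ahat E t = Am E t - G1 E t * M1 E t * C1 E t"
definition Qhat where
  "Qhat E t = Wm E t * Qm E t * (Wm E t)\<^sup>T +
     G1 E t * M1 E t * R1 E t * (M1 E t)\<^sup>T * (G1 E t)\<^sup>T"
definition Rtil2 where
  "Rtil2 E Px t =
     (Cb2 E t * Ahat E t + Tb2 E t * Cbb E t) * Px t * (Cb2 E t * Ahat E t + Tb2 E t * Cbb E t)\<^sup>T
     + Cb2 E t * Qhat E t * (Cb2 E t)\<^sup>T + Rb2 E t
     - (Rg12 E t)\<^sup>T * (M1 E t)\<^sup>T * (G1 E t)\<^sup>T * (Cb2 E t)\<^sup>T
     - Cb2 E t * G1 E t * M1 E t * Rg12 E t"
definition M2 where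
  "M2 E Px t =
     minv ((G2 E t)\<^sup>T * (Cb2 E t)\<^sup>T * minv (Rtil2 E Px t) * Cb2 E t * G2 E t)
     * (G2 E t)\<^sup>T * (Cb2 E t)\<^sup>T * minv (Rtil2 E Px t)"
definition N2 where "N2 E Px t = 1\<^sub>m (nx E) - G2 E t * M2 E Px t * Cb2 E t"
definition Qbar where
  "Qbar E Px t = N2 E Px t * Qhat E t * (N2 E Px t)\<^sup>T +
     G2 E t * M2 E Px t * Rb2 E t * (M2 E Px t)\<^sup>T * (G2 E t)\<^sup>T"
definition Abar where
  "Abar E Px t = N2 E Px t * Ahat E t - G2 E t * M2 E Px t * Tb2 E t * Cbb E t"

text \<open>The gain \<open>L\<close> built from a covariance \<open>P\<close>, while \<open>M2\<close> is built from \<open>Px\<close>; the filter itself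
  uses \<open>gain E Px Px\<close>.\<close>

definition gain where
  "gain E Px P t =
     (P t * (C2 E t)\<^sup>T - G2 E t * M2 E Px t * (Rg2 E t)\<^sup>T) * minv (R2 E t)"

text \<open>The variance equation of the equivalent system: the coefficients \<open>Abar\<close>, \<open>Qbar\<close>, \<open>M2\<close> are the
  time functions produced by the filter, and \<open>P\<close> is an arbitrary solution.  The filter's own
  covariance is characterized by \<open>solves_riccati E Px Px\<close>.\<close>

definition solves_riccati ::
  "'m elise_model_scheme \<Rightarrow> (real \<Rightarrow> real mat) \<Rightarrow> (real \<Rightarrow> real mat) \<Rightarrow> bool" where
  "solves_riccati E Px P \<longleftrightarrow> (\<forall>t\<ge>t0 E. P t \<in> carrier_mat (nx E) (nx E) \<and>
     mat_has_deriv P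
       (Abar E Px t * P t + P t * (Abar E Px t)\<^sup>T + Qbar E Px t
        - gain E Px P t * R2 E t * (gain E Px P t)\<^sup>T)
       t (horizon E))"

text \<open>\<open>Rtil2\<close> must be nonsingular for \<open>M2\<close> to make sense; being a covariance, it is then positive
  definite.\<close>

definition elise_filter ::
  "'m elise_model_scheme \<Rightarrow> 'w measure \<Rightarrow> (real \<Rightarrow> real mat) \<Rightarrow> real mat \<Rightarrow>
   'w gproc \<Rightarrow> 'w gproc \<Rightarrow> 'w gproc \<Rightarrow> 'w gproc \<Rightarrow>
   'w gproc \<Rightarrow> ('w \<Rightarrow> real vec) \<Rightarrow> 'w gproc \<Rightarrow> 'w gproc \<Rightarrow> 'w gproc \<Rightarrow> bool" where
  "elise_filter E M Px P\<^sub>0 u du y yb xh xh\<^sub>0 dh1 dh2 dh \<longleftrightarrow>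
     Px (t0 E) = P\<^sub>0 \<and> solves_riccati E Px Px \<and>
     (\<forall>t\<ge>t0 E. pd (nyb E - rHb E) (Rtil2 E Px t)) \<and>
     gproc M (t0 E) (nx E) xh \<and> gproc M (t0 E) (rH E) dh1 \<and>
     gproc M (t0 E) (nd E - rH E) dh2 \<and> gproc M (t0 E) (nd E) dh \<and>
     gp_eq M (t0 E) (rH E) dh1 (M1 E *\<^sub>g (T1 E *\<^sub>g y - C1 E *\<^sub>g xh - D1 E *\<^sub>g u)) \<and>
     gp_eq M (t0 E) (nd E - rH E) dh2
       (M2 E Px *\<^sub>g (Tb2 E *\<^sub>g yb
          - (\<lambda>t. Cb2 E t * Am E t + Tb2 E t * Cbb E t) *\<^sub>g xh
          - (\<lambda>t. Cb2 E t * Bm E t) *\<^sub>g u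
          - (\<lambda>t. Cb2 E t * G1 E t) *\<^sub>g dh1
          - Db2 E *\<^sub>g du
          - (\<lambda>t. Tb2 E t * Dbb E t) *\<^sub>g u)) \<and>
     gp_eq M (t0 E) (nd E) dh (V1 E *\<^sub>g dh1 + V2 E *\<^sub>g dh2) \<and>
     gp_deriv M (t0 E) (nx E) xh xh\<^sub>0
       (Am E *\<^sub>g xh + Bm E *\<^sub>g u + G1 E *\<^sub>g dh1 + G2 E *\<^sub>g dh2
        + gain E Px Px *\<^sub>g (T2 E *\<^sub>g y - C2 E *\<^sub>g xh - D2 E *\<^sub>g u))"


section \<open>The equivalent system\<close>

definition decor where
  "decor E Px t = G2 E t * M2 E Px t * (Rg2 E t)\<^sup>T * minv (R2 E t)"

definition Ae where "Ae E Px t = Abar E Px t + decor E Px t * C2 E t"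
definition Qe where
  "Qe E Px t = Qbar E Px t - decor E Px t * Rg2 E t * (M2 E Px t)\<^sup>T * (G2 E t)\<^sup>T"

definition wbar ::
  "'m elise_model_scheme \<Rightarrow> (real \<Rightarrow> real mat) \<Rightarrow> 'w gproc \<Rightarrow> 'w gproc \<Rightarrow> 'w gproc \<Rightarrow> 'w gproc" where
  "wbar E Px w v vb =
     (\<lambda>t. N2 E Px t * Wm E t) *\<^sub>g w
     - (\<lambda>t. N2 E Px t * G1 E t * M1 E t) *\<^sub>g (T1 E *\<^sub>g v)
     - (\<lambda>t. G2 E t * M2 E Px t) *\<^sub>g (Tb2 E *\<^sub>g vb)"

definition we ::
  "'m elise_model_scheme \<Rightarrow> (real \<Rightarrow> real mat) \<Rightarrow> 'w gproc \<Rightarrow> 'w gproc \<Rightarrow> 'w gproc \<Rightarrow> 'w gproc" where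
  "we E Px w v vb = decor E Px *\<^sub>g (T2 E *\<^sub>g v) + wbar E Px w v vb"

text \<open>Contribution of the correlation between \<open>v\<^sub>1\<close> and the noise of the additional measurement to
  the covariance of \<open>wbar\<close>.  It does not appear in \<open>Qbar\<close>.\<close>

definition cross where
  "cross E Px t = N2 E Px t * G1 E t * M1 E t * Rg12 E t * (M2 E Px t)\<^sup>T * (G2 E t)\<^sup>T"

definition virtual_system ::
  "'m elise_model_scheme \<Rightarrow> 'w measure \<Rightarrow> (real \<Rightarrow> real mat) \<Rightarrow> 'w gproc \<Rightarrow> 'w gproc \<Rightarrow> 'w gproc \<Rightarrow>
   'w gproc \<Rightarrow> ('w \<Rightarrow> real vec) \<Rightarrow> 'w gproc \<Rightarrow> 'w gproc \<Rightarrow> bool" where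
  "virtual_system E M Px w v vb xe xe\<^sub>0 ye ue \<longleftrightarrow>
     gproc M (t0 E) (nx E) xe \<and> random_vec M (nx E) xe\<^sub>0 \<and>
     gproc M (t0 E) (ny E - rH E) ye \<and> gproc M (t0 E) (nx E) ue \<and>
     gp_deriv M (t0 E) (nx E) xe xe\<^sub>0 (Ae E Px *\<^sub>g xe + ue + we E Px w v vb) \<and>
     gp_eq M (t0 E) (ny E - rH E) ye (C2 E *\<^sub>g xe + T2 E *\<^sub>g v) \<and>
     gp_eq M (t0 E) (nx E) ue (- (decor E Px *\<^sub>g ye))"

text \<open>The Kalman-Bucy filter of the virtual system, in which \<open>ue\<close> is a known input.\<close>

definition kalman_bucy_filter ::
  "'m elise_model_scheme \<Rightarrow> 'w measure \<Rightarrow> (real \<Rightarrow> real mat) \<Rightarrow>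
   'w gproc \<Rightarrow> 'w gproc \<Rightarrow> 'w gproc \<Rightarrow> ('w \<Rightarrow> real vec) \<Rightarrow> bool" where
  "kalman_bucy_filter E M Px ye ue xhe xhe\<^sub>0 \<longleftrightarrow>
     gproc M (t0 E) (nx E) xhe \<and> random_vec M (nx E) xhe\<^sub>0 \<and>
     gp_deriv M (t0 E) (nx E) xhe xhe\<^sub>0
       (Ae E Px *\<^sub>g xhe + ue
        + (\<lambda>t. Px t * (C2 E t)\<^sup>T * minv (R2 E t)) *\<^sub>g (ye - C2 E *\<^sub>g xhe))"

definition error_dynamics ::
  "'m elise_model_scheme \<Rightarrow> 'w measure \<Rightarrow> (real \<Rightarrow> real mat) \<Rightarrow> 'w gproc \<Rightarrow> 'w gproc \<Rightarrow> 'w gproc \<Rightarrow>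
   'w gproc \<Rightarrow> ('w \<Rightarrow> real vec) \<Rightarrow> bool" where
  "error_dynamics E M Px w v vb e e\<^sub>0 \<longleftrightarrow>
     gp_deriv M (t0 E) (nx E) e e\<^sub>0
       ((\<lambda>t. Abar E Px t - gain E Px Px t * C2 E t) *\<^sub>g e
        + wbar E Px w v vb - gain E Px Px *\<^sub>g (T2 E *\<^sub>g v))"

definition filter_uas :: "'m elise_model_scheme \<Rightarrow> (real \<Rightarrow> real mat) \<Rightarrow> bool" where
  "filter_uas E Px \<longleftrightarrow> uas (nx E) (t0 E) (\<lambda>t. Abar E Px t - gain E Px Px t * C2 E t)"

definition approaches :: "(real \<Rightarrow> real mat) \<Rightarrow> (real \<Rightarrow> real mat) \<Rightarrow> bool" where
  "approaches P P' \<longleftrightarrow> ((\<lambda>t. mnorm (P t - P' t)) \<longlongrightarrow> 0) at_top"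

definition norm_bounded_below_above :: "real set \<Rightarrow> (real \<Rightarrow> real mat) \<Rightarrow> bool" where
  "norm_bounded_below_above T F \<longleftrightarrow>
     (\<exists>\<alpha>>0. \<exists>\<beta>>0. \<forall>t\<in>T. \<alpha> \<le> mnorm (F t) \<and> mnorm (F t) \<le> \<beta>)"

text \<open>Boundedness from below in the semidefinite order.  A lower bound on the norm controls only the
  largest eigenvalue; a noise covariance with another eigenvalue tending to \<open>0\<close> gives unbounded
  gains and, for outputs of dimension at least two, transients that are not uniformly bounded.\<close>

definition uniformly_pd :: "nat \<Rightarrow> real set \<Rightarrow> (real \<Rightarrow> real mat) \<Rightarrow> bool" where
  "uniformly_pd n T F \<longleftrightarrow> (\<exists>\<rho>>0. \<forall>t\<in>T. loewner_le n (\<rho> \<cdot>\<^sub>m 1\<^sub>m n) (F t))"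

end

theory Submission imports Defs begin

text \<open>
  The theorem has a probabilistic part, about the error of the filter and of the equivalent system,
  and a deterministic part, about a matrix Riccati equation.

  \<^bold>\<open>Errors and covariances.\<close>  Multiplying the output by \<open>T1\<close> and \<open>T2\<close> separates the directions in
  which the unknown input is seen.  The gains satisfy \<open>M1 Sig = 1\<close> and \<open>M2 (Cb2 G2) = 1\<close>, so the two
  input estimates reproduce the components of \<open>d\<close> exactly, up to the estimation error and noise, and
  \<open>d\<close> cancels from the error equation (\<open>filter_error\<close>).  In the equivalent system the feedback
  \<open>decor\<close> is added to the dynamics through \<open>ye\<close> and taken away again by the filter, which leaves the
  same error equation (\<open>virtual_error\<close>).  Signals are generalized processes, on which a coefficient
  acts by its transpose on test functions; all these manipulations are therefore linear algebra of
  test functions, up to null sets.  The noise covariances follow from bilinearity.  Two facts decide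
  which terms survive: \<open>T1 R T2\<^sup>T = 0\<close>, and \<open>decor R2 = G2 M2 Rg2\<^sup>T\<close>, by which \<open>decor v\<^sub>2\<close> removes the
  correlation with the output noise at the cost of the term subtracted in \<open>Qe\<close>
  (\<open>noise_intensities\<close>).

  \<^bold>\<open>The Riccati equation.\<close>  Every solution of the variance equation that is symmetric at \<open>t0\<close> stays
  symmetric, and for symmetric \<open>P\<close> completing the square turns the variance equation into
  \<open>P' = Ae P + P Ae\<^sup>T + Qe - P K P\<close> with \<open>K = C2\<^sup>T R2\<^sup>-\<^sup>1 C2\<close> (\<open>riccati_standard_form\<close>); the closed loop
  \<open>Abar - L C2\<close> becomes \<open>Ae - P K\<close>.  Everything is then read off from the adjoint of the closed loop,
  \<open>z' = - Ae\<^sup>T z + K P z\<close>, along which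
  \<open>(z \<bullet> P z)' = z \<bullet> Qe z + P z \<bullet> K P z \<ge> 0\<close>.

  \<^item> Over a controllability window this form gains a fixed multiple of \<open>|z|\<^sup>2\<close>
    (\<open>controllability_window\<close>).  Since it starts nonnegative, this is also a lower bound for \<open>P\<close>.
  \<^item> Observability bounds \<open>P\<close> from above, by comparison with a suboptimal estimator
    (\<open>observability_upper_bound\<close>).
  \<^item> Hence \<open>z \<bullet> P z\<close> is comparable to \<open>|z|\<^sup>2\<close> and gains a fixed fraction over every window: adjoint
    solutions decay exponentially backwards in time (\<open>adjoint_decay\<close>).
  \<^item> For a solution \<open>x\<close> of the closed loop, \<open>x \<bullet> z\<close> is constant, so \<open>x\<close> decays forwards in time
    (\<open>closed_loop_decay\<close>).  This is the stability of the filter.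
  \<^item> For two solutions \<open>P1\<close>, \<open>P2\<close> with closed-loop adjoint solutions \<open>z\<close>, \<open>y\<close>, the number
    \<open>z \<bullet> (P1 - P2) y\<close> is constant (\<open>difference_form_invariant\<close>).  At the left end it is
    exponentially small, so all solutions approach each other (\<open>solutions_approach\<close>).

  The hypotheses on Gramians enter only through solutions of the adjoint and of the state equation
  (\<open>ucc_form\<close>, \<open>uco_form\<close>), after which no transition matrix occurs.
\<close>

section \<open>Matrix algebra under dimension side conditions\<close>

text \<open>With equations between dimensions as side conditions, in place of membership in \<open>carrier_mat\<close> for
  dimensions that would have to be guessed, these laws are conditional rewrite rules.\<close>

lemma dim_assoc_mult:
  "dim_col A = dim_row B \<Longrightarrow> dim_col B = dim_row C \<Longrightarrow> (A * B) * C = A * (B * (C :: real mat))"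
  by (rule assoc_mult_mat[of A "dim_row A" "dim_row B" B "dim_row C" C "dim_col C"]) (auto)

lemma dim_assoc_mult_vec:
  "dim_col A = dim_row B \<Longrightarrow> dim_col B = dim_vec v \<Longrightarrow> (A * B) *\<^sub>v v = A *\<^sub>v (B *\<^sub>v (v :: real vec))"
  by (rule assoc_mult_mat_vec[of A "dim_row A" "dim_row B" B "dim_col B"]) (auto intro: carrier_vecI)

lemma dim_add_mult:
  "dim_row A = dim_row B \<Longrightarrow> dim_col A = dim_row C \<Longrightarrow> dim_col B = dim_row C \<Longrightarrow>
   (A + B) * C = A * C + B * (C :: real mat)"
  by (rule add_mult_distrib_mat[of A "dim_row A" "dim_row C"]) (auto)

lemma dim_minus_mult:
  "dim_row A = dim_row B \<Longrightarrow> dim_col A = dim_row C \<Longrightarrow> dim_col B = dim_row C \<Longrightarrow>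
   (A - B) * C = A * C - B * (C :: real mat)"
  by (rule minus_mult_distrib_mat[of A "dim_row A" "dim_row C"]) (auto)

lemma dim_mult_add:
  "dim_col A = dim_row B \<Longrightarrow> dim_row B = dim_row C \<Longrightarrow> dim_col B = dim_col C \<Longrightarrow>
   A * (B + C) = A * B + A * (C :: real mat)"
  by (rule mult_add_distrib_mat[of A "dim_row A" "dim_row C" _ "dim_col C"]) (auto)

lemma dim_mult_minus:
  "dim_col A = dim_row B \<Longrightarrow> dim_row B = dim_row C \<Longrightarrow> dim_col B = dim_col C \<Longrightarrow>
   A * (B - C) = A * B - A * (C :: real mat)"
  by (rule mult_minus_distrib_mat[of A "dim_row A" "dim_row C" _ "dim_col C"]) (auto)

lemma dim_add_mult_vec:
  "dim_row A = dim_row B \<Longrightarrow> dim_col A = dim_vec v \<Longrightarrow> dim_col B = dim_vec v \<Longrightarrow>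
   (A + B) *\<^sub>v v = A *\<^sub>v v + B *\<^sub>v (v :: real vec)"
  by (rule add_mult_distrib_mat_vec[of A "dim_row A" "dim_vec v"]) (auto intro: carrier_vecI)

lemma dim_minus_mult_vec:
  "dim_row A = dim_row B \<Longrightarrow> dim_col A = dim_vec v \<Longrightarrow> dim_col B = dim_vec v \<Longrightarrow>
   (A - B) *\<^sub>v v = A *\<^sub>v v - B *\<^sub>v (v :: real vec)"
  by (rule minus_mult_distrib_mat_vec[of A "dim_row A" "dim_vec v"]) (auto intro: carrier_vecI)

lemma dim_mult_vec_add:
  "dim_col A = dim_vec v \<Longrightarrow> dim_vec v = dim_vec w \<Longrightarrow> A *\<^sub>v (v + w) = A *\<^sub>v v + A *\<^sub>v (w :: real vec)"
  by (rule mult_add_distrib_mat_vec[of A "dim_row A" "dim_vec w"]) (auto intro: carrier_vecI)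

lemma dim_mult_vec_minus:
  "dim_col A = dim_vec v \<Longrightarrow> dim_vec v = dim_vec w \<Longrightarrow> A *\<^sub>v (v - w) = A *\<^sub>v v - A *\<^sub>v (w :: real vec)"
  by (rule mult_minus_distrib_mat_vec[of A "dim_row A" "dim_vec w"]) (auto intro: carrier_vecI)

lemma dim_mult_vec_smult:
  "dim_col A = dim_vec v \<Longrightarrow> A *\<^sub>v (c \<cdot>\<^sub>v v) = c \<cdot>\<^sub>v (A *\<^sub>v (v :: real vec))"
  by (rule mult_mat_vec[of A "dim_row A" "dim_vec v"]) (auto intro: carrier_vecI)

lemma dim_transpose_mult:
  "dim_col A = dim_row B \<Longrightarrow> (A * B)\<^sup>T = B\<^sup>T * (A :: real mat)\<^sup>T"
  by (rule transpose_mult[of A "dim_row A" "dim_row B" _ "dim_col B"]) (auto)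

lemma dim_transpose_add:
  "dim_row A = dim_row B \<Longrightarrow> dim_col A = dim_col B \<Longrightarrow> (A + B)\<^sup>T = A\<^sup>T + (B :: real mat)\<^sup>T"
  by (rule transpose_add[of A "dim_row A" "dim_col B"]) (auto)

lemma dim_transpose_minus:
  "dim_row A = dim_row B \<Longrightarrow> dim_col A = dim_col B \<Longrightarrow> (A - B)\<^sup>T = A\<^sup>T - (B :: real mat)\<^sup>T"
  by (rule transpose_minus[of A "dim_row A" "dim_col B"]) (auto)

lemma dim_one_mult: "dim_row A = n \<Longrightarrow> 1\<^sub>m n * A = (A :: real mat)"
  by (auto intro: left_mult_one_mat)

lemma dim_mult_one: "dim_col A = n \<Longrightarrow> A * 1\<^sub>m n = (A :: real mat)"
  by (auto intro: right_mult_one_mat)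

lemma dim_one_mult_vec: "dim_vec v = n \<Longrightarrow> 1\<^sub>m n *\<^sub>v v = (v :: real vec)"
  by (auto intro: one_mult_mat_vec)

lemma dim_zero_mult: "dim_row A = n \<Longrightarrow> 0\<^sub>m k n * A = (0\<^sub>m k (dim_col A) :: real mat)"
  by (auto intro!: left_mult_zero_mat)

lemma dim_mult_zero: "dim_col A = n \<Longrightarrow> A * 0\<^sub>m n k = (0\<^sub>m (dim_row A) k :: real mat)"
  by (auto intro!: right_mult_zero_mat)

lemma dim_mult_vec_zero: "dim_col A = n \<Longrightarrow> A *\<^sub>v 0\<^sub>v n = (0\<^sub>v (dim_row A) :: real vec)"
  by (intro eq_vecI) auto

lemma dim_add_zero: "dim_row A = m \<Longrightarrow> dim_col A = n \<Longrightarrow> A + 0\<^sub>m m n = (A :: real mat)"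
  "dim_row A = m \<Longrightarrow> dim_col A = n \<Longrightarrow> 0\<^sub>m m n + A = (A :: real mat)"
  by (rule eq_matI; simp)+

lemma dim_minus_zero: "dim_row A = m \<Longrightarrow> dim_col A = n \<Longrightarrow> A - 0\<^sub>m m n = (A :: real mat)"
  by (rule eq_matI; simp)

lemmas dim_algebra = dim_add_zero dim_minus_zero dim_assoc_mult dim_add_mult dim_minus_mult dim_mult_add dim_mult_minus
  dim_transpose_mult dim_transpose_add dim_transpose_minus dim_one_mult dim_mult_one
  dim_zero_mult dim_mult_zero transpose_one zero_transpose_mat transpose_transpose

lemmas dim_vec_algebra = dim_assoc_mult_vec dim_add_mult_vec dim_minus_mult_vec dim_mult_vec_add
  dim_mult_vec_minus dim_mult_vec_smult dim_one_mult_vec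

lemma sp_add_left: "dim_vec u = dim_vec w \<Longrightarrow> dim_vec v = dim_vec w \<Longrightarrow> (u + v) \<bullet> w = u \<bullet> w + v \<bullet> (w :: real vec)"
  by (rule add_scalar_prod_distrib[of _ "dim_vec w"]) (auto intro: carrier_vecI)

lemma sp_add_right: "dim_vec u = dim_vec w \<Longrightarrow> dim_vec v = dim_vec w \<Longrightarrow> u \<bullet> (v + w) = u \<bullet> v + u \<bullet> (w :: real vec)"
  by (rule scalar_prod_add_distrib[of _ "dim_vec w"]) (auto intro: carrier_vecI)

lemma sp_minus_left: "dim_vec u = dim_vec w \<Longrightarrow> dim_vec v = dim_vec w \<Longrightarrow> (u - v) \<bullet> w = u \<bullet> w - v \<bullet> (w :: real vec)"
  by (rule minus_scalar_prod_distrib[of _ "dim_vec w"]) (auto intro: carrier_vecI)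

lemma sp_minus_right: "dim_vec u = dim_vec w \<Longrightarrow> dim_vec v = dim_vec w \<Longrightarrow> u \<bullet> (v - w) = u \<bullet> v - u \<bullet> (w :: real vec)"
  by (rule scalar_prod_minus_distrib[of _ "dim_vec w"]) (auto intro: carrier_vecI)

lemma sp_smult_left: "(c \<cdot>\<^sub>v u) \<bullet> w = c * (u \<bullet> (w :: real vec))" if "dim_vec u = dim_vec w"
  using that by (simp add: scalar_prod_def sum_distrib_left mult.assoc)

lemma sp_smult_right: "u \<bullet> (c \<cdot>\<^sub>v w) = c * (u \<bullet> (w :: real vec))" if "dim_vec u = dim_vec w"
  using that by (simp add: scalar_prod_def sum_distrib_left mult_ac)

lemma sp_zero: "dim_vec v = n \<Longrightarrow> 0\<^sub>v n \<bullet> v = (0 :: real)" "v \<bullet> 0\<^sub>v n = (0 :: real)"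
  by (auto simp: scalar_prod_def)

lemma sp_comm: "dim_vec u = dim_vec w \<Longrightarrow> u \<bullet> w = w \<bullet> (u :: real vec)"
  by (rule comm_scalar_prod[of _ "dim_vec w"]) (auto intro: carrier_vecI)

lemmas sp_algebra = sp_add_left sp_add_right sp_minus_left sp_minus_right sp_smult_left sp_smult_right

lemma sp_transpose:
  "dim_vec x = dim_row A \<Longrightarrow> dim_vec y = dim_col A \<Longrightarrow> (A\<^sup>T *\<^sub>v x) \<bullet> y = x \<bullet> (A *\<^sub>v (y :: real vec))"
  using transpose_vec_mult_scalar[of A "dim_row A" "dim_col A" y x]
  by (auto intro: carrier_vecI)

lemma sp_mult_left:
  "dim_vec x = dim_col A \<Longrightarrow> dim_vec y = dim_row A \<Longrightarrow> (A *\<^sub>v x) \<bullet> y = x \<bullet> (A\<^sup>T *\<^sub>v (y :: real vec))"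
  using sp_transpose[of x "A\<^sup>T" y] by simp

section \<open>Euclidean and operator norms\<close>

lemma sp_self_nonneg: "0 \<le> x \<bullet> (x :: real vec)"
  unfolding scalar_prod_def by (rule sum_nonneg) simp

lemma sp_self_eq_0: "x \<bullet> x = 0 \<longleftrightarrow> x = 0\<^sub>v (dim_vec (x :: real vec))"
proof
  assume "x \<bullet> x = 0"
  then have "\<forall>i\<in>{0..<dim_vec x}. x $ i * x $ i = 0"
    unfolding scalar_prod_def by (subst (asm) sum_nonneg_eq_0_iff) simp_all
  then show "x = 0\<^sub>v (dim_vec x)" by (intro eq_vecI) simp_all
next
  assume *: "x = 0\<^sub>v (dim_vec x)"
  show "x \<bullet> x = 0" by (subst *, subst *) simp
qed

lemma vnorm_sq: "(vnorm x)\<^sup>2 = x \<bullet> x"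
  by (simp add: vnorm_def sp_self_nonneg)

lemma vnorm_nonneg [simp]: "0 \<le> vnorm x"
  by (simp add: vnorm_def sp_self_nonneg)

lemma vnorm_zero [simp]: "vnorm (0\<^sub>v n) = 0"
  by (simp add: vnorm_def)

lemma vnorm_eq_0: "x \<in> carrier_vec n \<Longrightarrow> vnorm x = 0 \<longleftrightarrow> x = 0\<^sub>v n"
  by (auto simp: vnorm_def sp_self_eq_0)

lemma vnorm_L2_set: "vnorm x = L2_set (\<lambda>i. x $ i) {0..<dim_vec x}"
  by (simp add: vnorm_def L2_set_def scalar_prod_def power2_eq_square)

lemma vnorm_smult: "vnorm (c \<cdot>\<^sub>v x) = \<bar>c\<bar> * vnorm x"
  by (simp add: vnorm_def sp_smult_left sp_smult_right real_sqrt_mult mult.assoc[symmetric])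

lemma Cauchy_Schwarz_vec: "dim_vec x = dim_vec y \<Longrightarrow> \<bar>x \<bullet> y\<bar> \<le> vnorm x * vnorm y"
proof -
  assume d: "dim_vec x = dim_vec y"
  have "\<bar>x \<bullet> y\<bar> \<le> (\<Sum>i\<in>{0..<dim_vec y}. \<bar>x $ i\<bar> * \<bar>y $ i\<bar>)"
    unfolding scalar_prod_def by (rule order_trans[OF sum_abs]) (simp add: abs_mult)
  also have "\<dots> \<le> vnorm x * vnorm y"
    unfolding vnorm_L2_set d by (rule L2_set_mult_ineq)
  finally show ?thesis .
qed

lemma vnorm_triangle: "dim_vec x = dim_vec y \<Longrightarrow> vnorm (x + y) \<le> vnorm x + vnorm y"
proof -
  assume d: "dim_vec x = dim_vec y"
  have "vnorm (x + y) = L2_set (\<lambda>i. x $ i + y $ i) {0..<dim_vec y}"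
    unfolding vnorm_L2_set using d by (intro L2_set_cong) auto
  also have "\<dots> \<le> vnorm x + vnorm y" unfolding vnorm_L2_set d by (rule L2_set_triangle_ineq)
  finally show ?thesis .
qed

text \<open>Duality for the norm: the vector \<open>A x\<close> itself is the best test vector.\<close>

lemma form_bound_imp_norm_bound:
  assumes A: "A \<in> carrier_mat m n" and x: "x \<in> carrier_vec n" and c: "0 \<le> c"
    and b: "\<And>z. z \<in> carrier_vec m \<Longrightarrow> z \<bullet> (A *\<^sub>v x) \<le> c * vnorm z"
  shows "vnorm (A *\<^sub>v x) \<le> c"
proof (cases "vnorm (A *\<^sub>v x) = 0")
  case False
  then have p: "0 < vnorm (A *\<^sub>v x)" using vnorm_nonneg[of "A *\<^sub>v x"] by linarith
  have "vnorm (A *\<^sub>v x) * vnorm (A *\<^sub>v x) \<le> c * vnorm (A *\<^sub>v x)"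
    using b[of "A *\<^sub>v x"] A x vnorm_sq[of "A *\<^sub>v x"] by (simp add: power2_eq_square)
  then show ?thesis using p by (simp)
qed (simp add: c)

lemma matrix_norm_bounded:
  assumes A: "A \<in> carrier_mat m n"
  shows "\<exists>c\<ge>0. \<forall>x\<in>carrier_vec n. vnorm (A *\<^sub>v x) \<le> c * vnorm x"
proof (intro exI conjI ballI)
  let ?c = "\<Sum>i<m. vnorm (row A i)"
  show "0 \<le> ?c" by (simp add: sum_nonneg)
  fix x :: "real vec" assume x: "x \<in> carrier_vec n"
  have "vnorm (A *\<^sub>v x) \<le> (\<Sum>i\<in>{0..<m}. \<bar>(A *\<^sub>v x) $ i\<bar>)"
    unfolding vnorm_L2_set using A by (auto intro!: order_trans[OF L2_set_le_sum_abs])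
  also have "\<dots> \<le> (\<Sum>i\<in>{0..<m}. vnorm (row A i) * vnorm x)"
    using A x by (intro sum_mono) (auto intro!: Cauchy_Schwarz_vec)
  finally show "vnorm (A *\<^sub>v x) \<le> ?c * vnorm x"
    by (simp add: sum_distrib_right lessThan_atLeast0)
qed

lemma mnorm_bdd_above:
  "bdd_above {vnorm (A *\<^sub>v x) | x. x \<in> carrier_vec (dim_col A) \<and> vnorm x \<le> 1}"
proof -
  obtain c where c: "0 \<le> c" "\<forall>x\<in>carrier_vec (dim_col A). vnorm (A *\<^sub>v x) \<le> c * vnorm x"
    using matrix_norm_bounded[of A "dim_row A" "dim_col A"] by auto
  show ?thesis
    by (rule bdd_aboveI[of _ c]) (use c in \<open>auto intro: order_trans mult_left_le\<close>)
qed

lemma vnorm_mult_le_mnorm: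
  assumes x: "dim_vec x = dim_col A"
  shows "vnorm (A *\<^sub>v x) \<le> mnorm A * vnorm x"
proof (cases "vnorm x = 0")
  case True
  then have "x = 0\<^sub>v (dim_col A)" using vnorm_eq_0[of x "dim_col A"] x by (auto intro: carrier_vecI)
  then have "A *\<^sub>v x = 0\<^sub>v (dim_row A)" by auto
  then show ?thesis using True by simp
next
  case False
  then have p: "0 < vnorm x" using vnorm_nonneg[of x] by linarith
  let ?y = "(1 / vnorm x) \<cdot>\<^sub>v x"
  have "vnorm (A *\<^sub>v ?y) \<le> mnorm A"
    unfolding mnorm_def
  proof (rule cSup_upper[OF _ mnorm_bdd_above], intro CollectI exI conjI)
    show "?y \<in> carrier_vec (dim_col A)" using x by (intro carrier_vecI) simp
    show "vnorm ?y \<le> 1" using p by (simp add: vnorm_smult)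
  qed (rule refl)
  moreover have "vnorm (A *\<^sub>v ?y) = vnorm (A *\<^sub>v x) / vnorm x"
    using p x by (simp add: dim_vec_algebra vnorm_smult)
  ultimately show ?thesis using p by (simp add: field_simps)
qed

lemma mnorm_le:
  assumes "\<And>x. x \<in> carrier_vec (dim_col A) \<Longrightarrow> vnorm (A *\<^sub>v x) \<le> c * vnorm x" and "0 \<le> c"
  shows "mnorm A \<le> c"
  unfolding mnorm_def
proof (rule cSup_least)
  have "vnorm (A *\<^sub>v 0\<^sub>v (dim_col A)) \<in> {vnorm (A *\<^sub>v x) | x. x \<in> carrier_vec (dim_col A) \<and> vnorm x \<le> 1}"
    by auto
  then show "{vnorm (A *\<^sub>v x) | x. x \<in> carrier_vec (dim_col A) \<and> vnorm x \<le> 1} \<noteq> {}" by blast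
qed (use assms in \<open>auto intro: order_trans mult_left_le\<close>)

lemma mnorm_nonneg: "0 \<le> mnorm A"
  unfolding mnorm_def
  by (rule cSup_upper2[OF _ _ mnorm_bdd_above, of "vnorm (A *\<^sub>v 0\<^sub>v (dim_col A))"]) auto

lemma transpose_norm_bound:
  assumes A: "A \<in> carrier_mat m n" and c: "0 \<le> c"
    and b: "\<And>x. x \<in> carrier_vec n \<Longrightarrow> vnorm (A *\<^sub>v x) \<le> c * vnorm x"
    and y: "y \<in> carrier_vec m"
  shows "vnorm (A\<^sup>T *\<^sub>v y) \<le> c * vnorm y"
proof (rule form_bound_imp_norm_bound[of _ n m])
  fix z :: "real vec" assume z: "z \<in> carrier_vec n"
  have "z \<bullet> (A\<^sup>T *\<^sub>v y) = (A *\<^sub>v z) \<bullet> y" using A y z by (simp add: sp_mult_left)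
  also have "\<dots> \<le> vnorm (A *\<^sub>v z) * vnorm y"
    using Cauchy_Schwarz_vec[of "A *\<^sub>v z" y] A y by auto
  also have "\<dots> \<le> (c * vnorm z) * vnorm y" by (intro mult_right_mono b z) auto
  finally show "z \<bullet> (A\<^sup>T *\<^sub>v y) \<le> (c * vnorm y) * vnorm z" by (simp add: mult_ac)
qed (use A y c in auto)

section \<open>Semidefinite forms\<close>

text \<open>The form is nonnegative on combinations of \<open>x\<close> and \<open>y\<close>.  For \<open>y \<bullet> P y \<noteq> 0\<close> this bounds the
  discriminant; for \<open>y \<bullet> P y = 0\<close> the linear term must vanish.\<close>

lemma psd_Cauchy_Schwarz:
  assumes P: "psd n P" and x: "x \<in> carrier_vec n" and y: "y \<in> carrier_vec n"
  shows "(x \<bullet> (P *\<^sub>v y))\<^sup>2 \<le> (x \<bullet> (P *\<^sub>v x)) * (y \<bullet> (P *\<^sub>v y))"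
proof -
  note d = P[unfolded psd_def]
  have dims: "dim_row P = n" "dim_col P = n" "dim_vec x = n" "dim_vec y = n" using d x y by auto
  define a b c where "a = x \<bullet> (P *\<^sub>v x)" and "b = x \<bullet> (P *\<^sub>v y)" and "c = y \<bullet> (P *\<^sub>v y)"
  have b': "y \<bullet> (P *\<^sub>v x) = b"
    unfolding b_def using d x y sp_mult_left[of y P x] sp_comm[of x "P *\<^sub>v y"] by auto
  have q: "0 \<le> s * s * a + 2 * s * t * b + t * t * c" for s t
  proof -
    have "0 \<le> (s \<cdot>\<^sub>v x + t \<cdot>\<^sub>v y) \<bullet> (P *\<^sub>v (s \<cdot>\<^sub>v x + t \<cdot>\<^sub>v y))"
      using d x y by auto
    also have "\<dots> = s * s * a + 2 * s * t * b + t * t * c"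
      using b' unfolding a_def b_def c_def by (simp add: dims dim_vec_algebra sp_algebra algebra_simps)
    finally show ?thesis .
  qed
  have c0: "0 \<le> c" and a0: "0 \<le> a" using d x y by (auto simp: a_def c_def)
  show ?thesis unfolding a_def[symmetric] b_def[symmetric] c_def[symmetric]
  proof (cases "c = 0")
    case False
    then have "0 < c" using c0 by simp
    have "0 \<le> c * (a * c - b\<^sup>2)"
      using q[of c "- b"] by (simp add: power2_eq_square algebra_simps)
    then show "b\<^sup>2 \<le> a * c" using \<open>0 < c\<close> by (simp add: zero_le_mult_iff)
  next
    case True
    have "b = 0"
    proof (rule ccontr)
      assume "b \<noteq> 0"
      then show False using q[of 1 "- (a + 1) / (2 * b)"] True a0 by (simp add: field_simps)
    qed
    then show "b\<^sup>2 \<le> a * c" using a0 c0 by simp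
  qed
qed

text \<open>The Cauchy-Schwarz inequality for \<open>P\<close>, applied to \<open>P x\<close> and \<open>x\<close>.  It bounds the feedback
  \<open>|K u|\<^sup>2\<close> by the form \<open>u \<bullet> K u\<close>, which is what the Riccati equation controls, with no square root of
  \<open>K\<close>.\<close>

lemma psd_norm_sq_le_form:
  assumes P: "psd n P" and x: "x \<in> carrier_vec n"
    and b: "\<And>x. x \<in> carrier_vec n \<Longrightarrow> vnorm (P *\<^sub>v x) \<le> c * vnorm x"
  shows "(vnorm (P *\<^sub>v x))\<^sup>2 \<le> c * (x \<bullet> (P *\<^sub>v x))"
proof (cases "vnorm (P *\<^sub>v x) = 0")
  case True
  have "P *\<^sub>v x = 0\<^sub>v n" using True vnorm_eq_0[of "P *\<^sub>v x" n] P x by (auto simp: psd_def)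
  then show ?thesis using x True by simp
next
  case False
  note d = P[unfolded psd_def]
  let ?y = "P *\<^sub>v x"
  have y: "?y \<in> carrier_vec n" using d x by auto
  have p: "0 < ?y \<bullet> ?y" using False sp_self_nonneg[of ?y] by (simp add: vnorm_def less_le)
  have "(?y \<bullet> ?y)\<^sup>2 \<le> (?y \<bullet> (P *\<^sub>v ?y)) * (x \<bullet> (P *\<^sub>v x))"
    by (rule psd_Cauchy_Schwarz[OF P y x])
  also have "\<dots> \<le> (c * (?y \<bullet> ?y)) * (x \<bullet> (P *\<^sub>v x))"
  proof (rule mult_right_mono)
    have "?y \<bullet> (P *\<^sub>v ?y) \<le> vnorm ?y * vnorm (P *\<^sub>v ?y)"
      using Cauchy_Schwarz_vec[of ?y "P *\<^sub>v ?y"] d by auto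
    also have "\<dots> \<le> vnorm ?y * (c * vnorm ?y)" by (intro mult_left_mono b y) auto
    also have "\<dots> = c * (?y \<bullet> ?y)" by (simp add: vnorm_sq[symmetric] power2_eq_square)
    finally show "?y \<bullet> (P *\<^sub>v ?y) \<le> c * (?y \<bullet> ?y)" .
  qed (use d x in auto)
  finally have "(?y \<bullet> ?y) * (?y \<bullet> ?y) \<le> (c * (x \<bullet> (P *\<^sub>v x))) * (?y \<bullet> ?y)"
    by (simp add: power2_eq_square mult_ac)
  then show ?thesis using p by (simp add: vnorm_sq)
qed

section \<open>Inverses\<close>

lemma minv_carrier: "A \<in> carrier_mat n n \<Longrightarrow> minv A \<in> carrier_mat n n"
  by (auto simp: minv_def dest: mat_inverse(2) split: option.splits)

lemma dim_minv [simp]: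
  "dim_row A = dim_col A \<Longrightarrow> dim_row (minv A) = dim_row A"
  "dim_row A = dim_col A \<Longrightarrow> dim_col (minv A) = dim_row A"
proof -
  have "minv A \<in> carrier_mat (dim_row A) (dim_row A)" if "dim_row A = dim_col A"
    by (rule minv_carrier, rule carrier_matI) (simp_all only: that)
  then show "dim_row A = dim_col A \<Longrightarrow> dim_row (minv A) = dim_row A"
    and "dim_row A = dim_col A \<Longrightarrow> dim_col (minv A) = dim_row A"
    by (blast dest: carrier_matD)+
qed

lemma minv_inverse:
  assumes A: "A \<in> carrier_mat n n" and inj: "\<And>x. x \<in> carrier_vec n \<Longrightarrow> A *\<^sub>v x = 0\<^sub>v n \<Longrightarrow> x = 0\<^sub>v n"
  shows "A * minv A = 1\<^sub>m n" "minv A * A = 1\<^sub>m n" "det A \<noteq> 0"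
proof -
  show d: "det A \<noteq> 0" using det_0_iff_vec_prod_zero_field[OF A] inj by blast
  obtain B where "mat_inverse A = Some B"
  proof (cases "mat_inverse A")
    case None
    show ?thesis using mat_inverse(1)[OF A None, of "()"] det_non_zero_imp_unit[OF A d, of "()"] by (rule notE)
  qed
  then show "A * minv A = 1\<^sub>m n" "minv A * A = 1\<^sub>m n"
    using mat_inverse(2)[OF A] by (auto simp: minv_def)
qed

lemma pd_inverse:
  assumes "pd n A"
  shows "A * minv A = 1\<^sub>m n" "minv A * A = 1\<^sub>m n" "det A \<noteq> 0"
proof -
  have A: "A \<in> carrier_mat n n" using assms by (simp add: pd_def)
  have i: "x = 0\<^sub>v n" if "x \<in> carrier_vec n" "A *\<^sub>v x = 0\<^sub>v n" for x
    using assms that unfolding pd_def by (metis less_irrefl scalar_prod_right_zero)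
  show "A * minv A = 1\<^sub>m n" "minv A * A = 1\<^sub>m n" "det A \<noteq> 0" using minv_inverse[OF A i] by auto
qed

lemma minv_symmetric:
  assumes A: "A \<in> carrier_mat n n" and s: "A\<^sup>T = A" and i: "A * minv A = 1\<^sub>m n"
  shows "(minv A)\<^sup>T = minv A"
proof -
  note B = minv_carrier[OF A]
  have l: "(minv A)\<^sup>T * A = 1\<^sub>m n"
    using arg_cong[OF i, of transpose_mat] A B s by (simp add: dim_transpose_mult)
  have "(minv A)\<^sup>T = (minv A)\<^sup>T * (A * minv A)" using B by (simp add: i dim_mult_one)
  also have "\<dots> = ((minv A)\<^sup>T * A) * minv A" using A B by (simp add: dim_assoc_mult)
  also have "\<dots> = minv A" using B by (simp add: l dim_one_mult)
  finally show ?thesis .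
qed

lemma pd_minv:
  assumes P: "pd n A"
  shows "pd n (minv A)"
  unfolding pd_def
proof (intro conjI ballI impI)
  have A: "A \<in> carrier_mat n n" "A\<^sup>T = A" using P by (auto simp: pd_def)
  show B: "minv A \<in> carrier_mat n n" by (rule minv_carrier) fact
  show "(minv A)\<^sup>T = minv A" by (rule minv_symmetric[OF A pd_inverse(1)[OF P]])
  fix x :: "real vec" assume x: "x \<in> carrier_vec n" "x \<noteq> 0\<^sub>v n"
  let ?u = "minv A *\<^sub>v x"
  have xu: "A *\<^sub>v ?u = x"
    using A B x pd_inverse(1)[OF P] by (simp add: dim_one_mult_vec dim_assoc_mult_vec[symmetric])
  moreover have "?u \<noteq> 0\<^sub>v n" using xu x A by (auto simp: dim_mult_vec_zero)
  moreover have "?u \<in> carrier_vec n" using B x by simp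
  ultimately have "0 < ?u \<bullet> x" using P unfolding pd_def by metis
  then show "0 < x \<bullet> ?u" using sp_comm[of x ?u] B x by simp
qed

lemma pd_imp_psd: "pd n A \<Longrightarrow> psd n A"
  unfolding pd_def psd_def
  by (metis less_imp_le order_refl scalar_prod_left_zero mult_mat_vec_carrier)

lemma pd_congruence:
  assumes A: "pd m A" and X: "X \<in> carrier_mat m n"
    and inj: "\<And>x. x \<in> carrier_vec n \<Longrightarrow> X *\<^sub>v x = 0\<^sub>v m \<Longrightarrow> x = 0\<^sub>v n"
  shows "pd n (X\<^sup>T * A * X)"
  unfolding pd_def
proof (intro conjI ballI impI)
  have A': "A \<in> carrier_mat m m" "A\<^sup>T = A" using A by (auto simp: pd_def)
  show "X\<^sup>T * A * X \<in> carrier_mat n n" using A' X by auto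
  show "(X\<^sup>T * A * X)\<^sup>T = X\<^sup>T * A * X" using A' X by (simp add: dim_algebra)
  fix x :: "real vec" assume x: "x \<in> carrier_vec n" "x \<noteq> 0\<^sub>v n"
  have "x \<bullet> (X\<^sup>T * A * X *\<^sub>v x) = (X *\<^sub>v x) \<bullet> (A *\<^sub>v (X *\<^sub>v x))"
    using A' X x by (simp add: dim_vec_algebra sp_mult_left)
  moreover have "X *\<^sub>v x \<noteq> 0\<^sub>v m" using inj x by auto
  ultimately show "0 < x \<bullet> (X\<^sup>T * A * X *\<^sub>v x)" using A X x by (auto simp: pd_def)
qed

text \<open>Full rank forces the columns to be distinct, and then a kernel vector is a linear dependence
  between them.\<close>

lemma full_column_rank_injective:
  assumes A: "A \<in> carrier_mat m n" and r: "mrank A = n"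
    and x: "x \<in> carrier_vec n" and z: "A *\<^sub>v x = 0\<^sub>v m"
  shows "x = 0\<^sub>v n"
proof (rule ccontr)
  assume "x \<noteq> 0\<^sub>v n"
  interpret vec_space "TYPE(real)" m .
  have r': "rank A = n" using r A by (simp add: mrank_def)
  have d: "distinct (cols A)"
  proof -
    have b: "\<And>T. T \<subseteq> set (cols A) \<and> lin_indpt T \<Longrightarrow> finite T \<and> card T \<le> card (set (cols A))"
      by (auto intro: card_mono finite_subset)
    have e: "{} \<subseteq> set (cols A) \<and> lin_indpt {}" using finite_lin_indpt2[of "{}"] by simp
    obtain S where S: "maximal S (\<lambda>T. T \<subseteq> set (cols A) \<and> lin_indpt T)"
      using maximal_exists[of "(\<lambda>T. T \<subseteq> set (cols A) \<and> lin_indpt T)", OF b e] by blast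
    have "card S \<le> card (set (cols A))" using S by (simp add: card_mono maximal_def)
    then have "n \<le> card (set (cols A))" using rank_card_indpt[OF A S] r' by simp
    moreover have "length (cols A) = n" using A by simp
    ultimately show ?thesis using card_length[of "cols A"] by (intro card_distinct) simp
  qed
  have "lin_indpt (set (cols A))" by (rule full_rank_lin_indpt[OF A r' d])
  moreover have "lin_dep (set (cols A))" by (rule lin_depI[OF A x \<open>x \<noteq> 0\<^sub>v n\<close> z d])
  ultimately show False by simp
qed

section \<open>Continuous and differentiable matrix functions\<close>

definition mat_cont_on :: "real set \<Rightarrow> (real \<Rightarrow> real mat) \<Rightarrow> nat \<Rightarrow> nat \<Rightarrow> bool" where
  "mat_cont_on T F a b \<longleftrightarrow> (\<forall>t\<in>T. F t \<in> carrier_mat a b) \<and>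
     (\<forall>i<a. \<forall>j<b. continuous_on T (\<lambda>t. F t $$ (i, j)))"

definition vec_cont_on :: "real set \<Rightarrow> (real \<Rightarrow> real vec) \<Rightarrow> nat \<Rightarrow> bool" where
  "vec_cont_on T x n \<longleftrightarrow> (\<forall>t\<in>T. x t \<in> carrier_vec n) \<and> (\<forall>i<n. continuous_on T (\<lambda>t. x t $ i))"

definition vec_deriv_on :: "real set \<Rightarrow> nat \<Rightarrow> (real \<Rightarrow> real vec) \<Rightarrow> (real \<Rightarrow> real vec) \<Rightarrow> bool" where
  "vec_deriv_on T n x x' \<longleftrightarrow> (\<forall>t\<in>T. x t \<in> carrier_vec n \<and> x' t \<in> carrier_vec n \<and>
     (\<forall>i<n. ((\<lambda>s. x s $ i) has_real_derivative x' t $ i) (at t within T)))"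

definition mat_deriv_on ::
  "real set \<Rightarrow> nat \<Rightarrow> nat \<Rightarrow> (real \<Rightarrow> real mat) \<Rightarrow> (real \<Rightarrow> real mat) \<Rightarrow> bool" where
  "mat_deriv_on T a b F F' \<longleftrightarrow> (\<forall>t\<in>T. F t \<in> carrier_mat a b \<and> F' t \<in> carrier_mat a b \<and>
     (\<forall>i<a. \<forall>j<b. ((\<lambda>s. F s $$ (i, j)) has_real_derivative F' t $$ (i, j)) (at t within T)))"

lemma mat_cont_on_carrier: "mat_cont_on T F a b \<Longrightarrow> t \<in> T \<Longrightarrow> F t \<in> carrier_mat a b"
  by (simp add: mat_cont_on_def)

lemma vec_cont_on_carrier: "vec_cont_on T x n \<Longrightarrow> t \<in> T \<Longrightarrow> x t \<in> carrier_vec n"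
  by (simp add: vec_cont_on_def)

lemma mat_cont_on_subset: "mat_cont_on T F a b \<Longrightarrow> S \<subseteq> T \<Longrightarrow> mat_cont_on S F a b"
  unfolding mat_cont_on_def by (meson continuous_on_subset subsetD)

lemma vec_deriv_on_subset: "vec_deriv_on T n x x' \<Longrightarrow> S \<subseteq> T \<Longrightarrow> vec_deriv_on S n x x'"
  unfolding vec_deriv_on_def by (meson DERIV_subset subsetD)

lemma mat_deriv_on_subset: "mat_deriv_on T a b F F' \<Longrightarrow> S \<subseteq> T \<Longrightarrow> mat_deriv_on S a b F F'"
  unfolding mat_deriv_on_def by (meson DERIV_subset subsetD)

lemma mat_cont_on_cong:
  assumes "mat_cont_on T F a b" "\<And>t. t \<in> T \<Longrightarrow> G t = F t"
  shows "mat_cont_on T G a b"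
  unfolding mat_cont_on_def
proof (intro conjI ballI allI impI)
  fix i j assume "i < a" "j < b"
  then have "continuous_on T (\<lambda>t. F t $$ (i, j))" using assms(1) by (simp add: mat_cont_on_def)
  then show "continuous_on T (\<lambda>t. G t $$ (i, j))"
    by (rule continuous_on_cong[THEN iffD1, rotated 2]) (simp_all add: assms(2))
qed (use assms in \<open>simp add: mat_cont_on_def\<close>)

lemma vec_deriv_on_cong:
  assumes x: "vec_deriv_on T n x x'" and e: "\<And>t. t \<in> T \<Longrightarrow> x' t = y' t"
  shows "vec_deriv_on T n x y'"
  using x unfolding vec_deriv_on_def by (simp add: e)

lemma vec_deriv_on_cont: "vec_deriv_on T n x x' \<Longrightarrow> vec_cont_on T x n"
  unfolding vec_deriv_on_def vec_cont_on_def
  by (auto simp: continuous_on_eq_continuous_within intro: DERIV_continuous)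

lemma mat_deriv_on_cont: "mat_deriv_on T a b F F' \<Longrightarrow> mat_cont_on T F a b"
  unfolding mat_deriv_on_def mat_cont_on_def
  by (auto simp: continuous_on_eq_continuous_within intro: DERIV_continuous)

lemma mat_cont_on_mult:
  assumes F: "mat_cont_on T F a b" and G: "mat_cont_on T G b c"
  shows "mat_cont_on T (\<lambda>t. F t * G t) a c"
  unfolding mat_cont_on_def
proof (intro conjI ballI allI impI)
  fix t assume t: "t \<in> T"
  show "F t * G t \<in> carrier_mat a c"
    by (rule mult_carrier_mat[OF mat_cont_on_carrier[OF F t] mat_cont_on_carrier[OF G t]])
next
  fix i j assume ij: "i < a" "j < c"
  have "continuous_on T (\<lambda>t. \<Sum>k<b. F t $$ (i, k) * G t $$ (k, j))"
    using F G ij by (intro continuous_intros) (auto simp: mat_cont_on_def)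
  moreover have "(F t * G t) $$ (i, j) = (\<Sum>k<b. F t $$ (i, k) * G t $$ (k, j))" if "t \<in> T" for t
    using mat_cont_on_carrier[OF F that] mat_cont_on_carrier[OF G that] ij
    by (simp add: scalar_prod_def lessThan_atLeast0)
  ultimately show "continuous_on T (\<lambda>t. (F t * G t) $$ (i, j))"
    by (simp cong: continuous_on_cong)
qed

lemma mat_cont_on_add:
  assumes F: "mat_cont_on T F a b" and G: "mat_cont_on T G a b"
  shows "mat_cont_on T (\<lambda>t. F t + G t) a b"
  unfolding mat_cont_on_def
proof (intro conjI ballI allI impI)
  fix t assume t: "t \<in> T"
  show "F t + G t \<in> carrier_mat a b" using mat_cont_on_carrier[OF G t] by auto
next
  fix i j assume ij: "i < a" "j < b"
  have "continuous_on T (\<lambda>t. F t $$ (i, j) + G t $$ (i, j))"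
    using F G ij by (intro continuous_intros) (auto simp: mat_cont_on_def)
  moreover have "(F t + G t) $$ (i, j) = F t $$ (i, j) + G t $$ (i, j)" if "t \<in> T" for t
    using mat_cont_on_carrier[OF F that] mat_cont_on_carrier[OF G that] ij by simp
  ultimately show "continuous_on T (\<lambda>t. (F t + G t) $$ (i, j))" by (simp cong: continuous_on_cong)
qed

lemma mat_cont_on_minus:
  assumes F: "mat_cont_on T F a b" and G: "mat_cont_on T G a b"
  shows "mat_cont_on T (\<lambda>t. F t - G t) a b"
  unfolding mat_cont_on_def
proof (intro conjI ballI allI impI)
  fix t assume t: "t \<in> T"
  show "F t - G t \<in> carrier_mat a b" using mat_cont_on_carrier[OF G t] by auto
next
  fix i j assume ij: "i < a" "j < b"
  have "continuous_on T (\<lambda>t. F t $$ (i, j) - G t $$ (i, j))"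
    using F G ij by (intro continuous_intros) (auto simp: mat_cont_on_def)
  moreover have "(F t - G t) $$ (i, j) = F t $$ (i, j) - G t $$ (i, j)" if "t \<in> T" for t
    using mat_cont_on_carrier[OF F that] mat_cont_on_carrier[OF G that] ij by simp
  ultimately show "continuous_on T (\<lambda>t. (F t - G t) $$ (i, j))" by (simp cong: continuous_on_cong)
qed

lemma mat_cont_on_transpose:
  assumes F: "mat_cont_on T F a b"
  shows "mat_cont_on T (\<lambda>t. (F t)\<^sup>T) b a"
  unfolding mat_cont_on_def
proof (intro conjI ballI allI impI)
  fix t assume t: "t \<in> T"
  show "(F t)\<^sup>T \<in> carrier_mat b a" using mat_cont_on_carrier[OF F t] by simp
next
  fix i j assume ij: "i < b" "j < a"
  have "continuous_on T (\<lambda>t. F t $$ (j, i))" using F ij by (auto simp: mat_cont_on_def)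
  moreover have "(F t)\<^sup>T $$ (i, j) = F t $$ (j, i)" if "t \<in> T" for t
    using mat_cont_on_carrier[OF F that] ij by simp
  ultimately show "continuous_on T (\<lambda>t. (F t)\<^sup>T $$ (i, j))" by (simp cong: continuous_on_cong)
qed

lemma mat_cont_on_const: "A \<in> carrier_mat a b \<Longrightarrow> mat_cont_on T (\<lambda>_. A) a b"
  by (simp add: mat_cont_on_def)

lemma continuous_on_det:
  assumes F: "mat_cont_on T F n n"
  shows "continuous_on T (\<lambda>t. det (F t))"
proof -
  have "continuous_on T (\<lambda>t. \<Sum>p\<in>{p. p permutes {0..<n}}. signof p * (\<Prod>i = 0..<n. F t $$ (i, p i)))"
  proof (intro continuous_intros)
    fix p i assume "p \<in> {p. p permutes {0..<n}}" "i \<in> {0..<n}"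
    then have "p i < n" "i < n" using permutes_in_image[of p "{0..<n}" i] by simp_all
    then show "continuous_on T (\<lambda>t. F t $$ (i, p i))" using F by (simp add: mat_cont_on_def)
  qed
  moreover have "det (F t) = (\<Sum>p\<in>{p. p permutes {0..<n}}. signof p * (\<Prod>i = 0..<n. F t $$ (i, p i)))"
    if "t \<in> T" for t
    using mat_cont_on_carrier[OF F that] by (simp add: det_def)
  ultimately show ?thesis by (simp cong: continuous_on_cong)
qed

lemma mat_cont_on_mat_delete:
  assumes F: "mat_cont_on T F (Suc n) (Suc n)" and i: "i < Suc n" and j: "j < Suc n"
  shows "mat_cont_on T (\<lambda>t. mat_delete (F t) i j) n n"
  unfolding mat_cont_on_def
proof (intro conjI ballI allI impI)
  fix t assume t: "t \<in> T"
  show "mat_delete (F t) i j \<in> carrier_mat n n"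
    using mat_delete_carrier[OF mat_cont_on_carrier[OF F t], of i j] by simp
next
  fix k l assume kl: "k < n" "l < n"
  let ?k = "if k < i then k else Suc k" and ?l = "if l < j then l else Suc l"
  have "continuous_on T (\<lambda>t. F t $$ (?k, ?l))"
  proof -
    have "?k < Suc n" "?l < Suc n" using kl by simp_all
    then show ?thesis using F by (simp only: mat_cont_on_def)
  qed
  moreover have "mat_delete (F t) i j $$ (k, l) = F t $$ (?k, ?l)" if "t \<in> T" for t
    using mat_cont_on_carrier[OF F that] kl by (simp add: mat_delete_def)
  ultimately show "continuous_on T (\<lambda>t. mat_delete (F t) i j $$ (k, l))"
    by (simp cong: continuous_on_cong)
qed

text \<open>Cramer's rule makes every entry of the inverse a quotient of polynomials in the entries.\<close>

lemma mat_cont_on_minv: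
  assumes F: "mat_cont_on T F n n" and pd: "\<And>t. t \<in> T \<Longrightarrow> pd n (F t)"
  shows "mat_cont_on T (\<lambda>t. minv (F t)) n n"
  unfolding mat_cont_on_def
proof (intro conjI ballI allI impI)
  fix t assume t: "t \<in> T"
  show "minv (F t) \<in> carrier_mat n n" by (rule minv_carrier[OF mat_cont_on_carrier[OF F t]])
next
  fix i j assume ij: "i < n" "j < n"
  then obtain m where m: "n = Suc m" by (cases n) auto
  have "minv (F t) $$ (i, j) = (-1) ^ (j + i) * det (mat_delete (F t) j i) / det (F t)" if "t \<in> T" for t
  proof -
    note A = mat_cont_on_carrier[OF F that]
    have "adj_mat (F t) = minv (F t) * (F t * adj_mat (F t))"
      using dim_assoc_mult[of "minv (F t)" "F t" "adj_mat (F t)"] pd_inverse(2)[OF pd[OF that]]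
        minv_carrier[OF A] adj_mat(1)[OF A] A dim_one_mult[of "adj_mat (F t)" n]
      by (metis carrier_matD)
    also have "\<dots> = det (F t) \<cdot>\<^sub>m minv (F t)"
      unfolding adj_mat(2)[OF A]
      using mult_smult_distrib[OF minv_carrier[OF A], of "1\<^sub>m n" n "det (F t)"] minv_carrier[OF A]
      by (simp add: right_mult_one_mat[OF minv_carrier[OF A]])
    finally have "adj_mat (F t) $$ (i, j) = det (F t) * minv (F t) $$ (i, j)"
      using minv_carrier[OF A] ij by simp
    then show ?thesis
      using pd_inverse(3)[OF pd[OF that]] A ij
      by (simp add: adj_mat_def cofactor_def field_simps)
  qed
  moreover have "continuous_on T (\<lambda>t. (-1) ^ (j + i) * det (mat_delete (F t) j i) / det (F t))"
    using F pd_inverse(3)[OF pd] ij m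
    by (intro continuous_intros continuous_on_det[of _ _ m] continuous_on_det[of _ _ n] mat_cont_on_mat_delete) auto
  ultimately show "continuous_on T (\<lambda>t. minv (F t) $$ (i, j))" by (simp cong: continuous_on_cong)
qed

lemma vec_cont_on_mult:
  assumes F: "mat_cont_on T F a b" and x: "vec_cont_on T x b"
  shows "vec_cont_on T (\<lambda>t. F t *\<^sub>v x t) a"
  unfolding vec_cont_on_def
proof (intro conjI ballI allI impI)
  fix t assume t: "t \<in> T"
  show "F t *\<^sub>v x t \<in> carrier_vec a"
    by (rule mult_mat_vec_carrier[OF mat_cont_on_carrier[OF F t] vec_cont_on_carrier[OF x t]])
next
  fix i assume i: "i < a"
  have "continuous_on T (\<lambda>t. \<Sum>k<b. F t $$ (i, k) * x t $ k)"
    using F x i by (intro continuous_intros) (auto simp: mat_cont_on_def vec_cont_on_def)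
  moreover have "(F t *\<^sub>v x t) $ i = (\<Sum>k<b. F t $$ (i, k) * x t $ k)" if "t \<in> T" for t
    using mat_cont_on_carrier[OF F that] vec_cont_on_carrier[OF x that] i
    by (simp add: scalar_prod_def lessThan_atLeast0)
  ultimately show "continuous_on T (\<lambda>t. (F t *\<^sub>v x t) $ i)" by (simp cong: continuous_on_cong)
qed

lemma continuous_on_scalar_prod:
  assumes x: "vec_cont_on T x n" and y: "vec_cont_on T y n"
  shows "continuous_on T (\<lambda>t. x t \<bullet> y t)"
proof -
  have "continuous_on T (\<lambda>t. \<Sum>k<n. x t $ k * y t $ k)"
    using x y by (intro continuous_intros) (auto simp: vec_cont_on_def)
  moreover have "x t \<bullet> y t = (\<Sum>k<n. x t $ k * y t $ k)" if "t \<in> T" for t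
    using vec_cont_on_carrier[OF y that] by (simp add: scalar_prod_def lessThan_atLeast0)
  ultimately show ?thesis by (simp cong: continuous_on_cong)
qed

lemma has_real_derivative_scalar_prod:
  assumes x: "vec_deriv_on T n x x'" and y: "vec_deriv_on T n y y'" and t: "t \<in> T"
  shows "((\<lambda>s. x s \<bullet> y s) has_real_derivative x' t \<bullet> y t + x t \<bullet> y' t) (at t within T)"
proof -
  have "((\<lambda>s. \<Sum>k<n. x s $ k * y s $ k) has_real_derivative
      (\<Sum>k<n. x' t $ k * y t $ k + x t $ k * y' t $ k)) (at t within T)"
    using x y t unfolding vec_deriv_on_def
    by (intro DERIV_sum) (auto intro!: derivative_eq_intros)
  also have "(\<Sum>k<n. x' t $ k * y t $ k + x t $ k * y' t $ k) = x' t \<bullet> y t + x t \<bullet> y' t"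
  proof -
    have "dim_vec (y t) = n" "dim_vec (y' t) = n" using y t unfolding vec_deriv_on_def by auto
    then show ?thesis by (simp add: scalar_prod_def lessThan_atLeast0 sum.distrib)
  qed
  finally show ?thesis
  proof (rule has_field_derivative_transform_within[where d = 1])
    fix s assume "s \<in> T"
    then have "dim_vec (y s) = n" using y unfolding vec_deriv_on_def by auto
    then show "(\<Sum>k<n. x s $ k * y s $ k) = x s \<bullet> y s"
      by (simp add: scalar_prod_def lessThan_atLeast0)
  qed (simp_all add: t)
qed

lemma vec_deriv_on_mult:
  assumes F: "mat_deriv_on T a b F F'" and x: "vec_deriv_on T b x x'"
  shows "vec_deriv_on T a (\<lambda>t. F t *\<^sub>v x t) (\<lambda>t. F' t *\<^sub>v x t + F t *\<^sub>v x' t)"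
  unfolding vec_deriv_on_def
proof (intro ballI conjI allI impI)
  fix t assume t: "t \<in> T"
  have c: "F t \<in> carrier_mat a b" "F' t \<in> carrier_mat a b" "x t \<in> carrier_vec b" "x' t \<in> carrier_vec b"
    using F x t by (auto simp: mat_deriv_on_def vec_deriv_on_def)
  show "F t *\<^sub>v x t \<in> carrier_vec a" "F' t *\<^sub>v x t + F t *\<^sub>v x' t \<in> carrier_vec a"
    using c by auto
  fix i assume i: "i < a"
  have "((\<lambda>s. \<Sum>k<b. F s $$ (i, k) * x s $ k) has_real_derivative
      (\<Sum>k<b. F' t $$ (i, k) * x t $ k + F t $$ (i, k) * x' t $ k)) (at t within T)"
    using F x t i unfolding vec_deriv_on_def mat_deriv_on_def
    by (intro DERIV_sum) (auto intro!: derivative_eq_intros)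
  also have "(\<Sum>k<b. F' t $$ (i, k) * x t $ k + F t $$ (i, k) * x' t $ k) = (F' t *\<^sub>v x t + F t *\<^sub>v x' t) $ i"
    using c i by (auto simp: scalar_prod_def lessThan_atLeast0 sum.distrib)
  finally show "((\<lambda>s. (F s *\<^sub>v x s) $ i) has_real_derivative (F' t *\<^sub>v x t + F t *\<^sub>v x' t) $ i) (at t within T)"
  proof (rule has_field_derivative_transform_within[where d = 1])
    fix s assume s: "s \<in> T"
    have "F s \<in> carrier_mat a b" "x s \<in> carrier_vec b"
      using F x s by (auto simp: mat_deriv_on_def vec_deriv_on_def)
    then show "(\<Sum>k<b. F s $$ (i, k) * x s $ k) = (F s *\<^sub>v x s) $ i"
      using i by (auto simp: scalar_prod_def lessThan_atLeast0)
  qed (simp_all add: t)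
qed

section \<open>Linear differential equations\<close>

text \<open>Picard iteration: the solution is the series whose terms are obtained by feeding each term
  into the homogeneous equation.  The weight \<open>exp (l (t - a))\<close> with \<open>l > 2 n L\<close>, where \<open>L\<close> bounds the
  coefficients, makes every step halve the terms, whatever the length of the interval.\<close>

lemma linear_ode_functions:
  fixes F :: "nat \<Rightarrow> nat \<Rightarrow> real \<Rightarrow> real" and h :: "nat \<Rightarrow> real \<Rightarrow> real"
  assumes ab: "a \<le> b"
    and F: "\<And>i j. i < n \<Longrightarrow> j < n \<Longrightarrow> continuous_on {a..b} (F i j)"
    and h: "\<And>i. i < n \<Longrightarrow> continuous_on {a..b} (h i)"
  shows "\<exists>x. \<forall>i<n. x i a = x0 i \<and> (\<forall>t\<in>{a..b}.
    (x i has_real_derivative (\<Sum>j<n. F i j t * x j t) + h i t) (at t within {a..b}))"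
proof -
  let ?S = "{a..b}"
  define Y :: "nat \<Rightarrow> nat \<Rightarrow> real \<Rightarrow> real" where
    "Y = rec_nat (\<lambda>i t. x0 i + integral {a..t} (h i))
       (\<lambda>k y i t. integral {a..t} (\<lambda>s. \<Sum>j<n. F i j s * y j s))"
  define Y' where "Y' k i t = (case k of 0 \<Rightarrow> h i t | Suc k \<Rightarrow> \<Sum>j<n. F i j t * Y k j t)" for k i t
  have Y0: "Y 0 i t = x0 i + integral {a..t} (h i)" for i t by (simp add: Y_def)
  have YS: "Y (Suc k) i t = integral {a..t} (\<lambda>s. \<Sum>j<n. F i j s * Y k j s)" for k i t
    by (simp add: Y_def)
  have cont: "\<forall>i<n. continuous_on ?S (Y k i)" for k
  proof (induction k)
    case 0
    show ?case using h unfolding Y0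
      by (intro allI impI continuous_intros indefinite_integral_continuous_1 integrable_continuous_real) auto
  next
    case (Suc k)
    show ?case using F Suc unfolding YS
      by (intro allI impI continuous_intros indefinite_integral_continuous_1 integrable_continuous_real) auto
  qed
  have cont': "continuous_on ?S (\<lambda>s. \<Sum>j<n. F i j s * Y k j s)" if "i < n" for i k
    using F cont that by (intro continuous_intros) auto
  have der: "(Y k i has_real_derivative Y' k i t) (at t within ?S)" if "i < n" "t \<in> ?S" for k i t
  proof (cases k)
    case 0
    have "((\<lambda>t. x0 i + integral {a..t} (h i)) has_real_derivative h i t) (at t within ?S)"
      using integral_has_real_derivative[OF h[OF that(1)] that(2)] by (auto intro!: derivative_eq_intros)
    then show ?thesis by (simp add: 0 Y'_def Y0[abs_def])
  next
    case (Suc m)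
    show ?thesis
      using integral_has_real_derivative[OF cont'[OF that(1), of m] that(2)] by (simp add: Suc Y'_def YS[abs_def])
  qed
  obtain L where L: "L \<ge> 0" "\<And>i j t. i < n \<Longrightarrow> j < n \<Longrightarrow> t \<in> ?S \<Longrightarrow> \<bar>F i j t\<bar> \<le> L"
  proof -
    have "continuous_on ?S (\<lambda>t. \<Sum>i<n. \<Sum>j<n. \<bar>F i j t\<bar>)" using F by (intro continuous_intros) auto
    then have "bounded ((\<lambda>t. \<Sum>i<n. \<Sum>j<n. \<bar>F i j t\<bar>) ` ?S)"
      by (intro compact_imp_bounded compact_continuous_image) auto
    then obtain L where L0: "L > 0"
      and "\<forall>x\<in>(\<lambda>t. \<Sum>i<n. \<Sum>j<n. \<bar>F i j t\<bar>) ` ?S. norm x \<le> L"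
      unfolding bounded_pos by blast
    then have L: "\<bar>\<Sum>i<n. \<Sum>j<n. \<bar>F i j t\<bar>\<bar> \<le> L" if "t \<in> ?S" for t using that by simp
    have "\<bar>F i j t\<bar> \<le> L" if "i < n" "j < n" "t \<in> ?S" for i j t
    proof -
      have "\<bar>F i j t\<bar> \<le> (\<Sum>j<n. \<bar>F i j t\<bar>)" using that by (intro member_le_sum) auto
      also have "\<dots> \<le> (\<Sum>i<n. \<Sum>j<n. \<bar>F i j t\<bar>)"
        using that by (intro member_le_sum[of i "{..<n}" "\<lambda>i. \<Sum>j<n. \<bar>F i j t\<bar>"]) (auto intro: sum_nonneg)
      also have "\<dots> \<le> L" using L[OF that(3)] by linarith
      finally show ?thesis .
    qed
    with L0 show ?thesis by (intro that[of L]) auto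
  qed
  obtain B where B: "B \<ge> 0" "\<And>i t. i < n \<Longrightarrow> t \<in> ?S \<Longrightarrow> \<bar>Y 0 i t\<bar> \<le> B"
    "\<And>i t. i < n \<Longrightarrow> t \<in> ?S \<Longrightarrow> \<bar>h i t\<bar> \<le> B"
  proof -
    have "continuous_on ?S (\<lambda>t. (\<Sum>i<n. \<bar>Y 0 i t\<bar>) + (\<Sum>i<n. \<bar>h i t\<bar>))"
      using cont[of 0] h by (intro continuous_intros) auto
    then have "bounded ((\<lambda>t. (\<Sum>i<n. \<bar>Y 0 i t\<bar>) + (\<Sum>i<n. \<bar>h i t\<bar>)) ` ?S)"
      by (intro compact_imp_bounded compact_continuous_image) auto
    then obtain B where B0: "B > 0"
      and "\<forall>x\<in>(\<lambda>t. (\<Sum>i<n. \<bar>Y 0 i t\<bar>) + (\<Sum>i<n. \<bar>h i t\<bar>)) ` ?S. norm x \<le> B"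
      unfolding bounded_pos by blast
    then have B: "\<bar>(\<Sum>i<n. \<bar>Y 0 i t\<bar>) + (\<Sum>i<n. \<bar>h i t\<bar>)\<bar> \<le> B" if "t \<in> ?S" for t
      using that by simp
    have "\<bar>Y 0 i t\<bar> \<le> B \<and> \<bar>h i t\<bar> \<le> B" if "i < n" "t \<in> ?S" for i t
    proof -
      have "\<bar>Y 0 i t\<bar> \<le> (\<Sum>i<n. \<bar>Y 0 i t\<bar>)" "\<bar>h i t\<bar> \<le> (\<Sum>i<n. \<bar>h i t\<bar>)"
        using that by (auto intro!: member_le_sum)
      moreover have "0 \<le> (\<Sum>i<n. \<bar>Y 0 i t\<bar>)" "0 \<le> (\<Sum>i<n. \<bar>h i t\<bar>)" by (simp_all add: sum_nonneg)
      ultimately show ?thesis using B[OF that(2)] by linarith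
    qed
    with B0 show ?thesis by (intro that[of B]) auto
  qed
  define l where "l = 2 * real n * L + 1"
  have l: "l > 0" "real n * L / l \<le> 1 / 2" using L(1) by (simp_all add: l_def field_simps add_pos_nonneg)
  have Ybound: "\<forall>i<n. \<forall>t\<in>?S. \<bar>Y k i t\<bar> \<le> B * (1/2)^k * exp (l * (t - a))" for k
  proof (induction k)
    case 0
    show ?case
    proof (intro allI impI ballI)
      fix i t assume "i < n" "t \<in> ?S"
      then have "\<bar>Y 0 i t\<bar> \<le> B * 1" using B by simp
      also have "\<dots> \<le> B * exp (l * (t - a))" using B l \<open>t \<in> ?S\<close> by (intro mult_left_mono) auto
      finally show "\<bar>Y 0 i t\<bar> \<le> B * (1/2)^0 * exp (l * (t - a))" by simp
    qed
  next
    case (Suc k)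
    show ?case
    proof (intro allI impI ballI)
      fix i t assume i: "i < n" and t: "t \<in> ?S"
      let ?c = "real n * L * (B * (1/2)^k)"
      have sub: "{a..t} \<subseteq> ?S" using t by auto
      have I: "((\<lambda>s. ?c * exp (l * (s - a))) has_integral
          (?c / l * exp (l * (t - a)) - ?c / l * exp (l * (a - a)))) {a..t}"
        using t l by (intro fundamental_theorem_of_calculus)
          (auto intro!: derivative_eq_intros simp flip: has_real_derivative_iff_has_vector_derivative)
      have "norm (Y (Suc k) i t) \<le> integral {a..t} (\<lambda>s. ?c * exp (l * (s - a)))"
        unfolding YS
      proof (rule integral_norm_bound_integral)
        show "(\<lambda>s. \<Sum>j<n. F i j s * Y k j s) integrable_on {a..t}"
          by (rule integrable_continuous_real[OF continuous_on_subset[OF cont'[OF i] sub]])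
        show "(\<lambda>s. ?c * exp (l * (s - a))) integrable_on {a..t}" using I by blast
        fix s assume s: "s \<in> {a..t}"
        have "\<bar>\<Sum>j<n. F i j s * Y k j s\<bar> \<le> (\<Sum>j<n. L * (B * (1/2)^k * exp (l * (s - a))))"
        proof (rule order_trans[OF sum_abs], rule sum_mono)
          fix j assume "j \<in> {..<n}"
          then show "\<bar>F i j s * Y k j s\<bar> \<le> L * (B * (1/2)^k * exp (l * (s - a)))"
            unfolding abs_mult using s sub i L Suc by (intro mult_mono) auto
        qed
        then show "norm (\<Sum>j<n. F i j s * Y k j s) \<le> ?c * exp (l * (s - a))" by (simp add: mult_ac)
      qed
      also have "\<dots> = ?c / l * exp (l * (t - a)) - ?c / l" unfolding integral_unique[OF I] by simp
      also have "\<dots> \<le> ?c / l * exp (l * (t - a))" using l L B by simp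
      also have "\<dots> = (real n * L / l) * (B * (1/2)^k * exp (l * (t - a)))" by simp
      also have "\<dots> \<le> (1/2) * (B * (1/2)^k * exp (l * (t - a)))"
        using l B by (intro mult_right_mono) auto
      finally show "\<bar>Y (Suc k) i t\<bar> \<le> B * (1/2)^(Suc k) * exp (l * (t - a))" by simp
    qed
  qed
  define E where "E = exp (l * (b - a))"
  have YE: "\<bar>Y k i t\<bar> \<le> B * E * (1/2)^k" if "i < n" "t \<in> ?S" for k i t
  proof -
    have "\<bar>Y k i t\<bar> \<le> B * (1/2)^k * exp (l * (t - a))" using Ybound that by blast
    also have "\<dots> \<le> B * (1/2)^k * E" unfolding E_def using B l that by (intro mult_left_mono) auto
    finally show ?thesis by (simp add: mult_ac)
  qed
  define C where "C = B + 2 * real n * L * (B * E)"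
  have E0: "E \<ge> 0" by (simp add: E_def)
  have Y'E: "\<bar>Y' k i t\<bar> \<le> C * (1/2)^k" if "i < n" "t \<in> ?S" for k i t
  proof (cases k)
    case 0
    have "0 \<le> 2 * real n * L * (B * E)" using L B E0 by simp
    then have "\<bar>h i t\<bar> \<le> C" unfolding C_def using B(3)[OF that] by linarith
    then show ?thesis by (simp add: 0 Y'_def)
  next
    case (Suc m)
    have "\<bar>\<Sum>j<n. F i j t * Y m j t\<bar> \<le> (\<Sum>j<n. L * (B * E * (1/2)^m))"
    proof (rule order_trans[OF sum_abs], rule sum_mono)
      fix j assume "j \<in> {..<n}"
      then show "\<bar>F i j t * Y m j t\<bar> \<le> L * (B * E * (1/2)^m)"
        unfolding abs_mult using that L YE by (intro mult_mono) auto
    qed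
    also have "\<dots> = (2 * real n * L * (B * E)) * (1/2)^k" by (simp add: Suc)
    also have "\<dots> \<le> C * (1/2)^k" using B by (intro mult_right_mono) (auto simp: C_def)
    finally show ?thesis by (simp add: Suc Y'_def)
  qed
  have geom: "summable (\<lambda>k. c * (1/2::real)^k)" for c by (intro summable_mult summable_geometric) simp
  have sol: "\<exists>g. \<forall>t\<in>?S. (\<lambda>k. Y k i t) sums g t \<and> (g has_real_derivative (\<Sum>k. Y' k i t)) (at t within ?S)"
    if i: "i < n" for i
  proof (rule has_field_derivative_series[where f' = "\<lambda>k. Y' k i"])
    show "(Y k i has_real_derivative Y' k i t) (at t within ?S)" if "t \<in> ?S" for k t
      by (rule der[OF i that])
    show "uniform_limit ?S (\<lambda>m t. \<Sum>k<m. Y' k i t) (\<lambda>t. \<Sum>k. Y' k i t) sequentially"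
      by (rule Weierstrass_m_test[OF _ geom[of C]]) (use Y'E[OF i] in auto)
    show "a \<in> ?S" using ab by simp
    show "summable (\<lambda>k. Y k i a)"
      by (rule summable_comparison_test'[OF geom[of "B * E"], of 0]) (use YE[OF i] ab in auto)
  qed simp
  then obtain g where g: "\<And>i t. i < n \<Longrightarrow> t \<in> ?S \<Longrightarrow> (\<lambda>k. Y k i t) sums g i t"
    "\<And>i t. i < n \<Longrightarrow> t \<in> ?S \<Longrightarrow> (g i has_real_derivative (\<Sum>k. Y' k i t)) (at t within ?S)"
    by metis
  show ?thesis
  proof (intro exI allI impI conjI ballI)
    fix i assume i: "i < n"
    have "(\<lambda>k. Y k i a) = (\<lambda>k. if k = 0 then x0 i else 0)"
      by (rule ext, case_tac k) (simp_all add: Y0 YS)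
    then have "(\<lambda>k. Y k i a) sums x0 i" using sums_single[of 0 "\<lambda>_. x0 i"] by simp
    then show "g i a = x0 i" using g(1)[OF i, of a] ab sums_unique2 by auto
    fix t assume t: "t \<in> ?S"
    have "(\<lambda>k. \<Sum>j<n. F i j t * Y k j t) sums (\<Sum>j<n. F i j t * g j t)"
      using g(1) t by (intro sums_sum sums_mult) auto
    then have "(\<lambda>k. Y' (Suc k) i t) sums (\<Sum>j<n. F i j t * g j t)" by (simp add: Y'_def)
    then have "(\<lambda>k. Y' k i t) sums ((\<Sum>j<n. F i j t * g j t) + Y' 0 i t)" by (subst (asm) sums_Suc_iff) simp
    then have "(\<Sum>k. Y' k i t) = (\<Sum>j<n. F i j t * g j t) + h i t" by (simp add: sums_iff Y'_def)
    then show "(g i has_real_derivative (\<Sum>j<n. F i j t * g j t) + h i t) (at t within ?S)"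
      using g(2)[OF i t] by simp
  qed
qed

lemma linear_ode_forward:
  assumes ab: "a \<le> b" and F: "mat_cont_on {a..b} F n n" and h: "vec_cont_on {a..b} h n"
    and x0: "x0 \<in> carrier_vec n"
  shows "\<exists>x. x a = x0 \<and> vec_deriv_on {a..b} n x (\<lambda>t. F t *\<^sub>v x t + h t)"
proof -
  have "\<exists>x. \<forall>i<n. x i a = x0 $ i \<and> (\<forall>t\<in>{a..b}. (x i has_real_derivative
      (\<Sum>j<n. F t $$ (i, j) * x j t) + h t $ i) (at t within {a..b}))"
    using F h by (intro linear_ode_functions[OF ab]) (auto simp: mat_cont_on_def vec_cont_on_def)
  then obtain x where x: "\<And>i. i < n \<Longrightarrow> x i a = x0 $ i"
    "\<And>i t. i < n \<Longrightarrow> t \<in> {a..b} \<Longrightarrow> (x i has_real_derivative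
      (\<Sum>j<n. F t $$ (i, j) * x j t) + h t $ i) (at t within {a..b})" by blast
  show ?thesis
  proof (intro exI conjI)
    let ?x = "\<lambda>t. vec n (\<lambda>i. x i t)"
    show "?x a = x0" using x0 x(1) by (intro eq_vecI) auto
    show "vec_deriv_on {a..b} n ?x (\<lambda>t. F t *\<^sub>v ?x t + h t)"
      unfolding vec_deriv_on_def
    proof (intro ballI conjI allI impI)
      fix t assume t: "t \<in> {a..b}"
      note c = mat_cont_on_carrier[OF F t] vec_cont_on_carrier[OF h t]
      show "?x t \<in> carrier_vec n" "F t *\<^sub>v ?x t + h t \<in> carrier_vec n" using c by auto
      fix i assume i: "i < n"
      have "(F t *\<^sub>v ?x t + h t) $ i = (\<Sum>j<n. F t $$ (i, j) * x j t) + h t $ i"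
        using c i by (auto simp: scalar_prod_def lessThan_atLeast0)
      then show "((\<lambda>s. ?x s $ i) has_real_derivative (F t *\<^sub>v ?x t + h t) $ i) (at t within {a..b})"
        using x(2)[OF i t] i by simp
    qed
  qed
qed

text \<open>The reflection \<open>t \<mapsto> a + b - t\<close> exchanges initial and terminal conditions.\<close>

lemma linear_ode_backward:
  assumes ab: "a \<le> b" and F: "mat_cont_on {a..b} F n n" and x0: "x0 \<in> carrier_vec n"
  shows "\<exists>x. x b = x0 \<and> vec_deriv_on {a..b} n x (\<lambda>t. F t *\<^sub>v x t)"
proof -
  let ?r = "\<lambda>t. a + b - t"
  have img: "?r ` {a..b} = {a..b}"
  proof (intro equalityI subsetI)
    fix x assume "x \<in> {a..b}"
    then show "x \<in> ?r ` {a..b}" by (intro image_eqI[of _ _ "?r x"]) simp_all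
  qed (elim imageE, simp)
  have rt: "?r t \<in> {a..b}" if "t \<in> {a..b}" for t using that by auto
  have Fr: "mat_cont_on {a..b} (\<lambda>t. 0\<^sub>m n n - F (?r t)) n n"
  proof (rule mat_cont_on_minus[OF mat_cont_on_const])
    show "mat_cont_on {a..b} (\<lambda>t. F (?r t)) n n"
      unfolding mat_cont_on_def
    proof (intro conjI ballI allI impI)
      fix t assume "t \<in> {a..b}"
      then show "F (?r t) \<in> carrier_mat n n" by (intro mat_cont_on_carrier[OF F] rt)
    next
      fix i j assume "i < n" "j < n"
      then have "continuous_on {a..b} (\<lambda>t. F t $$ (i, j))" using F by (simp add: mat_cont_on_def)
      moreover have "continuous_on {a..b} ?r" by (intro continuous_intros)
      ultimately show "continuous_on {a..b} (\<lambda>t. F (?r t) $$ (i, j))"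
        by (rule continuous_on_compose2) (simp add: img)
    qed
  qed simp
  have "vec_cont_on {a..b} (\<lambda>_. 0\<^sub>v n) n" by (simp add: vec_cont_on_def)
  from linear_ode_forward[OF ab Fr this x0] obtain y where y: "y a = x0"
    "vec_deriv_on {a..b} n y (\<lambda>t. (0\<^sub>m n n - F (?r t)) *\<^sub>v y t + 0\<^sub>v n)" by blast
  have "vec_deriv_on {a..b} n (\<lambda>t. y (?r t)) (\<lambda>t. F t *\<^sub>v y (?r t))"
    unfolding vec_deriv_on_def
  proof (intro ballI conjI allI impI)
    fix t assume t: "t \<in> {a..b}"
    note Ft = mat_cont_on_carrier[OF F t]
    have c: "y (?r t) \<in> carrier_vec n" using y(2) rt[OF t] unfolding vec_deriv_on_def by blast
    then show "y (?r t) \<in> carrier_vec n" "F t *\<^sub>v y (?r t) \<in> carrier_vec n" using Ft by auto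
    fix i assume i: "i < n"
    have "((\<lambda>s. y s $ i) has_real_derivative ((0\<^sub>m n n - F (?r (?r t))) *\<^sub>v y (?r t) + 0\<^sub>v n) $ i) (at (?r t) within ?r ` {a..b})"
      unfolding img using y(2) rt[OF t] i unfolding vec_deriv_on_def by blast
    moreover have "((0\<^sub>m n n - F (?r (?r t))) *\<^sub>v y (?r t) + 0\<^sub>v n) $ i = - (F t *\<^sub>v y (?r t)) $ i"
      using Ft c i by (simp add: scalar_prod_def sum_negf)
    ultimately have "((\<lambda>s. y s $ i) has_real_derivative - (F t *\<^sub>v y (?r t)) $ i) (at (?r t) within ?r ` {a..b})"
      by simp
    moreover have "(?r has_real_derivative - 1) (at t within {a..b})"
      by (auto intro!: derivative_eq_intros)
    ultimately have "((\<lambda>s. y s $ i) \<circ> ?r has_real_derivative - (F t *\<^sub>v y (?r t)) $ i * - 1) (at t within {a..b})"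
      by (rule DERIV_image_chain)
    then show "((\<lambda>s. y (?r s) $ i) has_real_derivative (F t *\<^sub>v y (?r t)) $ i) (at t within {a..b})"
      by (simp add: o_def)
  qed
  then show ?thesis using y(1) by (intro exI[of _ "\<lambda>t. y (?r t)"]) simp
qed

section \<open>Growth estimates\<close>

lemma integral_of_derivative:
  fixes f :: "real \<Rightarrow> real"
  assumes "a \<le> b" and "\<And>t. t \<in> {a..b} \<Longrightarrow> (f has_real_derivative f' t) (at t within {a..b})"
  shows "(f' has_integral (f b - f a)) {a..b}"
  by (rule fundamental_theorem_of_calculus)
    (simp_all add: assms has_real_derivative_iff_has_vector_derivative[symmetric])

lemma increment_mono:
  fixes f g :: "real \<Rightarrow> real"
  assumes ab: "a \<le> b" and f: "\<And>t. t \<in> {a..b} \<Longrightarrow> (f has_real_derivative f' t) (at t within {a..b})"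
    and g: "continuous_on {a..b} g" and le: "\<And>t. t \<in> {a..b} \<Longrightarrow> f' t \<le> g t"
  shows "f b - f a \<le> integral {a..b} g"
  by (rule has_integral_le[OF integral_of_derivative[OF ab f] integrable_integral[OF integrable_continuous_real[OF g]] le])

lemma gronwall_forward:
  fixes f g :: "real \<Rightarrow> real"
  assumes ab: "a \<le> b" and c: "0 \<le> c"
    and f: "\<And>t. t \<in> {a..b} \<Longrightarrow> (f has_real_derivative f' t) (at t within {a..b})"
    and g: "continuous_on {a..b} g" "\<And>t. t \<in> {a..b} \<Longrightarrow> 0 \<le> g t"
    and le: "\<And>t. t \<in> {a..b} \<Longrightarrow> f' t \<le> c * f t + g t"
  shows "f b \<le> exp (c * (b - a)) * (f a + integral {a..b} g)"
proof -
  let ?E = "\<lambda>t. exp (- c * (t - a))"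
  have "f b * ?E b - f a * ?E a \<le> integral {a..b} g"
  proof (rule increment_mono[OF ab _ g(1)])
    fix t assume t: "t \<in> {a..b}"
    show "((\<lambda>t. f t * ?E t) has_real_derivative ?E t * (f' t - c * f t)) (at t within {a..b})"
      by (auto intro!: derivative_eq_intros f[OF t] simp: algebra_simps)
    have "?E t * (f' t - c * f t) \<le> ?E t * g t" using le[OF t] by (intro mult_left_mono) auto
    also have "\<dots> \<le> 1 * g t" using g(2)[OF t] c t by (intro mult_right_mono) auto
    finally show "?E t * (f' t - c * f t) \<le> g t" by simp
  qed
  then have "f b * ?E b \<le> f a + integral {a..b} g" by simp
  then have "f b * ?E b * exp (c * (b - a)) \<le> (f a + integral {a..b} g) * exp (c * (b - a))"
    by (intro mult_right_mono) auto
  moreover have "?E b * exp (c * (b - a)) = 1" by (simp add: exp_add[symmetric])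
  ultimately show ?thesis by (simp only: mult.assoc mult.commute[of "f a + integral {a..b} g"] mult_1_right)
qed

lemma gronwall_backward:
  fixes f g :: "real \<Rightarrow> real"
  assumes ab: "a \<le> b" and c: "0 \<le> c"
    and f: "\<And>t. t \<in> {a..b} \<Longrightarrow> (f has_real_derivative f' t) (at t within {a..b})"
    and g: "continuous_on {a..b} g" "\<And>t. t \<in> {a..b} \<Longrightarrow> 0 \<le> g t"
    and le: "\<And>t. t \<in> {a..b} \<Longrightarrow> - f' t \<le> c * f t + g t"
  shows "f a \<le> exp (c * (b - a)) * (f b + integral {a..b} g)"
proof -
  let ?E = "\<lambda>t. exp (c * (t - b))"
  have "- (f b * ?E b) - - (f a * ?E a) \<le> integral {a..b} g"
  proof (rule increment_mono[OF ab _ g(1)])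
    fix t assume t: "t \<in> {a..b}"
    show "((\<lambda>t. - (f t * ?E t)) has_real_derivative ?E t * (- f' t - c * f t)) (at t within {a..b})"
      by (auto intro!: derivative_eq_intros f[OF t] simp: algebra_simps)
    have "?E t * (- f' t - c * f t) \<le> ?E t * g t" using le[OF t] by (intro mult_left_mono) auto
    also have "\<dots> \<le> 1 * g t" using g(2)[OF t] c t
      by (intro mult_right_mono) (auto simp: mult_nonneg_nonpos)
    finally show "?E t * (- f' t - c * f t) \<le> g t" by simp
  qed
  then have "f a * ?E a \<le> f b + integral {a..b} g" by simp
  then have "f a * ?E a * exp (c * (b - a)) \<le> (f b + integral {a..b} g) * exp (c * (b - a))"
    by (intro mult_right_mono) auto
  then show ?thesis by (simp add: mult.assoc exp_add[symmetric] algebra_simps)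
qed

section \<open>The matrix Riccati equation\<close>

lemma vec_deriv_on_minus:
  assumes x: "vec_deriv_on T n x x'" and y: "vec_deriv_on T n y y'"
  shows "vec_deriv_on T n (\<lambda>t. x t - y t) (\<lambda>t. x' t - y' t)"
  unfolding vec_deriv_on_def
proof (intro ballI conjI allI impI)
  fix t assume t: "t \<in> T"
  have c: "x t \<in> carrier_vec n" "x' t \<in> carrier_vec n" "y t \<in> carrier_vec n" "y' t \<in> carrier_vec n"
    using x y t by (simp_all add: vec_deriv_on_def)
  show "x t - y t \<in> carrier_vec n" "x' t - y' t \<in> carrier_vec n" using c by auto
  fix i assume i: "i < n"
  have "((\<lambda>s. x s $ i - y s $ i) has_real_derivative x' t $ i - y' t $ i) (at t within T)"
    using x y t i by (intro DERIV_diff) (simp_all add: vec_deriv_on_def)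
  moreover have "x' t $ i - y' t $ i = (x' t - y' t) $ i" using c i by simp
  ultimately have "((\<lambda>s. x s $ i - y s $ i) has_real_derivative (x' t - y' t) $ i) (at t within T)" by simp
  then show "((\<lambda>s. (x s - y s) $ i) has_real_derivative (x' t - y' t) $ i) (at t within T)"
  proof (rule has_field_derivative_transform_within[where d = 1])
    fix s assume "s \<in> T"
    then have "y s \<in> carrier_vec n" using y by (simp add: vec_deriv_on_def)
    then show "x s $ i - y s $ i = (x s - y s) $ i" using i by simp
  qed (simp_all add: t)
qed

lemma mat_deriv_on_cong:
  assumes "mat_deriv_on T a b F F'" "\<And>t. t \<in> T \<Longrightarrow> F' t = G t"
  shows "mat_deriv_on T a b F G"
  using assms(1) unfolding mat_deriv_on_def by (simp add: assms(2))

lemma mat_deriv_on_transpose: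
  assumes F: "mat_deriv_on T a b F F'"
  shows "mat_deriv_on T b a (\<lambda>t. (F t)\<^sup>T) (\<lambda>t. (F' t)\<^sup>T)"
  unfolding mat_deriv_on_def
proof (intro ballI conjI allI impI)
  fix t assume t: "t \<in> T"
  have c: "F t \<in> carrier_mat a b" "F' t \<in> carrier_mat a b" using F t by (simp_all add: mat_deriv_on_def)
  then show "(F t)\<^sup>T \<in> carrier_mat b a" "(F' t)\<^sup>T \<in> carrier_mat b a" by simp_all
  fix i j assume ij: "i < b" "j < a"
  have "(F' t)\<^sup>T $$ (i, j) = F' t $$ (j, i)" using c ij by simp
  then have "((\<lambda>s. F s $$ (j, i)) has_real_derivative (F' t)\<^sup>T $$ (i, j)) (at t within T)"
    using F t ij by (simp add: mat_deriv_on_def)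
  then show "((\<lambda>s. (F s)\<^sup>T $$ (i, j)) has_real_derivative (F' t)\<^sup>T $$ (i, j)) (at t within T)"
  proof (rule has_field_derivative_transform_within[where d = 1])
    fix s assume "s \<in> T"
    then have "F s \<in> carrier_mat a b" using F by (simp add: mat_deriv_on_def)
    then show "F s $$ (j, i) = (F s)\<^sup>T $$ (i, j)" using ij by simp
  qed (use t in simp_all)
qed

lemma mat_deriv_on_minus:
  assumes F: "mat_deriv_on T a b F F'" and G: "mat_deriv_on T a b G G'"
  shows "mat_deriv_on T a b (\<lambda>t. F t - G t) (\<lambda>t. F' t - G' t)"
  unfolding mat_deriv_on_def
proof (intro ballI conjI allI impI)
  fix t assume t: "t \<in> T"
  have c: "F' t \<in> carrier_mat a b" "G t \<in> carrier_mat a b" "G' t \<in> carrier_mat a b"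
    using F G t by (simp_all add: mat_deriv_on_def)
  then show "F t - G t \<in> carrier_mat a b" "F' t - G' t \<in> carrier_mat a b" by auto
  fix i j assume ij: "i < a" "j < b"
  have "((\<lambda>s. F s $$ (i, j) - G s $$ (i, j)) has_real_derivative F' t $$ (i, j) - G' t $$ (i, j)) (at t within T)"
    using F G t ij by (intro DERIV_diff) (simp_all add: mat_deriv_on_def)
  also have "F' t $$ (i, j) - G' t $$ (i, j) = (F' t - G' t) $$ (i, j)" using c ij by simp
  finally show "((\<lambda>s. (F s - G s) $$ (i, j)) has_real_derivative (F' t - G' t) $$ (i, j)) (at t within T)"
  proof (rule has_field_derivative_transform_within[where d = 1])
    fix s assume "s \<in> T"
    then have "G s \<in> carrier_mat a b" using G by (simp add: mat_deriv_on_def)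
    then show "F s $$ (i, j) - G s $$ (i, j) = (F s - G s) $$ (i, j)" using ij by simp
  qed (use t in simp_all)
qed

lemma mat_cont_on_interval_bounded:
  assumes F: "mat_cont_on {a..b} F m n"
  shows "\<exists>c\<ge>0. \<forall>t\<in>{a..b}. \<forall>x\<in>carrier_vec n. vnorm (F t *\<^sub>v x) \<le> c * vnorm x"
proof -
  let ?f = "\<lambda>t. \<Sum>i<m. \<Sum>j<n. \<bar>F t $$ (i, j)\<bar>"
  have "continuous_on {a..b} ?f"
    using F by (intro continuous_intros) (auto simp: mat_cont_on_def)
  then have "bounded (?f ` {a..b})" by (intro compact_imp_bounded compact_continuous_image) auto
  then obtain c where c0: "c > 0" and c: "\<forall>x\<in>?f ` {a..b}. norm x \<le> c" unfolding bounded_pos by blast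
  have "vnorm (F t *\<^sub>v x) \<le> c * vnorm x" if t: "t \<in> {a..b}" and x: "x \<in> carrier_vec n" for t x
  proof -
    note A = mat_cont_on_carrier[OF F t]
    have "vnorm (F t *\<^sub>v x) \<le> (\<Sum>i\<in>{0..<m}. \<bar>(F t *\<^sub>v x) $ i\<bar>)"
      unfolding vnorm_L2_set using A by (auto intro!: order_trans[OF L2_set_le_sum_abs])
    also have "\<dots> \<le> (\<Sum>i\<in>{0..<m}. \<Sum>j<n. \<bar>F t $$ (i, j)\<bar> * vnorm x)"
    proof (rule sum_mono)
      fix i assume i: "i \<in> {0..<m}"
      have "\<bar>(F t *\<^sub>v x) $ i\<bar> = \<bar>\<Sum>j<n. F t $$ (i, j) * x $ j\<bar>"
        using A x i by (simp add: scalar_prod_def lessThan_atLeast0)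
      also have "\<dots> \<le> (\<Sum>j<n. \<bar>F t $$ (i, j)\<bar> * \<bar>x $ j\<bar>)"
        by (rule order_trans[OF sum_abs]) (simp add: abs_mult)
      also have "\<dots> \<le> (\<Sum>j<n. \<bar>F t $$ (i, j)\<bar> * vnorm x)"
      proof (intro sum_mono mult_left_mono)
        fix j assume "j \<in> {..<n}"
        then have "\<bar>x $ j\<bar> \<le> L2_set (\<lambda>i. \<bar>x $ i\<bar>) {0..<dim_vec x}"
          using x by (intro member_le_L2_set) auto
        then show "\<bar>x $ j\<bar> \<le> vnorm x" by (simp add: vnorm_L2_set L2_set_def)
      qed simp
      finally show "\<bar>(F t *\<^sub>v x) $ i\<bar> \<le> (\<Sum>j<n. \<bar>F t $$ (i, j)\<bar> * vnorm x)" .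
    qed
    also have "\<dots> = ?f t * vnorm x" by (simp add: sum_distrib_right lessThan_atLeast0)
    also have "\<dots> \<le> c * vnorm x"
    proof (rule mult_right_mono)
      have "norm (?f t) \<le> c" using c t by blast
      then show "?f t \<le> c" by simp
    qed simp
    finally show ?thesis .
  qed
  then show ?thesis using c0 by (intro exI[of _ c]) auto
qed

lemma mat_eq_0_if_form_0:
  assumes A: "A \<in> carrier_mat n n" and z: "\<And>x y. x \<in> carrier_vec n \<Longrightarrow> y \<in> carrier_vec n \<Longrightarrow> x \<bullet> (A *\<^sub>v y) = 0"
  shows "A = (0\<^sub>m n n :: real mat)"
proof (rule eq_matI)
  fix i j assume "i < dim_row (0\<^sub>m n n)" "j < dim_col (0\<^sub>m n n)"
  then have ij: "i < n" "j < n" by simp_all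
  have "unit_vec n i \<bullet> (A *\<^sub>v unit_vec n j) = A $$ (i, j)" using A ij by simp
  then show "A $$ (i, j) = 0\<^sub>m n n $$ (i, j)" using z[of "unit_vec n i" "unit_vec n j"] ij by simp
qed (use A in simp_all)

lemma derivative_zero_imp_equal:
  fixes f :: "real \<Rightarrow> real"
  assumes "s \<le> t" and d: "\<And>r. r \<in> {s..t} \<Longrightarrow> (f has_real_derivative 0) (at r within {s..t})"
  shows "f s = f t"
proof -
  have "((\<lambda>_. 0) has_integral f t - f s) {s..t}" by (rule integral_of_derivative[OF assms])
  then show ?thesis using has_integral_unique[OF has_integral_0] by fastforce
qed

lemma two_mult_le_add_squares: "2 * x * y \<le> x * x + y * (y :: real)"
  using zero_le_power2[of "x - y"] by (simp add: power2_eq_square algebra_simps)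

text \<open>The Riccati equation \<open>P' = A P + P A\<^sup>T + Q - P K P\<close> with bounded semidefinite data.  The bounds are
  inequalities for vectors rather than for the operator norm, the form in which they are used.\<close>

locale riccati =
  fixes n :: nat and t\<^sub>0 :: real and A Q K :: "real \<Rightarrow> real mat" and a q k :: real
  assumes A_cont: "mat_cont_on {t\<^sub>0..} A n n"
    and Q_cont: "mat_cont_on {t\<^sub>0..} Q n n"
    and K_cont: "mat_cont_on {t\<^sub>0..} K n n"
    and Q_psd: "\<And>t. t\<^sub>0 \<le> t \<Longrightarrow> psd n (Q t)"
    and K_psd: "\<And>t. t\<^sub>0 \<le> t \<Longrightarrow> psd n (K t)"
    and A_bound: "\<And>t x. t\<^sub>0 \<le> t \<Longrightarrow> x \<in> carrier_vec n \<Longrightarrow> vnorm (A t *\<^sub>v x) \<le> a * vnorm x"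
    and Q_bound: "\<And>t x. t\<^sub>0 \<le> t \<Longrightarrow> x \<in> carrier_vec n \<Longrightarrow> vnorm (Q t *\<^sub>v x) \<le> q * vnorm x"
    and K_bound: "\<And>t x. t\<^sub>0 \<le> t \<Longrightarrow> x \<in> carrier_vec n \<Longrightarrow> vnorm (K t *\<^sub>v x) \<le> k * vnorm x"
    and bounds_nonneg: "0 \<le> a" "0 \<le> q" "0 \<le> k"
begin

lemma coeff_carrier:
  assumes "t\<^sub>0 \<le> t"
  shows "A t \<in> carrier_mat n n" "Q t \<in> carrier_mat n n" "K t \<in> carrier_mat n n"
  using assms A_cont Q_cont K_cont by (auto intro: mat_cont_on_carrier)

lemma coeff_dim:
  assumes "t\<^sub>0 \<le> t"
  shows "dim_row (A t) = n" "dim_col (A t) = n" "dim_row (Q t) = n" "dim_col (Q t) = n"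
    "dim_row (K t) = n" "dim_col (K t) = n"
  using coeff_carrier[OF assms] by auto

lemma coeff_transpose:
  assumes "t\<^sub>0 \<le> t"
  shows "(Q t)\<^sup>T = Q t" "(K t)\<^sup>T = K t"
  using Q_psd[OF assms] K_psd[OF assms] by (simp_all add: psd_def)

lemma form_le:
  assumes "t\<^sub>0 \<le> t" "x \<in> carrier_vec n"
  shows "x \<bullet> (Q t *\<^sub>v x) \<le> q * (x \<bullet> x)" "x \<bullet> (K t *\<^sub>v x) \<le> k * (x \<bullet> x)"
    "x \<bullet> (A t *\<^sub>v x) \<le> a * (x \<bullet> x)" "- (x \<bullet> (A t *\<^sub>v x)) \<le> a * (x \<bullet> x)"
proof -
  have *: "\<bar>x \<bullet> (B *\<^sub>v x)\<bar> \<le> c * (x \<bullet> x)" if "B \<in> carrier_mat n n" "vnorm (B *\<^sub>v x) \<le> c * vnorm x" for B c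
  proof -
    have "\<bar>x \<bullet> (B *\<^sub>v x)\<bar> \<le> vnorm x * vnorm (B *\<^sub>v x)"
      using that assms by (intro Cauchy_Schwarz_vec) auto
    also have "\<dots> \<le> vnorm x * (c * vnorm x)" using that by (intro mult_left_mono) auto
    finally show ?thesis by (simp add: vnorm_sq[symmetric] power2_eq_square mult_ac)
  qed
  show "x \<bullet> (Q t *\<^sub>v x) \<le> q * (x \<bullet> x)"
    using *[OF coeff_carrier(2)[OF assms(1)] Q_bound[OF assms]] by linarith
  show "x \<bullet> (K t *\<^sub>v x) \<le> k * (x \<bullet> x)"
    using *[OF coeff_carrier(3)[OF assms(1)] K_bound[OF assms]] by linarith
  show "x \<bullet> (A t *\<^sub>v x) \<le> a * (x \<bullet> x)" "- (x \<bullet> (A t *\<^sub>v x)) \<le> a * (x \<bullet> x)"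
    using *[OF coeff_carrier(1)[OF assms(1)] A_bound[OF assms]] by linarith+
qed

definition solution :: "(real \<Rightarrow> real mat) \<Rightarrow> bool" where
  "solution P \<longleftrightarrow> mat_deriv_on {t\<^sub>0..} n n P
     (\<lambda>t. A t * P t + P t * (A t)\<^sup>T + Q t - P t * K t * P t)"

text \<open>The adjoint equation \<open>z' = - A\<^sup>T z\<close> with the forcing \<open>K u\<close>.  The choice of \<open>u\<close> is what turns
  one computation into the comparison arguments below: \<open>u = P z\<close> closes the loop, any other \<open>u\<close>
  is a suboptimal control.\<close>

definition forced_adjoint :: "real set \<Rightarrow> (real \<Rightarrow> real vec) \<Rightarrow> (real \<Rightarrow> real vec) \<Rightarrow> bool" where
  "forced_adjoint S u z \<longleftrightarrow> (\<forall>t\<in>S. u t \<in> carrier_vec n) \<and>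
     vec_deriv_on S n z (\<lambda>t. K t *\<^sub>v u t - (A t)\<^sup>T *\<^sub>v z t)"

lemma solution_carrier: "solution P \<Longrightarrow> t\<^sub>0 \<le> t \<Longrightarrow> P t \<in> carrier_mat n n"
  by (simp add: solution_def mat_deriv_on_def)

lemma solution_cont: "solution P \<Longrightarrow> mat_cont_on {t\<^sub>0..} P n n"
  unfolding solution_def by (rule mat_deriv_on_cont)

lemma forced_adjoint_carrier: "forced_adjoint S u z \<Longrightarrow> t \<in> S \<Longrightarrow> z t \<in> carrier_vec n"
  "forced_adjoint S u z \<Longrightarrow> t \<in> S \<Longrightarrow> u t \<in> carrier_vec n"
  by (simp_all add: forced_adjoint_def vec_deriv_on_def)

lemma forced_adjoint_subset: "forced_adjoint S u z \<Longrightarrow> R \<subseteq> S \<Longrightarrow> forced_adjoint R u z"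
  unfolding forced_adjoint_def using vec_deriv_on_subset by blast

text \<open>The terms with \<open>A\<close> cancel, because \<open>z\<close> and \<open>y\<close> move with \<open>- A\<^sup>T\<close>.  What remains is \<open>Q\<close>, the quadratic
  term and the two controls.\<close>

lemma form_derivative:
  assumes P: "solution P" and S: "S \<subseteq> {t\<^sub>0..}" and z: "forced_adjoint S u z" and y: "forced_adjoint S v y"
    and t: "t \<in> S"
  shows "((\<lambda>s. z s \<bullet> (P s *\<^sub>v y s)) has_real_derivative
    z t \<bullet> (Q t *\<^sub>v y t) - z t \<bullet> (P t *\<^sub>v (K t *\<^sub>v (P t *\<^sub>v y t))) + (K t *\<^sub>v u t) \<bullet> (P t *\<^sub>v y t)
      + z t \<bullet> (P t *\<^sub>v (K t *\<^sub>v v t))) (at t within S)"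
proof -
  have t0: "t\<^sub>0 \<le> t" using S t by auto
  have d: "dim_row (P t) = n" "dim_col (P t) = n" "dim_vec (z t) = n" "dim_vec (y t) = n"
    "dim_vec (u t) = n" "dim_vec (v t) = n"
    using solution_carrier[OF P t0] forced_adjoint_carrier[OF z t] forced_adjoint_carrier[OF y t] by auto
  note dims = d coeff_dim[OF t0]
  have Py: "vec_deriv_on S n (\<lambda>t. P t *\<^sub>v y t)
      (\<lambda>t. (A t * P t + P t * (A t)\<^sup>T + Q t - P t * K t * P t) *\<^sub>v y t
         + P t *\<^sub>v (K t *\<^sub>v v t - (A t)\<^sup>T *\<^sub>v y t))"
    by (rule vec_deriv_on_mult[OF mat_deriv_on_subset[OF P[unfolded solution_def] S]
          conjunct2[OF y[unfolded forced_adjoint_def]]])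
  have z': "vec_deriv_on S n z (\<lambda>t. K t *\<^sub>v u t - (A t)\<^sup>T *\<^sub>v z t)"
    using z by (simp add: forced_adjoint_def)
  have e: "(K t *\<^sub>v u t - (A t)\<^sup>T *\<^sub>v z t) \<bullet> (P t *\<^sub>v y t) +
      z t \<bullet> ((A t * P t + P t * (A t)\<^sup>T + Q t - P t * K t * P t) *\<^sub>v y t
         + P t *\<^sub>v (K t *\<^sub>v v t - (A t)\<^sup>T *\<^sub>v y t))
    = z t \<bullet> (Q t *\<^sub>v y t) - z t \<bullet> (P t *\<^sub>v (K t *\<^sub>v (P t *\<^sub>v y t))) + (K t *\<^sub>v u t) \<bullet> (P t *\<^sub>v y t)
      + z t \<bullet> (P t *\<^sub>v (K t *\<^sub>v v t))"
    by (simp add: dims dim_vec_algebra sp_algebra sp_transpose)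
  show ?thesis using has_real_derivative_scalar_prod[OF z' Py t] unfolding e .
qed

lemma closed_loop_adjoint_exists:
  assumes P: "mat_cont_on {t\<^sub>0..} P n n" and st: "t\<^sub>0 \<le> s" "s \<le> t" and x: "x \<in> carrier_vec n"
  obtains z where "z t = x" "forced_adjoint {s..t} (\<lambda>r. P r *\<^sub>v z r) z"
proof -
  have S: "{s..t} \<subseteq> {t\<^sub>0..}" using st by auto
  have F: "mat_cont_on {s..t} (\<lambda>r. K r * P r - (A r)\<^sup>T) n n"
    by (rule mat_cont_on_minus[OF mat_cont_on_mult[OF mat_cont_on_subset[OF K_cont S] mat_cont_on_subset[OF P S]]
          mat_cont_on_transpose[OF mat_cont_on_subset[OF A_cont S]]])
  obtain z where zz: "z t = x \<and>
    vec_deriv_on {s..t} n z (\<lambda>r. (K r * P r - (A r)\<^sup>T) *\<^sub>v z r)"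
    using linear_ode_backward[OF st(2) F x] by (rule exE)
  note z = conjunct1[OF zz] conjunct2[OF zz]
  have zc: "z r \<in> carrier_vec n" if "r \<in> {s..t}" for r using z(2) that by (simp add: vec_deriv_on_def)
  have "vec_deriv_on {s..t} n z (\<lambda>r. K r *\<^sub>v (P r *\<^sub>v z r) - (A r)\<^sup>T *\<^sub>v z r)"
  proof (rule vec_deriv_on_cong[OF z(2)])
    fix r assume r: "r \<in> {s..t}"
    then have r0: "t\<^sub>0 \<le> r" using st by simp
    have "dim_row (P r) = n" "dim_col (P r) = n" "dim_vec (z r) = n"
      using mat_cont_on_carrier[OF P, of r] r0 zc[OF r] by auto
    then show "(K r * P r - (A r)\<^sup>T) *\<^sub>v z r = K r *\<^sub>v (P r *\<^sub>v z r) - (A r)\<^sup>T *\<^sub>v z r"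
      by (simp add: coeff_dim[OF r0] dim_vec_algebra)
  qed
  moreover have "P r *\<^sub>v z r \<in> carrier_vec n" if "r \<in> {s..t}" for r
    using mat_cont_on_carrier[OF P, of r] zc[OF that] that st by auto
  ultimately have "forced_adjoint {s..t} (\<lambda>r. P r *\<^sub>v z r) z" unfolding forced_adjoint_def by simp
  with z(1) show ?thesis by (rule that)
qed

text \<open>The difference of two solutions is transported by the two closed-loop adjoint flows.  This
  single identity gives symmetry of solutions and, later, their convergence.\<close>

lemma difference_form_invariant:
  assumes P1: "solution P1" and P2: "solution P2" and st: "t\<^sub>0 \<le> s" "s \<le> t"
    and z: "forced_adjoint {s..t} (\<lambda>r. (P1 r)\<^sup>T *\<^sub>v z r) z"
    and y: "forced_adjoint {s..t} (\<lambda>r. P2 r *\<^sub>v y r) y"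
  shows "z s \<bullet> (P1 s *\<^sub>v y s) - z s \<bullet> (P2 s *\<^sub>v y s) = z t \<bullet> (P1 t *\<^sub>v y t) - z t \<bullet> (P2 t *\<^sub>v y t)"
proof (rule derivative_zero_imp_equal[OF st(2)])
  fix r assume r: "r \<in> {s..t}"
  have S: "{s..t} \<subseteq> {t\<^sub>0..}" and r0: "t\<^sub>0 \<le> r" using st r by auto
  note c = coeff_dim[OF r0] coeff_transpose[OF r0]
  have d: "dim_row (P1 r) = n" "dim_col (P1 r) = n" "dim_row (P2 r) = n" "dim_col (P2 r) = n"
    "dim_vec (z r) = n" "dim_vec (y r) = n"
    using solution_carrier[OF P1 r0] solution_carrier[OF P2 r0] forced_adjoint_carrier(1)[OF z r]
      forced_adjoint_carrier(1)[OF y r] by auto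
  have k: "(K r *\<^sub>v ((P1 r)\<^sup>T *\<^sub>v z r)) \<bullet> w = z r \<bullet> (P1 r *\<^sub>v (K r *\<^sub>v w))" if "dim_vec w = n" for w
    using that d c by (simp add: sp_mult_left[of _ "K r"] sp_transpose)
  show "((\<lambda>s. z s \<bullet> (P1 s *\<^sub>v y s) - z s \<bullet> (P2 s *\<^sub>v y s)) has_real_derivative 0) (at r within {s..t})"
    using DERIV_diff[OF form_derivative[OF P1 S z y r] form_derivative[OF P2 S z y r]]
    by (simp add: k d)
qed

lemma transpose_solution:
  assumes P: "solution P"
  shows "solution (\<lambda>t. (P t)\<^sup>T)"
  unfolding solution_def
proof (rule mat_deriv_on_cong[OF mat_deriv_on_transpose[OF P[unfolded solution_def]]])
  fix t assume "t \<in> {t\<^sub>0..}"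
  then have t0: "t\<^sub>0 \<le> t" by simp
  have d: "dim_row (P t) = n" "dim_col (P t) = n" using solution_carrier[OF P t0] by auto
  show "(A t * P t + P t * (A t)\<^sup>T + Q t - P t * K t * P t)\<^sup>T
      = A t * (P t)\<^sup>T + (P t)\<^sup>T * (A t)\<^sup>T + Q t - (P t)\<^sup>T * K t * (P t)\<^sup>T"
    by (simp add: d coeff_dim[OF t0] coeff_transpose[OF t0] dim_algebra)
      (rule eq_matI, simp_all add: d coeff_dim[OF t0] del: index_mult_mat(1))
qed

text \<open>\<open>P\<close> and \<open>P\<^sup>T\<close> solve the same equation; if they agree at \<open>t\<^sub>0\<close>, their invariant difference form is
  zero and they agree throughout.\<close>

lemma solution_symmetric:
  assumes P: "solution P" and s: "(P t\<^sub>0)\<^sup>T = P t\<^sub>0" and t: "t\<^sub>0 \<le> t"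
  shows "(P t)\<^sup>T = P t"
proof -
  note PT = transpose_solution[OF P]
  note c = mat_cont_on_transpose[OF solution_cont[OF P]]
  have d: "dim_row (P t) = n" "dim_col (P t) = n" using solution_carrier[OF P t] by auto
  have "P t - (P t)\<^sup>T = 0\<^sub>m n n"
  proof (rule mat_eq_0_if_form_0)
    show "P t - (P t)\<^sup>T \<in> carrier_mat n n" using solution_carrier[OF PT t] by auto
    fix x y :: "real vec" assume x: "x \<in> carrier_vec n" and y: "y \<in> carrier_vec n"
    obtain z where z: "z t = x" "forced_adjoint {t\<^sub>0..t} (\<lambda>r. (P r)\<^sup>T *\<^sub>v z r) z"
      by (rule closed_loop_adjoint_exists[OF c order_refl t x])
    obtain w where w: "w t = y" "forced_adjoint {t\<^sub>0..t} (\<lambda>r. (P r)\<^sup>T *\<^sub>v w r) w"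
      by (rule closed_loop_adjoint_exists[OF c order_refl t y])
    have "x \<bullet> (P t *\<^sub>v y) - x \<bullet> ((P t)\<^sup>T *\<^sub>v y) = 0"
      using difference_form_invariant[OF P PT order_refl t z(2) w(2)] z(1) w(1) by (simp add: s)
    then show "x \<bullet> ((P t - (P t)\<^sup>T) *\<^sub>v y) = 0"
      using d x y by (simp add: dim_vec_algebra sp_algebra)
  qed
  then have *: "(P t - (P t)\<^sup>T) $$ (i, j) = 0\<^sub>m n n $$ (i, j)" for i j by simp
  show ?thesis
  proof (rule eq_matI)
    fix i j assume "i < dim_row (P t)" "j < dim_col (P t)"
    then show "(P t)\<^sup>T $$ (i, j) = P t $$ (i, j)" using *[of i j] d by simp
  qed (simp_all add: d)
qed

text \<open>With \<open>u = P z\<close> the two control terms outweigh the quadratic term, and a semidefinite sum is left.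
  This monotonicity gives \<open>P \<ge> 0\<close> and is the source of all decay estimates.\<close>

lemma closed_loop_form_derivative:
  assumes P: "solution P" and s: "(P t)\<^sup>T = P t" and S: "S \<subseteq> {t\<^sub>0..}"
    and z: "forced_adjoint S (\<lambda>r. P r *\<^sub>v z r) z" and t: "t \<in> S"
  shows "((\<lambda>s. z s \<bullet> (P s *\<^sub>v z s)) has_real_derivative
    z t \<bullet> (Q t *\<^sub>v z t) + (P t *\<^sub>v z t) \<bullet> (K t *\<^sub>v (P t *\<^sub>v z t))) (at t within S)"
proof -
  have t0: "t\<^sub>0 \<le> t" using S t by auto
  have d: "dim_row (P t) = n" "dim_col (P t) = n" "dim_vec (z t) = n"
    using solution_carrier[OF P t0] forced_adjoint_carrier(1)[OF z t] by auto
  have "(K t *\<^sub>v (P t *\<^sub>v z t)) \<bullet> (P t *\<^sub>v z t) = (P t *\<^sub>v z t) \<bullet> (K t *\<^sub>v (P t *\<^sub>v z t))"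
    using d coeff_dim[OF t0] by (intro sp_comm) simp
  then show ?thesis
    using form_derivative[OF P S z z t] by simp
qed

lemma closed_loop_increment:
  assumes P: "solution P" and s: "\<And>t. t\<^sub>0 \<le> t \<Longrightarrow> (P t)\<^sup>T = P t" and st: "t\<^sub>0 \<le> s" "s \<le> t"
    and z: "forced_adjoint {s..t} (\<lambda>r. P r *\<^sub>v z r) z"
  shows "((\<lambda>r. z r \<bullet> (Q r *\<^sub>v z r) + (P r *\<^sub>v z r) \<bullet> (K r *\<^sub>v (P r *\<^sub>v z r))) has_integral
    z t \<bullet> (P t *\<^sub>v z t) - z s \<bullet> (P s *\<^sub>v z s)) {s..t}"
    and "z s \<bullet> (P s *\<^sub>v z s) \<le> z t \<bullet> (P t *\<^sub>v z t)"
proof -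
  have S: "{s..t} \<subseteq> {t\<^sub>0..}" using st by auto
  show i: "((\<lambda>r. z r \<bullet> (Q r *\<^sub>v z r) + (P r *\<^sub>v z r) \<bullet> (K r *\<^sub>v (P r *\<^sub>v z r))) has_integral
    z t \<bullet> (P t *\<^sub>v z t) - z s \<bullet> (P s *\<^sub>v z s)) {s..t}"
    by (rule integral_of_derivative[OF st(2) closed_loop_form_derivative[OF P s S z]]) (use st in auto)
  have "0 \<le> z t \<bullet> (P t *\<^sub>v z t) - z s \<bullet> (P s *\<^sub>v z s)"
  proof (rule has_integral_nonneg[OF i])
    fix r assume r: "r \<in> {s..t}"
    then have r0: "t\<^sub>0 \<le> r" using st by simp
    show "0 \<le> z r \<bullet> (Q r *\<^sub>v z r) + (P r *\<^sub>v z r) \<bullet> (K r *\<^sub>v (P r *\<^sub>v z r))"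
      using Q_psd[OF r0] K_psd[OF r0] forced_adjoint_carrier[OF z r] by (simp add: psd_def)
  qed
  then show "z s \<bullet> (P s *\<^sub>v z s) \<le> z t \<bullet> (P t *\<^sub>v z t)" by simp
qed

lemma solution_psd:
  assumes P: "solution P" and i: "psd n (P t\<^sub>0)" and t: "t\<^sub>0 \<le> t"
  shows "psd n (P t)"
proof -
  have s: "(P r)\<^sup>T = P r" if "t\<^sub>0 \<le> r" for r
    by (rule solution_symmetric[OF P _ that]) (use i in \<open>simp add: psd_def\<close>)
  have "0 \<le> x \<bullet> (P t *\<^sub>v x)" if x: "x \<in> carrier_vec n" for x
  proof -
    obtain z where z: "z t = x" "forced_adjoint {t\<^sub>0..t} (\<lambda>r. P r *\<^sub>v z r) z"
      by (rule closed_loop_adjoint_exists[OF solution_cont[OF P] order_refl t x])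
    have "z t\<^sub>0 \<in> carrier_vec n" using forced_adjoint_carrier(1)[OF z(2)] t by simp
    then have "0 \<le> z t\<^sub>0 \<bullet> (P t\<^sub>0 *\<^sub>v z t\<^sub>0)" using i by (simp add: psd_def)
    also have "\<dots> \<le> z t \<bullet> (P t *\<^sub>v z t)" by (rule closed_loop_increment(2)[OF P s order_refl t z(2)])
    finally show ?thesis by (simp add: z)
  qed
  then show ?thesis using s[OF t] solution_carrier[OF P t] by (simp add: psd_def)
qed

end

section \<open>Uniform bounds and exponential decay\<close>

context riccati
begin

text \<open>This and \<open>controllable\<close> are the conditions on the Gramians, expressed by solutions; the weighting by the
  inverse output noise is absorbed in \<open>K\<close>.\<close>

definition observable :: "real \<Rightarrow> real \<Rightarrow> bool" where
  "observable \<epsilon> \<mu> \<longleftrightarrow> 0 < \<epsilon> \<and> 0 < \<mu> \<and> (\<forall>s x. t\<^sub>0 \<le> s \<longrightarrow>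
     vec_deriv_on {s..s + \<epsilon>} n x (\<lambda>r. A r *\<^sub>v x r) \<longrightarrow>
     \<mu> * (x s \<bullet> x s) \<le> integral {s..s + \<epsilon>} (\<lambda>r. x r \<bullet> (K r *\<^sub>v x r)))"

definition controllable :: "real \<Rightarrow> real \<Rightarrow> bool" where
  "controllable \<epsilon> \<mu> \<longleftrightarrow> 0 < \<epsilon> \<and> 0 < \<mu> \<and> (\<forall>t z. t\<^sub>0 \<le> t - \<epsilon> \<longrightarrow>
     forced_adjoint {t - \<epsilon>..t} (\<lambda>_. 0\<^sub>v n) z \<longrightarrow>
     \<mu> * (z t \<bullet> z t) \<le> integral {t - \<epsilon>..t} (\<lambda>r. z r \<bullet> (Q r *\<^sub>v z r)))"

definition psd_solution :: "(real \<Rightarrow> real mat) \<Rightarrow> bool" where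
  "psd_solution P \<longleftrightarrow> solution P \<and> psd n (P t\<^sub>0)"

lemma psd_solutionD:
  assumes "psd_solution P"
  shows "solution P" "t\<^sub>0 \<le> t \<Longrightarrow> psd n (P t)" "t\<^sub>0 \<le> t \<Longrightarrow> (P t)\<^sup>T = P t"
  using assms solution_psd[of P t] by (simp_all add: psd_solution_def psd_def)

lemma forced_adjoint_vec_cont: "forced_adjoint S u z \<Longrightarrow> vec_cont_on S z n"
  unfolding forced_adjoint_def by (blast intro: vec_deriv_on_cont)

text \<open>Both signs of the rate are bounded, since the energy is estimated forwards in time in one place and
  backwards in another.\<close>

lemma forced_adjoint_energy_rate:
  assumes S: "S \<subseteq> {t\<^sub>0..}" and z: "forced_adjoint S u z" and t: "t \<in> S"
  shows "((\<lambda>s. z s \<bullet> z s) has_real_derivative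
      2 * (z t \<bullet> (K t *\<^sub>v u t)) - 2 * (z t \<bullet> (A t *\<^sub>v z t))) (at t within S)"
    and "\<bar>2 * (z t \<bullet> (K t *\<^sub>v u t)) - 2 * (z t \<bullet> (A t *\<^sub>v z t))\<bar>
      \<le> (2 * a + 1) * (z t \<bullet> z t) + (vnorm (K t *\<^sub>v u t))\<^sup>2"
proof -
  have t0: "t\<^sub>0 \<le> t" using S t by auto
  have zc: "z t \<in> carrier_vec n" by (rule forced_adjoint_carrier(1)[OF z t])
  have d: "dim_vec (z t) = n" "dim_vec (u t) = n"
    using forced_adjoint_carrier[OF z t] by auto
  note dims = d coeff_dim[OF t0]
  have z': "vec_deriv_on S n z (\<lambda>t. K t *\<^sub>v u t - (A t)\<^sup>T *\<^sub>v z t)"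
    using z by (simp add: forced_adjoint_def)
  have c: "(K t *\<^sub>v u t) \<bullet> z t = z t \<bullet> (K t *\<^sub>v u t)" using dims by (intro sp_comm) simp
  have c': "z t \<bullet> ((A t)\<^sup>T *\<^sub>v z t) = z t \<bullet> (A t *\<^sub>v z t)"
    using dims sp_comm[of "z t" "(A t)\<^sup>T *\<^sub>v z t"] by (simp add: sp_transpose)
  have "(K t *\<^sub>v u t - (A t)\<^sup>T *\<^sub>v z t) \<bullet> z t + z t \<bullet> (K t *\<^sub>v u t - (A t)\<^sup>T *\<^sub>v z t)
    = 2 * (z t \<bullet> (K t *\<^sub>v u t)) - 2 * (z t \<bullet> (A t *\<^sub>v z t))"
    by (simp add: dims sp_algebra sp_transpose c c')
  then show "((\<lambda>s. z s \<bullet> z s) has_real_derivative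
      2 * (z t \<bullet> (K t *\<^sub>v u t)) - 2 * (z t \<bullet> (A t *\<^sub>v z t))) (at t within S)"
    using has_real_derivative_scalar_prod[OF z' z' t] by simp
  have "\<bar>z t \<bullet> (K t *\<^sub>v u t)\<bar> \<le> vnorm (z t) * vnorm (K t *\<^sub>v u t)"
    using dims by (intro Cauchy_Schwarz_vec) simp
  then have "2 * \<bar>z t \<bullet> (K t *\<^sub>v u t)\<bar> \<le> z t \<bullet> z t + (vnorm (K t *\<^sub>v u t))\<^sup>2"
    using two_mult_le_add_squares[of "vnorm (z t)" "vnorm (K t *\<^sub>v u t)"] vnorm_sq[of "z t"]
    by (simp add: power2_eq_square)
  moreover have "2 * \<bar>z t \<bullet> (A t *\<^sub>v z t)\<bar> \<le> 2 * a * (z t \<bullet> z t)"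
    using form_le(3,4)[OF t0 zc] by (simp add: abs_le_iff)
  moreover have "(2 * a + 1) * (z t \<bullet> z t) = 2 * a * (z t \<bullet> z t) + z t \<bullet> z t"
    by (simp add: algebra_simps)
  ultimately show "\<bar>2 * (z t \<bullet> (K t *\<^sub>v u t)) - 2 * (z t \<bullet> (A t *\<^sub>v z t))\<bar>
      \<le> (2 * a + 1) * (z t \<bullet> z t) + (vnorm (K t *\<^sub>v u t))\<^sup>2"
    by linarith
qed

text \<open>Along the closed-loop adjoint flow the form of \<open>P\<close> grows over a controllability window by a
  fixed multiple of \<open>|z|\<^sup>2\<close>.  Either the feedback term \<open>K P z\<close> itself contributes, or it is small;
  then \<open>z\<close> stays close to a solution of the unforced adjoint equation, and the controllability
  Gramian makes the contribution of \<open>Q\<close> large.\<close>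

lemma controllability_window:
  assumes ctrl: "controllable \<epsilon> \<mu>"
  shows "\<exists>c>0. \<forall>P t z. psd_solution P \<longrightarrow> t\<^sub>0 \<le> t - \<epsilon> \<longrightarrow>
    forced_adjoint {t - \<epsilon>..t} (\<lambda>r. P r *\<^sub>v z r) z \<longrightarrow>
    c * (z t \<bullet> z t) \<le> z t \<bullet> (P t *\<^sub>v z t) - z (t - \<epsilon>) \<bullet> (P (t - \<epsilon>) *\<^sub>v z (t - \<epsilon>))"
proof -
  have e0: "0 < \<epsilon>" and m0: "0 < \<mu>" using ctrl by (auto simp: controllable_def)
  define E where "E = exp ((2 * a + 1) * \<epsilon>)"
  define D where "D = 2 + 2 * q * (E * k) * \<epsilon>"
  have E0: "0 < E" by (simp add: E_def)
  have D0: "0 < D" using bounds_nonneg e0 E0 by (simp add: D_def add_pos_nonneg)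
  have main: "\<mu> / D * (z t \<bullet> z t) \<le> z t \<bullet> (P t *\<^sub>v z t) - z (t - \<epsilon>) \<bullet> (P (t - \<epsilon>) *\<^sub>v z (t - \<epsilon>))"
    if P: "psd_solution P" and t: "t\<^sub>0 \<le> t - \<epsilon>" and z: "forced_adjoint {t - \<epsilon>..t} (\<lambda>r. P r *\<^sub>v z r) z"
    for P t z
  proof -
    let ?S = "{t - \<epsilon>..t}"
    have S: "?S \<subseteq> {t\<^sub>0..}" and le: "t - \<epsilon> \<le> t" and tS: "t \<in> ?S" using t e0 by auto
    note Ps = psd_solutionD[OF P]
    have PS: "mat_cont_on ?S P n n" and QS: "mat_cont_on ?S Q n n" and KS: "mat_cont_on ?S K n n"
      and AS: "mat_cont_on ?S A n n"
      using mat_cont_on_subset[OF _ S] solution_cont[OF Ps(1)] Q_cont K_cont A_cont by blast+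
    note zc = forced_adjoint_vec_cont[OF z]
    note Pzc = vec_cont_on_mult[OF PS zc]
    let ?J1 = "\<lambda>r. z r \<bullet> (Q r *\<^sub>v z r)" and ?J2 = "\<lambda>r. (P r *\<^sub>v z r) \<bullet> (K r *\<^sub>v (P r *\<^sub>v z r))"
    have J1c: "continuous_on ?S ?J1" by (rule continuous_on_scalar_prod[OF zc vec_cont_on_mult[OF QS zc]])
    have J2c: "continuous_on ?S ?J2" by (rule continuous_on_scalar_prod[OF Pzc vec_cont_on_mult[OF KS Pzc]])
    have J1i: "?J1 integrable_on ?S" and J2i: "?J2 integrable_on ?S"
      using J1c J2c by (simp_all add: integrable_continuous_real)
    have V: "integral ?S ?J1 + integral ?S ?J2 = z t \<bullet> (P t *\<^sub>v z t) - z (t - \<epsilon>) \<bullet> (P (t - \<epsilon>) *\<^sub>v z (t - \<epsilon>))"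
      using integral_unique[OF closed_loop_increment(1)[OF Ps(1,3) t le z]] integral_add[OF J1i J2i] by simp
    have ztc: "z t \<in> carrier_vec n" by (rule forced_adjoint_carrier(1)[OF z tS])
    have Z: "mat_cont_on {t\<^sub>0..} (\<lambda>_. 0\<^sub>m n n) n n" by (rule mat_cont_on_const) simp
    obtain y where yt: "y t = z t" and y': "forced_adjoint ?S (\<lambda>r. 0\<^sub>m n n *\<^sub>v y r) y"
      by (rule closed_loop_adjoint_exists[OF Z t le ztc])
    have yv: "y r \<in> carrier_vec n" if "r \<in> ?S" for r by (rule forced_adjoint_carrier(1)[OF y' that])
    have y0: "0\<^sub>m n n *\<^sub>v y r = 0\<^sub>v n" if "r \<in> ?S" for r using yv[OF that] by auto
    have y: "forced_adjoint ?S (\<lambda>_. 0\<^sub>v n) y"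
      unfolding forced_adjoint_def
    proof (intro conjI ballI)
      show "vec_deriv_on ?S n y (\<lambda>r. K r *\<^sub>v 0\<^sub>v n - (A r)\<^sup>T *\<^sub>v y r)"
        by (rule vec_deriv_on_cong[OF conjunct2[OF y'[unfolded forced_adjoint_def]]]) (simp only: y0)
    qed simp
    \<comment> \<open>the deviation \<open>e = z - y\<close> from the unforced solution vanishes at the right end\<close>
    let ?e = "\<lambda>r. z r - y r"
    have e: "forced_adjoint ?S (\<lambda>r. P r *\<^sub>v z r) ?e"
      unfolding forced_adjoint_def
    proof (intro conjI ballI)
      fix r assume "r \<in> ?S" then show "P r *\<^sub>v z r \<in> carrier_vec n" by (rule forced_adjoint_carrier(2)[OF z])
    next
      have "vec_deriv_on ?S n ?e (\<lambda>r. (K r *\<^sub>v (P r *\<^sub>v z r) - (A r)\<^sup>T *\<^sub>v z r) - (K r *\<^sub>v 0\<^sub>v n - (A r)\<^sup>T *\<^sub>v y r))"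
        using z y unfolding forced_adjoint_def by (intro vec_deriv_on_minus) simp_all
      then show "vec_deriv_on ?S n ?e (\<lambda>r. K r *\<^sub>v (P r *\<^sub>v z r) - (A r)\<^sup>T *\<^sub>v (z r - y r))"
      proof (rule vec_deriv_on_cong)
        fix r assume r: "r \<in> ?S"
        then have r0: "t\<^sub>0 \<le> r" using t by simp
        have d: "dim_vec (z r) = n" "dim_vec (y r) = n"
          using forced_adjoint_carrier(1)[OF z r] yv[OF r] by auto
        show "(K r *\<^sub>v (P r *\<^sub>v z r) - (A r)\<^sup>T *\<^sub>v z r) - (K r *\<^sub>v 0\<^sub>v n - (A r)\<^sup>T *\<^sub>v y r)
          = K r *\<^sub>v (P r *\<^sub>v z r) - (A r)\<^sup>T *\<^sub>v (z r - y r)"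
          using d coeff_dim[OF r0]
          by (simp add: dim_mult_vec_minus dim_mult_vec_zero) (rule eq_vecI, simp_all)
      qed
    qed
    let ?g = "\<lambda>r. k * ?J2 r"
    have gc: "continuous_on ?S ?g" using J2c by (intro continuous_intros)
    have J20: "0 \<le> ?J2 r" if "r \<in> ?S" for r
      using K_psd[of r] forced_adjoint_carrier(2)[OF z that] that t by (auto simp: psd_def)
    have J10: "0 \<le> ?J1 r" if "r \<in> ?S" for r
      using Q_psd[of r] forced_adjoint_carrier(1)[OF z that] that t by (auto simp: psd_def)
    have dev: "?e r \<bullet> ?e r \<le> E * k * integral ?S ?J2" if r: "r \<in> ?S" for r
    proof -
      have sub: "{r..t} \<subseteq> ?S" using r by auto
      have "?e r \<bullet> ?e r \<le> exp ((2 * a + 1) * (t - r)) * (?e t \<bullet> ?e t + integral {r..t} ?g)"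
      proof (rule gronwall_backward)
        show "r \<le> t" using r by simp
        show "0 \<le> 2 * a + 1" using bounds_nonneg by simp
        show "continuous_on {r..t} ?g" by (rule continuous_on_subset[OF gc sub])
        fix s assume "s \<in> {r..t}"
        then have s: "s \<in> ?S" and s0: "t\<^sub>0 \<le> s" using sub t by auto
        show "0 \<le> ?g s" using J20[OF s] bounds_nonneg by simp
        show "((\<lambda>s. ?e s \<bullet> ?e s) has_real_derivative
          2 * (?e s \<bullet> (K s *\<^sub>v (P s *\<^sub>v z s))) - 2 * (?e s \<bullet> (A s *\<^sub>v ?e s))) (at s within {r..t})"
          by (rule DERIV_subset[OF forced_adjoint_energy_rate(1)[OF S e s] sub])
        have "(vnorm (K s *\<^sub>v (P s *\<^sub>v z s)))\<^sup>2 \<le> ?g s"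
          by (rule psd_norm_sq_le_form[OF K_psd[OF s0] forced_adjoint_carrier(2)[OF z s] K_bound[OF s0]])
        then show "- (2 * (?e s \<bullet> (K s *\<^sub>v (P s *\<^sub>v z s))) - 2 * (?e s \<bullet> (A s *\<^sub>v ?e s)))
            \<le> (2 * a + 1) * (?e s \<bullet> ?e s) + ?g s"
          using forced_adjoint_energy_rate(2)[OF S e s] by linarith
      qed
      also have "?e t \<bullet> ?e t = 0" using ztc by (simp add: yt)
      also have "exp ((2 * a + 1) * (t - r)) * (0 + integral {r..t} ?g) \<le> E * integral ?S ?g"
      proof (rule mult_mono)
        show "exp ((2 * a + 1) * (t - r)) \<le> E"
          unfolding E_def using r bounds_nonneg by (simp add: mult_left_mono)
        show "0 + integral {r..t} ?g \<le> integral ?S ?g"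
          unfolding add_0
        proof (rule integral_subset_le[OF sub])
          show "?g integrable_on {r..t}"
            by (rule integrable_continuous_real[OF continuous_on_subset[OF gc sub]])
          show "?g integrable_on ?S" by (rule integrable_continuous_real[OF gc])
        qed (use J20 bounds_nonneg in simp)
        show "0 \<le> 0 + integral {r..t} ?g"
          unfolding add_0 using J20 bounds_nonneg sub
          by (intro integral_nonneg integrable_continuous_real[OF continuous_on_subset[OF gc sub]]) auto
      qed (use E0 in simp)
      finally show ?thesis by (simp add: mult.assoc)
    qed
    \<comment> \<open>\<open>y = z - e\<close>, so the parallelogram law bounds the form at \<open>y\<close> by twice those at \<open>z\<close> and \<open>e\<close>\<close>
    have pw: "y r \<bullet> (Q r *\<^sub>v y r) \<le> 2 * ?J1 r + 2 * q * (E * k) * integral ?S ?J2" if r: "r \<in> ?S" for r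
    proof -
      have r0: "t\<^sub>0 \<le> r" using r t by simp
      have c: "z r \<in> carrier_vec n" "y r \<in> carrier_vec n" "?e r \<in> carrier_vec n"
        using forced_adjoint_carrier(1)[OF z r] yv[OF r] by auto
      then have d: "dim_vec (z r) = n" "dim_vec (y r) = n" by auto
      have "0 \<le> (z r + ?e r) \<bullet> (Q r *\<^sub>v (z r + ?e r))" using Q_psd[OF r0] c by (simp add: psd_def)
      also have "\<dots> = 2 * ?J1 r + 2 * (?e r \<bullet> (Q r *\<^sub>v ?e r)) - y r \<bullet> (Q r *\<^sub>v y r)"
        using d coeff_dim[OF r0] by (simp add: dim_vec_algebra sp_algebra)
      finally have "y r \<bullet> (Q r *\<^sub>v y r) \<le> 2 * ?J1 r + 2 * (?e r \<bullet> (Q r *\<^sub>v ?e r))" by simp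
      moreover have "?e r \<bullet> (Q r *\<^sub>v ?e r) \<le> q * (?e r \<bullet> ?e r)" by (rule form_le(1)[OF r0 c(3)])
      moreover have "q * (?e r \<bullet> ?e r) \<le> q * (E * k * integral ?S ?J2)"
        by (rule mult_left_mono[OF dev[OF r] bounds_nonneg(2)])
      ultimately show ?thesis by (simp add: mult.assoc)
    qed
    have J2n: "0 \<le> integral ?S ?J2" using J2i J20 by (intro integral_nonneg) auto
    have J1n: "0 \<le> integral ?S ?J1" using J1i J10 by (intro integral_nonneg) auto
    have "\<mu> * (y t \<bullet> y t) \<le> integral ?S (\<lambda>r. y r \<bullet> (Q r *\<^sub>v y r))"
      using ctrl t y unfolding controllable_def by blast
    also have "\<dots> \<le> integral ?S (\<lambda>r. 2 * ?J1 r + 2 * q * (E * k) * integral ?S ?J2)"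
    proof (rule integral_le)
      show "(\<lambda>r. y r \<bullet> (Q r *\<^sub>v y r)) integrable_on ?S"
        using forced_adjoint_vec_cont[OF y] QS
        by (intro integrable_continuous_real continuous_on_scalar_prod[of _ _ n] vec_cont_on_mult[of _ _ n n])
      show "(\<lambda>r. 2 * ?J1 r + 2 * q * (E * k) * integral ?S ?J2) integrable_on ?S"
        using J1c by (intro integrable_continuous_real continuous_intros)
    qed (rule pw)
    also have "\<dots> = 2 * integral ?S ?J1 + 2 * q * (E * k) * integral ?S ?J2 * \<epsilon>"
      using J1i e0 by (subst integral_add) (auto intro: integrable_on_cmult_left)
    also have "\<dots> \<le> D * (integral ?S ?J1 + integral ?S ?J2)"
    proof -
      have "0 \<le> 2 * q * (E * k) * \<epsilon> * integral ?S ?J1"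
        using J1n bounds_nonneg E0 e0 by simp
      then show ?thesis using J2n by (simp add: D_def algebra_simps)
    qed
    finally show ?thesis using V yt D0 by (simp add: field_simps)
  qed
  show ?thesis using main m0 D0 by (intro exI[of _ "\<mu> / D"]) simp
qed

text \<open>A suboptimal estimate of the state bounds the optimal error covariance.  The control \<open>g\<close>,
  itself a solution of the state equation, steers the adjoint state from \<open>0\<close> to a vector \<open>z\<close> whose
  product with \<open>g\<close> is the observability Gramian form; taking \<open>g = P u\<close> at the right end lets the
  Cauchy-Schwarz inequality for \<open>P\<close> replace any inversion of the Gramian.\<close>

lemma observability_upper_bound:
  assumes obs: "observable \<epsilon> \<mu>"
  shows "\<exists>c\<ge>0. \<forall>P t u. psd_solution P \<longrightarrow> t\<^sub>0 + \<epsilon> \<le> t \<longrightarrow> u \<in> carrier_vec n \<longrightarrow>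
    vnorm (P t *\<^sub>v u) \<le> c * vnorm u"
proof -
  have e0: "0 < \<epsilon>" and m0: "0 < \<mu>" using obs by (auto simp: observable_def)
  define E where "E = exp (2 * a * \<epsilon>)"
  define E1 where "E1 = exp ((2 * a + 1) * \<epsilon>)"
  define m where "m = \<mu> / E"
  define B where "B = E1 * (\<epsilon> * (k * k * E))"
  define C where "C = \<epsilon> * (q * B + k * E)"
  have E0: "0 < E" "0 < E1" by (simp_all add: E_def E1_def)
  have m: "0 < m" using m0 E0 by (simp add: m_def)
  have B0: "0 \<le> B" using bounds_nonneg e0 E0 by (simp add: B_def)
  have C0: "0 \<le> C" using bounds_nonneg e0 E0 B0 by (simp add: C_def)
  have main: "vnorm (P t *\<^sub>v u) \<le> C / (m * m) * vnorm u"
    if P: "psd_solution P" and te: "t\<^sub>0 + \<epsilon> \<le> t" and u: "u \<in> carrier_vec n" for P t u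
  proof -
    define s where "s = t - \<epsilon>"
    have s: "t\<^sub>0 \<le> s" "s \<le> t" "t = s + \<epsilon>" "t\<^sub>0 \<le> t" using te e0 by (auto simp: s_def)
    let ?S = "{s..t}"
    have S: "?S \<subseteq> {t\<^sub>0..}" using s by auto
    note Ps = psd_solutionD[OF P]
    have PS: "mat_cont_on ?S P n n" and QS: "mat_cont_on ?S Q n n" and KS: "mat_cont_on ?S K n n"
      and AS: "mat_cont_on ?S A n n"
      using mat_cont_on_subset[OF _ S] solution_cont[OF Ps(1)] Q_cont K_cont A_cont by blast+
    have Pu: "P t *\<^sub>v u \<in> carrier_vec n"
      by (rule mult_mat_vec_carrier[OF solution_carrier[OF Ps(1) s(4)] u])
    obtain g where gg: "g t = P t *\<^sub>v u \<and> vec_deriv_on ?S n g (\<lambda>r. A r *\<^sub>v g r)"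
      using linear_ode_backward[OF s(2) AS Pu] by (rule exE)
    note gt = conjunct1[OF gg] and g = conjunct2[OF gg]
    have gv: "g r \<in> carrier_vec n" if "r \<in> ?S" for r using g that by (simp add: vec_deriv_on_def)
    note gcont = vec_deriv_on_cont[OF g]
    have ZA: "mat_cont_on ?S (\<lambda>r. 0\<^sub>m n n - (A r)\<^sup>T) n n"
      by (rule mat_cont_on_minus[OF mat_cont_on_const mat_cont_on_transpose[OF AS]]) simp
    obtain z where zz: "z s = 0\<^sub>v n \<and> vec_deriv_on ?S n z (\<lambda>r. (0\<^sub>m n n - (A r)\<^sup>T) *\<^sub>v z r + K r *\<^sub>v g r)"
      using linear_ode_forward[OF s(2) ZA vec_cont_on_mult[OF KS gcont] zero_carrier_vec] by (rule exE)
    note zs = conjunct1[OF zz]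
    have zv: "z r \<in> carrier_vec n" if "r \<in> ?S" for r using zz that by (simp add: vec_deriv_on_def)
    have z: "forced_adjoint ?S g z"
      unfolding forced_adjoint_def
    proof (intro conjI ballI)
      show "vec_deriv_on ?S n z (\<lambda>r. K r *\<^sub>v g r - (A r)\<^sup>T *\<^sub>v z r)"
      proof (rule vec_deriv_on_cong[OF conjunct2[OF zz]])
        fix r assume r: "r \<in> ?S"
        then have r0: "t\<^sub>0 \<le> r" using s by simp
        have d: "dim_vec (z r) = n" "dim_vec (g r) = n" using zv[OF r] gv[OF r] by auto
        have "0\<^sub>m n n *\<^sub>v z r = 0\<^sub>v n" using zv[OF r] by auto
        then show "(0\<^sub>m n n - (A r)\<^sup>T) *\<^sub>v z r + K r *\<^sub>v g r = K r *\<^sub>v g r - (A r)\<^sup>T *\<^sub>v z r"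
          using d coeff_dim[OF r0]
          by (simp add: dim_minus_mult_vec) (rule eq_vecI, simp_all)
      qed
    qed (rule gv)
    have z': "vec_deriv_on ?S n z (\<lambda>r. K r *\<^sub>v g r - (A r)\<^sup>T *\<^sub>v z r)"
      using z by (simp add: forced_adjoint_def)
    let ?G = "g t \<bullet> g t"
    have G0: "0 \<le> ?G" by (rule sp_self_nonneg)
    have gder: "((\<lambda>r. g r \<bullet> g r) has_real_derivative 2 * (g r \<bullet> (A r *\<^sub>v g r))) (at r within ?S)"
      if r: "r \<in> ?S" for r
    proof -
      have "(A r *\<^sub>v g r) \<bullet> g r = g r \<bullet> (A r *\<^sub>v g r)"
        using gv[OF r] coeff_dim[of r] r s by (intro sp_comm) auto
      then show ?thesis using has_real_derivative_scalar_prod[OF g g r] by simp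
    qed
    have gback: "g r \<bullet> g r \<le> E * ?G" if r: "r \<in> ?S" for r
    proof -
      have sub: "{r..t} \<subseteq> ?S" using r by auto
      have "g r \<bullet> g r \<le> exp (2 * a * (t - r)) * (?G + integral {r..t} (\<lambda>_. 0))"
      proof (rule gronwall_backward)
        fix x assume "x \<in> {r..t}"
        then have x: "x \<in> ?S" and x0: "t\<^sub>0 \<le> x" using sub s by auto
        show "((\<lambda>r. g r \<bullet> g r) has_real_derivative 2 * (g x \<bullet> (A x *\<^sub>v g x))) (at x within {r..t})"
          by (rule DERIV_subset[OF gder[OF x] sub])
        show "- (2 * (g x \<bullet> (A x *\<^sub>v g x))) \<le> 2 * a * (g x \<bullet> g x) + 0"
          using form_le(4)[OF x0 gv[OF x]] by simp
      qed (use r bounds_nonneg in auto)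
      also have "\<dots> = exp (2 * a * (t - r)) * ?G" by simp
      also have "\<dots> \<le> E * ?G"
        unfolding E_def using r s bounds_nonneg G0 by (intro mult_right_mono) (auto intro: mult_left_mono)
      finally show ?thesis .
    qed
    have gforw: "?G \<le> E * (g s \<bullet> g s)"
    proof -
      have "?G \<le> exp (2 * a * (t - s)) * (g s \<bullet> g s + integral {s..t} (\<lambda>_. 0))"
      proof (rule gronwall_forward)
        fix x assume x: "x \<in> ?S"
        then have x0: "t\<^sub>0 \<le> x" using s by auto
        show "((\<lambda>r. g r \<bullet> g r) has_real_derivative 2 * (g x \<bullet> (A x *\<^sub>v g x))) (at x within ?S)"
          by (rule gder[OF x])
        show "2 * (g x \<bullet> (A x *\<^sub>v g x)) \<le> 2 * a * (g x \<bullet> g x) + 0"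
          using form_le(3)[OF x0 gv[OF x]] by simp
      qed (use s bounds_nonneg in auto)
      then show ?thesis using s by (simp add: E_def)
    qed
    have zg: "m * ?G \<le> z t \<bullet> g t"
    proof -
      have "((\<lambda>r. g r \<bullet> (K r *\<^sub>v g r)) has_integral z t \<bullet> g t - z s \<bullet> g s) ?S"
      proof (rule integral_of_derivative[OF s(2)])
        fix r assume r: "r \<in> ?S"
        then have r0: "t\<^sub>0 \<le> r" using s by simp
        have d: "dim_vec (z r) = n" "dim_vec (g r) = n" using zv[OF r] gv[OF r] by auto
        have "(K r *\<^sub>v g r - (A r)\<^sup>T *\<^sub>v z r) \<bullet> g r + z r \<bullet> (A r *\<^sub>v g r) = g r \<bullet> (K r *\<^sub>v g r)"
          using d coeff_dim[OF r0] sp_comm[of "K r *\<^sub>v g r" "g r"] by (simp add: sp_algebra sp_transpose)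
        then show "((\<lambda>r. z r \<bullet> g r) has_real_derivative g r \<bullet> (K r *\<^sub>v g r)) (at r within ?S)"
          using has_real_derivative_scalar_prod[OF z' g r] by simp
      qed
      moreover have "z s \<bullet> g s = 0" using zs gv[of s] s by simp
      ultimately have "z t \<bullet> g t = integral ?S (\<lambda>r. g r \<bullet> (K r *\<^sub>v g r))"
        by (simp add: integral_unique)
      moreover have "\<mu> * (g s \<bullet> g s) \<le> integral {s..s + \<epsilon>} (\<lambda>r. g r \<bullet> (K r *\<^sub>v g r))"
        using obs g s(1) unfolding observable_def s(3) by blast
      moreover have "m * ?G \<le> \<mu> * (g s \<bullet> g s)"
        using mult_left_mono[OF gforw, of "\<mu> / E"] m0 E0 by (simp add: m_def)
      ultimately show ?thesis using s(3) by simp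
    qed
    have zb: "z r \<bullet> z r \<le> B * ?G" if r: "r \<in> ?S" for r
    proof -
      have sub: "{s..r} \<subseteq> ?S" using r by auto
      have "z r \<bullet> z r \<le> exp ((2 * a + 1) * (r - s)) * (z s \<bullet> z s + integral {s..r} (\<lambda>_. k * k * (E * ?G)))"
      proof (rule gronwall_forward)
        fix x assume "x \<in> {s..r}"
        then have x: "x \<in> ?S" and x0: "t\<^sub>0 \<le> x" using sub s by auto
        show "((\<lambda>r. z r \<bullet> z r) has_real_derivative
          2 * (z x \<bullet> (K x *\<^sub>v g x)) - 2 * (z x \<bullet> (A x *\<^sub>v z x))) (at x within {s..r})"
          by (rule DERIV_subset[OF forced_adjoint_energy_rate(1)[OF S z x] sub])
        have "(vnorm (K x *\<^sub>v g x))\<^sup>2 \<le> (k * vnorm (g x))\<^sup>2"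
          using K_bound[OF x0 gv[OF x]] by (intro power_mono) auto
        also have "\<dots> = k * k * (g x \<bullet> g x)" by (simp add: power_mult_distrib vnorm_sq power2_eq_square[of k])
        also have "\<dots> \<le> k * k * (E * ?G)" using gback[OF x] bounds_nonneg by (intro mult_left_mono) auto
        finally show "2 * (z x \<bullet> (K x *\<^sub>v g x)) - 2 * (z x \<bullet> (A x *\<^sub>v z x))
            \<le> (2 * a + 1) * (z x \<bullet> z x) + k * k * (E * ?G)"
          using forced_adjoint_energy_rate(2)[OF S z x] by linarith
      qed (use r bounds_nonneg E0 G0 in auto)
      also have "\<dots> = exp ((2 * a + 1) * (r - s)) * ((r - s) * (k * k * (E * ?G)))"
        using r zs by simp
      also have "\<dots> \<le> E1 * (\<epsilon> * (k * k * (E * ?G)))"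
      proof (rule mult_mono)
        show "exp ((2 * a + 1) * (r - s)) \<le> E1"
          unfolding E1_def using r s bounds_nonneg by (auto intro: mult_left_mono)
        show "(r - s) * (k * k * (E * ?G)) \<le> \<epsilon> * (k * k * (E * ?G))"
          using r s bounds_nonneg E0 G0 by (intro mult_right_mono) auto
      qed (use r bounds_nonneg E0 G0 in auto)
      finally show ?thesis by (simp add: B_def mult_ac)
    qed
    \<comment> \<open>suboptimality: \<open>0 \<le> (P z - g) \<bullet> K (P z - g)\<close> replaces the optimal cost by that of \<open>g\<close>\<close>
    have zPz: "z t \<bullet> (P t *\<^sub>v z t) \<le> C * ?G"
    proof -
      have "z t \<bullet> (P t *\<^sub>v z t) - z s \<bullet> (P s *\<^sub>v z s) \<le> integral ?S (\<lambda>_. (q * B + k * E) * ?G)"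
      proof (rule increment_mono[OF s(2) form_derivative[OF Ps(1) S z z]])
        fix r assume r: "r \<in> ?S"
        then have r0: "t\<^sub>0 \<le> r" using s by simp
        let ?w = "P r *\<^sub>v z r"
        have Pd: "dim_row (P r) = n" "dim_col (P r) = n" using solution_carrier[OF Ps(1) r0] by auto
        have d: "dim_vec (z r) = n" "dim_vec (g r) = n" using zv[OF r] gv[OF r] by auto
        note dims = d Pd coeff_dim[OF r0]
        have PT: "(P r)\<^sup>T = P r" by (rule Ps(3)[OF r0])
        have sw: "z r \<bullet> (P r *\<^sub>v v) = ?w \<bullet> v" if "dim_vec v = n" for v
          using that dims by (simp add: sp_mult_left PT)
        have wK: "(K r *\<^sub>v g r) \<bullet> ?w = ?w \<bullet> (K r *\<^sub>v g r)" using dims by (intro sp_comm) simp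
        have gK: "g r \<bullet> (K r *\<^sub>v ?w) = ?w \<bullet> (K r *\<^sub>v g r)"
          using dims sp_mult_left[of "g r" "K r" ?w] by (simp add: coeff_transpose(2)[OF r0] wK)
        have "?w - g r \<in> carrier_vec n" by (rule carrier_vecI) (simp add: dims)
        then have "0 \<le> (?w - g r) \<bullet> (K r *\<^sub>v (?w - g r))"
          using K_psd[OF r0] by (simp only: psd_def)
        also have "\<dots> = ?w \<bullet> (K r *\<^sub>v ?w) - 2 * (?w \<bullet> (K r *\<^sub>v g r)) + g r \<bullet> (K r *\<^sub>v g r)"
          using dims by (simp add: dim_mult_vec_minus sp_algebra gK)
        finally have "2 * (?w \<bullet> (K r *\<^sub>v g r)) - ?w \<bullet> (K r *\<^sub>v ?w) \<le> g r \<bullet> (K r *\<^sub>v g r)" by simp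
        moreover have "g r \<bullet> (K r *\<^sub>v g r) \<le> k * (E * ?G)"
          using form_le(2)[OF r0 gv[OF r]] mult_left_mono[OF gback[OF r] bounds_nonneg(3)] by linarith
        moreover have "z r \<bullet> (Q r *\<^sub>v z r) \<le> q * (B * ?G)"
          using form_le(1)[OF r0 zv[OF r]] mult_left_mono[OF zb[OF r] bounds_nonneg(2)] by linarith
        moreover have "z r \<bullet> (P r *\<^sub>v (K r *\<^sub>v ?w)) = ?w \<bullet> (K r *\<^sub>v ?w)"
          and "z r \<bullet> (P r *\<^sub>v (K r *\<^sub>v g r)) = ?w \<bullet> (K r *\<^sub>v g r)"
          using dims by (auto intro: sw)
        moreover have "(q * B + k * E) * ?G = q * (B * ?G) + k * (E * ?G)" by (simp add: algebra_simps)
        ultimately show "z r \<bullet> (Q r *\<^sub>v z r) - z r \<bullet> (P r *\<^sub>v (K r *\<^sub>v ?w)) + (K r *\<^sub>v g r) \<bullet> ?w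
            + z r \<bullet> (P r *\<^sub>v (K r *\<^sub>v g r)) \<le> (q * B + k * E) * ?G"
          using wK by linarith
      qed simp_all
      moreover have "z s \<bullet> (P s *\<^sub>v z s) = 0"
        unfolding zs using solution_carrier[OF Ps(1) s(1)] by simp
      moreover have "integral ?S (\<lambda>_. (q * B + k * E) * ?G) = (t - s) * ((q * B + k * E) * ?G)"
        using s(2) by simp
      moreover have "\<dots> = C * ?G" unfolding C_def s(3) by (simp add: mult_ac)
      ultimately show ?thesis by linarith
    qed
    have zt: "z t \<in> carrier_vec n" by (rule zv) (use s in simp)
    have Pt: "psd n (P t)" by (rule Ps(2)[OF s(4)])
    have uPz: "u \<bullet> (P t *\<^sub>v z t) = z t \<bullet> g t"
    proof -
      have d: "dim_row (P t) = n" "dim_col (P t) = n" "dim_vec (z t) = n" "dim_vec u = n"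
        using Pt zt u by (auto simp: psd_def)
      have "u \<bullet> (P t *\<^sub>v z t) = (P t *\<^sub>v u) \<bullet> z t"
        using d by (simp add: sp_mult_left Ps(3)[OF s(4)])
      also have "\<dots> = z t \<bullet> (P t *\<^sub>v u)" using d by (intro sp_comm) simp
      finally show ?thesis by (simp add: gt)
    qed
    \<comment> \<open>with \<open>g = P u\<close>: \<open>m\<^sup>2 |P u|\<^sup>4 \<le> (u \<bullet> P z)\<^sup>2 \<le> (u \<bullet> P u) (z \<bullet> P z) \<le> |u| |P u| C |P u|\<^sup>2\<close>\<close>
    have "(m * ?G)\<^sup>2 \<le> (z t \<bullet> g t)\<^sup>2" using zg m G0 by (intro power_mono) auto
    also have "\<dots> \<le> (u \<bullet> (P t *\<^sub>v u)) * (z t \<bullet> (P t *\<^sub>v z t))"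
      unfolding uPz[symmetric] by (rule psd_Cauchy_Schwarz[OF Pt u zt])
    also have "\<dots> \<le> (u \<bullet> (P t *\<^sub>v u)) * (C * ?G)"
      using zPz Pt u by (intro mult_left_mono) (auto simp: psd_def)
    also have "\<dots> \<le> (vnorm u * vnorm (g t)) * (C * ?G)"
    proof (rule mult_right_mono)
      have "\<bar>u \<bullet> (P t *\<^sub>v u)\<bar> \<le> vnorm u * vnorm (P t *\<^sub>v u)"
        using u Pt by (intro Cauchy_Schwarz_vec) (auto simp: psd_def)
      then show "u \<bullet> (P t *\<^sub>v u) \<le> vnorm u * vnorm (g t)" by (simp add: gt)
    qed (use C0 G0 in simp)
    finally have fin: "(m * ?G)\<^sup>2 \<le> (vnorm u * vnorm (g t)) * (C * ?G)" .
    define x where "x = vnorm (g t)"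
    have x: "?G = x * x" "0 \<le> x" unfolding x_def using vnorm_sq[of "g t"] by (simp_all add: power2_eq_square)
    show ?thesis
    proof (cases "x = 0")
      case True
      then show ?thesis using C0 by (simp add: x_def gt)
    next
      case False
      then have xp: "0 < x" using x by simp
      have "(m * m * x) * (x * x * x) \<le> (C * vnorm u) * (x * x * x)"
        using fin unfolding x(1) x_def[symmetric] by (simp add: power2_eq_square mult_ac)
      then have "m * m * x \<le> C * vnorm u" using xp by simp
      then show ?thesis using m by (simp add: x_def gt field_simps)
    qed
  qed
  show ?thesis using main C0 m by (intro exI[of _ "C / (m * m)"]) simp
qed

text \<open>The observability bound needs one full window behind \<open>t\<close>; the first window is compact.\<close>

lemma solution_bounded:
  assumes obs: "observable \<epsilon> \<mu>" and P: "psd_solution P"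
  shows "\<exists>p\<ge>0. \<forall>t\<ge>t\<^sub>0. \<forall>u\<in>carrier_vec n. vnorm (P t *\<^sub>v u) \<le> p * vnorm u"
proof -
  obtain c where c': "c \<ge> 0 \<and> (\<forall>P t u. psd_solution P \<longrightarrow> t\<^sub>0 + \<epsilon> \<le> t \<longrightarrow> u \<in> carrier_vec n \<longrightarrow>
      vnorm (P t *\<^sub>v u) \<le> c * vnorm u)"
    using observability_upper_bound[OF obs] by (rule exE)
  note c = conjunct1[OF c'] conjunct2[OF c', rule_format, OF P]
  have "mat_cont_on {t\<^sub>0..t\<^sub>0 + \<epsilon>} P n n"
    by (rule mat_cont_on_subset[OF solution_cont[OF psd_solutionD(1)[OF P]]]) auto
  then obtain b where "b \<ge> 0 \<and> (\<forall>t\<in>{t\<^sub>0..t\<^sub>0 + \<epsilon>}. \<forall>u\<in>carrier_vec n. vnorm (P t *\<^sub>v u) \<le> b * vnorm u)"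
    by (rule exE[OF mat_cont_on_interval_bounded])
  then have b: "b \<ge> 0" "\<forall>t\<in>{t\<^sub>0..t\<^sub>0 + \<epsilon>}. \<forall>u\<in>carrier_vec n. vnorm (P t *\<^sub>v u) \<le> b * vnorm u"
    by (rule conjunct1, rule conjunct2)
  have "vnorm (P t *\<^sub>v u) \<le> max b c * vnorm u" if t: "t\<^sub>0 \<le> t" and u: "u \<in> carrier_vec n" for t u
  proof (cases "t \<le> t\<^sub>0 + \<epsilon>")
    case True
    then have "vnorm (P t *\<^sub>v u) \<le> b * vnorm u" using b t u by simp
    also have "\<dots> \<le> max b c * vnorm u" by (intro mult_right_mono) auto
    finally show ?thesis .
  next
    case False
    then have "vnorm (P t *\<^sub>v u) \<le> c * vnorm u" using c(2)[of t u] u by simp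
    also have "\<dots> \<le> max b c * vnorm u" by (intro mult_right_mono) auto
    finally show ?thesis .
  qed
  then show ?thesis using b by (intro exI[of _ "max b c"]) auto
qed

text \<open>Geometric decay, backwards in time, of the solutions of the closed-loop adjoint equation.  The
  exponent counts whole windows of length \<open>\<epsilon>\<close>, so that no real power occurs.\<close>

definition decays :: "(real \<Rightarrow> real mat) \<Rightarrow> real \<Rightarrow> real \<Rightarrow> real \<Rightarrow> bool" where
  "decays P \<epsilon> C l \<longleftrightarrow> (\<forall>s t z. t\<^sub>0 \<le> s \<longrightarrow> s \<le> t \<longrightarrow> forced_adjoint {s..t} (\<lambda>r. P r *\<^sub>v z r) z \<longrightarrow>
     z s \<bullet> z s \<le> C * (z t \<bullet> z t) \<and>
     (\<forall>m::nat. s + (real m + 1) * \<epsilon> \<le> t \<longrightarrow> z s \<bullet> z s \<le> C * l ^ m * (z t \<bullet> z t)))"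

lemma decaysD:
  assumes "decays P \<epsilon> C l" "t\<^sub>0 \<le> s" "s \<le> t" "forced_adjoint {s..t} (\<lambda>r. P r *\<^sub>v z r) z"
  shows "z s \<bullet> z s \<le> C * (z t \<bullet> z t)"
    and "s + (real m + 1) * \<epsilon> \<le> t \<Longrightarrow> z s \<bullet> z s \<le> C * l ^ m * (z t \<bullet> z t)"
  using assms(1)[unfolded decays_def, rule_format, OF assms(2-4)] by simp_all

text \<open>The form of \<open>P\<close> is comparable to \<open>|z|\<^sup>2\<close> and gains a fixed fraction over every window, so
  closed-loop adjoint solutions decay geometrically backwards in time.  The lower bound on \<open>P\<close> is
  available only one window after \<open>t\<^sub>0\<close>, as \<open>P(t\<^sub>0)\<close> may be singular; the initial window is crossed
  with a growth estimate, which is why a step is lost in the exponent.\<close>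

lemma adjoint_decay:
  assumes obs: "observable \<epsilon>' \<mu>'" and ctrl: "controllable \<epsilon> \<mu>" and P: "psd_solution P"
  shows "\<exists>C>0. \<exists>l. 0 \<le> l \<and> l < 1 \<and> decays P \<epsilon> C l"
proof -
  have e0: "0 < \<epsilon>" using ctrl by (simp add: controllable_def)
  note Ps = psd_solutionD[OF P]
  obtain c where c': "c > 0 \<and> (\<forall>P t z. psd_solution P \<longrightarrow> t\<^sub>0 \<le> t - \<epsilon> \<longrightarrow>
    forced_adjoint {t - \<epsilon>..t} (\<lambda>r. P r *\<^sub>v z r) z \<longrightarrow>
    c * (z t \<bullet> z t) \<le> z t \<bullet> (P t *\<^sub>v z t) - z (t - \<epsilon>) \<bullet> (P (t - \<epsilon>) *\<^sub>v z (t - \<epsilon>)))"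
    using controllability_window[OF ctrl] by (rule exE)
  note c = conjunct1[OF c'] conjunct2[OF c', rule_format, OF P]
  obtain p0 where p0': "p0 \<ge> 0 \<and> (\<forall>t\<ge>t\<^sub>0. \<forall>u\<in>carrier_vec n. vnorm (P t *\<^sub>v u) \<le> p0 * vnorm u)"
    using solution_bounded[OF obs P] by (rule exE)
  note p0 = conjunct1[OF p0'] conjunct2[OF p0', rule_format]
  \<comment> \<open>\<open>p \<ge> 2 c\<close> keeps the ratio \<open>l = 1 - c / p\<close> nonnegative\<close>
  define p where "p = max p0 (2 * c)"
  have p: "0 < p" "2 * c \<le> p" "p0 \<le> p" using c(1) by (auto simp: p_def)
  have up: "x \<bullet> (P t *\<^sub>v x) \<le> p * (x \<bullet> x)" if t: "t\<^sub>0 \<le> t" and x: "x \<in> carrier_vec n" for t x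
  proof -
    have "x \<bullet> (P t *\<^sub>v x) \<le> vnorm x * vnorm (P t *\<^sub>v x)"
      using Cauchy_Schwarz_vec[of x "P t *\<^sub>v x"] solution_carrier[OF Ps(1) t] x by auto
    also have "\<dots> \<le> vnorm x * (p0 * vnorm x)" by (intro mult_left_mono p0(2) t x) simp
    also have "\<dots> = p0 * (x \<bullet> x)" by (simp add: vnorm_sq[symmetric] power2_eq_square mult_ac)
    also have "\<dots> \<le> p * (x \<bullet> x)" by (intro mult_right_mono p sp_self_nonneg)
    finally show ?thesis .
  qed
  have low: "c * (x \<bullet> x) \<le> x \<bullet> (P t *\<^sub>v x)" if t: "t\<^sub>0 + \<epsilon> \<le> t" and x: "x \<in> carrier_vec n" for t x
  proof -
    have t': "t\<^sub>0 \<le> t - \<epsilon>" "t - \<epsilon> \<le> t" using t e0 by auto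
    obtain z where z: "z t = x" "forced_adjoint {t - \<epsilon>..t} (\<lambda>r. P r *\<^sub>v z r) z"
      by (rule closed_loop_adjoint_exists[OF solution_cont[OF Ps(1)] t' x])
    have "z (t - \<epsilon>) \<in> carrier_vec n" using forced_adjoint_carrier(1)[OF z(2)] t' by simp
    then have "0 \<le> z (t - \<epsilon>) \<bullet> (P (t - \<epsilon>) *\<^sub>v z (t - \<epsilon>))" using Ps(2)[OF t'(1)] by (simp add: psd_def)
    then show ?thesis using c(2)[OF t'(1) z(2)] z(1) by simp
  qed
  define l where "l = 1 - c / p"
  have l: "0 \<le> l" "l < 1" using c(1) p by (simp_all add: l_def field_simps)
  define E where "E = exp (2 * (a + k * p) * \<epsilon>)"
  have E1: "1 \<le> E" unfolding E_def using bounds_nonneg p e0 by simp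
  define C where "C = E * (p / c)"
  have pc: "1 \<le> p / c" using p c(1) by (simp add: field_simps)
  have "0 < E" "0 < p / c" using E1 pc by linarith+
  then have C0: "0 < C" unfolding C_def by (rule mult_pos_pos)
  have CE: "E \<le> C" using E1 pc mult_left_mono[of 1 "p / c" E] by (simp add: C_def)
  have short: "z s \<bullet> z s \<le> E * (z t \<bullet> z t)"
    if s: "t\<^sub>0 \<le> s" "s \<le> t" "t \<le> s + \<epsilon>" and z: "forced_adjoint {s..t} (\<lambda>r. P r *\<^sub>v z r) z" for s t z
  proof -
    have S: "{s..t} \<subseteq> {t\<^sub>0..}" using s by auto
    have nn: "0 \<le> 2 * (a + k * p)" using bounds_nonneg p by simp
    have "z s \<bullet> z s \<le> exp (2 * (a + k * p) * (t - s)) * (z t \<bullet> z t + integral {s..t} (\<lambda>_. 0))"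
    proof (rule gronwall_backward[OF s(2) nn forced_adjoint_energy_rate(1)[OF S z]])
      fix r assume r: "r \<in> {s..t}"
      then have r0: "t\<^sub>0 \<le> r" using s by simp
      note zc = forced_adjoint_carrier[OF z r]
      have "\<bar>z r \<bullet> (K r *\<^sub>v (P r *\<^sub>v z r))\<bar> \<le> vnorm (z r) * vnorm (K r *\<^sub>v (P r *\<^sub>v z r))"
        using zc coeff_carrier[OF r0] by (intro Cauchy_Schwarz_vec) auto
      also have "\<dots> \<le> vnorm (z r) * (k * (p0 * vnorm (z r)))"
        using K_bound[OF r0 zc(2)] mult_left_mono[OF p0(2)[OF r0 zc(1)] bounds_nonneg(3)]
        by (intro mult_left_mono) auto
      also have "\<dots> = k * p0 * (z r \<bullet> z r)" by (simp add: vnorm_sq[symmetric] power2_eq_square mult_ac)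
      also have "\<dots> \<le> k * p * (z r \<bullet> z r)"
        using bounds_nonneg p by (intro mult_right_mono mult_left_mono sp_self_nonneg)
      finally have "\<bar>z r \<bullet> (K r *\<^sub>v (P r *\<^sub>v z r))\<bar> \<le> k * p * (z r \<bullet> z r)" .
      moreover have "z r \<bullet> (A r *\<^sub>v z r) \<le> a * (z r \<bullet> z r)" by (rule form_le(3)[OF r0 zc(1)])
      moreover have "2 * (a + k * p) * (z r \<bullet> z r) = 2 * (a * (z r \<bullet> z r)) + 2 * (k * p * (z r \<bullet> z r))"
        by (simp add: algebra_simps)
      ultimately show "- (2 * (z r \<bullet> (K r *\<^sub>v (P r *\<^sub>v z r))) - 2 * (z r \<bullet> (A r *\<^sub>v z r)))
          \<le> 2 * (a + k * p) * (z r \<bullet> z r) + 0" by linarith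
    qed simp_all
    also have "\<dots> = exp (2 * (a + k * p) * (t - s)) * (z t \<bullet> z t)" by simp
    also have "\<dots> \<le> E * (z t \<bullet> z t)"
      unfolding E_def using nn s by (intro mult_right_mono sp_self_nonneg) (auto intro: mult_left_mono)
    finally show ?thesis .
  qed
  have steps: "z s \<bullet> (P s *\<^sub>v z s) \<le> l ^ m * (z t \<bullet> (P t *\<^sub>v z t))"
    if s: "t\<^sub>0 \<le> s" "s + real m * \<epsilon> \<le> t" and z: "forced_adjoint {s..t} (\<lambda>r. P r *\<^sub>v z r) z" for s t z m
    using s(2) z
  proof (induction m arbitrary: t)
    case 0
    then have "s \<le> t" by simp
    from closed_loop_increment(2)[OF Ps(1,3) s(1) this 0(2)] show ?case by simp
  next
    case (Suc m)
    have t1: "s + real m * \<epsilon> \<le> t - \<epsilon>" using Suc(2) by (simp add: algebra_simps)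
    moreover have "0 \<le> real m * \<epsilon>" using e0 by simp
    ultimately have t2: "s \<le> t - \<epsilon>" by linarith
    have z1: "forced_adjoint {s..t - \<epsilon>} (\<lambda>r. P r *\<^sub>v z r) z"
      and z2: "forced_adjoint {t - \<epsilon>..t} (\<lambda>r. P r *\<^sub>v z r) z"
      using t2 e0 by (auto intro: forced_adjoint_subset[OF Suc(3)])
    let ?V = "z t \<bullet> (P t *\<^sub>v z t)"
    have t0: "t\<^sub>0 \<le> t - \<epsilon>" "t\<^sub>0 \<le> t" using t2 s e0 by auto
    have zt: "z t \<in> carrier_vec n" using forced_adjoint_carrier(1)[OF z2] e0 by simp
    have "z s \<bullet> (P s *\<^sub>v z s) \<le> l ^ m * (z (t - \<epsilon>) \<bullet> (P (t - \<epsilon>) *\<^sub>v z (t - \<epsilon>)))"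
      by (rule Suc.IH[OF t1 z1])
    also have "\<dots> \<le> l ^ m * (?V - c * (z t \<bullet> z t))"
      using c(2)[OF t0(1) z2] l by (intro mult_left_mono) auto
    also have "\<dots> \<le> l ^ m * (l * ?V)"
    proof (rule mult_left_mono)
      have "c / p * ?V \<le> c / p * (p * (z t \<bullet> z t))"
        using up[OF t0(2) zt] c(1) p by (intro mult_left_mono) auto
      also have "\<dots> = c * (z t \<bullet> z t)" using p by simp
      finally show "?V - c * (z t \<bullet> z t) \<le> l * ?V" by (simp add: l_def algebra_simps)
    qed (use l in simp)
    finally show ?case by (simp add: mult_ac)
  qed
  have late: "z s \<bullet> z s \<le> (p / c) * l ^ m * (z t \<bullet> z t)"
    if s: "t\<^sub>0 + \<epsilon> \<le> s" "s + real m * \<epsilon> \<le> t" and z: "forced_adjoint {s..t} (\<lambda>r. P r *\<^sub>v z r) z" for s t z m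
  proof -
    have "0 \<le> real m * \<epsilon>" using e0 by simp
    then have st: "s \<le> t" "t\<^sub>0 \<le> s" "t\<^sub>0 \<le> t" using s e0 by linarith+
    have zs: "z s \<in> carrier_vec n" and zt: "z t \<in> carrier_vec n"
      using forced_adjoint_carrier(1)[OF z] st by simp_all
    have "c * (z s \<bullet> z s) \<le> z s \<bullet> (P s *\<^sub>v z s)" by (rule low[OF s(1) zs])
    also have "\<dots> \<le> l ^ m * (z t \<bullet> (P t *\<^sub>v z t))" by (rule steps[OF st(2) s(2) z])
    also have "\<dots> \<le> l ^ m * (p * (z t \<bullet> z t))" using l by (intro mult_left_mono up st zt) simp
    finally show ?thesis using c(1) by (simp add: field_simps)
  qed
  have "decays P \<epsilon> C l"
    unfolding decays_def
  proof (intro allI impI conjI)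
    fix s t z assume s: "t\<^sub>0 \<le> s" "s \<le> t" and z: "forced_adjoint {s..t} (\<lambda>r. P r *\<^sub>v z r) z"
    have long: "z s \<bullet> z s \<le> C * l ^ m * (z t \<bullet> z t)" if m: "s + (real m + 1) * \<epsilon> \<le> t" for m
    proof -
      \<comment> \<open>cross the part before \<open>t\<^sub>0 + \<epsilon>\<close>, where \<open>P\<close> has no lower bound, by the growth estimate\<close>
      define s' where "s' = max s (t\<^sub>0 + \<epsilon>)"
      have m': "s + \<epsilon> + real m * \<epsilon> \<le> t" using m by (simp add: algebra_simps)
      have me: "0 \<le> real m * \<epsilon>" using e0 by simp
      have s0: "s \<le> s'" "s' \<le> s + \<epsilon>" "t\<^sub>0 + \<epsilon> \<le> s'" using s e0 by (simp_all add: s'_def)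
      then have s': "s \<le> s'" "s' \<le> s + \<epsilon>" "t\<^sub>0 + \<epsilon> \<le> s'" "s' + real m * \<epsilon> \<le> t" "s' \<le> t"
        using m' me by linarith+
      have z1: "forced_adjoint {s..s'} (\<lambda>r. P r *\<^sub>v z r) z" and z2: "forced_adjoint {s'..t} (\<lambda>r. P r *\<^sub>v z r) z"
        using s' by (auto intro: forced_adjoint_subset[OF z])
      have "z s \<bullet> z s \<le> E * (z s' \<bullet> z s')" by (rule short[OF s(1) s'(1,2) z1])
      also have "\<dots> \<le> E * ((p / c) * l ^ m * (z t \<bullet> z t))"
        using late[OF s'(3,4) z2] E1 by (intro mult_left_mono) auto
      finally show ?thesis by (simp add: C_def mult.assoc)
    qed
    show "z s \<bullet> z s \<le> C * (z t \<bullet> z t)"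
    proof (cases "s + \<epsilon> \<le> t")
      case True
      then show ?thesis using long[of 0] by simp
    next
      case False
      then have "z s \<bullet> z s \<le> E * (z t \<bullet> z t)" using short[OF s _ z] by simp
      also have "\<dots> \<le> C * (z t \<bullet> z t)" by (intro mult_right_mono CE sp_self_nonneg)
      finally show ?thesis .
    qed
    fix m :: nat assume "s + (real m + 1) * \<epsilon> \<le> t"
    then show "z s \<bullet> z s \<le> C * l ^ m * (z t \<bullet> z t)" by (rule long)
  qed
  then show ?thesis using C0 l by (intro exI conjI)
qed

text \<open>The product of a closed-loop solution and a closed-loop adjoint solution is constant; with
  the adjoint solution that ends in \<open>x(t)\<close> this turns backward decay into forward decay.\<close>

lemma closed_loop_decay:
  assumes dec: "decays P \<epsilon> C l" and C: "0 < C" "0 \<le> l" and P: "psd_solution P"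
    and xi: "vec_deriv_on {s..} n x (\<lambda>t. (A t - P t * K t) *\<^sub>v x t)" and st: "t\<^sub>0 \<le> s" "s \<le> t"
  shows "x t \<bullet> x t \<le> C * (x s \<bullet> x s)"
    "s + (real m + 1) * \<epsilon> \<le> t \<Longrightarrow> x t \<bullet> x t \<le> C * l ^ m * (x s \<bullet> x s)"
proof -
  note Ps = psd_solutionD[OF P]
  have xS: "vec_deriv_on {s..t} n x (\<lambda>t. (A t - P t * K t) *\<^sub>v x t)"
    by (rule vec_deriv_on_subset[OF xi]) auto
  have xc: "x r \<in> carrier_vec n" if "r \<in> {s..t}" for r using xS that by (simp add: vec_deriv_on_def)
  have xt: "x t \<in> carrier_vec n" using xc st by simp
  obtain z where z: "z t = x t" "forced_adjoint {s..t} (\<lambda>r. P r *\<^sub>v z r) z"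
    by (rule closed_loop_adjoint_exists[OF solution_cont[OF Ps(1)] st xt])
  have z': "vec_deriv_on {s..t} n z (\<lambda>r. K r *\<^sub>v (P r *\<^sub>v z r) - (A r)\<^sup>T *\<^sub>v z r)"
    using z(2) by (simp add: forced_adjoint_def)
  have "x s \<bullet> z s = x t \<bullet> z t"
  proof (rule derivative_zero_imp_equal[OF st(2)])
    fix r assume r: "r \<in> {s..t}"
    then have r0: "t\<^sub>0 \<le> r" using st by simp
    have d: "dim_vec (x r) = n" "dim_vec (z r) = n" "dim_row (P r) = n" "dim_col (P r) = n"
      using xc[OF r] forced_adjoint_carrier(1)[OF z(2) r] solution_carrier[OF Ps(1) r0] by auto
    note dims = d coeff_dim[OF r0] coeff_transpose[OF r0] Ps(3)[OF r0]
    have "((A r - P r * K r) *\<^sub>v x r) \<bullet> z r + x r \<bullet> (K r *\<^sub>v (P r *\<^sub>v z r) - (A r)\<^sup>T *\<^sub>v z r) = 0"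
      by (simp add: dims dim_vec_algebra sp_algebra sp_mult_left)
    then show "((\<lambda>r. x r \<bullet> z r) has_real_derivative 0) (at r within {s..t})"
      using has_real_derivative_scalar_prod[OF xS z' r] by simp
  qed
  then have eq: "x t \<bullet> x t = x s \<bullet> z s" using z(1) by simp
  have xs: "x s \<in> carrier_vec n" and zs: "z s \<in> carrier_vec n"
    using xc forced_adjoint_carrier(1)[OF z(2)] st by simp_all
  have gen: "x t \<bullet> x t \<le> b * (x s \<bullet> x s)" if b: "z s \<bullet> z s \<le> b * (x t \<bullet> x t)" and b0: "0 \<le> b" for b
  proof (cases "x t \<bullet> x t = 0")
    case True
    then show ?thesis using b0 sp_self_nonneg[of "x s"] by simp
  next
    case False
    then have pos: "0 < x t \<bullet> x t" using sp_self_nonneg[of "x t"] by linarith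
    have "(x t \<bullet> x t)\<^sup>2 = \<bar>x s \<bullet> z s\<bar>\<^sup>2" by (simp add: eq)
    also have "\<dots> \<le> (vnorm (x s) * vnorm (z s))\<^sup>2"
      using Cauchy_Schwarz_vec[of "x s" "z s"] xs zs by (intro power_mono) auto
    also have "\<dots> = (x s \<bullet> x s) * (z s \<bullet> z s)" by (simp add: power_mult_distrib vnorm_sq)
    also have "\<dots> \<le> (x s \<bullet> x s) * (b * (x t \<bullet> x t))" by (intro mult_left_mono b sp_self_nonneg)
    finally have "(x t \<bullet> x t) * (x t \<bullet> x t) \<le> (b * (x s \<bullet> x s)) * (x t \<bullet> x t)"
      by (simp add: power2_eq_square mult_ac)
    then show ?thesis using pos by simp
  qed
  have "z s \<bullet> z s \<le> C * (x t \<bullet> x t)"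
    using decaysD(1)[OF dec st z(2)] z(1) by simp
  then show "x t \<bullet> x t \<le> C * (x s \<bullet> x s)" using C by (intro gen) auto
  assume m: "s + (real m + 1) * \<epsilon> \<le> t"
  have "z s \<bullet> z s \<le> C * l ^ m * (z t \<bullet> z t)"
    by (rule decaysD(2)[OF dec st z(2) m])
  then show "x t \<bullet> x t \<le> C * l ^ m * (x s \<bullet> x s)" using C z(1) by (intro gen) auto
qed

lemma power_tends_to_zero_witness:
  fixes B l \<eta> :: real
  assumes "0 \<le> l" "l < 1" "0 < \<eta>"
  shows "\<exists>m::nat. B * l ^ m < \<eta>"
proof -
  have "(\<lambda>m. B * l ^ m) \<longlonglongrightarrow> B * 0"
    by (intro tendsto_mult tendsto_const LIMSEQ_power_zero) (use assms in simp)
  then have "eventually (\<lambda>m. B * l ^ m < \<eta>) sequentially"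
    using assms(3) by (intro order_tendstoD(2)) simp_all
  then show ?thesis by (auto simp: eventually_sequentially)
qed

lemma lin_solution_vec_deriv_on:
  assumes x: "lin_solution n F s x" and F: "\<And>t. s \<le> t \<Longrightarrow> F t \<in> carrier_mat n n"
  shows "vec_deriv_on {s..} n x (\<lambda>t. F t *\<^sub>v x t)"
  unfolding vec_deriv_on_def
proof (intro ballI conjI allI impI)
  fix t assume t: "t \<in> {s..}"
  then show xt: "x t \<in> carrier_vec n" using x by (simp add: lin_solution_def)
  show "F t *\<^sub>v x t \<in> carrier_vec n" by (rule mult_mat_vec_carrier[OF F xt]) (use t in simp)
  fix i assume "i < n"
  then show "((\<lambda>s. x s $ i) has_real_derivative (F t *\<^sub>v x t) $ i) (at t within {s..})"
    using x t unfolding lin_solution_def by simp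
qed

theorem closed_loop_uas:
  assumes obs: "observable \<epsilon>' \<mu>'" and ctrl: "controllable \<epsilon> \<mu>" and P: "psd_solution P"
  shows "uas n t\<^sub>0 (\<lambda>t. A t - P t * K t)"
proof -
  have e0: "0 < \<epsilon>" using ctrl by (simp add: controllable_def)
  obtain C where C': "C > 0 \<and> (\<exists>l. 0 \<le> l \<and> l < 1 \<and> decays P \<epsilon> C l)"
    using adjoint_decay[OF obs ctrl P] by (rule exE)
  then obtain l where C: "0 < C" and l: "0 \<le> l" "l < 1" and dec: "decays P \<epsilon> C l" by blast
  have F: "A t - P t * K t \<in> carrier_mat n n" if "t\<^sub>0 \<le> t" for t
    using coeff_carrier[OF that] solution_carrier[OF psd_solutionD(1)[OF P] that] by auto
  have sol: "vec_deriv_on {s..} n x (\<lambda>t. (A t - P t * K t) *\<^sub>v x t)"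
    if "t\<^sub>0 \<le> s" "lin_solution n (\<lambda>t. A t - P t * K t) s x" for s x
    by (rule lin_solution_vec_deriv_on[OF that(2) F]) (use that(1) in simp)
  note D = closed_loop_decay[OF dec C l(1) P sol]
  have lt: "vnorm x < \<eta>" if "x \<bullet> x < \<eta>\<^sup>2" "0 < \<eta>" for x \<eta>
    using that unfolding vnorm_sq[symmetric] by (simp add: power_less_imp_less_base)
  show ?thesis
    unfolding uas_def
  proof (intro conjI allI impI)
    fix e :: real assume e: "0 < e"
    show "\<exists>\<delta>>0. \<forall>s\<ge>t\<^sub>0. \<forall>\<xi>. lin_solution n (\<lambda>t. A t - P t * K t) s \<xi> \<and> vnorm (\<xi> s) < \<delta> \<longrightarrow>
        (\<forall>t\<ge>s. vnorm (\<xi> t) < e)"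
    proof (intro exI[of _ "e / sqrt C"] conjI allI impI)
      show "0 < e / sqrt C" using e C by simp
      fix s x t assume s: "t\<^sub>0 \<le> s"
        and x: "lin_solution n (\<lambda>t. A t - P t * K t) s x \<and> vnorm (x s) < e / sqrt C" and t: "s \<le> t"
      have "(vnorm (x s))\<^sup>2 < (e / sqrt C)\<^sup>2" using x by (intro power_strict_mono) auto
      then have "C * (x s \<bullet> x s) < e\<^sup>2" using C by (simp add: vnorm_sq power_divide field_simps)
      moreover have "x t \<bullet> x t \<le> C * (x s \<bullet> x s)" using D(1)[OF s _ s t] x by blast
      ultimately show "vnorm (x t) < e" using e by (intro lt) auto
    qed
  next
    show "\<exists>c>0. \<forall>\<eta>>0. \<exists>\<theta>>0. \<forall>s\<ge>t\<^sub>0. \<forall>\<xi>. lin_solution n (\<lambda>t. A t - P t * K t) s \<xi> \<and> vnorm (\<xi> s) < c \<longrightarrow>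
        (\<forall>t\<ge>s + \<theta>. vnorm (\<xi> t) < \<eta>)"
    proof (rule exI[of _ 1], intro conjI allI impI)
      fix \<eta> :: real assume \<eta>: "0 < \<eta>"
      then have "0 < \<eta>\<^sup>2" by simp
      from power_tends_to_zero_witness[OF l this] obtain m where m: "C * l ^ m < \<eta>\<^sup>2" by (rule exE)
      show "\<exists>\<theta>>0. \<forall>s\<ge>t\<^sub>0. \<forall>\<xi>. lin_solution n (\<lambda>t. A t - P t * K t) s \<xi> \<and> vnorm (\<xi> s) < 1 \<longrightarrow>
        (\<forall>t\<ge>s + \<theta>. vnorm (\<xi> t) < \<eta>)"
      proof (intro exI[of _ "(real m + 1) * \<epsilon>"] conjI allI impI)
        show th: "0 < (real m + 1) * \<epsilon>" using e0 by simp
        fix s x t assume s: "t\<^sub>0 \<le> s"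
          and x: "lin_solution n (\<lambda>t. A t - P t * K t) s x \<and> vnorm (x s) < 1"
          and t: "s + (real m + 1) * \<epsilon> \<le> t"
        have st: "s \<le> t" using t th by linarith
        have "(vnorm (x s))\<^sup>2 \<le> 1\<^sup>2" using x by (intro power_mono) auto
        then have "C * l ^ m * (x s \<bullet> x s) \<le> C * l ^ m * 1"
          using C l by (intro mult_left_mono) (auto simp: vnorm_sq)
        moreover have "x t \<bullet> x t \<le> C * l ^ m * (x s \<bullet> x s)" using D(2)[OF s _ s st t] x by blast
        ultimately show "vnorm (x t) < \<eta>" using m \<eta> by (intro lt) auto
      qed
    qed simp
  qed
qed

text \<open>The invariant \<open>z \<bullet> (P1 - P2) w\<close> is evaluated at \<open>t\<^sub>0\<close>, where \<open>P1 - P2\<close> is a fixed matrix and the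
  backward decay has made \<open>z\<close> small; it suffices that \<open>w\<close> stays bounded.\<close>

theorem solutions_approach:
  assumes obs: "observable \<epsilon>' \<mu>'" and ctrl: "controllable \<epsilon> \<mu>"
    and P1: "psd_solution P1" and P2: "psd_solution P2"
  shows "approaches P1 P2"
proof -
  have e0: "0 < \<epsilon>" using ctrl by (simp add: controllable_def)
  obtain C1 l where C1: "0 < C1" and l: "0 \<le> l" "l < 1" and dec1: "decays P1 \<epsilon> C1 l"
    using adjoint_decay[OF obs ctrl P1] by blast
  obtain C2 l2 where C2: "0 < C2" and dec2: "decays P2 \<epsilon> C2 l2"
    using adjoint_decay[OF obs ctrl P2] by blast
  note Ps1 = psd_solutionD[OF P1] and Ps2 = psd_solutionD[OF P2]
  define D where "D t = P1 t - P2 t" for t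
  have D: "D t \<in> carrier_mat n n" if "t\<^sub>0 \<le> t" for t
    using solution_carrier[OF Ps1(1) that] solution_carrier[OF Ps2(1) that] by (auto simp: D_def)
  obtain d0 where d': "d0 \<ge> 0 \<and> (\<forall>x\<in>carrier_vec n. vnorm (D t\<^sub>0 *\<^sub>v x) \<le> d0 * vnorm x)"
    using matrix_norm_bounded[OF D[OF order_refl]] by (rule exE)
  note d = conjunct1[OF d'] conjunct2[OF d', rule_format]
  have main: "mnorm (D t) \<le> sqrt (d0\<^sup>2 * C1 * C2 * l ^ m)" if t: "t\<^sub>0 + (real m + 1) * \<epsilon> \<le> t" for t m
  proof -
    have "0 \<le> (real m + 1) * \<epsilon>" using e0 by simp
    then have t0: "t\<^sub>0 \<le> t" using t by linarith
    let ?b = "sqrt (d0\<^sup>2 * C1 * C2 * l ^ m)"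
    have b0: "0 \<le> ?b" using C1 C2 l by simp
    have dc: "dim_row (D t) = n" "dim_col (D t) = n" using D[OF t0] by auto
    have form: "x \<bullet> (D t *\<^sub>v y) \<le> ?b * vnorm y * vnorm x" if x: "x \<in> carrier_vec n" and y: "y \<in> carrier_vec n" for x y
    proof -
      have P1c: "mat_cont_on {t\<^sub>0..} P1 n n" and P2c: "mat_cont_on {t\<^sub>0..} P2 n n"
        by (rule solution_cont, fact)+
      obtain z where z: "z t = x" "forced_adjoint {t\<^sub>0..t} (\<lambda>r. P1 r *\<^sub>v z r) z"
        by (rule closed_loop_adjoint_exists[OF P1c order_refl t0 x])
      obtain w where w: "w t = y" "forced_adjoint {t\<^sub>0..t} (\<lambda>r. P2 r *\<^sub>v w r) w"
        by (rule closed_loop_adjoint_exists[OF P2c order_refl t0 y])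
      have zT: "forced_adjoint {t\<^sub>0..t} (\<lambda>r. (P1 r)\<^sup>T *\<^sub>v z r) z"
      proof -
        have e: "(P1 r)\<^sup>T = P1 r" if "r \<in> {t\<^sub>0..t}" for r using Ps1(3)[of r] that by simp
        have v: "vec_deriv_on {t\<^sub>0..t} n z (\<lambda>r. K r *\<^sub>v ((P1 r)\<^sup>T *\<^sub>v z r) - (A r)\<^sup>T *\<^sub>v z r)"
          by (rule vec_deriv_on_cong[OF conjunct2[OF z(2)[unfolded forced_adjoint_def]]]) (simp only: e)
        show ?thesis unfolding forced_adjoint_def using v forced_adjoint_carrier(2)[OF z(2)] e by simp
      qed
      have zc: "z t\<^sub>0 \<in> carrier_vec n" and wc: "w t\<^sub>0 \<in> carrier_vec n"
        using forced_adjoint_carrier(1)[OF z(2)] forced_adjoint_carrier(1)[OF w(2)] t0 by simp_all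
      have split: "u \<bullet> (D r *\<^sub>v v) = u \<bullet> (P1 r *\<^sub>v v) - u \<bullet> (P2 r *\<^sub>v v)"
        if "t\<^sub>0 \<le> r" "u \<in> carrier_vec n" "v \<in> carrier_vec n" for u v r
      proof -
        have "dim_row (P1 r) = n" "dim_col (P1 r) = n" "dim_row (P2 r) = n" "dim_col (P2 r) = n"
          "dim_vec u = n" "dim_vec v = n"
          using solution_carrier[OF Ps1(1) that(1)] solution_carrier[OF Ps2(1) that(1)] that by auto
        then show ?thesis by (simp add: D_def dim_minus_mult_vec sp_minus_right)
      qed
      have "x \<bullet> (D t *\<^sub>v y) = z t\<^sub>0 \<bullet> (D t\<^sub>0 *\<^sub>v w t\<^sub>0)"
        using difference_form_invariant[OF Ps1(1) Ps2(1) order_refl t0 zT w(2)] z(1) w(1)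
        by (simp add: split t0 x y zc wc)
      also have "\<dots> \<le> vnorm (z t\<^sub>0) * vnorm (D t\<^sub>0 *\<^sub>v w t\<^sub>0)"
        using Cauchy_Schwarz_vec[of "z t\<^sub>0" "D t\<^sub>0 *\<^sub>v w t\<^sub>0"] zc wc D[OF order_refl] by auto
      also have "\<dots> \<le> vnorm (z t\<^sub>0) * (d0 * vnorm (w t\<^sub>0))" by (intro mult_left_mono d wc) simp
      also have "\<dots> = sqrt (d0\<^sup>2 * (z t\<^sub>0 \<bullet> z t\<^sub>0) * (w t\<^sub>0 \<bullet> w t\<^sub>0))"
        using d(1) by (simp add: real_sqrt_mult vnorm_def)
      also have "\<dots> \<le> sqrt (d0\<^sup>2 * (C1 * l ^ m * (x \<bullet> x)) * (C2 * (y \<bullet> y)))"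
      proof (intro real_sqrt_le_mono mult_mono)
        show "z t\<^sub>0 \<bullet> z t\<^sub>0 \<le> C1 * l ^ m * (x \<bullet> x)"
          using decaysD(2)[OF dec1 order_refl t0 z(2) t] z(1) by simp
        show "w t\<^sub>0 \<bullet> w t\<^sub>0 \<le> C2 * (y \<bullet> y)"
          using decaysD(1)[OF dec2 order_refl t0 w(2)] w(1) by simp
      qed (use C1 C2 l sp_self_nonneg[of x] sp_self_nonneg[of "z t\<^sub>0"] sp_self_nonneg[of "w t\<^sub>0"] in simp_all)
      also have "\<dots> = ?b * vnorm y * vnorm x"
        using C1 C2 l by (simp add: real_sqrt_mult vnorm_def)
      finally show ?thesis .
    qed
    show ?thesis
    proof (rule mnorm_le[OF _ b0])
      fix y :: "real vec" assume "y \<in> carrier_vec (dim_col (D t))"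
      then have y: "y \<in> carrier_vec n" by (simp only: dc)
      show "vnorm (D t *\<^sub>v y) \<le> ?b * vnorm y"
        by (rule form_bound_imp_norm_bound[OF D[OF t0] y _ form[OF _ y]]) (use b0 in simp)
    qed
  qed
  show ?thesis
    unfolding approaches_def D_def[symmetric]
  proof (rule tendstoI)
    fix \<eta> :: real assume "0 < \<eta>"
    then have "0 < \<eta>\<^sup>2" by simp
    from power_tends_to_zero_witness[OF l this] obtain m where m: "d0\<^sup>2 * C1 * C2 * l ^ m < \<eta>\<^sup>2" by (rule exE)
    show "eventually (\<lambda>t. dist (mnorm (D t)) 0 < \<eta>) at_top"
    proof (rule eventually_at_top_linorderI)
      fix t assume "t\<^sub>0 + (real m + 1) * \<epsilon> \<le> t"
      then have "mnorm (D t) \<le> sqrt (d0\<^sup>2 * C1 * C2 * l ^ m)" by (rule main)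
      also have "\<dots> < sqrt (\<eta>\<^sup>2)" by (rule real_sqrt_less_mono[OF m])
      also have "\<dots> = \<eta>" using \<open>0 < \<eta>\<close> by simp
      finally show "dist (mnorm (D t)) 0 < \<eta>" using mnorm_nonneg[of "D t"] by simp
    qed
  qed
qed

end

lemma approaches_sandwich:
  assumes P: "approaches P R" and P': "approaches P P'"
    and c: "\<And>t. t\<^sub>0 \<le> t \<Longrightarrow> P t \<in> carrier_mat n n" "\<And>t. t\<^sub>0 \<le> t \<Longrightarrow> P' t \<in> carrier_mat n n"
      "\<And>t. t\<^sub>0 \<le> t \<Longrightarrow> R t \<in> carrier_mat n n"
  shows "approaches P' R"
  unfolding approaches_def
proof (rule tendsto_sandwich[OF _ _ tendsto_const])
  show "((\<lambda>t. mnorm (P t - R t) + mnorm (P t - P' t)) \<longlongrightarrow> 0) at_top"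
    using tendsto_add[OF P[unfolded approaches_def] P'[unfolded approaches_def]] by simp
  show "eventually (\<lambda>t. 0 \<le> mnorm (P' t - R t)) at_top" by (simp add: mnorm_nonneg)
  show "eventually (\<lambda>t. mnorm (P' t - R t) \<le> mnorm (P t - R t) + mnorm (P t - P' t)) at_top"
  proof (rule eventually_at_top_linorderI)
    fix t assume t: "t\<^sub>0 \<le> t"
    have d: "dim_row (P t) = n" "dim_col (P t) = n" "dim_row (P' t) = n" "dim_col (P' t) = n"
      "dim_row (R t) = n" "dim_col (R t) = n" using c[OF t] by auto
    show "mnorm (P' t - R t) \<le> mnorm (P t - R t) + mnorm (P t - P' t)"
    proof (rule mnorm_le)
      fix x :: "real vec" assume "x \<in> carrier_vec (dim_col (P' t - R t))"
      then have x: "dim_vec x = n" using d by simp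
      have "(P' t - R t) *\<^sub>v x = (P t - R t) *\<^sub>v x + (- 1) \<cdot>\<^sub>v ((P t - P' t) *\<^sub>v x)"
        using d x by (simp add: dim_minus_mult_vec) (rule eq_vecI, simp_all)
      then have "vnorm ((P' t - R t) *\<^sub>v x) \<le> vnorm ((P t - R t) *\<^sub>v x) + vnorm ((P t - P' t) *\<^sub>v x)"
        using vnorm_triangle[of "(P t - R t) *\<^sub>v x" "(- 1) \<cdot>\<^sub>v ((P t - P' t) *\<^sub>v x)"] d
        by (simp add: vnorm_smult)
      also have "\<dots> \<le> mnorm (P t - R t) * vnorm x + mnorm (P t - P' t) * vnorm x"
        using d x by (intro add_mono vnorm_mult_le_mnorm) simp_all
      finally show "vnorm ((P' t - R t) *\<^sub>v x) \<le> (mnorm (P t - R t) + mnorm (P t - P' t)) * vnorm x"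
        by (simp add: algebra_simps)
    qed (simp add: mnorm_nonneg)
  qed
qed

section \<open>Calculus of generalized processes\<close>

text \<open>A coefficient acts on test functions through its transpose.  Off the time interval only the
  number of columns matters, since test functions vanish there.\<close>

definition gcoef :: "real \<Rightarrow> (real \<Rightarrow> real mat) \<Rightarrow> nat \<Rightarrow> nat \<Rightarrow> bool" where
  "gcoef s F a b \<longleftrightarrow> mat_cont_on {s..} F a b \<and> (\<forall>t. dim_col (F t) = b)"

lemma gcoef_cont: "gcoef s F a b \<Longrightarrow> mat_cont_on {s..} F a b"
  by (simp add: gcoef_def)

lemma gcoef_carrier: "gcoef s F a b \<Longrightarrow> s \<le> t \<Longrightarrow> F t \<in> carrier_mat a b"
  unfolding gcoef_def by (auto intro: mat_cont_on_carrier)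

lemma gcoef_dim: "gcoef s F a b \<Longrightarrow> dim_col (F t) = b"
  by (simp add: gcoef_def)

lemma gcoef_mult: "gcoef s F a b \<Longrightarrow> gcoef s G b c \<Longrightarrow> gcoef s (\<lambda>t. F t * G t) a c"
  unfolding gcoef_def by (auto intro: mat_cont_on_mult)

lemma gcoef_add: "gcoef s F a b \<Longrightarrow> gcoef s G a b \<Longrightarrow> gcoef s (\<lambda>t. F t + G t) a b"
  unfolding gcoef_def by (auto intro: mat_cont_on_add)

lemma gcoef_minus: "gcoef s F a b \<Longrightarrow> gcoef s G a b \<Longrightarrow> gcoef s (\<lambda>t. F t - G t) a b"
  unfolding gcoef_def by (auto intro: mat_cont_on_minus)

lemma mcont_gcoef: "mcont {s..} F a b \<Longrightarrow> gcoef s F a b"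
  unfolding gcoef_def mcont_def mcarrier_def mat_cont_on_def by auto

lemma mcont_transpose_gcoef: "mcont {s..} F a b \<Longrightarrow> gcoef s (\<lambda>t. (F t)\<^sup>T) b a"
  using mat_cont_on_transpose[OF gcoef_cont[OF mcont_gcoef[of s F a b]]]
  unfolding gcoef_def by (auto simp: mcont_def mcarrier_def)

lemma mult_zero_vec: "A *\<^sub>v 0\<^sub>v k = (0\<^sub>v (dim_row A) :: real vec)"
  by (rule eq_vecI) (auto simp: scalar_prod_def)

lemma test_carrier: "\<phi> \<in> test s a \<Longrightarrow> \<phi> t \<in> carrier_vec a"
  by (simp add: test_def)

lemma test_before: "\<phi> \<in> test s a \<Longrightarrow> t < s \<Longrightarrow> \<phi> t = 0\<^sub>v a"
  by (auto simp: test_def)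

lemma test_cont: "\<phi> \<in> test s a \<Longrightarrow> vec_cont_on {s..} \<phi> a"
  by (auto simp: test_def vec_cont_on_def)

lemma test_mult:
  assumes F: "gcoef s F a b" and \<phi>: "\<phi> \<in> test s a"
  shows "(\<lambda>t. (F t)\<^sup>T *\<^sub>v \<phi> t) \<in> test s b"
  unfolding test_def
proof (intro CollectI conjI allI impI)
  fix t show "(F t)\<^sup>T *\<^sub>v \<phi> t \<in> carrier_vec b" by (rule carrier_vecI) (simp add: gcoef_dim[OF F])
next
  fix i assume "i < b"
  then show "continuous_on {s..} (\<lambda>t. ((F t)\<^sup>T *\<^sub>v \<phi> t) $ i)"
    using vec_cont_on_mult[OF mat_cont_on_transpose[OF gcoef_cont[OF F]] test_cont[OF \<phi>]]
    by (simp add: vec_cont_on_def)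
next
  obtain B where B: "\<And>t. t < s \<or> B < t \<Longrightarrow> \<phi> t = 0\<^sub>v a" using \<phi> by (auto simp: test_def)
  show "\<exists>B. \<forall>t. t < s \<or> B < t \<longrightarrow> (F t)\<^sup>T *\<^sub>v \<phi> t = 0\<^sub>v b"
    by (rule exI[of _ B]) (simp add: B mult_zero_vec gcoef_dim[OF F])
qed

lemma gp_eqD: "gp_eq M s a X Y \<Longrightarrow> \<phi> \<in> test s a \<Longrightarrow> AE \<omega> in M. X \<phi> \<omega> = Y \<phi> \<omega>"
  by (simp add: gp_eq_def)

lemma gp_eq_refl [simp]: "gp_eq M s a X X"
  by (simp add: gp_eq_def)

lemma gp_eq_sym: "gp_eq M s a X Y \<Longrightarrow> gp_eq M s a Y X"
  by (auto simp: gp_eq_def elim: eventually_mono)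

lemma gp_eq_trans [trans]:
  assumes "gp_eq M s a X Y" "gp_eq M s a Y Z"
  shows "gp_eq M s a X Z"
  unfolding gp_eq_def
proof
  fix \<phi> assume \<phi>: "\<phi> \<in> test s a"
  show "AE \<omega> in M. X \<phi> \<omega> = Z \<phi> \<omega>"
    using gp_eqD[OF assms(1) \<phi>] gp_eqD[OF assms(2) \<phi>] by eventually_elim simp
qed

lemma gp_eq_add:
  assumes "gp_eq M s a X X'" "gp_eq M s a Y Y'"
  shows "gp_eq M s a (X + Y) (X' + Y')"
  unfolding gp_eq_def
proof
  fix \<phi> assume \<phi>: "\<phi> \<in> test s a"
  show "AE \<omega> in M. (X + Y) \<phi> \<omega> = (X' + Y') \<phi> \<omega>"
    using gp_eqD[OF assms(1) \<phi>] gp_eqD[OF assms(2) \<phi>] by eventually_elim simp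
qed

lemma gp_eq_diff:
  assumes "gp_eq M s a X X'" "gp_eq M s a Y Y'"
  shows "gp_eq M s a (X - Y) (X' - Y')"
  unfolding gp_eq_def
proof
  fix \<phi> assume \<phi>: "\<phi> \<in> test s a"
  show "AE \<omega> in M. (X - Y) \<phi> \<omega> = (X' - Y') \<phi> \<omega>"
    using gp_eqD[OF assms(1) \<phi>] gp_eqD[OF assms(2) \<phi>] by eventually_elim simp
qed

text \<open>Equality of processes holds outside a null set that depends on the test function.  Since
  coefficients only change the test function, equality is a congruence for them.\<close>

lemma gp_eq_mult:
  assumes F: "gcoef s F a b" and X: "gp_eq M s b X Y"
  shows "gp_eq M s a (F *\<^sub>g X) (F *\<^sub>g Y)"
  unfolding gp_eq_def gp_mult_def using gp_eqD[OF X test_mult[OF F]] by blast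

lemma gp_mult_add: "F *\<^sub>g (X + Y) = F *\<^sub>g X + F *\<^sub>g Y"
  by (simp add: gp_mult_def fun_eq_iff)

lemma gp_mult_diff: "F *\<^sub>g (X - Y) = F *\<^sub>g X - F *\<^sub>g Y"
  by (simp add: gp_mult_def fun_eq_iff)

lemma gp_mult_cong:
  assumes F: "gcoef s F a b" and G: "\<And>t. s \<le> t \<Longrightarrow> F t = G t" "\<And>t. dim_col (G t) = b"
  shows "gp_eq M s a (F *\<^sub>g X) (G *\<^sub>g X)"
  unfolding gp_eq_def gp_mult_def
proof
  fix \<phi> assume \<phi>: "\<phi> \<in> test s a"
  have "(F t)\<^sup>T *\<^sub>v \<phi> t = (G t)\<^sup>T *\<^sub>v \<phi> t" for t
  proof (cases "s \<le> t")
    case False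
    then show ?thesis
      using test_before[OF \<phi>, of t] by (simp add: mult_zero_vec gcoef_dim[OF F] G(2))
  qed (simp add: G(1))
  then show "AE \<omega> in M. X (\<lambda>t. (F t)\<^sup>T *\<^sub>v \<phi> t) \<omega> = X (\<lambda>t. (G t)\<^sup>T *\<^sub>v \<phi> t) \<omega>" by simp
qed

lemma gp_mult_mult:
  assumes F: "gcoef s F a b" and G: "gcoef s G b c"
  shows "gp_eq M s a (F *\<^sub>g (G *\<^sub>g X)) ((\<lambda>t. F t * G t) *\<^sub>g X)"
  unfolding gp_eq_def gp_mult_def
proof
  fix \<phi> assume \<phi>: "\<phi> \<in> test s a"
  have "(G t)\<^sup>T *\<^sub>v ((F t)\<^sup>T *\<^sub>v \<phi> t) = (F t * G t)\<^sup>T *\<^sub>v \<phi> t" for t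
  proof (cases "s \<le> t")
    case True
    have "dim_row (F t) = a" "dim_col (F t) = b" "dim_row (G t) = b" "dim_vec (\<phi> t) = a"
      using gcoef_carrier[OF F True] gcoef_carrier[OF G True] test_carrier[OF \<phi>, of t] by auto
    then show ?thesis by (simp add: dim_transpose_mult dim_assoc_mult_vec)
  next
    case False
    then show ?thesis
      using test_before[OF \<phi>, of t] by (simp add: mult_zero_vec gcoef_dim[OF F] gcoef_dim[OF G])
  qed
  then show "AE \<omega> in M. X (\<lambda>t. (G t)\<^sup>T *\<^sub>v ((F t)\<^sup>T *\<^sub>v \<phi> t)) \<omega> = X (\<lambda>t. (F t * G t)\<^sup>T *\<^sub>v \<phi> t) \<omega>"
    by simp
qed

lemma gproc_linear:
  assumes "gproc M s a X" "\<phi> \<in> test s a" "\<psi> \<in> test s a"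
  shows "AE \<omega> in M. X (\<lambda>t. c \<cdot>\<^sub>v \<phi> t + d \<cdot>\<^sub>v \<psi> t) \<omega> = c * X \<phi> \<omega> + d * X \<psi> \<omega>"
  using assms by (simp add: gproc_def)

text \<open>Processes are linear in the test function only up to null sets, so linearity in the coefficient
  is not an equation between functions but a \<open>gp_eq\<close>.\<close>

lemma gp_coef_lincomb:
  assumes X: "gproc M s b X" and F: "gcoef s F a b" and G: "gcoef s G a b" and \<phi>: "\<phi> \<in> test s a"
    and H: "\<And>t. s \<le> t \<Longrightarrow> (H t)\<^sup>T *\<^sub>v \<phi> t = c \<cdot>\<^sub>v ((F t)\<^sup>T *\<^sub>v \<phi> t) + d \<cdot>\<^sub>v ((G t)\<^sup>T *\<^sub>v \<phi> t)"
      "\<And>t. dim_col (H t) = b"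
  shows "AE \<omega> in M. (H *\<^sub>g X) \<phi> \<omega> = c * (F *\<^sub>g X) \<phi> \<omega> + d * (G *\<^sub>g X) \<phi> \<omega>"
proof -
  have "(H t)\<^sup>T *\<^sub>v \<phi> t = c \<cdot>\<^sub>v ((F t)\<^sup>T *\<^sub>v \<phi> t) + d \<cdot>\<^sub>v ((G t)\<^sup>T *\<^sub>v \<phi> t)" for t
  proof (cases "s \<le> t")
    case False
    then show ?thesis
      using test_before[OF \<phi>, of t]
      by (simp add: mult_zero_vec gcoef_dim[OF F] gcoef_dim[OF G] H(2)) (rule eq_vecI, simp_all)
  qed (rule H(1))
  then show ?thesis
    using gproc_linear[OF X test_mult[OF F \<phi>] test_mult[OF G \<phi>], of c d] by (simp add: gp_mult_def)
qed

lemma gp_coef_add: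
  assumes X: "gproc M s b X" and F: "gcoef s F a b" and G: "gcoef s G a b"
  shows "gp_eq M s a ((\<lambda>t. F t + G t) *\<^sub>g X) (F *\<^sub>g X + G *\<^sub>g X)"
  unfolding gp_eq_def
proof
  fix \<phi> assume \<phi>: "\<phi> \<in> test s a"
  have "AE \<omega> in M. ((\<lambda>t. F t + G t) *\<^sub>g X) \<phi> \<omega> = 1 * (F *\<^sub>g X) \<phi> \<omega> + 1 * (G *\<^sub>g X) \<phi> \<omega>"
  proof (rule gp_coef_lincomb[OF X F G \<phi>])
    fix t assume t: "s \<le> t"
    have "dim_row (F t) = a" "dim_col (F t) = b" "dim_row (G t) = a" "dim_col (G t) = b" "dim_vec (\<phi> t) = a"
      using gcoef_carrier[OF F t] gcoef_carrier[OF G t] test_carrier[OF \<phi>, of t] by auto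
    then show "(F t + G t)\<^sup>T *\<^sub>v \<phi> t = 1 \<cdot>\<^sub>v ((F t)\<^sup>T *\<^sub>v \<phi> t) + 1 \<cdot>\<^sub>v ((G t)\<^sup>T *\<^sub>v \<phi> t)"
      by (simp add: dim_transpose_add dim_add_mult_vec)
  qed (simp add: gcoef_dim[OF G])
  then show "AE \<omega> in M. ((\<lambda>t. F t + G t) *\<^sub>g X) \<phi> \<omega> = (F *\<^sub>g X + G *\<^sub>g X) \<phi> \<omega>" by simp
qed

lemma gp_coef_diff:
  assumes X: "gproc M s b X" and F: "gcoef s F a b" and G: "gcoef s G a b"
  shows "gp_eq M s a ((\<lambda>t. F t - G t) *\<^sub>g X) (F *\<^sub>g X - G *\<^sub>g X)"
  unfolding gp_eq_def
proof
  fix \<phi> assume \<phi>: "\<phi> \<in> test s a"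
  have "AE \<omega> in M. ((\<lambda>t. F t - G t) *\<^sub>g X) \<phi> \<omega> = 1 * (F *\<^sub>g X) \<phi> \<omega> + (- 1) * (G *\<^sub>g X) \<phi> \<omega>"
  proof (rule gp_coef_lincomb[OF X F G \<phi>])
    fix t assume t: "s \<le> t"
    have d: "dim_row (F t) = a" "dim_col (F t) = b" "dim_row (G t) = a" "dim_col (G t) = b" "dim_vec (\<phi> t) = a"
      using gcoef_carrier[OF F t] gcoef_carrier[OF G t] test_carrier[OF \<phi>, of t] by auto
    show "(F t - G t)\<^sup>T *\<^sub>v \<phi> t = 1 \<cdot>\<^sub>v ((F t)\<^sup>T *\<^sub>v \<phi> t) + (- 1) \<cdot>\<^sub>v ((G t)\<^sup>T *\<^sub>v \<phi> t)"
      by (rule eq_vecI) (simp_all add: d dim_transpose_minus dim_minus_mult_vec)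
  qed (simp add: gcoef_dim[OF G])
  then show "AE \<omega> in M. ((\<lambda>t. F t - G t) *\<^sub>g X) \<phi> \<omega> = (F *\<^sub>g X - G *\<^sub>g X) \<phi> \<omega>" by simp
qed

lemma gp_coef_zero:
  assumes X: "gproc M s b X" and F: "gcoef s F a b" and z: "\<And>t. s \<le> t \<Longrightarrow> F t = 0\<^sub>m a b"
  shows "gp_eq M s a (F *\<^sub>g X) 0"
  unfolding gp_eq_def
proof
  fix \<phi> assume \<phi>: "\<phi> \<in> test s a"
  have "AE \<omega> in M. (F *\<^sub>g X) \<phi> \<omega> = 0 * (F *\<^sub>g X) \<phi> \<omega> + 0 * (F *\<^sub>g X) \<phi> \<omega>"
  proof (rule gp_coef_lincomb[OF X F F \<phi>])
    fix t assume t: "s \<le> t"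
    have "dim_vec (\<phi> t) = a" using test_carrier[OF \<phi>, of t] by auto
    then have "(F t)\<^sup>T *\<^sub>v \<phi> t = 0\<^sub>v b"
      unfolding z[OF t] by (intro eq_vecI) (auto simp: scalar_prod_def)
    then show "(F t)\<^sup>T *\<^sub>v \<phi> t = 0 \<cdot>\<^sub>v ((F t)\<^sup>T *\<^sub>v \<phi> t) + 0 \<cdot>\<^sub>v ((F t)\<^sup>T *\<^sub>v \<phi> t)"
      by simp (rule eq_vecI, simp_all)
  qed (simp add: gcoef_dim[OF F])
  then show "AE \<omega> in M. (F *\<^sub>g X) \<phi> \<omega> = (0 :: 'a gproc) \<phi> \<omega>" by simp
qed

lemma gp_mult_mult_cong:
  assumes F: "gcoef s F a b" and G: "gcoef s G b c"
    and H: "\<And>t. s \<le> t \<Longrightarrow> F t * G t = H t" "\<And>t. dim_col (H t) = c"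
  shows "gp_eq M s a (F *\<^sub>g (G *\<^sub>g X)) (H *\<^sub>g X)"
  by (rule gp_eq_trans[OF gp_mult_mult[OF F G] gp_mult_cong[OF gcoef_mult[OF F G] H]])

lemma gp_coef_add_cong:
  assumes X: "gproc M s b X" and F: "gcoef s F a b" and G: "gcoef s G a b"
    and H: "\<And>t. s \<le> t \<Longrightarrow> F t + G t = H t" "\<And>t. dim_col (H t) = b"
  shows "gp_eq M s a (H *\<^sub>g X) (F *\<^sub>g X + G *\<^sub>g X)"
  by (rule gp_eq_trans[OF gp_eq_sym[OF gp_mult_cong[OF gcoef_add[OF F G] H]] gp_coef_add[OF X F G]])

lemma gp_coef_diff_cong:
  assumes X: "gproc M s b X" and F: "gcoef s F a b" and G: "gcoef s G a b"
    and H: "\<And>t. s \<le> t \<Longrightarrow> F t - G t = H t" "\<And>t. dim_col (H t) = b"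
  shows "gp_eq M s a (H *\<^sub>g X) (F *\<^sub>g X - G *\<^sub>g X)"
  by (rule gp_eq_trans[OF gp_eq_sym[OF gp_mult_cong[OF gcoef_minus[OF F G] H]] gp_coef_diff[OF X F G]])

lemma gproc_mult:
  assumes F: "gcoef s F a b" and X: "gproc M s b X"
  shows "gproc M s a (F *\<^sub>g X)"
  unfolding gproc_def
proof (intro conjI ballI allI)
  fix \<phi> assume "\<phi> \<in> test s a"
  from test_mult[OF F this] show "(F *\<^sub>g X) \<phi> \<in> borel_measurable M"
    using X unfolding gproc_def gp_mult_def by blast
next
  fix \<phi> \<psi> c d assume \<phi>: "\<phi> \<in> test s a" and \<psi>: "\<psi> \<in> test s a"
  have "(F t)\<^sup>T *\<^sub>v (c \<cdot>\<^sub>v \<phi> t + d \<cdot>\<^sub>v \<psi> t) = c \<cdot>\<^sub>v ((F t)\<^sup>T *\<^sub>v \<phi> t) + d \<cdot>\<^sub>v ((F t)\<^sup>T *\<^sub>v \<psi> t)" for t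
  proof (cases "s \<le> t")
    case True
    have "dim_row (F t) = a" "dim_vec (\<phi> t) = a" "dim_vec (\<psi> t) = a"
      using gcoef_carrier[OF F True] test_carrier[OF \<phi>, of t] test_carrier[OF \<psi>, of t] by auto
    then show ?thesis by (simp add: dim_mult_vec_add dim_mult_vec_smult)
  next
    case False
    have z: "c \<cdot>\<^sub>v 0\<^sub>v k + d \<cdot>\<^sub>v 0\<^sub>v k = (0\<^sub>v k :: real vec)" for k by (rule eq_vecI) simp_all
    show ?thesis
      using False test_before[OF \<phi>, of t] test_before[OF \<psi>, of t] by (simp add: mult_zero_vec z)
  qed
  then show "AE \<omega> in M. (F *\<^sub>g X) (\<lambda>t. c \<cdot>\<^sub>v \<phi> t + d \<cdot>\<^sub>v \<psi> t) \<omega> = c * (F *\<^sub>g X) \<phi> \<omega> + d * (F *\<^sub>g X) \<psi> \<omega>"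
    using gproc_linear[OF X test_mult[OF F \<phi>] test_mult[OF F \<psi>], of c d] by (simp add: gp_mult_def)
qed

lemma gproc_diff:
  assumes X: "gproc M s a X" and Y: "gproc M s a Y"
  shows "gproc M s a (X - Y)"
  unfolding gproc_def
proof (intro conjI ballI allI)
  fix \<phi> assume "\<phi> \<in> test s a"
  then show "(X - Y) \<phi> \<in> borel_measurable M"
    using X Y unfolding fun_diff_def by (intro borel_measurable_diff) (simp_all add: gproc_def)
next
  fix \<phi> \<psi> c d assume t: "\<phi> \<in> test s a" "\<psi> \<in> test s a"
  show "AE \<omega> in M. (X - Y) (\<lambda>t. c \<cdot>\<^sub>v \<phi> t + d \<cdot>\<^sub>v \<psi> t) \<omega> = c * (X - Y) \<phi> \<omega> + d * (X - Y) \<psi> \<omega>"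
    using gproc_linear[OF X t, of c d] gproc_linear[OF Y t, of c d]
    by eventually_elim (simp add: algebra_simps)
qed

lemma gp_deriv_diff:
  assumes X: "gp_deriv M s a X x DX" and Y: "gp_deriv M s a Y y DY"
    and x: "random_vec M a x" and y: "random_vec M a y"
    and D: "gp_eq M s a (DX - DY) D"
  shows "gp_deriv M s a (X - Y) (\<lambda>\<omega>. x \<omega> - y \<omega>) D"
  unfolding gp_deriv_def
proof (intro ballI impI)
  fix \<phi> \<phi>' assume t: "\<phi> \<in> test s a" "\<phi>' \<in> test s a"
    and d: "\<forall>i<a. \<forall>t\<ge>s. ((\<lambda>s. \<phi> s $ i) has_real_derivative \<phi>' t $ i) (at t within {s..})"
  have "AE \<omega> in M. DX \<phi> \<omega> = - X \<phi>' \<omega> - x \<omega> \<bullet> \<phi> s" "AE \<omega> in M. DY \<phi> \<omega> = - Y \<phi>' \<omega> - y \<omega> \<bullet> \<phi> s"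
    using X Y t d unfolding gp_deriv_def by blast+
  then show "AE \<omega> in M. D \<phi> \<omega> = - (X - Y) \<phi>' \<omega> - (x \<omega> - y \<omega>) \<bullet> \<phi> s"
    using gp_eqD[OF D t(1)]
  proof eventually_elim
    case (elim \<omega>)
    have "dim_vec (x \<omega>) = a" "dim_vec (y \<omega>) = a" "dim_vec (\<phi> s) = a"
      using x y test_carrier[OF t(1), of s] by (auto simp: random_vec_def)
    then show ?case using elim by (simp add: sp_minus_left)
  qed
qed

section \<open>White-noise covariances\<close>

text \<open>The integral over the half line that defines a covariance exists because test functions have
  compact support.  The continuity of \<open>K\<close> that this takes is what the rules below carry along.\<close>

lemma form_integrable:
  assumes K: "mat_cont_on {s..} K a b" and \<phi>: "\<phi> \<in> test s a" and \<psi>: "\<psi> \<in> test s b"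
  shows "(\<lambda>t. \<phi> t \<bullet> (K t *\<^sub>v \<psi> t)) integrable_on {s..}"
proof -
  let ?f = "\<lambda>t. \<phi> t \<bullet> (K t *\<^sub>v \<psi> t)"
  obtain B where B: "\<And>t. B < t \<Longrightarrow> \<phi> t = 0\<^sub>v a" using \<phi> by (auto simp: test_def)
  have "continuous_on {s..} ?f"
    by (rule continuous_on_scalar_prod[OF test_cont[OF \<phi>] vec_cont_on_mult[OF K test_cont[OF \<psi>]]])
  then have "continuous_on {s..B} ?f" by (rule continuous_on_subset) auto
  then have i: "?f integrable_on {s..B}" by (rule integrable_continuous_real)
  have "(\<lambda>t. if t \<in> {s..B} then ?f t else 0) integrable_on {s..}"
    by (rule integrable_on_superset[where S = "{s..B}"]) (auto intro: integrable_eq[OF i])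
  then show ?thesis
  proof (rule integrable_eq)
    fix t assume t: "t \<in> {s..}"
    show "(if t \<in> {s..B} then ?f t else 0) = ?f t"
    proof (cases "t \<le> B")
      case False
      have "K t *\<^sub>v \<psi> t \<in> carrier_vec a"
        by (rule mult_mat_vec_carrier[OF mat_cont_on_carrier[OF K t] test_carrier[OF \<psi>]])
      then show ?thesis using False B[of t] by simp
    qed (use t in simp)
  qed
qed

lemma delta_cov_cong:
  assumes "delta_cov M s a b X Y K" "\<And>t. s \<le> t \<Longrightarrow> K t = K' t"
  shows "delta_cov M s a b X Y K'"
proof -
  have "integral {s..} (\<lambda>t. \<phi> t \<bullet> (K t *\<^sub>v \<psi> t)) = integral {s..} (\<lambda>t. \<phi> t \<bullet> (K' t *\<^sub>v \<psi> t))" for \<phi> \<psi>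
    by (rule integral_cong) (simp add: assms(2))
  then show ?thesis using assms(1) by (simp add: delta_cov_def)
qed

lemma delta_cov_swap:
  assumes K: "delta_cov M s a b X Y K" and Kc: "mat_cont_on {s..} K a b"
  shows "delta_cov M s b a Y X (\<lambda>t. (K t)\<^sup>T)"
  unfolding delta_cov_def
proof (intro ballI)
  fix \<phi> \<psi> assume \<phi>: "\<phi> \<in> test s b" and \<psi>: "\<psi> \<in> test s a"
  have "integral {s..} (\<lambda>t. \<psi> t \<bullet> (K t *\<^sub>v \<phi> t)) = integral {s..} (\<lambda>t. \<phi> t \<bullet> ((K t)\<^sup>T *\<^sub>v \<psi> t))"
  proof (rule integral_cong)
    fix t assume t: "t \<in> {s..}"
    have "dim_row (K t) = a" "dim_col (K t) = b" "dim_vec (\<phi> t) = b" "dim_vec (\<psi> t) = a"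
      using mat_cont_on_carrier[OF Kc t] test_carrier[OF \<phi>, of t] test_carrier[OF \<psi>, of t] by auto
    then show "\<psi> t \<bullet> (K t *\<^sub>v \<phi> t) = \<phi> t \<bullet> ((K t)\<^sup>T *\<^sub>v \<psi> t)"
      using sp_comm[of "\<phi> t" "(K t)\<^sup>T *\<^sub>v \<psi> t"] by (simp add: sp_transpose)
  qed
  then show "integrable M (\<lambda>\<omega>. Y \<phi> \<omega> * X \<psi> \<omega>) \<and>
      (\<integral>\<omega>. Y \<phi> \<omega> * X \<psi> \<omega> \<partial>M) = integral {s..} (\<lambda>t. \<phi> t \<bullet> ((K t)\<^sup>T *\<^sub>v \<psi> t))"
    using K \<phi> \<psi> by (simp add: delta_cov_def mult.commute)
qed

lemma delta_cov_mult_left: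
  assumes K: "delta_cov M s a b X Y K" and Kc: "mat_cont_on {s..} K a b" and F: "gcoef s F a' a"
  shows "delta_cov M s a' b (F *\<^sub>g X) Y (\<lambda>t. F t * K t)"
  unfolding delta_cov_def
proof (intro ballI)
  fix \<phi> \<psi> assume \<phi>: "\<phi> \<in> test s a'" and \<psi>: "\<psi> \<in> test s b"
  note K' = K[unfolded delta_cov_def, rule_format, OF test_mult[OF F \<phi>] \<psi>]
  have "integral {s..} (\<lambda>t. ((F t)\<^sup>T *\<^sub>v \<phi> t) \<bullet> (K t *\<^sub>v \<psi> t)) = integral {s..} (\<lambda>t. \<phi> t \<bullet> (F t * K t *\<^sub>v \<psi> t))"
  proof (rule integral_cong)
    fix t assume t: "t \<in> {s..}"
    then have t': "s \<le> t" by simp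
    have "dim_row (F t) = a'" "dim_col (F t) = a" "dim_row (K t) = a" "dim_col (K t) = b"
      "dim_vec (\<phi> t) = a'" "dim_vec (\<psi> t) = b"
      using gcoef_carrier[OF F t'] mat_cont_on_carrier[OF Kc t] test_carrier[OF \<phi>, of t]
        test_carrier[OF \<psi>, of t] by auto
    then show "((F t)\<^sup>T *\<^sub>v \<phi> t) \<bullet> (K t *\<^sub>v \<psi> t) = \<phi> t \<bullet> (F t * K t *\<^sub>v \<psi> t)"
      by (simp add: sp_transpose dim_assoc_mult_vec)
  qed
  then show "integrable M (\<lambda>\<omega>. (F *\<^sub>g X) \<phi> \<omega> * Y \<psi> \<omega>) \<and>
      (\<integral>\<omega>. (F *\<^sub>g X) \<phi> \<omega> * Y \<psi> \<omega> \<partial>M) = integral {s..} (\<lambda>t. \<phi> t \<bullet> (F t * K t *\<^sub>v \<psi> t))"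
    using K' by (simp add: gp_mult_def)
qed

lemma delta_cov_mult_right:
  assumes K: "delta_cov M s a b X Y K" and Kc: "mat_cont_on {s..} K a b" and G: "gcoef s G b' b"
  shows "delta_cov M s a b' X (G *\<^sub>g Y) (\<lambda>t. K t * (G t)\<^sup>T)"
proof (rule delta_cov_cong)
  note KT = mat_cont_on_transpose[OF Kc]
  show "delta_cov M s a b' X (G *\<^sub>g Y) (\<lambda>t. (G t * (K t)\<^sup>T)\<^sup>T)"
    by (rule delta_cov_swap[OF delta_cov_mult_left[OF delta_cov_swap[OF K Kc] KT G]
          mat_cont_on_mult[OF gcoef_cont[OF G] KT]])
  fix t assume t: "s \<le> t"
  have "dim_row (G t) = b'" "dim_col (G t) = b" "dim_row (K t) = a" "dim_col (K t) = b"
    using gcoef_carrier[OF G t] mat_cont_on_carrier[OF Kc, of t] t by auto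
  then show "(G t * (K t)\<^sup>T)\<^sup>T = K t * (G t)\<^sup>T" by (simp add: dim_transpose_mult)
qed

lemma delta_cov_add_left:
  assumes K1: "delta_cov M s a b X Z K1" and K2: "delta_cov M s a b Y Z K2"
    and c1: "mat_cont_on {s..} K1 a b" and c2: "mat_cont_on {s..} K2 a b"
  shows "delta_cov M s a b (X + Y) Z (\<lambda>t. K1 t + K2 t)"
  unfolding delta_cov_def
proof (intro ballI)
  fix \<phi> \<psi> assume \<phi>: "\<phi> \<in> test s a" and \<psi>: "\<psi> \<in> test s b"
  note k1 = K1[unfolded delta_cov_def, rule_format, OF \<phi> \<psi>]
    and k2 = K2[unfolded delta_cov_def, rule_format, OF \<phi> \<psi>]
  have "integral {s..} (\<lambda>t. \<phi> t \<bullet> ((K1 t + K2 t) *\<^sub>v \<psi> t))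
      = integral {s..} (\<lambda>t. \<phi> t \<bullet> (K1 t *\<^sub>v \<psi> t) + \<phi> t \<bullet> (K2 t *\<^sub>v \<psi> t))"
  proof (rule integral_cong)
    fix t assume t: "t \<in> {s..}"
    have "dim_row (K1 t) = a" "dim_col (K1 t) = b" "dim_row (K2 t) = a" "dim_col (K2 t) = b"
      "dim_vec (\<phi> t) = a" "dim_vec (\<psi> t) = b"
      using mat_cont_on_carrier[OF c1 t] mat_cont_on_carrier[OF c2 t] test_carrier[OF \<phi>, of t]
        test_carrier[OF \<psi>, of t] by auto
    then show "\<phi> t \<bullet> ((K1 t + K2 t) *\<^sub>v \<psi> t) = \<phi> t \<bullet> (K1 t *\<^sub>v \<psi> t) + \<phi> t \<bullet> (K2 t *\<^sub>v \<psi> t)"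
      by (simp add: dim_add_mult_vec sp_add_right)
  qed
  also have "\<dots> = integral {s..} (\<lambda>t. \<phi> t \<bullet> (K1 t *\<^sub>v \<psi> t)) + integral {s..} (\<lambda>t. \<phi> t \<bullet> (K2 t *\<^sub>v \<psi> t))"
    by (rule Henstock_Kurzweil_Integration.integral_add[OF form_integrable[OF c1 \<phi> \<psi>] form_integrable[OF c2 \<phi> \<psi>]])
  finally have e: "integral {s..} (\<lambda>t. \<phi> t \<bullet> ((K1 t + K2 t) *\<^sub>v \<psi> t)) = \<dots>" .
  show "integrable M (\<lambda>\<omega>. (X + Y) \<phi> \<omega> * Z \<psi> \<omega>) \<and>
      (\<integral>\<omega>. (X + Y) \<phi> \<omega> * Z \<psi> \<omega> \<partial>M) = integral {s..} (\<lambda>t. \<phi> t \<bullet> ((K1 t + K2 t) *\<^sub>v \<psi> t))"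
    unfolding e using k1 k2 by (simp add: distrib_right)
qed

lemma delta_cov_diff_left:
  assumes K1: "delta_cov M s a b X Z K1" and K2: "delta_cov M s a b Y Z K2"
    and c1: "mat_cont_on {s..} K1 a b" and c2: "mat_cont_on {s..} K2 a b"
  shows "delta_cov M s a b (X - Y) Z (\<lambda>t. K1 t - K2 t)"
  unfolding delta_cov_def
proof (intro ballI)
  fix \<phi> \<psi> assume \<phi>: "\<phi> \<in> test s a" and \<psi>: "\<psi> \<in> test s b"
  note k1 = K1[unfolded delta_cov_def, rule_format, OF \<phi> \<psi>]
    and k2 = K2[unfolded delta_cov_def, rule_format, OF \<phi> \<psi>]
  have "integral {s..} (\<lambda>t. \<phi> t \<bullet> ((K1 t - K2 t) *\<^sub>v \<psi> t))
      = integral {s..} (\<lambda>t. \<phi> t \<bullet> (K1 t *\<^sub>v \<psi> t) - \<phi> t \<bullet> (K2 t *\<^sub>v \<psi> t))"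
  proof (rule integral_cong)
    fix t assume t: "t \<in> {s..}"
    have "dim_row (K1 t) = a" "dim_col (K1 t) = b" "dim_row (K2 t) = a" "dim_col (K2 t) = b"
      "dim_vec (\<phi> t) = a" "dim_vec (\<psi> t) = b"
      using mat_cont_on_carrier[OF c1 t] mat_cont_on_carrier[OF c2 t] test_carrier[OF \<phi>, of t]
        test_carrier[OF \<psi>, of t] by auto
    then show "\<phi> t \<bullet> ((K1 t - K2 t) *\<^sub>v \<psi> t) = \<phi> t \<bullet> (K1 t *\<^sub>v \<psi> t) - \<phi> t \<bullet> (K2 t *\<^sub>v \<psi> t)"
      by (simp add: dim_minus_mult_vec sp_minus_right)
  qed
  also have "\<dots> = integral {s..} (\<lambda>t. \<phi> t \<bullet> (K1 t *\<^sub>v \<psi> t)) - integral {s..} (\<lambda>t. \<phi> t \<bullet> (K2 t *\<^sub>v \<psi> t))"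
    by (rule Henstock_Kurzweil_Integration.integral_diff[OF form_integrable[OF c1 \<phi> \<psi>] form_integrable[OF c2 \<phi> \<psi>]])
  finally have e: "integral {s..} (\<lambda>t. \<phi> t \<bullet> ((K1 t - K2 t) *\<^sub>v \<psi> t)) = \<dots>" .
  show "integrable M (\<lambda>\<omega>. (X - Y) \<phi> \<omega> * Z \<psi> \<omega>) \<and>
      (\<integral>\<omega>. (X - Y) \<phi> \<omega> * Z \<psi> \<omega> \<partial>M) = integral {s..} (\<lambda>t. \<phi> t \<bullet> ((K1 t - K2 t) *\<^sub>v \<psi> t))"
    unfolding e using k1 k2 by (simp add: left_diff_distrib)
qed

section \<open>Blocks of a singular value decomposition\<close>

lemma four_block_mat_inject:
  assumes "A \<in> carrier_mat m k" "B \<in> carrier_mat m l" "C \<in> carrier_mat m' k" "D \<in> carrier_mat m' l"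
    and "A' \<in> carrier_mat m k" "B' \<in> carrier_mat m l" "C' \<in> carrier_mat m' k" "D' \<in> carrier_mat m' l"
    and e: "four_block_mat A B C D = four_block_mat A' B' C' D'"
  shows "A = A'" "B = B'" "C = C'" "D = D'"
proof -
  have dims: "dim_row A = m" "dim_col A = k" "dim_row B = m" "dim_col B = l" "dim_row C = m'" "dim_col C = k"
    "dim_row D = m'" "dim_col D = l" "dim_row A' = m" "dim_col A' = k" "dim_row B' = m" "dim_col B' = l"
    "dim_row C' = m'" "dim_col C' = k" "dim_row D' = m'" "dim_col D' = l"
    using assms by auto
  have i: "four_block_mat A B C D $$ (i, j) = four_block_mat A' B' C' D' $$ (i, j)" for i j by (simp add: e)
  show "A = A'"
  proof (rule eq_matI)
    fix i j assume "i < dim_row A'" "j < dim_col A'"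
    then show "A $$ (i, j) = A' $$ (i, j)" using i[of i j] by (simp add: dims)
  qed (simp_all add: dims)
  show "B = B'"
  proof (rule eq_matI)
    fix i j assume "i < dim_row B'" "j < dim_col B'"
    then show "B $$ (i, j) = B' $$ (i, j)" using i[of i "k + j"] by (simp add: dims)
  qed (simp_all add: dims)
  show "C = C'"
  proof (rule eq_matI)
    fix i j assume "i < dim_row C'" "j < dim_col C'"
    then show "C $$ (i, j) = C' $$ (i, j)" using i[of "m + i" j] by (simp add: dims)
  qed (simp_all add: dims)
  show "D = D'"
  proof (rule eq_matI)
    fix i j assume "i < dim_row D'" "j < dim_col D'"
    then show "D $$ (i, j) = D' $$ (i, j)" using i[of "m + i" "k + j"] by (simp add: dims)
  qed (simp_all add: dims)
qed

lemma four_block_mat_degenerate: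
  assumes "A \<in> carrier_mat m k" "B \<in> carrier_mat m 0" "C \<in> carrier_mat 0 k" "D \<in> carrier_mat 0 0"
  shows "four_block_mat A B C D = A"
proof -
  have dims: "dim_row A = m" "dim_col A = k" "dim_row D = 0" "dim_col D = 0" using assms by auto
  show ?thesis by (rule eq_matI) (simp_all add: dims)
qed

text \<open>\<open>U\<^sup>T U = 1\<close> and \<open>U U\<^sup>T = 1\<close> for \<open>U = [A B]\<close>, read block by block.\<close>

lemma hcat_orthogonal_blocks:
  assumes A: "A \<in> carrier_mat m k" and B: "B \<in> carrier_mat m (m - k)" and k: "k \<le> m"
    and o: "orthogonal_square m (hcat A B)"
  shows "A\<^sup>T * A = 1\<^sub>m k" "A\<^sup>T * B = 0\<^sub>m k (m - k)" "B\<^sup>T * A = 0\<^sub>m (m - k) k" "B\<^sup>T * B = 1\<^sub>m (m - k)"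
    "A * A\<^sup>T + B * B\<^sup>T = 1\<^sub>m m"
proof -
  let ?l = "m - k"
  have dims: "dim_row A = m" "dim_col A = k" "dim_row B = m" "dim_col B = ?l" using A B by auto
  have h: "hcat A B = four_block_mat A B (0\<^sub>m 0 k) (0\<^sub>m 0 ?l)" by (simp add: hcat_def dims)
  have hT: "(hcat A B)\<^sup>T = four_block_mat A\<^sup>T (0\<^sub>m k 0) B\<^sup>T (0\<^sub>m ?l 0)"
    unfolding h by (subst transpose_four_block_mat[OF A B zero_carrier_mat zero_carrier_mat]) simp_all
  have AT: "A\<^sup>T \<in> carrier_mat k m" "B\<^sup>T \<in> carrier_mat ?l m" using A B by simp_all
  have "(hcat A B)\<^sup>T * hcat A B = four_block_mat (A\<^sup>T * A + 0\<^sub>m k 0 * 0\<^sub>m 0 k) (A\<^sup>T * B + 0\<^sub>m k 0 * 0\<^sub>m 0 ?l)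
      (B\<^sup>T * A + 0\<^sub>m ?l 0 * 0\<^sub>m 0 k) (B\<^sup>T * B + 0\<^sub>m ?l 0 * 0\<^sub>m 0 ?l)"
    unfolding h hT[unfolded h]
    by (rule mult_four_block_mat[OF AT(1) zero_carrier_mat AT(2) zero_carrier_mat A B zero_carrier_mat zero_carrier_mat])
  also have "\<dots> = four_block_mat (A\<^sup>T * A) (A\<^sup>T * B) (B\<^sup>T * A) (B\<^sup>T * B)"
    using dims by (simp add: dim_zero_mult dim_add_zero)
  finally have "four_block_mat (A\<^sup>T * A) (A\<^sup>T * B) (B\<^sup>T * A) (B\<^sup>T * B) = 1\<^sub>m (k + ?l)"
    using o k by (simp add: orthogonal_square_def)
  also have "\<dots> = four_block_mat (1\<^sub>m k) (0\<^sub>m k ?l) (0\<^sub>m ?l k) (1\<^sub>m ?l)" by simp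
  finally have e: "four_block_mat (A\<^sup>T * A) (A\<^sup>T * B) (B\<^sup>T * A) (B\<^sup>T * B)
      = four_block_mat (1\<^sub>m k) (0\<^sub>m k ?l) (0\<^sub>m ?l k) (1\<^sub>m ?l)" .
  have c: "A\<^sup>T * A \<in> carrier_mat k k" "A\<^sup>T * B \<in> carrier_mat k ?l" "B\<^sup>T * A \<in> carrier_mat ?l k" "B\<^sup>T * B \<in> carrier_mat ?l ?l"
    using A B AT by (auto intro: mult_carrier_mat)
  show "A\<^sup>T * A = 1\<^sub>m k" "A\<^sup>T * B = 0\<^sub>m k ?l" "B\<^sup>T * A = 0\<^sub>m ?l k" "B\<^sup>T * B = 1\<^sub>m ?l"
    by (rule four_block_mat_inject[OF c _ _ _ _ e]; simp)+
  have "hcat A B * (hcat A B)\<^sup>T = four_block_mat (A * A\<^sup>T + B * B\<^sup>T) (A * 0\<^sub>m k 0 + B * 0\<^sub>m ?l 0)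
      (0\<^sub>m 0 k * A\<^sup>T + 0\<^sub>m 0 ?l * B\<^sup>T) (0\<^sub>m 0 k * 0\<^sub>m k 0 + 0\<^sub>m 0 ?l * 0\<^sub>m ?l 0)"
    unfolding hT unfolding h
    by (rule mult_four_block_mat[OF A B zero_carrier_mat zero_carrier_mat AT(1) zero_carrier_mat AT(2) zero_carrier_mat])
  also have "\<dots> = A * A\<^sup>T + B * B\<^sup>T"
    by (rule four_block_mat_degenerate[of _ m m]) (use A B AT in auto)
  finally show "A * A\<^sup>T + B * B\<^sup>T = 1\<^sub>m m" using o by (simp add: orthogonal_square_def)
qed

lemma positive_diagonal_pd:
  assumes S: "S \<in> carrier_mat r r" and d: "diagonal_mat S" and p: "\<And>i. i < r \<Longrightarrow> 0 < S $$ (i, i)"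
  shows "pd r S"
  unfolding pd_def
proof (intro conjI ballI impI)
  have off: "S $$ (i, j) = 0" if "i < r" "j < r" "i \<noteq> j" for i j
    using d S that by (auto simp: diagonal_mat_def)
  show "S \<in> carrier_mat r r" by fact
  show "S\<^sup>T = S"
  proof (rule eq_matI)
    fix i j assume "i < dim_row S" "j < dim_col S"
    then have "i < r" "j < r" using S by auto
    then show "S\<^sup>T $$ (i, j) = S $$ (i, j)" using S off[of i j] off[of j i] by (cases "i = j") auto
  qed (use S in auto)
  fix x :: "real vec" assume x: "x \<in> carrier_vec r" "x \<noteq> 0\<^sub>v r"
  have "(S *\<^sub>v x) $ i = S $$ (i, i) * x $ i" if i: "i < r" for i
  proof -
    have "(S *\<^sub>v x) $ i = (\<Sum>j\<in>{0..<r}. S $$ (i, j) * x $ j)" using S x i by (simp add: scalar_prod_def)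
    also have "\<dots> = (\<Sum>j\<in>{0..<r}. if j = i then S $$ (i, i) * x $ i else 0)"
      by (rule sum.cong) (use off i in auto)
    finally show ?thesis using i by simp
  qed
  then have e: "x \<bullet> (S *\<^sub>v x) = (\<Sum>i\<in>{0..<r}. S $$ (i, i) * (x $ i)\<^sup>2)"
    using S x unfolding scalar_prod_def by (intro sum.cong) (auto simp: power2_eq_square)
  obtain i where i: "i < r" "x $ i \<noteq> 0"
    using x by (metis carrier_vecD eq_vecI index_zero_vec(1) index_zero_vec(2))
  have "0 < S $$ (i, i) * (x $ i)\<^sup>2" using p[OF i(1)] i(2) by simp
  also have "\<dots> \<le> (\<Sum>i\<in>{0..<r}. S $$ (i, i) * (x $ i)\<^sup>2)"
  proof (rule member_le_sum[of i "{0..<r}" "\<lambda>i. S $$ (i, i) * (x $ i)\<^sup>2"])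
    fix j assume "j \<in> {0..<r} - {i}"
    then have "0 < S $$ (j, j)" using p by simp
    then show "0 \<le> S $$ (j, j) * (x $ j)\<^sup>2" by simp
  qed (use i in simp_all)
  finally show "0 < x \<bullet> (S *\<^sub>v x)" by (simp add: e)
qed

lemma svd_product:
  assumes svd: "is_svd a b r N Ua Ub S Va Vb"
  shows "N = Ua * S * Va\<^sup>T"
proof -
  note s = svd[unfolded is_svd_def]
  have c: "Ua \<in> carrier_mat a r" "Ub \<in> carrier_mat a (a - r)" "S \<in> carrier_mat r r"
    "Va \<in> carrier_mat b r" "Vb \<in> carrier_mat b (b - r)" using s by auto
  have dims: "dim_row Ua = a" "dim_col Ua = r" "dim_row Ub = a" "dim_col Ub = a - r" "dim_row S = r" "dim_col S = r"
    "dim_row Va = b" "dim_col Va = r" "dim_row Vb = b" "dim_col Vb = b - r" using c by auto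
  have hT: "(hcat Va Vb)\<^sup>T = four_block_mat Va\<^sup>T (0\<^sub>m r 0) Vb\<^sup>T (0\<^sub>m (b - r) 0)"
    unfolding hcat_def dims by (subst transpose_four_block_mat[OF c(4,5) zero_carrier_mat zero_carrier_mat]) simp_all
  have "hcat Ua Ub * four_block_mat S (0\<^sub>m r (b - r)) (0\<^sub>m (a - r) r) (0\<^sub>m (a - r) (b - r))
      = four_block_mat (Ua * S + Ub * 0\<^sub>m (a - r) r) (Ua * 0\<^sub>m r (b - r) + Ub * 0\<^sub>m (a - r) (b - r))
        (0\<^sub>m 0 r * S + 0\<^sub>m 0 (a - r) * 0\<^sub>m (a - r) r) (0\<^sub>m 0 r * 0\<^sub>m r (b - r) + 0\<^sub>m 0 (a - r) * 0\<^sub>m (a - r) (b - r))"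
    unfolding hcat_def dims by (rule mult_four_block_mat[OF c(1,2) zero_carrier_mat zero_carrier_mat c(3) zero_carrier_mat zero_carrier_mat zero_carrier_mat])
  also have "\<dots> = four_block_mat (Ua * S) (0\<^sub>m a (b - r)) (0\<^sub>m 0 r) (0\<^sub>m 0 (b - r))"
    using dims by (simp add: dim_zero_mult dim_mult_zero dim_add_zero)
  finally have 1: "hcat Ua Ub * four_block_mat S (0\<^sub>m r (b - r)) (0\<^sub>m (a - r) r) (0\<^sub>m (a - r) (b - r)) = \<dots>" .
  have US: "Ua * S \<in> carrier_mat a r" using c by auto
  have VT: "Va\<^sup>T \<in> carrier_mat r b" "Vb\<^sup>T \<in> carrier_mat (b - r) b" using c by auto
  have "N = four_block_mat (Ua * S) (0\<^sub>m a (b - r)) (0\<^sub>m 0 r) (0\<^sub>m 0 (b - r))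
      * four_block_mat Va\<^sup>T (0\<^sub>m r 0) Vb\<^sup>T (0\<^sub>m (b - r) 0)"
    using s 1 hT by simp
  also have "\<dots> = four_block_mat (Ua * S * Va\<^sup>T + 0\<^sub>m a (b - r) * Vb\<^sup>T) (Ua * S * 0\<^sub>m r 0 + 0\<^sub>m a (b - r) * 0\<^sub>m (b - r) 0)
      (0\<^sub>m 0 r * Va\<^sup>T + 0\<^sub>m 0 (b - r) * Vb\<^sup>T) (0\<^sub>m 0 r * 0\<^sub>m r 0 + 0\<^sub>m 0 (b - r) * 0\<^sub>m (b - r) 0)"
    by (rule mult_four_block_mat[OF US zero_carrier_mat zero_carrier_mat zero_carrier_mat VT(1) zero_carrier_mat VT(2) zero_carrier_mat])
  also have "\<dots> = Ua * S * Va\<^sup>T + 0\<^sub>m a (b - r) * Vb\<^sup>T"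
    by (rule four_block_mat_degenerate[of _ a b]) (use US VT in auto)
  also have "\<dots> = Ua * S * Va\<^sup>T" using dims by (simp add: dim_zero_mult dim_add_zero)
  finally show ?thesis .
qed

section \<open>The decoupled model\<close>

lemma smooth_fn_continuous:
  assumes "smooth_fn T f" shows "continuous_on T f"
proof -
  obtain D :: "nat \<Rightarrow> real \<Rightarrow> real" where D: "D 0 = f"
    "\<forall>k. \<forall>t\<in>T. (D k has_real_derivative D (Suc k) t) (at t within T)"
    using assms by (auto simp: smooth_fn_def)
  then have "\<forall>t\<in>T. (f has_real_derivative D (Suc 0) t) (at t within T)" by metis
  then show ?thesis by (auto simp: continuous_on_eq_continuous_within intro: DERIV_continuous)
qed

lemma msmooth_mcont: "msmooth_bounded T F a b \<Longrightarrow> mcont T F a b"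
  unfolding msmooth_bounded_def mcont_def by (auto intro: smooth_fn_continuous)

lemma mcont_mat_cont_on: "mcont T F a b \<Longrightarrow> mat_cont_on T F a b"
  by (auto simp: mcont_def mcarrier_def mat_cont_on_def)

lemma gcoefI: "mat_cont_on {s..} F a b \<Longrightarrow> (\<And>t. dim_col (F t) = b) \<Longrightarrow> gcoef s F a b"
  by (simp add: gcoef_def)

lemma mcarrier_dim: "mcarrier F a b \<Longrightarrow> dim_row (F t) = a" "mcarrier F a b \<Longrightarrow> dim_col (F t) = b"
  unfolding mcarrier_def by auto

lemma dim_mult_cancel:
  "A * B = C \<Longrightarrow> dim_col A = dim_row B \<Longrightarrow> dim_col B = dim_row X \<Longrightarrow> A * (B * X) = C * (X :: real mat)"
  by (simp add: dim_assoc_mult[symmetric])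

text \<open>\<open>Px\<close> is a solution of the variance equation whose gain \<open>M2\<close> is built from itself.
  Positivity of \<open>Rtil2\<close> makes this gain well defined.\<close>

locale elise =
  fixes E :: "'m elise_model_scheme" and Px :: "real \<Rightarrow> real mat"
  assumes standing: "standing_assms E" and measurement: "noise_and_measurement_assms E"
    and riccati_Px: "solves_riccati E Px Px"
    and Rtil2_pd: "t0 E \<le> t \<Longrightarrow> pd (nyb E - rHb E) (Rtil2 E Px t)"
begin

lemma
  shows mc_A: "mcont (horizon E) (Am E) (nx E) (nx E)"
    and mc_B: "mcont (horizon E) (Bm E) (nx E) (nu E)"
    and mc_G: "mcont (horizon E) (Gm E) (nx E) (nd E)"
    and mc_C: "mcont (horizon E) (Cm E) (ny E) (nx E)"
    and mc_D: "mcont (horizon E) (Dm E) (ny E) (nu E)"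
    and mc_W: "mcont (horizon E) (Wm E) (nx E) (nw E)"
    and mc_U1: "mcont (horizon E) (U1 E) (ny E) (rH E)"
    and mc_U2: "mcont (horizon E) (U2 E) (ny E) (ny E - rH E)"
    and mc_Sig: "mcont (horizon E) (Sig E) (rH E) (rH E)"
    and mc_V1: "mcont (horizon E) (V1 E) (nd E) (rH E)"
    and mc_V2: "mcont (horizon E) (V2 E) (nd E) (nd E - rH E)"
    and car_H: "mcarrier (Hm E) (ny E) (nd E)"
  using standing unfolding standing_assms_def manalytic_def by (auto intro: msmooth_mcont)

lemma
  shows mc_Q: "mcont (horizon E) (Qm E) (nw E) (nw E)"
    and mc_R: "mcont (horizon E) (Rm E) (ny E) (ny E)"
    and mc_Rb: "mcont (horizon E) (Rb E) (nyb E) (nyb E)"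
    and mc_Rg: "mcont (horizon E) (Rg E) (ny E) (nyb E)"
    and mc_Cb: "mcont (horizon E) (Cb E) (nyb E) (nx E)"
    and mc_Cbb: "mcont (horizon E) (Cbb E) (nyb E) (nx E)"
    and mc_Db: "mcont (horizon E) (Db E) (nyb E) (nu E)"
    and mc_Dbb: "mcont (horizon E) (Dbb E) (nyb E) (nu E)"
    and mc_Hb: "mcont (horizon E) (Hb E) (nyb E) (nd E)"
    and mc_Hbb: "mcont (horizon E) (Hbb E) (nyb E) (nd E)"
    and mc_Ub2: "mcont (horizon E) (Ub2 E) (nyb E) (nyb E - rHb E)"
  using measurement unfolding noise_and_measurement_assms_def by auto

lemma mcont_dims: "mcont T F a b \<Longrightarrow> dim_row (F t) = a" "mcont T F a b \<Longrightarrow> dim_col (F t) = b"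
  by (auto simp: mcont_def intro: mcarrier_dim)

lemmas base_dims [simp] =
  mcont_dims[OF mc_A] mcont_dims[OF mc_B] mcont_dims[OF mc_G] mcont_dims[OF mc_C] mcont_dims[OF mc_D]
  mcont_dims[OF mc_W] mcont_dims[OF mc_U1] mcont_dims[OF mc_U2] mcont_dims[OF mc_Sig] mcont_dims[OF mc_V1]
  mcont_dims[OF mc_V2] mcarrier_dim[OF car_H] mcont_dims[OF mc_Q] mcont_dims[OF mc_R] mcont_dims[OF mc_Rb]
  mcont_dims[OF mc_Rg] mcont_dims[OF mc_Cb] mcont_dims[OF mc_Cbb] mcont_dims[OF mc_Db] mcont_dims[OF mc_Dbb]
  mcont_dims[OF mc_Hb] mcont_dims[OF mc_Hbb] mcont_dims[OF mc_Ub2]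

lemma derived_dims [simp]:
  "dim_row (G1 E t) = nx E" "dim_col (G1 E t) = rH E"
  "dim_row (G2 E t) = nx E" "dim_col (G2 E t) = nd E - rH E"
  "dim_row (T1 E t) = rH E" "dim_col (T1 E t) = ny E"
  "dim_row (T2 E t) = ny E - rH E" "dim_col (T2 E t) = ny E"
  "dim_row (C1 E t) = rH E" "dim_col (C1 E t) = nx E"
  "dim_row (C2 E t) = ny E - rH E" "dim_col (C2 E t) = nx E"
  "dim_row (D1 E t) = rH E" "dim_col (D1 E t) = nu E"
  "dim_row (D2 E t) = ny E - rH E" "dim_col (D2 E t) = nu E"
  "dim_row (R1 E t) = rH E" "dim_col (R1 E t) = rH E"
  "dim_row (R2 E t) = ny E - rH E" "dim_col (R2 E t) = ny E - rH E"
  "dim_row (Tb2 E t) = nyb E - rHb E" "dim_col (Tb2 E t) = nyb E"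
  "dim_row (Cb2 E t) = nyb E - rHb E" "dim_col (Cb2 E t) = nx E"
  "dim_row (Db2 E t) = nyb E - rHb E" "dim_col (Db2 E t) = nu E"
  "dim_row (Rb2 E t) = nyb E - rHb E" "dim_col (Rb2 E t) = nyb E - rHb E"
  "dim_row (Rg2 E t) = ny E - rH E" "dim_col (Rg2 E t) = nyb E - rHb E"
  "dim_row (Rg12 E t) = rH E" "dim_col (Rg12 E t) = nyb E - rHb E"
  "dim_row (M1 E t) = rH E" "dim_col (M1 E t) = rH E"
  "dim_row (Ahat E t) = nx E" "dim_col (Ahat E t) = nx E"
  "dim_row (Qhat E t) = nx E" "dim_col (Qhat E t) = nx E"
  by (simp_all add: G1_def G2_def T1_def T2_def C1_def C2_def D1_def D2_def R1_def R2_def Tb2_def Cb2_def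
      Db2_def Rb2_def Rg2_def Rg12_def M1_def Ahat_def Qhat_def)

lemma Rtil2_dims [simp]:
  "dim_row (Rtil2 E Px t) = nyb E - rHb E" "dim_col (Rtil2 E Px t) = nyb E - rHb E"
  by (simp_all add: Rtil2_def)

lemma filter_dims [simp]:
  "dim_row (M2 E Px t) = nd E - rH E" "dim_col (M2 E Px t) = nyb E - rHb E"
  "dim_row (N2 E Px t) = nx E" "dim_col (N2 E Px t) = nx E"
  "dim_row (Qbar E Px t) = nx E" "dim_col (Qbar E Px t) = nx E"
  "dim_row (Abar E Px t) = nx E" "dim_col (Abar E Px t) = nx E"
  "dim_row (gain E Px P t) = nx E" "dim_col (gain E Px P t) = ny E - rH E"
  "dim_row (decor E Px t) = nx E" "dim_col (decor E Px t) = ny E - rH E"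
  "dim_row (Ae E Px t) = nx E" "dim_col (Ae E Px t) = nx E"
  "dim_row (Qe E Px t) = nx E" "dim_col (Qe E Px t) = nx E"
  "dim_row (cross E Px t) = nx E" "dim_col (cross E Px t) = nx E"
  by (simp_all add: M2_def N2_def Qbar_def Abar_def gain_def decor_def Ae_def Qe_def cross_def)

section \<open>Algebraic identities of the decoupling\<close>

context
  fixes t assumes t: "t0 E \<le> t"
begin

lemma svd_H: "is_svd (ny E) (nd E) (rH E) (Hm E t) (U1 E t) (U2 E t) (Sig E t) (V1 E t) (V2 E t)"
  using standing t by (simp add: standing_assms_def)

lemma svd_Hb: "is_svd (nyb E) (nd E) (rHb E) (Hb E t) (Ub1 E t) (Ub2 E t) (Sigb E t) (Vb1 E t) (Vb2 E t)"
  using measurement t by (simp add: noise_and_measurement_assms_def)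

lemma noise_psd: "psd (nw E) (Qm E t)" "pd (ny E) (Rm E t)" "pd (nyb E) (Rb E t)"
  using measurement t by (simp_all add: noise_and_measurement_assms_def)

lemma noise_sym: "(Qm E t)\<^sup>T = Qm E t" "(Rm E t)\<^sup>T = Rm E t" "(Rb E t)\<^sup>T = Rb E t"
  using noise_psd by (simp_all add: psd_def pd_def)

lemma U_blocks:
  "(U1 E t)\<^sup>T * U1 E t = 1\<^sub>m (rH E)" "(U1 E t)\<^sup>T * U2 E t = 0\<^sub>m (rH E) (ny E - rH E)"
  "(U2 E t)\<^sup>T * U1 E t = 0\<^sub>m (ny E - rH E) (rH E)" "(U2 E t)\<^sup>T * U2 E t = 1\<^sub>m (ny E - rH E)"
  using svd_H unfolding is_svd_def by (auto intro!: hcat_orthogonal_blocks)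

lemma V_complete: "V1 E t * (V1 E t)\<^sup>T + V2 E t * (V2 E t)\<^sup>T = 1\<^sub>m (nd E)"
  using svd_H unfolding is_svd_def by (auto intro!: hcat_orthogonal_blocks)

lemma Ub_block: "(Ub2 E t)\<^sup>T * Ub1 E t = 0\<^sub>m (nyb E - rHb E) (rHb E)"
  using svd_Hb unfolding is_svd_def by (auto intro!: hcat_orthogonal_blocks)

lemma H_svd: "Hm E t = U1 E t * Sig E t * (V1 E t)\<^sup>T"
  by (rule svd_product[OF svd_H])

lemma Sig_pd: "pd (rH E) (Sig E t)"
  using svd_H by (intro positive_diagonal_pd) (auto simp: is_svd_def)

lemma M1_Sig: "M1 E t * Sig E t = 1\<^sub>m (rH E)"
  unfolding M1_def by (rule pd_inverse(2)[OF Sig_pd])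

lemma U2_injective:
  assumes x: "x \<in> carrier_vec (ny E - rH E)" and z: "U2 E t *\<^sub>v x = 0\<^sub>v (ny E)"
  shows "x = 0\<^sub>v (ny E - rH E)"
proof -
  have d: "dim_vec x = ny E - rH E" using x by simp
  have "x = ((U2 E t)\<^sup>T * U2 E t) *\<^sub>v x" using d by (simp add: U_blocks dim_one_mult_vec)
  also have "\<dots> = (U2 E t)\<^sup>T *\<^sub>v 0\<^sub>v (ny E)" using d by (simp add: dim_assoc_mult_vec z)
  finally show ?thesis by (simp add: mult_zero_vec)
qed

lemma R2_pd: "pd (ny E - rH E) (R2 E t)"
proof -
  have "pd (ny E - rH E) ((U2 E t)\<^sup>T * Rm E t * U2 E t)"
    by (rule pd_congruence[OF noise_psd(2) _ U2_injective]) (auto intro: carrier_matI)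
  then show ?thesis by (simp add: R2_def T2_def)
qed

lemma R2_sym: "(R2 E t)\<^sup>T = R2 E t" "(minv (R2 E t))\<^sup>T = minv (R2 E t)"
  using R2_pd pd_minv[OF R2_pd] by (simp_all add: pd_def)

lemma R2_inverse: "R2 E t * minv (R2 E t) = 1\<^sub>m (ny E - rH E)" "minv (R2 E t) * R2 E t = 1\<^sub>m (ny E - rH E)"
  by (rule pd_inverse[OF R2_pd])+

lemma T1_alt: "T1 E t = (U1 E t)\<^sup>T - (U1 E t)\<^sup>T * Rm E t * U2 E t * minv (R2 E t) * (U2 E t)\<^sup>T"
  by (simp add: T1_def R2_def T2_def)

lemma T1_H: "T1 E t * Hm E t = Sig E t * (V1 E t)\<^sup>T"
  by (simp add: T1_alt H_svd dim_algebra dim_mult_cancel[OF U_blocks(1)] dim_mult_cancel[OF U_blocks(3)])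

lemma T2_H: "T2 E t * Hm E t = 0\<^sub>m (ny E - rH E) (nd E)"
  by (simp add: T2_def H_svd dim_algebra dim_mult_cancel[OF U_blocks(3)])

text \<open>The correction in \<open>T\<^sub>1\<close> is chosen exactly so that the two parts of the output noise become
  uncorrelated.\<close>

lemma T2_R_T1: "T2 E t * Rm E t * (T1 E t)\<^sup>T = 0\<^sub>m (ny E - rH E) (rH E)"
proof -
  have "T2 E t * Rm E t * (T1 E t)\<^sup>T = (U2 E t)\<^sup>T * (Rm E t * U1 E t)
      - R2 E t * (minv (R2 E t) * ((U2 E t)\<^sup>T * (Rm E t * U1 E t)))"
    by (simp add: T1_alt T2_def dim_algebra noise_sym R2_sym) (simp add: R2_def T2_def dim_algebra)
  also have "R2 E t * (minv (R2 E t) * ((U2 E t)\<^sup>T * (Rm E t * U1 E t))) = (U2 E t)\<^sup>T * (Rm E t * U1 E t)"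
    by (simp add: dim_mult_cancel[OF R2_inverse(1)] dim_one_mult)
  finally show ?thesis by (simp) (rule eq_matI, simp_all)
qed

lemma T1_R_T2: "T1 E t * Rm E t * (T2 E t)\<^sup>T = 0\<^sub>m (rH E) (ny E - rH E)"
proof -
  have "T1 E t * Rm E t * (T2 E t)\<^sup>T = (T2 E t * Rm E t * (T1 E t)\<^sup>T)\<^sup>T"
    by (simp add: dim_algebra noise_sym)
  then show ?thesis by (simp add: T2_R_T1)
qed

lemma Tb2_Hb: "Tb2 E t * Hb E t = 0\<^sub>m (nyb E - rHb E) (nd E)"
proof -
  have "dim_row (Ub1 E t) = nyb E" "dim_col (Ub1 E t) = rHb E" "dim_row (Sigb E t) = rHb E"
    "dim_col (Sigb E t) = rHb E" "dim_row (Vb1 E t) = nd E" "dim_col (Vb1 E t) = rHb E"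
    using svd_Hb by (auto simp: is_svd_def)
  then show ?thesis
    by (simp add: Tb2_def svd_product[OF svd_Hb] dim_algebra dim_mult_cancel[OF Ub_block])
qed

lemma Tb2_Hbb: "Tb2 E t * Hbb E t = 0\<^sub>m (nyb E - rHb E) (nd E)"
  using measurement t by (simp add: noise_and_measurement_assms_def)

end

section \<open>Continuity of the filter data\<close>

lemmas base_cont = mc_A[THEN mcont_mat_cont_on] mc_B[THEN mcont_mat_cont_on] mc_G[THEN mcont_mat_cont_on]
  mc_C[THEN mcont_mat_cont_on] mc_D[THEN mcont_mat_cont_on] mc_W[THEN mcont_mat_cont_on]
  mc_U1[THEN mcont_mat_cont_on] mc_U2[THEN mcont_mat_cont_on] mc_Sig[THEN mcont_mat_cont_on]
  mc_V1[THEN mcont_mat_cont_on] mc_V2[THEN mcont_mat_cont_on] mc_Q[THEN mcont_mat_cont_on]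
  mc_R[THEN mcont_mat_cont_on] mc_Rb[THEN mcont_mat_cont_on] mc_Rg[THEN mcont_mat_cont_on]
  mc_Cb[THEN mcont_mat_cont_on] mc_Cbb[THEN mcont_mat_cont_on] mc_Db[THEN mcont_mat_cont_on]
  mc_Dbb[THEN mcont_mat_cont_on] mc_Hb[THEN mcont_mat_cont_on] mc_Hbb[THEN mcont_mat_cont_on]
  mc_Ub2[THEN mcont_mat_cont_on]

lemmas cont_intros = mat_cont_on_add mat_cont_on_minus mat_cont_on_mult mat_cont_on_transpose base_cont

lemma H_cont: "mat_cont_on (horizon E) (Hm E) (ny E) (nd E)"
proof (rule mat_cont_on_cong)
  show "mat_cont_on (horizon E) (\<lambda>t. U1 E t * Sig E t * (V1 E t)\<^sup>T) (ny E) (nd E)"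
    by (rule cont_intros)+
qed (simp add: H_svd)

lemma cont_decoupling:
  shows "mat_cont_on (horizon E) (G1 E) (nx E) (rH E)"
    and "mat_cont_on (horizon E) (G2 E) (nx E) (nd E - rH E)"
    and "mat_cont_on (horizon E) (T2 E) (ny E - rH E) (ny E)"
    and "mat_cont_on (horizon E) (Tb2 E) (nyb E - rHb E) (nyb E)"
  unfolding G1_def[abs_def] G2_def[abs_def] T2_def[abs_def] Tb2_def[abs_def]
  by (rule cont_intros)+

lemma cont_M1: "mat_cont_on (horizon E) (M1 E) (rH E) (rH E)"
  unfolding M1_def[abs_def] by (rule mat_cont_on_minv[OF mc_Sig[THEN mcont_mat_cont_on]]) (simp add: Sig_pd)

lemma cont_decoupled_2:
  shows "mat_cont_on (horizon E) (C2 E) (ny E - rH E) (nx E)"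
    and "mat_cont_on (horizon E) (D2 E) (ny E - rH E) (nu E)"
    and "mat_cont_on (horizon E) (R2 E) (ny E - rH E) (ny E - rH E)"
    and "mat_cont_on (horizon E) (Cb2 E) (nyb E - rHb E) (nx E)"
    and "mat_cont_on (horizon E) (Db2 E) (nyb E - rHb E) (nu E)"
    and "mat_cont_on (horizon E) (Rb2 E) (nyb E - rHb E) (nyb E - rHb E)"
    and "mat_cont_on (horizon E) (Rg2 E) (ny E - rH E) (nyb E - rHb E)"
  unfolding C2_def[abs_def] D2_def[abs_def] R2_def[abs_def] Cb2_def[abs_def] Db2_def[abs_def]
    Rb2_def[abs_def] Rg2_def[abs_def]
  by (rule cont_intros cont_decoupling)+

lemma cont_R2_inv: "mat_cont_on (horizon E) (\<lambda>t. minv (R2 E t)) (ny E - rH E) (ny E - rH E)"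
  by (rule mat_cont_on_minv[OF cont_decoupled_2(3)]) (simp add: R2_pd)

lemma cont_T1: "mat_cont_on (horizon E) (T1 E) (rH E) (ny E)"
proof (rule mat_cont_on_cong)
  show "mat_cont_on (horizon E) (\<lambda>t. (U1 E t)\<^sup>T - (U1 E t)\<^sup>T * Rm E t * U2 E t * minv (R2 E t) * (U2 E t)\<^sup>T)
      (rH E) (ny E)"
    by (rule cont_intros cont_R2_inv)+
qed (simp add: T1_alt)

lemma cont_decoupled_1:
  shows "mat_cont_on (horizon E) (C1 E) (rH E) (nx E)"
    and "mat_cont_on (horizon E) (D1 E) (rH E) (nu E)"
    and "mat_cont_on (horizon E) (R1 E) (rH E) (rH E)"
    and "mat_cont_on (horizon E) (Rg12 E) (rH E) (nyb E - rHb E)"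
  unfolding C1_def[abs_def] D1_def[abs_def] R1_def[abs_def] Rg12_def[abs_def]
  by (rule cont_intros cont_decoupling cont_T1)+

lemma cont_hat:
  shows "mat_cont_on (horizon E) (Ahat E) (nx E) (nx E)"
    and "mat_cont_on (horizon E) (Qhat E) (nx E) (nx E)"
  unfolding Ahat_def[abs_def] Qhat_def[abs_def]
  by (rule cont_intros cont_decoupling cont_decoupled_1 cont_M1)+

lemma riccati_deriv:
  assumes "solves_riccati E Px P"
  shows "mat_deriv_on (horizon E) (nx E) (nx E) P (\<lambda>t. Abar E Px t * P t + P t * (Abar E Px t)\<^sup>T + Qbar E Px t
        - gain E Px P t * R2 E t * (gain E Px P t)\<^sup>T)"
  unfolding mat_deriv_on_def
proof (intro ballI conjI allI impI)
  fix t assume "t \<in> horizon E"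
  then have t: "t0 E \<le> t" by simp
  let ?D = "Abar E Px t * P t + P t * (Abar E Px t)\<^sup>T + Qbar E Px t - gain E Px P t * R2 E t * (gain E Px P t)\<^sup>T"
  show "P t \<in> carrier_mat (nx E) (nx E)" using assms t by (simp add: solves_riccati_def)
  show D: "?D \<in> carrier_mat (nx E) (nx E)" by (rule carrier_matI) simp_all
  fix i j assume "i < nx E" "j < nx E"
  moreover have "mat_has_deriv P ?D t (horizon E)" using assms t by (simp add: solves_riccati_def)
  moreover have "dim_row ?D = nx E" "dim_col ?D = nx E" by simp_all
  ultimately show "((\<lambda>s. P s $$ (i, j)) has_real_derivative ?D $$ (i, j)) (at t within horizon E)"
    unfolding mat_has_deriv_def by metis
qed

lemma cont_Px: "mat_cont_on (horizon E) Px (nx E) (nx E)"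
  by (rule mat_deriv_on_cont[OF riccati_deriv[OF riccati_Px]])

lemma cont_Rtil2: "mat_cont_on (horizon E) (Rtil2 E Px) (nyb E - rHb E) (nyb E - rHb E)"
  unfolding Rtil2_def[abs_def] by (rule cont_intros cont_decoupling cont_decoupled_2 cont_decoupled_1 cont_hat cont_M1 cont_Px)+

text \<open>The rank condition on \<open>Cb2 G2\<close> enters here: it makes the matrix inverted in \<open>M2\<close> definite, so that
  \<open>M2\<close> is a left inverse of \<open>Cb2 G2\<close>.\<close>

lemma M2_normal_pd:
  assumes t: "t0 E \<le> t"
  shows "pd (nd E - rH E) ((G2 E t)\<^sup>T * (Cb2 E t)\<^sup>T * minv (Rtil2 E Px t) * Cb2 E t * G2 E t)"
proof -
  let ?X = "Cb2 E t * G2 E t" and ?R = "minv (Rtil2 E Px t)"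
  have r: "mrank ?X = nd E - rH E" using measurement t by (simp add: noise_and_measurement_assms_def)
  have X: "?X \<in> carrier_mat (nyb E - rHb E) (nd E - rH E)" by (rule carrier_matI) simp_all
  have "pd (nd E - rH E) (?X\<^sup>T * ?R * ?X)"
    by (rule pd_congruence[OF pd_minv[OF Rtil2_pd[OF t]] X full_column_rank_injective[OF X r]])
  then show ?thesis by (simp add: dim_algebra)
qed

lemma M2_Cb2_G2:
  assumes t: "t0 E \<le> t"
  shows "M2 E Px t * (Cb2 E t * G2 E t) = 1\<^sub>m (nd E - rH E)"
  using pd_inverse(2)[OF M2_normal_pd[OF t]] by (simp add: M2_def dim_algebra)

lemma cont_M2: "mat_cont_on (horizon E) (M2 E Px) (nd E - rH E) (nyb E - rHb E)"
proof -
  have R: "mat_cont_on (horizon E) (\<lambda>t. minv (Rtil2 E Px t)) (nyb E - rHb E) (nyb E - rHb E)"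
    by (rule mat_cont_on_minv[OF cont_Rtil2]) (simp add: Rtil2_pd)
  have X: "mat_cont_on (horizon E) (\<lambda>t. (G2 E t)\<^sup>T * (Cb2 E t)\<^sup>T * minv (Rtil2 E Px t) * Cb2 E t * G2 E t)
      (nd E - rH E) (nd E - rH E)"
    by (rule cont_intros cont_decoupling cont_decoupled_2 R)+
  have Y: "mat_cont_on (horizon E) (\<lambda>t. minv ((G2 E t)\<^sup>T * (Cb2 E t)\<^sup>T * minv (Rtil2 E Px t) * Cb2 E t * G2 E t))
      (nd E - rH E) (nd E - rH E)"
    by (rule mat_cont_on_minv[OF X]) (simp add: M2_normal_pd)
  show ?thesis
    unfolding M2_def[abs_def] by (rule cont_intros cont_decoupling cont_decoupled_2 R Y)+
qed

lemma cont_N2: "mat_cont_on (horizon E) (N2 E Px) (nx E) (nx E)"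
  unfolding N2_def[abs_def] by (rule cont_intros cont_decoupling cont_decoupled_2 cont_M2 mat_cont_on_const one_carrier_mat)+

lemma cont_bar:
  shows "mat_cont_on (horizon E) (Qbar E Px) (nx E) (nx E)"
    and "mat_cont_on (horizon E) (Abar E Px) (nx E) (nx E)"
    and "mat_cont_on (horizon E) (decor E Px) (nx E) (ny E - rH E)"
    and "mat_cont_on (horizon E) (gain E Px Px) (nx E) (ny E - rH E)"
    and "mat_cont_on (horizon E) (cross E Px) (nx E) (nx E)"
  unfolding Qbar_def[abs_def] Abar_def[abs_def] decor_def[abs_def] gain_def[abs_def] cross_def[abs_def]
  by (rule cont_intros cont_decoupling cont_decoupled_2 cont_decoupled_1 cont_hat cont_M1 cont_M2 cont_N2 cont_R2_inv cont_Px)+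

lemma cont_equivalent:
  shows "mat_cont_on (horizon E) (Ae E Px) (nx E) (nx E)"
    and "mat_cont_on (horizon E) (Qe E Px) (nx E) (nx E)"
  unfolding Ae_def[abs_def] Qe_def[abs_def]
  by (rule cont_intros cont_decoupling cont_decoupled_2 cont_decoupled_1 cont_hat cont_M1 cont_M2 cont_bar)+

end

section \<open>The estimation error\<close>

context elise
begin

lemma model_coef:
  "gcoef (t0 E) (Am E) (nx E) (nx E)" "gcoef (t0 E) (Bm E) (nx E) (nu E)" "gcoef (t0 E) (Gm E) (nx E) (nd E)"
  "gcoef (t0 E) (Cm E) (ny E) (nx E)" "gcoef (t0 E) (Dm E) (ny E) (nu E)" "gcoef (t0 E) (Wm E) (nx E) (nw E)"
  "gcoef (t0 E) (Hm E) (ny E) (nd E)" "gcoef (t0 E) (Sig E) (rH E) (rH E)"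
  "gcoef (t0 E) (Cb E) (nyb E) (nx E)" "gcoef (t0 E) (Cbb E) (nyb E) (nx E)"
  "gcoef (t0 E) (Db E) (nyb E) (nu E)" "gcoef (t0 E) (Dbb E) (nyb E) (nu E)"
  "gcoef (t0 E) (Hb E) (nyb E) (nd E)" "gcoef (t0 E) (Hbb E) (nyb E) (nd E)"
  "gcoef (t0 E) (T1 E) (rH E) (ny E)" "gcoef (t0 E) (T2 E) (ny E - rH E) (ny E)"
  "gcoef (t0 E) (C1 E) (rH E) (nx E)" "gcoef (t0 E) (C2 E) (ny E - rH E) (nx E)"
  "gcoef (t0 E) (G1 E) (nx E) (rH E)" "gcoef (t0 E) (G2 E) (nx E) (nd E - rH E)"
  "gcoef (t0 E) (M1 E) (rH E) (rH E)" "gcoef (t0 E) (M2 E Px) (nd E - rH E) (nyb E - rHb E)"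
  "gcoef (t0 E) (Tb2 E) (nyb E - rHb E) (nyb E)" "gcoef (t0 E) (Cb2 E) (nyb E - rHb E) (nx E)"
  "gcoef (t0 E) (N2 E Px) (nx E) (nx E)" "gcoef (t0 E) (Ahat E) (nx E) (nx E)"
  "gcoef (t0 E) (gain E Px Px) (nx E) (ny E - rH E)" "gcoef (t0 E) (decor E Px) (nx E) (ny E - rH E)"
  "gcoef (t0 E) (Abar E Px) (nx E) (nx E)" "gcoef (t0 E) (Ae E Px) (nx E) (nx E)"
  by (rule gcoefI, rule base_cont H_cont cont_decoupling cont_decoupled_2 cont_decoupled_1 cont_hat cont_bar cont_equivalent cont_T1 cont_M1 cont_M2 cont_N2, simp)+

lemma V_transpose_coef: "gcoef (t0 E) (\<lambda>t. (V1 E t)\<^sup>T) (rH E) (nd E)" "gcoef (t0 E) (\<lambda>t. (V2 E t)\<^sup>T) (nd E - rH E) (nd E)"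
  by (rule mcont_transpose_gcoef, rule mc_V1 mc_V2)+

text \<open>\<open>T1 H = Sig V1\<^sup>T\<close> and \<open>T2 H = 0\<close>: the first residual sees the first component of the unknown input,
  the second sees none of it.\<close>

lemma output_residual:
  assumes y: "gp_eq M (t0 E) (ny E) y (Cm E *\<^sub>g x + Dm E *\<^sub>g u + Hm E *\<^sub>g d + v)"
    and d: "gproc M (t0 E) (nd E) d"
  shows "gp_eq M (t0 E) (rH E) (T1 E *\<^sub>g y - C1 E *\<^sub>g xh - D1 E *\<^sub>g u)
      (C1 E *\<^sub>g (x - xh) + (\<lambda>t. Sig E t * (V1 E t)\<^sup>T) *\<^sub>g d + T1 E *\<^sub>g v)" (is ?A)
    and "gp_eq M (t0 E) (ny E - rH E) (T2 E *\<^sub>g y - C2 E *\<^sub>g xh - D2 E *\<^sub>g u)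
      (C2 E *\<^sub>g (x - xh) + T2 E *\<^sub>g v)" (is ?B)
proof -
  have a: "gp_eq M (t0 E) (rH E) (T1 E *\<^sub>g y)
      (T1 E *\<^sub>g Cm E *\<^sub>g x + T1 E *\<^sub>g Dm E *\<^sub>g u + T1 E *\<^sub>g Hm E *\<^sub>g d + T1 E *\<^sub>g v)"
    using gp_eq_mult[OF model_coef(15) y] by (simp only: gp_mult_add)
  have b: "gp_eq M (t0 E) (ny E - rH E) (T2 E *\<^sub>g y)
      (T2 E *\<^sub>g Cm E *\<^sub>g x + T2 E *\<^sub>g Dm E *\<^sub>g u + T2 E *\<^sub>g Hm E *\<^sub>g d + T2 E *\<^sub>g v)"
    using gp_eq_mult[OF model_coef(16) y] by (simp only: gp_mult_add)
  have a1: "gp_eq M (t0 E) (rH E) (T1 E *\<^sub>g Cm E *\<^sub>g x) (C1 E *\<^sub>g x)"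
    by (rule gp_mult_mult_cong[OF model_coef(15) model_coef(4)]) (simp_all add: C1_def)
  have a2: "gp_eq M (t0 E) (rH E) (T1 E *\<^sub>g Dm E *\<^sub>g u) (D1 E *\<^sub>g u)"
    by (rule gp_mult_mult_cong[OF model_coef(15) model_coef(5)]) (simp_all add: D1_def)
  have a3: "gp_eq M (t0 E) (rH E) (T1 E *\<^sub>g Hm E *\<^sub>g d) ((\<lambda>t. Sig E t * (V1 E t)\<^sup>T) *\<^sub>g d)"
    by (rule gp_mult_mult_cong[OF model_coef(15) model_coef(7)]) (simp_all add: T1_H)
  have b1: "gp_eq M (t0 E) (ny E - rH E) (T2 E *\<^sub>g Cm E *\<^sub>g x) (C2 E *\<^sub>g x)"
    by (rule gp_mult_mult_cong[OF model_coef(16) model_coef(4)]) (simp_all add: C2_def)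
  have b2: "gp_eq M (t0 E) (ny E - rH E) (T2 E *\<^sub>g Dm E *\<^sub>g u) (D2 E *\<^sub>g u)"
    by (rule gp_mult_mult_cong[OF model_coef(16) model_coef(5)]) (simp_all add: D2_def)
  have b3: "gp_eq M (t0 E) (ny E - rH E) (T2 E *\<^sub>g Hm E *\<^sub>g d) 0"
    by (rule gp_eq_trans[OF gp_mult_mult[OF model_coef(16) model_coef(7)] gp_coef_zero[OF d gcoef_mult[OF model_coef(16) model_coef(7)]]])
      (simp add: T2_H)
  show ?A
    unfolding gp_eq_def
  proof
    fix \<phi> assume \<phi>: "\<phi> \<in> test (t0 E) (rH E)"
    from a[THEN gp_eqD, OF \<phi>] a1[THEN gp_eqD, OF \<phi>] a2[THEN gp_eqD, OF \<phi>] a3[THEN gp_eqD, OF \<phi>]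
    show "AE \<omega> in M. (T1 E *\<^sub>g y - C1 E *\<^sub>g xh - D1 E *\<^sub>g u) \<phi> \<omega>
        = (C1 E *\<^sub>g (x - xh) + (\<lambda>t. Sig E t * (V1 E t)\<^sup>T) *\<^sub>g d + T1 E *\<^sub>g v) \<phi> \<omega>"
      by eventually_elim (simp add: gp_mult_diff)
  qed
  show ?B
    unfolding gp_eq_def
  proof
    fix \<phi> assume \<phi>: "\<phi> \<in> test (t0 E) (ny E - rH E)"
    from b[THEN gp_eqD, OF \<phi>] b1[THEN gp_eqD, OF \<phi>] b2[THEN gp_eqD, OF \<phi>] b3[THEN gp_eqD, OF \<phi>]
    show "AE \<omega> in M. (T2 E *\<^sub>g y - C2 E *\<^sub>g xh - D2 E *\<^sub>g u) \<phi> \<omega>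
        = (C2 E *\<^sub>g (x - xh) + T2 E *\<^sub>g v) \<phi> \<omega>"
      by eventually_elim (simp add: gp_mult_diff)
  qed
qed

text \<open>Coefficients of the estimation error and of \<open>v\<close> in the residual of the additional measurement,
  after the input estimate \<open>dh1\<close> has been inserted.\<close>

definition residual_error_gain where "residual_error_gain t = Cb2 E t * Ahat E t + Tb2 E t * Cbb E t"
definition residual_noise_gain where "residual_noise_gain t = Cb2 E t * G1 E t * (M1 E t * T1 E t)"

lemma residual_error_gain_dims [simp]: "dim_row (residual_error_gain t) = nyb E - rHb E" "dim_col (residual_error_gain t) = nx E"
  and residual_noise_gain_dims [simp]: "dim_row (residual_noise_gain t) = nyb E - rHb E" "dim_col (residual_noise_gain t) = ny E"
  by (simp_all add: residual_error_gain_def residual_noise_gain_def)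

lemma residual_coef: "gcoef (t0 E) residual_error_gain (nyb E - rHb E) (nx E)" "gcoef (t0 E) residual_noise_gain (nyb E - rHb E) (ny E)"
  unfolding residual_error_gain_def[abs_def] residual_noise_gain_def[abs_def] by (rule gcoef_add gcoef_mult model_coef)+

lemma input_estimate_1:
  assumes z: "gp_eq M (t0 E) (rH E) z (C1 E *\<^sub>g e + (\<lambda>t. Sig E t * (V1 E t)\<^sup>T) *\<^sub>g d + T1 E *\<^sub>g v)"
    and dh1: "gp_eq M (t0 E) (rH E) dh1 (M1 E *\<^sub>g z)"
  shows "gp_eq M (t0 E) (rH E) dh1
    ((\<lambda>t. M1 E t * C1 E t) *\<^sub>g e + (\<lambda>t. (V1 E t)\<^sup>T) *\<^sub>g d + (\<lambda>t. M1 E t * T1 E t) *\<^sub>g v)"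
proof -
  have "gp_eq M (t0 E) (rH E) (M1 E *\<^sub>g z) (M1 E *\<^sub>g C1 E *\<^sub>g e + M1 E *\<^sub>g (\<lambda>t. Sig E t * (V1 E t)\<^sup>T) *\<^sub>g d + M1 E *\<^sub>g T1 E *\<^sub>g v)"
    using gp_eq_mult[OF model_coef(21) z] by (simp only: gp_mult_add)
  also have "gp_eq M (t0 E) (rH E) \<dots>
      ((\<lambda>t. M1 E t * C1 E t) *\<^sub>g e + (\<lambda>t. (V1 E t)\<^sup>T) *\<^sub>g d + (\<lambda>t. M1 E t * T1 E t) *\<^sub>g v)"
  proof (intro gp_eq_add)
    show "gp_eq M (t0 E) (rH E) (M1 E *\<^sub>g C1 E *\<^sub>g e) ((\<lambda>t. M1 E t * C1 E t) *\<^sub>g e)"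
      by (rule gp_mult_mult[OF model_coef(21) model_coef(17)])
    show "gp_eq M (t0 E) (rH E) (M1 E *\<^sub>g T1 E *\<^sub>g v) ((\<lambda>t. M1 E t * T1 E t) *\<^sub>g v)"
      by (rule gp_mult_mult[OF model_coef(21) model_coef(15)])
    show "gp_eq M (t0 E) (rH E) (M1 E *\<^sub>g (\<lambda>t. Sig E t * (V1 E t)\<^sup>T) *\<^sub>g d) ((\<lambda>t. (V1 E t)\<^sup>T) *\<^sub>g d)"
    proof (rule gp_mult_mult_cong[OF model_coef(21) gcoef_mult[OF model_coef(8) V_transpose_coef(1)]])
      fix t assume "t0 E \<le> t"
      then show "M1 E t * (Sig E t * (V1 E t)\<^sup>T) = (V1 E t)\<^sup>T"
        by (simp add: dim_mult_cancel[OF M1_Sig] dim_one_mult)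
    qed simp
  qed
  finally show ?thesis using dh1 by (rule gp_eq_trans[rotated])
qed

text \<open>Substituting the state equation for \<open>dx\<close> brings \<open>G d = G1 V1\<^sup>T d + G2 V2\<^sup>T d\<close> into the residual.  The
  first component is cancelled by \<open>dh1\<close> up to error and noise; the derivative of \<open>d\<close> and \<open>d\<close> itself
  are annihilated by \<open>Tb2\<close>.\<close>

lemma additional_residual:
  assumes gp: "gproc M (t0 E) (nx E) x" "gproc M (t0 E) (nx E) xh" "gproc M (t0 E) (nd E) d" "gproc M (t0 E) (nd E) dd"
    and dx: "gp_eq M (t0 E) (nx E) dx (Am E *\<^sub>g x + Bm E *\<^sub>g u + Gm E *\<^sub>g d + Wm E *\<^sub>g w)"
    and yb: "gp_eq M (t0 E) (nyb E) yb
       (Cb E *\<^sub>g dx + Cbb E *\<^sub>g x + Db E *\<^sub>g du + Dbb E *\<^sub>g u + Hb E *\<^sub>g dd + Hbb E *\<^sub>g d + vb)"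
    and h1: "gp_eq M (t0 E) (rH E) dh1 ((\<lambda>t. M1 E t * C1 E t) *\<^sub>g (x - xh) + (\<lambda>t. (V1 E t)\<^sup>T) *\<^sub>g d
       + (\<lambda>t. M1 E t * T1 E t) *\<^sub>g v)"
  shows "gp_eq M (t0 E) (nyb E - rHb E)
      (Tb2 E *\<^sub>g yb - (\<lambda>t. Cb2 E t * Am E t + Tb2 E t * Cbb E t) *\<^sub>g xh - (\<lambda>t. Cb2 E t * Bm E t) *\<^sub>g u
        - (\<lambda>t. Cb2 E t * G1 E t) *\<^sub>g dh1 - Db2 E *\<^sub>g du - (\<lambda>t. Tb2 E t * Dbb E t) *\<^sub>g u)
      (residual_error_gain *\<^sub>g (x - xh) + (\<lambda>t. Cb2 E t * G2 E t * (V2 E t)\<^sup>T) *\<^sub>g d + (\<lambda>t. Cb2 E t * Wm E t) *\<^sub>g w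
        - residual_noise_gain *\<^sub>g v + Tb2 E *\<^sub>g vb)"
proof -
  let ?n = "nyb E - rHb E"
  let ?CA = "\<lambda>t. Cb2 E t * Am E t" and ?TC = "\<lambda>t. Tb2 E t * Cbb E t" and ?CG1 = "\<lambda>t. Cb2 E t * G1 E t"
  have e: "gproc M (t0 E) (nx E) (x - xh)" by (rule gproc_diff[OF gp(1,2)])
  note gCA = gcoef_mult[OF model_coef(24) model_coef(1)] and gTC = gcoef_mult[OF model_coef(23) model_coef(10)]
    and gCG1 = gcoef_mult[OF model_coef(24) model_coef(19)]
  have Y: "gp_eq M (t0 E) ?n (Tb2 E *\<^sub>g yb)
      (Tb2 E *\<^sub>g Cb E *\<^sub>g dx + Tb2 E *\<^sub>g Cbb E *\<^sub>g x + Tb2 E *\<^sub>g Db E *\<^sub>g du + Tb2 E *\<^sub>g Dbb E *\<^sub>g u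
        + Tb2 E *\<^sub>g Hb E *\<^sub>g dd + Tb2 E *\<^sub>g Hbb E *\<^sub>g d + Tb2 E *\<^sub>g vb)"
    using gp_eq_mult[OF model_coef(23) yb] by (simp only: gp_mult_add)
  have Y1: "gp_eq M (t0 E) ?n (Tb2 E *\<^sub>g Cb E *\<^sub>g dx) (Cb2 E *\<^sub>g dx)"
    by (rule gp_mult_mult_cong[OF model_coef(23) model_coef(9)]) (simp_all add: Cb2_def)
  have Y2: "gp_eq M (t0 E) ?n (Tb2 E *\<^sub>g Cbb E *\<^sub>g x) (?TC *\<^sub>g x)" by (rule gp_mult_mult[OF model_coef(23) model_coef(10)])
  have Y3: "gp_eq M (t0 E) ?n (Tb2 E *\<^sub>g Db E *\<^sub>g du) (Db2 E *\<^sub>g du)"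
    by (rule gp_mult_mult_cong[OF model_coef(23) model_coef(11)]) (simp_all add: Db2_def)
  have Y4: "gp_eq M (t0 E) ?n (Tb2 E *\<^sub>g Dbb E *\<^sub>g u) ((\<lambda>t. Tb2 E t * Dbb E t) *\<^sub>g u)"
    by (rule gp_mult_mult[OF model_coef(23) model_coef(12)])
  have Y5: "gp_eq M (t0 E) ?n (Tb2 E *\<^sub>g Hb E *\<^sub>g dd) 0"
    by (rule gp_eq_trans[OF gp_mult_mult[OF model_coef(23) model_coef(13)] gp_coef_zero[OF gp(4) gcoef_mult[OF model_coef(23) model_coef(13)]]])
      (simp add: Tb2_Hb)
  have Y6: "gp_eq M (t0 E) ?n (Tb2 E *\<^sub>g Hbb E *\<^sub>g d) 0"
    by (rule gp_eq_trans[OF gp_mult_mult[OF model_coef(23) model_coef(14)] gp_coef_zero[OF gp(3) gcoef_mult[OF model_coef(23) model_coef(14)]]])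
      (simp add: Tb2_Hbb)
  have D: "gp_eq M (t0 E) ?n (Cb2 E *\<^sub>g dx)
      (Cb2 E *\<^sub>g Am E *\<^sub>g x + Cb2 E *\<^sub>g Bm E *\<^sub>g u + Cb2 E *\<^sub>g Gm E *\<^sub>g d + Cb2 E *\<^sub>g Wm E *\<^sub>g w)"
    using gp_eq_mult[OF model_coef(24) dx] by (simp only: gp_mult_add)
  note D1 = gp_mult_mult[OF model_coef(24) model_coef(1), of M x] and D2 = gp_mult_mult[OF model_coef(24) model_coef(2), of M u]
    and D3 = gp_mult_mult[OF model_coef(24) model_coef(3), of M d] and D4 = gp_mult_mult[OF model_coef(24) model_coef(6), of M w]
  have H: "gp_eq M (t0 E) ?n (?CG1 *\<^sub>g dh1)
      (?CG1 *\<^sub>g (\<lambda>t. M1 E t * C1 E t) *\<^sub>g (x - xh) + ?CG1 *\<^sub>g (\<lambda>t. (V1 E t)\<^sup>T) *\<^sub>g d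
       + ?CG1 *\<^sub>g (\<lambda>t. M1 E t * T1 E t) *\<^sub>g v)"
    using gp_eq_mult[OF gCG1 h1] by (simp only: gp_mult_add)
  note H1 = gp_mult_mult[OF gCG1 gcoef_mult[OF model_coef(21) model_coef(17)], of M "x - xh"]
    and H2 = gp_mult_mult[OF gCG1 V_transpose_coef(1), of M d]
  have H3: "gp_eq M (t0 E) ?n (?CG1 *\<^sub>g (\<lambda>t. M1 E t * T1 E t) *\<^sub>g v) (residual_noise_gain *\<^sub>g v)"
    by (rule gp_mult_mult_cong[OF gCG1 gcoef_mult[OF model_coef(21) model_coef(15)]]) (simp_all add: residual_noise_gain_def)
  have S1: "gp_eq M (t0 E) ?n ((\<lambda>t. Cb2 E t * Am E t + Tb2 E t * Cbb E t) *\<^sub>g x) (?CA *\<^sub>g x + ?TC *\<^sub>g x)"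
    by (rule gp_coef_add[OF gp(1) gCA gTC])
  have S2: "gp_eq M (t0 E) ?n (residual_error_gain *\<^sub>g (x - xh)) ((\<lambda>t. Cb2 E t * Am E t + Tb2 E t * Cbb E t) *\<^sub>g (x - xh)
      - (\<lambda>t. Cb2 E t * G1 E t * (M1 E t * C1 E t)) *\<^sub>g (x - xh))"
  proof (rule gp_coef_diff_cong[OF e gcoef_add[OF gCA gTC] gcoef_mult[OF gCG1 gcoef_mult[OF model_coef(21) model_coef(17)]]])
    fix t
    show "Cb2 E t * Am E t + Tb2 E t * Cbb E t - Cb2 E t * G1 E t * (M1 E t * C1 E t) = residual_error_gain t"
      by (simp add: residual_error_gain_def Ahat_def dim_algebra) (rule eq_matI, simp_all del: index_mult_mat(1))
  qed simp
  have S3: "gp_eq M (t0 E) ?n ((\<lambda>t. Cb2 E t * G2 E t * (V2 E t)\<^sup>T) *\<^sub>g d)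
      ((\<lambda>t. Cb2 E t * Gm E t) *\<^sub>g d - (\<lambda>t. Cb2 E t * G1 E t * (V1 E t)\<^sup>T) *\<^sub>g d)"
  proof (rule gp_coef_diff_cong[OF gp(3) gcoef_mult[OF model_coef(24) model_coef(3)] gcoef_mult[OF gCG1 V_transpose_coef(1)]])
    fix t assume t: "t0 E \<le> t"
    have "Cb2 E t * Gm E t = Cb2 E t * (Gm E t * (V1 E t * (V1 E t)\<^sup>T + V2 E t * (V2 E t)\<^sup>T))"
      by (simp add: V_complete[OF t] dim_mult_one)
    then show "Cb2 E t * Gm E t - Cb2 E t * G1 E t * (V1 E t)\<^sup>T = Cb2 E t * G2 E t * (V2 E t)\<^sup>T"
      by (simp add: G1_def G2_def dim_algebra) (rule eq_matI, simp_all del: index_mult_mat(1))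
  qed simp
  show ?thesis
    unfolding gp_eq_def
  proof
    fix \<phi> assume \<phi>: "\<phi> \<in> test (t0 E) ?n"
    from Y[THEN gp_eqD, OF \<phi>] Y1[THEN gp_eqD, OF \<phi>] Y2[THEN gp_eqD, OF \<phi>] Y3[THEN gp_eqD, OF \<phi>]
      Y4[THEN gp_eqD, OF \<phi>] Y5[THEN gp_eqD, OF \<phi>] Y6[THEN gp_eqD, OF \<phi>] D[THEN gp_eqD, OF \<phi>]
      D1[THEN gp_eqD, OF \<phi>] D2[THEN gp_eqD, OF \<phi>] D3[THEN gp_eqD, OF \<phi>] D4[THEN gp_eqD, OF \<phi>]
      H[THEN gp_eqD, OF \<phi>] H1[THEN gp_eqD, OF \<phi>] H2[THEN gp_eqD, OF \<phi>] H3[THEN gp_eqD, OF \<phi>]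
      S1[THEN gp_eqD, OF \<phi>] S2[THEN gp_eqD, OF \<phi>] S3[THEN gp_eqD, OF \<phi>]
    show "AE \<omega> in M. (Tb2 E *\<^sub>g yb - (\<lambda>t. Cb2 E t * Am E t + Tb2 E t * Cbb E t) *\<^sub>g xh - (\<lambda>t. Cb2 E t * Bm E t) *\<^sub>g u
        - ?CG1 *\<^sub>g dh1 - Db2 E *\<^sub>g du - (\<lambda>t. Tb2 E t * Dbb E t) *\<^sub>g u) \<phi> \<omega>
      = (residual_error_gain *\<^sub>g (x - xh) + (\<lambda>t. Cb2 E t * G2 E t * (V2 E t)\<^sup>T) *\<^sub>g d + (\<lambda>t. Cb2 E t * Wm E t) *\<^sub>g w
        - residual_noise_gain *\<^sub>g v + Tb2 E *\<^sub>g vb) \<phi> \<omega>"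
      by eventually_elim (simp add: gp_mult_diff)
  qed
qed

lemma input_estimate_2:
  assumes z: "gp_eq M (t0 E) (nyb E - rHb E) z
      (residual_error_gain *\<^sub>g e + (\<lambda>t. Cb2 E t * G2 E t * (V2 E t)\<^sup>T) *\<^sub>g d + (\<lambda>t. Cb2 E t * Wm E t) *\<^sub>g w - residual_noise_gain *\<^sub>g v + Tb2 E *\<^sub>g vb)"
    and dh2: "gp_eq M (t0 E) (nd E - rH E) dh2 (M2 E Px *\<^sub>g z)"
  shows "gp_eq M (t0 E) (nd E - rH E) dh2
    ((\<lambda>t. M2 E Px t * residual_error_gain t) *\<^sub>g e + (\<lambda>t. (V2 E t)\<^sup>T) *\<^sub>g d + (\<lambda>t. M2 E Px t * (Cb2 E t * Wm E t)) *\<^sub>g w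
      - (\<lambda>t. M2 E Px t * residual_noise_gain t) *\<^sub>g v + (\<lambda>t. M2 E Px t * Tb2 E t) *\<^sub>g vb)"
proof -
  have "gp_eq M (t0 E) (nd E - rH E) (M2 E Px *\<^sub>g z)
      (M2 E Px *\<^sub>g residual_error_gain *\<^sub>g e + M2 E Px *\<^sub>g (\<lambda>t. Cb2 E t * G2 E t * (V2 E t)\<^sup>T) *\<^sub>g d
        + M2 E Px *\<^sub>g (\<lambda>t. Cb2 E t * Wm E t) *\<^sub>g w - M2 E Px *\<^sub>g residual_noise_gain *\<^sub>g v + M2 E Px *\<^sub>g Tb2 E *\<^sub>g vb)"
    using gp_eq_mult[OF model_coef(22) z] by (simp only: gp_mult_add gp_mult_diff)
  also have "gp_eq M (t0 E) (nd E - rH E) \<dots>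
      ((\<lambda>t. M2 E Px t * residual_error_gain t) *\<^sub>g e + (\<lambda>t. (V2 E t)\<^sup>T) *\<^sub>g d + (\<lambda>t. M2 E Px t * (Cb2 E t * Wm E t)) *\<^sub>g w
      - (\<lambda>t. M2 E Px t * residual_noise_gain t) *\<^sub>g v + (\<lambda>t. M2 E Px t * Tb2 E t) *\<^sub>g vb)"
  proof (intro gp_eq_add gp_eq_diff)
    show "gp_eq M (t0 E) (nd E - rH E) (M2 E Px *\<^sub>g (\<lambda>t. Cb2 E t * G2 E t * (V2 E t)\<^sup>T) *\<^sub>g d) ((\<lambda>t. (V2 E t)\<^sup>T) *\<^sub>g d)"
    proof (rule gp_mult_mult_cong[OF model_coef(22) gcoef_mult[OF gcoef_mult[OF model_coef(24) model_coef(20)] V_transpose_coef(2)]])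
      fix t assume "t0 E \<le> t"
      then show "M2 E Px t * (Cb2 E t * G2 E t * (V2 E t)\<^sup>T) = (V2 E t)\<^sup>T"
        by (simp add: dim_mult_cancel[OF M2_Cb2_G2] dim_one_mult)
    qed simp
  qed (rule gp_mult_mult model_coef residual_coef gcoef_mult)+
  finally show ?thesis using dh2 by (rule gp_eq_trans[rotated])
qed

text \<open>Both input estimates are inserted in the filter equation.  The components of \<open>d\<close> add up to
  \<open>G d\<close> by completeness of \<open>[V1 V2]\<close> and cancel against the plant.\<close>

lemma filter_error:
  assumes gp: "gproc M (t0 E) (nx E) x" "gproc M (t0 E) (nx E) xh" "gproc M (t0 E) (nd E) d" "gproc M (t0 E) (nd E) dd"
      "gproc M (t0 E) (nw E) w" "gproc M (t0 E) (ny E) v"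
    and dx: "gp_eq M (t0 E) (nx E) dx (Am E *\<^sub>g x + Bm E *\<^sub>g u + Gm E *\<^sub>g d + Wm E *\<^sub>g w)"
    and y: "gp_eq M (t0 E) (ny E) y (Cm E *\<^sub>g x + Dm E *\<^sub>g u + Hm E *\<^sub>g d + v)"
    and yb: "gp_eq M (t0 E) (nyb E) yb
       (Cb E *\<^sub>g dx + Cbb E *\<^sub>g x + Db E *\<^sub>g du + Dbb E *\<^sub>g u + Hb E *\<^sub>g dd + Hbb E *\<^sub>g d + vb)"
    and dh1: "gp_eq M (t0 E) (rH E) dh1 (M1 E *\<^sub>g (T1 E *\<^sub>g y - C1 E *\<^sub>g xh - D1 E *\<^sub>g u))"
    and dh2: "gp_eq M (t0 E) (nd E - rH E) dh2
       (M2 E Px *\<^sub>g (Tb2 E *\<^sub>g yb - (\<lambda>t. Cb2 E t * Am E t + Tb2 E t * Cbb E t) *\<^sub>g xh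
          - (\<lambda>t. Cb2 E t * Bm E t) *\<^sub>g u - (\<lambda>t. Cb2 E t * G1 E t) *\<^sub>g dh1
          - Db2 E *\<^sub>g du - (\<lambda>t. Tb2 E t * Dbb E t) *\<^sub>g u))"
  shows "gp_eq M (t0 E) (nx E)
      (dx - (Am E *\<^sub>g xh + Bm E *\<^sub>g u + G1 E *\<^sub>g dh1 + G2 E *\<^sub>g dh2
        + gain E Px Px *\<^sub>g (T2 E *\<^sub>g y - C2 E *\<^sub>g xh - D2 E *\<^sub>g u)))
      ((\<lambda>t. Abar E Px t - gain E Px Px t * C2 E t) *\<^sub>g (x - xh)
        + wbar E Px w v vb - gain E Px Px *\<^sub>g (T2 E *\<^sub>g v))"
proof -
  let ?e = "x - xh" and ?n = "nx E"
  have e: "gproc M (t0 E) (nx E) ?e" by (rule gproc_diff[OF gp(1,2)])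
  note z = output_residual[OF y gp(3), of xh]
  note h1 = input_estimate_1[OF z(1) dh1]
  note h2 = input_estimate_2[OF additional_residual[OF gp(1-4) dx yb h1] dh2]
  have I: "gp_eq M (t0 E) ?n (G1 E *\<^sub>g dh1)
      (G1 E *\<^sub>g (\<lambda>t. M1 E t * C1 E t) *\<^sub>g ?e + G1 E *\<^sub>g (\<lambda>t. (V1 E t)\<^sup>T) *\<^sub>g d + G1 E *\<^sub>g (\<lambda>t. M1 E t * T1 E t) *\<^sub>g v)"
    using gp_eq_mult[OF model_coef(19) h1] by (simp only: gp_mult_add)
  note I1 = gp_mult_mult[OF model_coef(19) gcoef_mult[OF model_coef(21) model_coef(17)], of M ?e]
    and I2 = gp_mult_mult[OF model_coef(19) V_transpose_coef(1), of M d]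
    and I3 = gp_mult_mult[OF model_coef(19) gcoef_mult[OF model_coef(21) model_coef(15)], of M v]
  have J: "gp_eq M (t0 E) ?n (G2 E *\<^sub>g dh2)
      (G2 E *\<^sub>g (\<lambda>t. M2 E Px t * residual_error_gain t) *\<^sub>g ?e + G2 E *\<^sub>g (\<lambda>t. (V2 E t)\<^sup>T) *\<^sub>g d
        + G2 E *\<^sub>g (\<lambda>t. M2 E Px t * (Cb2 E t * Wm E t)) *\<^sub>g w - G2 E *\<^sub>g (\<lambda>t. M2 E Px t * residual_noise_gain t) *\<^sub>g v
        + G2 E *\<^sub>g (\<lambda>t. M2 E Px t * Tb2 E t) *\<^sub>g vb)"
    using gp_eq_mult[OF model_coef(20) h2] by (simp only: gp_mult_add gp_mult_diff)
  note gMK = gcoef_mult[OF model_coef(22) residual_coef(1)] and gMW = gcoef_mult[OF model_coef(22) gcoef_mult[OF model_coef(24) model_coef(6)]]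
    and gML = gcoef_mult[OF model_coef(22) residual_coef(2)] and gMT = gcoef_mult[OF model_coef(22) model_coef(23)]
  note J1 = gp_mult_mult[OF model_coef(20) gMK, of M ?e] and J2 = gp_mult_mult[OF model_coef(20) V_transpose_coef(2), of M d]
    and J3 = gp_mult_mult[OF model_coef(20) gMW, of M w] and J4 = gp_mult_mult[OF model_coef(20) gML, of M v]
    and J5 = gp_mult_mult[OF model_coef(20) gMT, of M vb]
  have L: "gp_eq M (t0 E) ?n (gain E Px Px *\<^sub>g (T2 E *\<^sub>g y - C2 E *\<^sub>g xh - D2 E *\<^sub>g u))
      (gain E Px Px *\<^sub>g C2 E *\<^sub>g ?e + gain E Px Px *\<^sub>g T2 E *\<^sub>g v)"
    using gp_eq_mult[OF model_coef(27) z(2)] by (simp only: gp_mult_add)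
  note L1' = gp_mult_mult[OF model_coef(27) model_coef(18), of M ?e]
  let ?X = "\<lambda>t. G1 E t * (M1 E t * C1 E t)" and ?Y = "\<lambda>t. G2 E t * (M2 E Px t * residual_error_gain t)"
    and ?Z = "\<lambda>t. gain E Px Px t * C2 E t"
  note gX = gcoef_mult[OF model_coef(19) gcoef_mult[OF model_coef(21) model_coef(17)]] and gY = gcoef_mult[OF model_coef(20) gMK]
    and gZ = gcoef_mult[OF model_coef(27) model_coef(18)]
  have F1: "gp_eq M (t0 E) ?n ((\<lambda>t. Abar E Px t - ?Z t) *\<^sub>g ?e) (Abar E Px *\<^sub>g ?e - ?Z *\<^sub>g ?e)"
    by (rule gp_coef_diff[OF e model_coef(29) gZ])
  have F2: "gp_eq M (t0 E) ?n (Abar E Px *\<^sub>g ?e) ((\<lambda>t. Am E t - ?X t) *\<^sub>g ?e - ?Y *\<^sub>g ?e)"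
  proof (rule gp_coef_diff_cong[OF e gcoef_minus[OF model_coef(1) gX] gY])
    fix t
    show "Am E t - G1 E t * (M1 E t * C1 E t) - G2 E t * (M2 E Px t * residual_error_gain t) = Abar E Px t"
      by (simp add: Abar_def N2_def residual_error_gain_def Ahat_def dim_algebra) (rule eq_matI, simp_all del: index_mult_mat(1))
  qed simp
  have F3: "gp_eq M (t0 E) ?n ((\<lambda>t. Am E t - ?X t) *\<^sub>g ?e) (Am E *\<^sub>g ?e - ?X *\<^sub>g ?e)"
    by (rule gp_coef_diff[OF e model_coef(1) gX])
  have W1: "gp_eq M (t0 E) ?n ((\<lambda>t. N2 E Px t * Wm E t) *\<^sub>g w)
      (Wm E *\<^sub>g w - (\<lambda>t. G2 E t * (M2 E Px t * (Cb2 E t * Wm E t))) *\<^sub>g w)"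
    by (rule gp_coef_diff_cong[OF gp(5) model_coef(6) gcoef_mult[OF model_coef(20) gMW]]) (simp_all add: N2_def dim_algebra)
  note gNGM = gcoef_mult[OF gcoef_mult[OF model_coef(25) model_coef(19)] model_coef(21)]
  have V1: "gp_eq M (t0 E) ?n ((\<lambda>t. N2 E Px t * G1 E t * M1 E t) *\<^sub>g T1 E *\<^sub>g v)
      ((\<lambda>t. N2 E Px t * G1 E t * M1 E t * T1 E t) *\<^sub>g v)"
    by (rule gp_mult_mult[OF gNGM model_coef(15)])
  have V2: "gp_eq M (t0 E) ?n ((\<lambda>t. N2 E Px t * G1 E t * M1 E t * T1 E t) *\<^sub>g v)
      ((\<lambda>t. G1 E t * (M1 E t * T1 E t)) *\<^sub>g v - (\<lambda>t. G2 E t * (M2 E Px t * residual_noise_gain t)) *\<^sub>g v)"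
    by (rule gp_coef_diff_cong[OF gp(6) gcoef_mult[OF model_coef(19) gcoef_mult[OF model_coef(21) model_coef(15)]] gcoef_mult[OF model_coef(20) gML]])
      (simp_all add: N2_def residual_noise_gain_def dim_algebra)
  have B: "gp_eq M (t0 E) ?n ((\<lambda>t. G2 E t * M2 E Px t) *\<^sub>g Tb2 E *\<^sub>g vb) ((\<lambda>t. G2 E t * (M2 E Px t * Tb2 E t)) *\<^sub>g vb)"
    by (rule gp_mult_mult_cong[OF gcoef_mult[OF model_coef(20) model_coef(22)] model_coef(23)]) (simp_all add: dim_algebra)
  have G: "gp_eq M (t0 E) ?n (Gm E *\<^sub>g d) ((\<lambda>t. G1 E t * (V1 E t)\<^sup>T) *\<^sub>g d + (\<lambda>t. G2 E t * (V2 E t)\<^sup>T) *\<^sub>g d)"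
  proof (rule gp_coef_add_cong[OF gp(3) gcoef_mult[OF model_coef(19) V_transpose_coef(1)] gcoef_mult[OF model_coef(20) V_transpose_coef(2)]])
    fix t assume t: "t0 E \<le> t"
    have "G1 E t * (V1 E t)\<^sup>T + G2 E t * (V2 E t)\<^sup>T = Gm E t * (V1 E t * (V1 E t)\<^sup>T + V2 E t * (V2 E t)\<^sup>T)"
      by (simp add: G1_def G2_def dim_algebra)
    then show "G1 E t * (V1 E t)\<^sup>T + G2 E t * (V2 E t)\<^sup>T = Gm E t" by (simp add: V_complete[OF t] dim_mult_one)
  qed simp
  show ?thesis
    unfolding gp_eq_def
  proof
    fix \<phi> assume \<phi>: "\<phi> \<in> test (t0 E) ?n"
    from dx[THEN gp_eqD, OF \<phi>] I[THEN gp_eqD, OF \<phi>] I1[THEN gp_eqD, OF \<phi>] I2[THEN gp_eqD, OF \<phi>]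
      I3[THEN gp_eqD, OF \<phi>] J[THEN gp_eqD, OF \<phi>] J1[THEN gp_eqD, OF \<phi>] J2[THEN gp_eqD, OF \<phi>]
      J3[THEN gp_eqD, OF \<phi>] J4[THEN gp_eqD, OF \<phi>] J5[THEN gp_eqD, OF \<phi>] L[THEN gp_eqD, OF \<phi>]
      L1'[THEN gp_eqD, OF \<phi>] F1[THEN gp_eqD, OF \<phi>] F2[THEN gp_eqD, OF \<phi>] F3[THEN gp_eqD, OF \<phi>]
      W1[THEN gp_eqD, OF \<phi>] V1[THEN gp_eqD, OF \<phi>] V2[THEN gp_eqD, OF \<phi>] B[THEN gp_eqD, OF \<phi>]
      G[THEN gp_eqD, OF \<phi>]
    show "AE \<omega> in M. (dx - (Am E *\<^sub>g xh + Bm E *\<^sub>g u + G1 E *\<^sub>g dh1 + G2 E *\<^sub>g dh2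
        + gain E Px Px *\<^sub>g (T2 E *\<^sub>g y - C2 E *\<^sub>g xh - D2 E *\<^sub>g u))) \<phi> \<omega>
      = ((\<lambda>t. Abar E Px t - gain E Px Px t * C2 E t) *\<^sub>g (x - xh)
        + wbar E Px w v vb - gain E Px Px *\<^sub>g (T2 E *\<^sub>g v)) \<phi> \<omega>"
      by eventually_elim (simp add: wbar_def gp_mult_diff)
  qed
qed

text \<open>The gain of the Kalman-Bucy filter for the equivalent system is \<open>L + decor\<close>.  The extra \<open>decor\<close> cancels
  against the one in \<open>Ae\<close> and against \<open>decor v\<^sub>2\<close> in \<open>we\<close>.\<close>

lemma virtual_error:
  assumes gp: "gproc M (t0 E) (nx E) xe" "gproc M (t0 E) (nx E) xhe" "gproc M (t0 E) (ny E) v"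
    and ye: "gp_eq M (t0 E) (ny E - rH E) ye (C2 E *\<^sub>g xe + T2 E *\<^sub>g v)"
  shows "gp_eq M (t0 E) (nx E)
      ((Ae E Px *\<^sub>g xe + ue + we E Px w v vb)
        - (Ae E Px *\<^sub>g xhe + ue + (\<lambda>t. Px t * (C2 E t)\<^sup>T * minv (R2 E t)) *\<^sub>g (ye - C2 E *\<^sub>g xhe)))
      ((\<lambda>t. Abar E Px t - gain E Px Px t * C2 E t) *\<^sub>g (xe - xhe)
        + wbar E Px w v vb - gain E Px Px *\<^sub>g (T2 E *\<^sub>g v))"
proof -
  let ?K = "\<lambda>t. Px t * (C2 E t)\<^sup>T * minv (R2 E t)" and ?e = "xe - xhe" and ?n = "nx E"
  have e: "gproc M (t0 E) (nx E) ?e" by (rule gproc_diff[OF gp(1,2)])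
  have K: "gcoef (t0 E) ?K ?n (ny E - rH E)"
    by (rule gcoefI, (rule cont_intros cont_decoupled_2 cont_R2_inv cont_Px)+, simp)
  have k: "gain E Px Px t = ?K t - decor E Px t" if "t0 E \<le> t" for t
  proof -
    have "dim_row (Px t) = ?n" "dim_col (Px t) = ?n" using mat_cont_on_carrier[OF cont_Px, of t] that by auto
    then show ?thesis by (simp add: gain_def decor_def dim_algebra)
  qed
  have Y: "gp_eq M (t0 E) ?n (?K *\<^sub>g (ye - C2 E *\<^sub>g xhe)) (?K *\<^sub>g (C2 E *\<^sub>g ?e + T2 E *\<^sub>g v))"
  proof (rule gp_eq_mult[OF K])
    have "gp_eq M (t0 E) (ny E - rH E) (ye - C2 E *\<^sub>g xhe) (C2 E *\<^sub>g xe + T2 E *\<^sub>g v - C2 E *\<^sub>g xhe)"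
      by (rule gp_eq_diff[OF ye gp_eq_refl])
    then show "gp_eq M (t0 E) (ny E - rH E) (ye - C2 E *\<^sub>g xhe) (C2 E *\<^sub>g ?e + T2 E *\<^sub>g v)"
      by (simp add: gp_mult_diff algebra_simps)
  qed
  note Y1 = gp_mult_mult[OF K model_coef(18), of M ?e]
  have F: "gp_eq M (t0 E) ?n ((\<lambda>t. Abar E Px t - gain E Px Px t * C2 E t) *\<^sub>g ?e) (Ae E Px *\<^sub>g ?e - (\<lambda>t. ?K t * C2 E t) *\<^sub>g ?e)"
  proof (rule gp_coef_diff_cong[OF e model_coef(30) gcoef_mult[OF K model_coef(18)]])
    fix t assume t: "t0 E \<le> t"
    have "dim_row (Px t) = ?n" "dim_col (Px t) = ?n" using mat_cont_on_carrier[OF cont_Px, of t] t by auto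
    then show "Ae E Px t - ?K t * C2 E t = Abar E Px t - gain E Px Px t * C2 E t"
      by (simp add: k[OF t] Ae_def dim_algebra) (rule eq_matI, simp_all del: index_mult_mat(1))
  qed simp
  have G: "gp_eq M (t0 E) ?n (gain E Px Px *\<^sub>g (T2 E *\<^sub>g v)) (?K *\<^sub>g (T2 E *\<^sub>g v) - decor E Px *\<^sub>g (T2 E *\<^sub>g v))"
    by (rule gp_coef_diff_cong[OF gproc_mult[OF model_coef(16) gp(3)] K model_coef(28)]) (simp_all add: k)
  show ?thesis
    unfolding gp_eq_def
  proof
    fix \<phi> assume \<phi>: "\<phi> \<in> test (t0 E) ?n"
    from Y[THEN gp_eqD, OF \<phi>] Y1[THEN gp_eqD, OF \<phi>] F[THEN gp_eqD, OF \<phi>] G[THEN gp_eqD, OF \<phi>]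
    show "AE \<omega> in M. ((Ae E Px *\<^sub>g xe + ue + we E Px w v vb)
        - (Ae E Px *\<^sub>g xhe + ue + ?K *\<^sub>g (ye - C2 E *\<^sub>g xhe))) \<phi> \<omega>
      = ((\<lambda>t. Abar E Px t - gain E Px Px t * C2 E t) *\<^sub>g ?e
        + wbar E Px w v vb - gain E Px Px *\<^sub>g (T2 E *\<^sub>g v)) \<phi> \<omega>"
      by eventually_elim (simp add: we_def gp_mult_diff gp_mult_add)
  qed
qed

end

section \<open>Covariances of the equivalent noises\<close>

context elise
begin

lemma noise_covariances:
  assumes np: "noise_processes E M w v vb"
  shows "delta_cov M (t0 E) (nw E) (nw E) w w (Qm E)" "delta_cov M (t0 E) (ny E) (ny E) v v (Rm E)"
    "delta_cov M (t0 E) (nw E) (ny E) w v (\<lambda>t. 0\<^sub>m (nw E) (ny E))"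
    "delta_cov M (t0 E) (nw E) (nyb E) w vb (\<lambda>t. 0\<^sub>m (nw E) (nyb E))"
    "delta_cov M (t0 E) (ny E) (nyb E) v vb (Rg E)" "delta_cov M (t0 E) (nyb E) (nyb E) vb vb (Rb E)"
  using np by (simp_all add: noise_processes_def)

text \<open>The coefficients of \<open>w\<close>, \<open>v\<^sub>1\<close> and the noise of the additional measurement in \<open>wbar\<close>.\<close>

definition gain_w where "gain_w t = N2 E Px t * Wm E t"
definition gain_v where "gain_v t = N2 E Px t * G1 E t * M1 E t"
definition gain_vb where "gain_vb t = G2 E t * M2 E Px t"

lemma noise_gain_dims [simp]:
  "dim_row (gain_w t) = nx E" "dim_col (gain_w t) = nw E" "dim_row (gain_v t) = nx E" "dim_col (gain_v t) = rH E"
  "dim_row (gain_vb t) = nx E" "dim_col (gain_vb t) = nyb E - rHb E"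
  by (simp_all add: gain_w_def gain_v_def gain_vb_def)

lemma noise_gain_coef: "gcoef (t0 E) gain_w (nx E) (nw E)" "gcoef (t0 E) gain_v (nx E) (rH E)"
  "gcoef (t0 E) gain_vb (nx E) (nyb E - rHb E)"
  unfolding gain_w_def[abs_def] gain_v_def[abs_def] gain_vb_def[abs_def] by (rule gcoef_mult model_coef)+

lemma wbar_alt: "wbar E Px w v vb = gain_w *\<^sub>g w - gain_v *\<^sub>g T1 E *\<^sub>g v - gain_vb *\<^sub>g Tb2 E *\<^sub>g vb"
  by (simp add: wbar_def gain_w_def[abs_def] gain_v_def[abs_def] gain_vb_def[abs_def])

lemmas coef_cont = model_coef[THEN gcoef_cont] noise_gain_coef[THEN gcoef_cont]

lemmas filter_cont_intros = mat_cont_on_mult mat_cont_on_transpose base_cont coef_cont cont_decoupling cont_decoupled_2 cont_decoupled_1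

lemma R_sym:
  assumes "t0 E \<le> t"
  shows "(R1 E t)\<^sup>T = R1 E t" "(Rb2 E t)\<^sup>T = Rb2 E t"
  by (simp_all add: R1_def Rb2_def dim_algebra noise_sym[OF assms])

text \<open>Covariances of the three parts of \<open>wbar\<close> and of \<open>decor v\<^sub>2\<close>.  The correlations with \<open>w\<close> vanish by
  assumption, that of \<open>v\<^sub>1\<close> with \<open>v\<^sub>2\<close> by the choice of \<open>T1\<close>; the correlation of \<open>v\<^sub>1\<close> with the additional
  measurement survives as \<open>cross\<close>.\<close>

lemma wbar_part_covariances:
  assumes np: "noise_processes E M w v vb"
  shows "delta_cov M (t0 E) (nx E) (nx E) (gain_w *\<^sub>g w) (gain_w *\<^sub>g w) (\<lambda>t. gain_w t * (Qm E t * (gain_w t)\<^sup>T))" (is ?ww)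
    and "delta_cov M (t0 E) (nx E) (nx E) (gain_w *\<^sub>g w) (gain_v *\<^sub>g T1 E *\<^sub>g v) (\<lambda>t. 0\<^sub>m (nx E) (nx E))" (is ?wv)
    and "delta_cov M (t0 E) (nx E) (nx E) (gain_w *\<^sub>g w) (gain_vb *\<^sub>g Tb2 E *\<^sub>g vb) (\<lambda>t. 0\<^sub>m (nx E) (nx E))" (is ?wb)
    and "delta_cov M (t0 E) (nx E) (nx E) (gain_v *\<^sub>g T1 E *\<^sub>g v) (gain_v *\<^sub>g T1 E *\<^sub>g v) (\<lambda>t. gain_v t * (R1 E t * (gain_v t)\<^sup>T))" (is ?vv)
    and "delta_cov M (t0 E) (nx E) (nx E) (gain_v *\<^sub>g T1 E *\<^sub>g v) (gain_vb *\<^sub>g Tb2 E *\<^sub>g vb) (cross E Px)" (is ?vb)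
    and "delta_cov M (t0 E) (nx E) (nx E) (gain_vb *\<^sub>g Tb2 E *\<^sub>g vb) (gain_vb *\<^sub>g Tb2 E *\<^sub>g vb) (\<lambda>t. gain_vb t * (Rb2 E t * (gain_vb t)\<^sup>T))" (is ?bb)
    and "delta_cov M (t0 E) (nx E) (nx E) (gain_w *\<^sub>g w) (decor E Px *\<^sub>g T2 E *\<^sub>g v) (\<lambda>t. 0\<^sub>m (nx E) (nx E))" (is ?wd)
    and "delta_cov M (t0 E) (nx E) (nx E) (gain_v *\<^sub>g T1 E *\<^sub>g v) (decor E Px *\<^sub>g T2 E *\<^sub>g v) (\<lambda>t. 0\<^sub>m (nx E) (nx E))" (is ?vd)
    and "delta_cov M (t0 E) (nx E) (nx E) (decor E Px *\<^sub>g T2 E *\<^sub>g v) (gain_vb *\<^sub>g Tb2 E *\<^sub>g vb)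
           (\<lambda>t. decor E Px t * (Rg2 E t * (gain_vb t)\<^sup>T))" (is ?db)
    and "delta_cov M (t0 E) (nx E) (nx E) (decor E Px *\<^sub>g T2 E *\<^sub>g v) (decor E Px *\<^sub>g T2 E *\<^sub>g v)
           (\<lambda>t. decor E Px t * (R2 E t * (decor E Px t)\<^sup>T))" (is ?dd)
proof -
  note nc = noise_covariances[OF np]
  have Z: "mat_cont_on (horizon E) (\<lambda>t. 0\<^sub>m a b) a b" for a b by (rule mat_cont_on_const) simp
  have "delta_cov M (t0 E) (nx E) (nx E) (gain_w *\<^sub>g w) (gain_w *\<^sub>g w) (\<lambda>t. gain_w t * (Qm E t * (gain_w t)\<^sup>T))"
    by (rule delta_cov_mult_left[OF delta_cov_mult_right[OF nc(1)]]; (rule filter_cont_intros noise_gain_coef)+)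
  then show ?ww .
  have "delta_cov M (t0 E) (nx E) (nx E) (gain_w *\<^sub>g w) (gain_v *\<^sub>g T1 E *\<^sub>g v) (\<lambda>t. gain_w t * (0\<^sub>m (nw E) (ny E) * (T1 E t)\<^sup>T * (gain_v t)\<^sup>T))"
    by (rule delta_cov_mult_left[OF delta_cov_mult_right[OF delta_cov_mult_right[OF nc(3)]]]; (rule filter_cont_intros Z model_coef noise_gain_coef)+)
  then show ?wv by (rule delta_cov_cong) (simp add: dim_algebra)
  have "delta_cov M (t0 E) (nx E) (nx E) (gain_w *\<^sub>g w) (gain_vb *\<^sub>g Tb2 E *\<^sub>g vb) (\<lambda>t. gain_w t * (0\<^sub>m (nw E) (nyb E) * (Tb2 E t)\<^sup>T * (gain_vb t)\<^sup>T))"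
    by (rule delta_cov_mult_left[OF delta_cov_mult_right[OF delta_cov_mult_right[OF nc(4)]]]; (rule filter_cont_intros Z model_coef noise_gain_coef)+)
  then show ?wb by (rule delta_cov_cong) (simp add: dim_algebra)
  have "delta_cov M (t0 E) (nx E) (nx E) (gain_v *\<^sub>g T1 E *\<^sub>g v) (gain_v *\<^sub>g T1 E *\<^sub>g v)
      (\<lambda>t. gain_v t * (T1 E t * (Rm E t * (T1 E t)\<^sup>T * (gain_v t)\<^sup>T)))"
    by (rule delta_cov_mult_left[OF delta_cov_mult_left[OF delta_cov_mult_right[OF delta_cov_mult_right[OF nc(2)]]]];
        (rule filter_cont_intros Z model_coef noise_gain_coef)+)
  then show ?vv by (rule delta_cov_cong) (simp add: R1_def dim_algebra)
  have "delta_cov M (t0 E) (nx E) (nx E) (gain_v *\<^sub>g T1 E *\<^sub>g v) (gain_vb *\<^sub>g Tb2 E *\<^sub>g vb)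
      (\<lambda>t. gain_v t * (T1 E t * (Rg E t * (Tb2 E t)\<^sup>T * (gain_vb t)\<^sup>T)))"
    by (rule delta_cov_mult_left[OF delta_cov_mult_left[OF delta_cov_mult_right[OF delta_cov_mult_right[OF nc(5)]]]];
        (rule filter_cont_intros Z model_coef noise_gain_coef)+)
  then show ?vb by (rule delta_cov_cong) (simp add: cross_def Rg12_def gain_v_def gain_vb_def dim_algebra)
  have "delta_cov M (t0 E) (nx E) (nx E) (gain_vb *\<^sub>g Tb2 E *\<^sub>g vb) (gain_vb *\<^sub>g Tb2 E *\<^sub>g vb)
      (\<lambda>t. gain_vb t * (Tb2 E t * (Rb E t * (Tb2 E t)\<^sup>T * (gain_vb t)\<^sup>T)))"
    by (rule delta_cov_mult_left[OF delta_cov_mult_left[OF delta_cov_mult_right[OF delta_cov_mult_right[OF nc(6)]]]];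
        (rule filter_cont_intros Z model_coef noise_gain_coef)+)
  then show ?bb by (rule delta_cov_cong) (simp add: Rb2_def dim_algebra)
  have "delta_cov M (t0 E) (nx E) (nx E) (gain_w *\<^sub>g w) (decor E Px *\<^sub>g T2 E *\<^sub>g v)
      (\<lambda>t. gain_w t * (0\<^sub>m (nw E) (ny E) * (T2 E t)\<^sup>T * (decor E Px t)\<^sup>T))"
    by (rule delta_cov_mult_left[OF delta_cov_mult_right[OF delta_cov_mult_right[OF nc(3)]]]; (rule filter_cont_intros Z model_coef noise_gain_coef)+)
  then show ?wd by (rule delta_cov_cong) (simp add: dim_algebra)
  have "delta_cov M (t0 E) (nx E) (nx E) (gain_v *\<^sub>g T1 E *\<^sub>g v) (decor E Px *\<^sub>g T2 E *\<^sub>g v)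
      (\<lambda>t. gain_v t * (T1 E t * (Rm E t * (T2 E t)\<^sup>T * (decor E Px t)\<^sup>T)))"
    by (rule delta_cov_mult_left[OF delta_cov_mult_left[OF delta_cov_mult_right[OF delta_cov_mult_right[OF nc(2)]]]];
        (rule filter_cont_intros Z model_coef noise_gain_coef)+)
  then show ?vd
  proof (rule delta_cov_cong)
    fix t assume t: "t0 E \<le> t"
    have "gain_v t * (T1 E t * (Rm E t * (T2 E t)\<^sup>T * (decor E Px t)\<^sup>T))
        = gain_v t * ((T1 E t * Rm E t * (T2 E t)\<^sup>T) * (decor E Px t)\<^sup>T)"
      by (simp add: dim_assoc_mult)
    also have "\<dots> = 0\<^sub>m (nx E) (nx E)" unfolding T1_R_T2[OF t] by (simp add: dim_algebra)
    finally show "gain_v t * (T1 E t * (Rm E t * (T2 E t)\<^sup>T * (decor E Px t)\<^sup>T)) = 0\<^sub>m (nx E) (nx E)" .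
  qed
  have "delta_cov M (t0 E) (nx E) (nx E) (decor E Px *\<^sub>g T2 E *\<^sub>g v) (gain_vb *\<^sub>g Tb2 E *\<^sub>g vb)
      (\<lambda>t. decor E Px t * (T2 E t * (Rg E t * (Tb2 E t)\<^sup>T * (gain_vb t)\<^sup>T)))"
    by (rule delta_cov_mult_left[OF delta_cov_mult_left[OF delta_cov_mult_right[OF delta_cov_mult_right[OF nc(5)]]]];
        (rule filter_cont_intros Z model_coef noise_gain_coef)+)
  then show ?db by (rule delta_cov_cong) (simp add: Rg2_def dim_algebra)
  have "delta_cov M (t0 E) (nx E) (nx E) (decor E Px *\<^sub>g T2 E *\<^sub>g v) (decor E Px *\<^sub>g T2 E *\<^sub>g v)
      (\<lambda>t. decor E Px t * (T2 E t * (Rm E t * (T2 E t)\<^sup>T * (decor E Px t)\<^sup>T)))"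
    by (rule delta_cov_mult_left[OF delta_cov_mult_left[OF delta_cov_mult_right[OF delta_cov_mult_right[OF nc(2)]]]];
        (rule filter_cont_intros Z model_coef noise_gain_coef)+)
  then show ?dd by (rule delta_cov_cong) (simp add: R2_def dim_algebra)
qed

text \<open>The variance of \<open>decor v\<^sub>2\<close> equals its covariance with the additional noise in \<open>wbar\<close>, which enters
  with a minus sign.  Hence of variance minus two covariances, minus one is left, as in \<open>Qe\<close>.\<close>

lemma decor_form:
  assumes t: "t0 E \<le> t"
  shows "decor E Px t * (R2 E t * (decor E Px t)\<^sup>T) = decor E Px t * (Rg2 E t * (gain_vb t)\<^sup>T)"
    and "(decor E Px t * (Rg2 E t * (gain_vb t)\<^sup>T))\<^sup>T = decor E Px t * (Rg2 E t * (gain_vb t)\<^sup>T)"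
    and "decor E Px t * Rg2 E t * (M2 E Px t)\<^sup>T * (G2 E t)\<^sup>T = decor E Px t * (Rg2 E t * (gain_vb t)\<^sup>T)"
  by (simp_all add: decor_def gain_vb_def dim_algebra R2_sym[OF t] dim_mult_cancel[OF R2_inverse(1)[OF t]])

text \<open>Bilinear expansion over the parts of \<open>wbar\<close>, and then over \<open>we = decor v\<^sub>2 + wbar\<close>.\<close>

lemma noise_intensities:
  assumes np: "noise_processes E M w v vb"
  shows "delta_cov M (t0 E) (nx E) (nx E) (wbar E Px w v vb) (wbar E Px w v vb)
       (\<lambda>t. Qbar E Px t + (cross E Px t + (cross E Px t)\<^sup>T))" (is ?A)
    and "delta_cov M (t0 E) (nx E) (nx E) (we E Px w v vb) (we E Px w v vb)
       (\<lambda>t. Qe E Px t + (cross E Px t + (cross E Px t)\<^sup>T))" (is ?B)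
proof -
  let ?n = "nx E" and ?s = "t0 E"
  let ?P1 = "gain_w *\<^sub>g w" and ?P2 = "gain_v *\<^sub>g T1 E *\<^sub>g v" and ?P3 = "gain_vb *\<^sub>g Tb2 E *\<^sub>g vb" and ?P0 = "decor E Px *\<^sub>g T2 E *\<^sub>g v"
  let ?Kw = "\<lambda>t. gain_w t * (Qm E t * (gain_w t)\<^sup>T)" and ?Kv = "\<lambda>t. gain_v t * (R1 E t * (gain_v t)\<^sup>T)"
    and ?Kb = "\<lambda>t. gain_vb t * (Rb2 E t * (gain_vb t)\<^sup>T)" and ?O = "\<lambda>t :: real. 0\<^sub>m (nx E) (nx E) :: real mat"
    and ?Kd = "\<lambda>t. decor E Px t * (Rg2 E t * (gain_vb t)\<^sup>T)"
  note cp = wbar_part_covariances[OF np]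
  have Z: "mat_cont_on (horizon E) ?O ?n ?n" by (rule mat_cont_on_const) simp
  have ZT: "mat_cont_on (horizon E) (\<lambda>t. (?O t)\<^sup>T) ?n ?n" by (rule mat_cont_on_transpose[OF Z])
  have Kw: "mat_cont_on (horizon E) ?Kw ?n ?n" and Kv: "mat_cont_on (horizon E) ?Kv ?n ?n"
    and Kb: "mat_cont_on (horizon E) ?Kb ?n ?n" and Kd: "mat_cont_on (horizon E) ?Kd ?n ?n"
    and KD: "mat_cont_on (horizon E) (\<lambda>t. decor E Px t * (R2 E t * (decor E Px t)\<^sup>T)) ?n ?n"
    by (rule filter_cont_intros)+
  note Kc = cont_bar(5)
  have KcT: "mat_cont_on (horizon E) (\<lambda>t. (cross E Px t)\<^sup>T) ?n ?n" by (rule mat_cont_on_transpose[OF Kc])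
  note m2 = mat_cont_on_minus
  have w1: "delta_cov M ?s ?n ?n (?P1 - ?P2 - ?P3) ?P1 (\<lambda>t. ?Kw t - (?O t)\<^sup>T - (?O t)\<^sup>T)"
    by (rule delta_cov_diff_left[OF delta_cov_diff_left[OF cp(1) delta_cov_swap[OF cp(2) Z] Kw ZT]
          delta_cov_swap[OF cp(3) Z] m2[OF Kw ZT] ZT])
  have w2: "delta_cov M ?s ?n ?n (?P1 - ?P2 - ?P3) ?P2 (\<lambda>t. ?O t - ?Kv t - (cross E Px t)\<^sup>T)"
    by (rule delta_cov_diff_left[OF delta_cov_diff_left[OF cp(2) cp(4) Z Kv] delta_cov_swap[OF cp(5) Kc] m2[OF Z Kv] KcT])
  have w3: "delta_cov M ?s ?n ?n (?P1 - ?P2 - ?P3) ?P3 (\<lambda>t. ?O t - cross E Px t - ?Kb t)"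
    by (rule delta_cov_diff_left[OF delta_cov_diff_left[OF cp(3) cp(5) Z Kc] cp(6) m2[OF Z Kc] Kb])
  have w0: "delta_cov M ?s ?n ?n (?P1 - ?P2 - ?P3) ?P0 (\<lambda>t. ?O t - ?O t - (?Kd t)\<^sup>T)"
    by (rule delta_cov_diff_left[OF delta_cov_diff_left[OF cp(7) cp(8) Z Z] delta_cov_swap[OF cp(9) Kd] m2[OF Z Z]
          mat_cont_on_transpose[OF Kd]])
  have c1: "mat_cont_on (horizon E) (\<lambda>t. ?Kw t - (?O t)\<^sup>T - (?O t)\<^sup>T) ?n ?n" by (rule m2[OF m2[OF Kw ZT] ZT])
  have c2: "mat_cont_on (horizon E) (\<lambda>t. ?O t - ?Kv t - (cross E Px t)\<^sup>T) ?n ?n" by (rule m2[OF m2[OF Z Kv] KcT])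
  have c3: "mat_cont_on (horizon E) (\<lambda>t. ?O t - cross E Px t - ?Kb t) ?n ?n" by (rule m2[OF m2[OF Z Kc] Kb])
  have c0: "mat_cont_on (horizon E) (\<lambda>t. ?O t - ?O t - (?Kd t)\<^sup>T) ?n ?n"
    by (rule m2[OF m2[OF Z Z] mat_cont_on_transpose[OF Kd]])
  note s1 = delta_cov_swap[OF w1 c1] and s2 = delta_cov_swap[OF w2 c2] and s3 = delta_cov_swap[OF w3 c3]
  note c1T = mat_cont_on_transpose[OF c1] and c2T = mat_cont_on_transpose[OF c2] and c3T = mat_cont_on_transpose[OF c3]
  have W: "delta_cov M ?s ?n ?n (?P1 - ?P2 - ?P3) (?P1 - ?P2 - ?P3)
      (\<lambda>t. (?Kw t - (?O t)\<^sup>T - (?O t)\<^sup>T)\<^sup>T - (?O t - ?Kv t - (cross E Px t)\<^sup>T)\<^sup>T - (?O t - cross E Px t - ?Kb t)\<^sup>T)"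
    by (rule delta_cov_diff_left[OF delta_cov_diff_left[OF s1 s2 c1T c2T] s3 m2[OF c1T c2T] c3T])
  show A: ?A
    unfolding wbar_alt
  proof (rule delta_cov_cong[OF W])
    fix t assume t: "t0 E \<le> t"
    have sym: "(?Kw t)\<^sup>T = ?Kw t" "(?Kv t)\<^sup>T = ?Kv t" "(?Kb t)\<^sup>T = ?Kb t"
      by (simp_all add: dim_algebra noise_sym[OF t] R_sym[OF t])
    have Q: "Qbar E Px t = ?Kw t + ?Kv t + ?Kb t"
      by (simp add: Qbar_def Qhat_def gain_w_def gain_v_def gain_vb_def dim_algebra)
    have "(?Kw t - (?O t)\<^sup>T - (?O t)\<^sup>T)\<^sup>T - (?O t - ?Kv t - (cross E Px t)\<^sup>T)\<^sup>T - (?O t - cross E Px t - ?Kb t)\<^sup>T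
      = ?Kw t - (?O t - ?Kv t - cross E Px t) - (?O t - (cross E Px t)\<^sup>T - ?Kb t)"
      by (simp add: dim_transpose_minus sym) (simp add: dim_minus_zero)
    also have "\<dots> = Qbar E Px t + (cross E Px t + (cross E Px t)\<^sup>T)"
      unfolding Q by (rule eq_matI, simp_all del: index_mult_mat(1))
    finally show "(?Kw t - (?O t)\<^sup>T - (?O t)\<^sup>T)\<^sup>T - (?O t - ?Kv t - (cross E Px t)\<^sup>T)\<^sup>T - (?O t - cross E Px t - ?Kb t)\<^sup>T
      = Qbar E Px t + (cross E Px t + (cross E Px t)\<^sup>T)" .
  qed
  let ?w = "wbar E Px w v vb" and ?Q = "\<lambda>t. Qbar E Px t + (cross E Px t + (cross E Px t)\<^sup>T)"
    and ?D = "\<lambda>t. decor E Px t * (R2 E t * (decor E Px t)\<^sup>T)"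
  have Qc: "mat_cont_on (horizon E) ?Q ?n ?n" by (rule mat_cont_on_add[OF cont_bar(1) mat_cont_on_add[OF Kc KcT]])
  note w0' = w0[folded wbar_alt]
  have e0: "delta_cov M ?s ?n ?n (?P0 + ?w) ?P0 (\<lambda>t. ?D t + (?O t - ?O t - (?Kd t)\<^sup>T))"
    by (rule delta_cov_add_left[OF cp(10) w0' KD c0])
  have e1: "delta_cov M ?s ?n ?n (?P0 + ?w) ?w (\<lambda>t. (?O t - ?O t - (?Kd t)\<^sup>T)\<^sup>T + ?Q t)"
    by (rule delta_cov_add_left[OF delta_cov_swap[OF w0' c0] A mat_cont_on_transpose[OF c0] Qc])
  note e0c = mat_cont_on_add[OF KD c0] and e1c = mat_cont_on_add[OF mat_cont_on_transpose[OF c0] Qc]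
  have W: "delta_cov M ?s ?n ?n (?P0 + ?w) (?P0 + ?w)
      (\<lambda>t. (?D t + (?O t - ?O t - (?Kd t)\<^sup>T))\<^sup>T + ((?O t - ?O t - (?Kd t)\<^sup>T)\<^sup>T + ?Q t)\<^sup>T)"
    by (rule delta_cov_add_left[OF delta_cov_swap[OF e0 e0c] delta_cov_swap[OF e1 e1c]
          mat_cont_on_transpose[OF e0c] mat_cont_on_transpose[OF e1c]])
  show ?B
    unfolding we_def
  proof (rule delta_cov_cong[OF W])
    fix t assume t: "t0 E \<le> t"
    have "(Qbar E Px t)\<^sup>T = Qbar E Px t"
      by (simp add: Qbar_def Qhat_def dim_algebra noise_sym[OF t] R_sym[OF t])
    then show "(?D t + (?O t - ?O t - (?Kd t)\<^sup>T))\<^sup>T + ((?O t - ?O t - (?Kd t)\<^sup>T)\<^sup>T + ?Q t)\<^sup>T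
        = Qe E Px t + (cross E Px t + (cross E Px t)\<^sup>T)"
      unfolding Qe_def decor_form[OF t]
      by (simp add: dim_transpose_add dim_transpose_minus decor_form[OF t])
        (rule eq_matI, simp_all del: index_mult_mat(1))
  qed
qed

end

section \<open>Gramians and solutions\<close>

text \<open>A solution of the adjoint equation is carried backwards by the transposed transition matrix.
  So a Gramian form is the integral of a quadratic form along an adjoint solution, and the bounds on
  the Gramian become statements that mention no transition matrix.\<close>

lemma transition_adjoint:
  assumes \<Phi>: "is_transition n T X \<Phi>" and I: "{s..t} \<subseteq> T" "s \<le> t"
    and X: "\<And>r. r \<in> {s..t} \<Longrightarrow> X r \<in> carrier_mat n n"
    and z: "vec_deriv_on {s..t} n z (\<lambda>r. (0\<^sub>m n n - (X r)\<^sup>T) *\<^sub>v z r)"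
  shows "z s = (\<Phi> t s)\<^sup>T *\<^sub>v z t"
proof -
  have sT: "s \<in> T" "t \<in> T" using I by auto
  have \<Phi>c: "\<Phi> r s \<in> carrier_mat n n" if "r \<in> {s..t}" for r
    using \<Phi> sT that I unfolding is_transition_def by blast
  have zc: "z r \<in> carrier_vec n" if "r \<in> {s..t}" for r using z that by (simp add: vec_deriv_on_def)
  have \<Phi>': "mat_deriv_on {s..t} n n (\<lambda>r. \<Phi> r s) (\<lambda>r. X r * \<Phi> r s)"
    unfolding mat_deriv_on_def
  proof (intro ballI conjI allI impI)
    fix r assume r: "r \<in> {s..t}"
    show "\<Phi> r s \<in> carrier_mat n n" "X r * \<Phi> r s \<in> carrier_mat n n"
      using \<Phi>c[OF r] X[OF r] by auto
    fix i j assume ij: "i < n" "j < n"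
    have "mat_has_deriv (\<lambda>r. \<Phi> r s) (X r * \<Phi> r s) r T"
      using \<Phi> sT r I unfolding is_transition_def by blast
    moreover have "dim_row (X r * \<Phi> r s) = n" "dim_col (X r * \<Phi> r s) = n"
      using \<Phi>c[OF r] X[OF r] by auto
    ultimately have "((\<lambda>q. \<Phi> q s $$ (i, j)) has_real_derivative (X r * \<Phi> r s) $$ (i, j)) (at r within T)"
      using ij unfolding mat_has_deriv_def by metis
    then show "((\<lambda>q. \<Phi> q s $$ (i, j)) has_real_derivative (X r * \<Phi> r s) $$ (i, j)) (at r within {s..t})"
      by (rule DERIV_subset[OF _ I(1)])
  qed
  have st: "s \<in> {s..t}" "t \<in> {s..t}" using I(2) by auto
  have key: "u \<bullet> z s = u \<bullet> ((\<Phi> t s)\<^sup>T *\<^sub>v z t)" if u: "u \<in> carrier_vec n" for u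
  proof -
    have u': "vec_deriv_on {s..t} n (\<lambda>_. u) (\<lambda>_. 0\<^sub>v n)" using u by (simp add: vec_deriv_on_def)
    note p' = vec_deriv_on_mult[OF \<Phi>' u']
    have "(\<Phi> s s *\<^sub>v u) \<bullet> z s = (\<Phi> t s *\<^sub>v u) \<bullet> z t"
    proof (rule derivative_zero_imp_equal[OF I(2)])
      fix r assume r: "r \<in> {s..t}"
      have d: "dim_row (X r) = n" "dim_col (X r) = n" "dim_row (\<Phi> r s) = n" "dim_col (\<Phi> r s) = n"
        "dim_vec (z r) = n" "dim_vec u = n" using X[OF r] \<Phi>c[OF r] zc[OF r] u by auto
      have "0\<^sub>m n n *\<^sub>v z r = 0\<^sub>v n" using zc[OF r] by auto
      then have "(X r * \<Phi> r s *\<^sub>v u + \<Phi> r s *\<^sub>v 0\<^sub>v n) \<bullet> z r + (\<Phi> r s *\<^sub>v u) \<bullet> ((0\<^sub>m n n - (X r)\<^sup>T) *\<^sub>v z r) = 0"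
        using d sp_mult_left[of "\<Phi> r s *\<^sub>v u" "X r" "z r"]
        by (simp add: dim_vec_algebra sp_algebra mult_zero_vec sp_zero)
      then show "((\<lambda>q. (\<Phi> q s *\<^sub>v u) \<bullet> z q) has_real_derivative 0) (at r within {s..t})"
        using has_real_derivative_scalar_prod[OF p' z r] by simp
    qed
    moreover have "\<Phi> s s *\<^sub>v u = u" using \<Phi> sT u by (simp add: is_transition_def)
    moreover have "(\<Phi> t s *\<^sub>v u) \<bullet> z t = u \<bullet> ((\<Phi> t s)\<^sup>T *\<^sub>v z t)"
      using \<Phi>c[OF st(2)] zc[OF st(2)] u by (intro sp_mult_left) auto
    ultimately show ?thesis by simp
  qed
  show ?thesis
  proof (rule eq_vecI)
    fix i assume "i < dim_vec ((\<Phi> t s)\<^sup>T *\<^sub>v z t)"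
    then have i: "i < n" using \<Phi>c[OF st(2)] by simp
    have "unit_vec n i \<bullet> z s = z s $ i" using zc[OF st(1)] i by simp
    moreover have "unit_vec n i \<bullet> ((\<Phi> t s)\<^sup>T *\<^sub>v z t) = ((\<Phi> t s)\<^sup>T *\<^sub>v z t) $ i"
      using \<Phi>c[OF st(2)] zc[OF st(2)] i by (intro scalar_prod_left_unit[of _ n]) auto
    ultimately show "z s $ i = ((\<Phi> t s)\<^sup>T *\<^sub>v z t) $ i" using key[of "unit_vec n i"] by simp
  qed (use \<Phi>c[OF st(2)] zc[OF st(1)] in auto)
qed

text \<open>Continuity of the transition matrix in its second argument, needed to integrate the Gramian,
  is read off from the adjoint solutions that are unit vectors at \<open>t\<close>.\<close>

lemma transition_cont_second:
  assumes \<Phi>: "is_transition n T X \<Phi>" and I: "{s..t} \<subseteq> T" "s \<le> t"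
    and X: "mat_cont_on {s..t} X n n"
  shows "mat_cont_on {s..t} (\<lambda>r. (\<Phi> t r)\<^sup>T) n n"
  unfolding mat_cont_on_def
proof (intro conjI ballI allI impI)
  have tT: "t \<in> T" using I by auto
  have c: "\<Phi> t r \<in> carrier_mat n n" if "r \<in> {s..t}" for r
    using \<Phi> that I tT unfolding is_transition_def by blast
  then show "(\<Phi> t r)\<^sup>T \<in> carrier_mat n n" if "r \<in> {s..t}" for r using that by simp
  fix i j assume ij: "i < n" "j < n"
  have F: "mat_cont_on {s..t} (\<lambda>r. 0\<^sub>m n n - (X r)\<^sup>T) n n"
    by (rule mat_cont_on_minus[OF mat_cont_on_const mat_cont_on_transpose[OF X]]) simp
  obtain z where zz: "z t = unit_vec n j \<and> vec_deriv_on {s..t} n z (\<lambda>r. (0\<^sub>m n n - (X r)\<^sup>T) *\<^sub>v z r)"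
    using linear_ode_backward[OF I(2) F, of "unit_vec n j"] by auto
  note zt = conjunct1[OF zz] and z = conjunct2[OF zz]
  have e: "z r $ i = (\<Phi> t r)\<^sup>T $$ (i, j)" if r: "r \<in> {s..t}" for r
  proof -
    have sub: "{r..t} \<subseteq> {s..t}" "r \<le> t" using r by auto
    have "z r = (\<Phi> t r)\<^sup>T *\<^sub>v unit_vec n j"
      unfolding zt[symmetric]
      by (rule transition_adjoint[OF \<Phi> subset_trans[OF sub(1) I(1)] sub(2) _ vec_deriv_on_subset[OF z sub(1)]])
        (use sub mat_cont_on_carrier[OF X] in blast)
    then show ?thesis using c[OF r] ij by simp
  qed
  have "continuous_on {s..t} (\<lambda>r. z r $ i)"
    using vec_deriv_on_cont[OF z] ij by (simp add: vec_cont_on_def)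
  then show "continuous_on {s..t} (\<lambda>r. (\<Phi> t r)\<^sup>T $$ (i, j))" by (rule continuous_on_eq) (rule e)
qed

lemma mat_integral_form:
  assumes F: "mat_cont_on {s..t} F n n" and x: "x \<in> carrier_vec n"
  shows "x \<bullet> (mat_integral n {s..t} F *\<^sub>v x) = integral {s..t} (\<lambda>r. x \<bullet> (F r *\<^sub>v x))"
proof -
  have ii: "(\<lambda>r. F r $$ (i, j)) integrable_on {s..t}" if "i < n" "j < n" for i j
    using F that by (intro integrable_continuous_real) (simp add: mat_cont_on_def)
  have ii': "(\<lambda>r. x $ i * x $ j * F r $$ (i, j)) integrable_on {s..t}" if "i < n" "j < n" for i j
    by (rule integrable_on_mult_right[OF ii[OF that]])
  have e: "x \<bullet> (B *\<^sub>v x) = (\<Sum>i<n. \<Sum>j<n. x $ i * x $ j * B $$ (i, j))" if "B \<in> carrier_mat n n" for B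
    using that x by (simp add: scalar_prod_def lessThan_atLeast0 sum_distrib_left mult_ac)
  have "integral {s..t} (\<lambda>r. x \<bullet> (F r *\<^sub>v x)) = integral {s..t} (\<lambda>r. \<Sum>i<n. \<Sum>j<n. x $ i * x $ j * F r $$ (i, j))"
    by (rule integral_cong) (use mat_cont_on_carrier[OF F] e in blast)
  also have "\<dots> = (\<Sum>i<n. integral {s..t} (\<lambda>r. \<Sum>j<n. x $ i * x $ j * F r $$ (i, j)))"
    by (rule Henstock_Kurzweil_Integration.integral_sum)
      (auto intro!: Henstock_Kurzweil_Integration.integrable_sum ii')
  also have "\<dots> = (\<Sum>i<n. \<Sum>j<n. integral {s..t} (\<lambda>r. x $ i * x $ j * F r $$ (i, j)))"
    by (rule sum.cong[OF refl], rule Henstock_Kurzweil_Integration.integral_sum)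
      (auto intro!: ii')
  also have "\<dots> = (\<Sum>i<n. \<Sum>j<n. x $ i * x $ j * mat_integral n {s..t} F $$ (i, j))"
    by (simp add: mat_integral_def)
  also have "\<dots> = x \<bullet> (mat_integral n {s..t} F *\<^sub>v x)"
    by (rule e[symmetric]) (simp add: mat_integral_def)
  finally show ?thesis by simp
qed

lemma gramian_form:
  assumes \<Phi>: "is_transition n T X \<Phi>" and I: "{s..t} \<subseteq> T" "s \<le> t"
    and X: "mat_cont_on {s..t} X n n"
    and Y: "mat_cont_on {s..t} (\<lambda>r. Y r * (Y r)\<^sup>T) n n" "\<And>r. r \<in> {s..t} \<Longrightarrow> Y r \<in> carrier_mat n m"
    and z: "vec_deriv_on {s..t} n z (\<lambda>r. (0\<^sub>m n n - (X r)\<^sup>T) *\<^sub>v z r)"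
  shows "z t \<bullet> (mat_integral n {s..t} (\<lambda>r. \<Phi> t r * Y r * (Y r)\<^sup>T * (\<Phi> t r)\<^sup>T) *\<^sub>v z t)
    = integral {s..t} (\<lambda>r. z r \<bullet> (Y r * (Y r)\<^sup>T *\<^sub>v z r))"
proof -
  note P = transition_cont_second[OF \<Phi> I X]
  let ?F = "\<lambda>r. \<Phi> t r * Y r * (Y r)\<^sup>T * (\<Phi> t r)\<^sup>T"
  have Pc: "\<Phi> t r \<in> carrier_mat n n" if "r \<in> {s..t}" for r
    using mat_cont_on_carrier[OF P that] by simp
  have zc: "z r \<in> carrier_vec n" if "r \<in> {s..t}" for r using z that by (simp add: vec_deriv_on_def)
  have "mat_cont_on {s..t} (\<lambda>r. ((\<Phi> t r)\<^sup>T)\<^sup>T * (Y r * (Y r)\<^sup>T) * (\<Phi> t r)\<^sup>T) n n"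
    by (rule mat_cont_on_mult[OF mat_cont_on_mult[OF mat_cont_on_transpose[OF P] Y(1)] P])
  then have F: "mat_cont_on {s..t} ?F n n"
  proof (rule mat_cont_on_cong)
    fix r assume r: "r \<in> {s..t}"
    have "dim_row (\<Phi> t r) = n" "dim_col (\<Phi> t r) = n" "dim_row (Y r) = n" "dim_col (Y r) = m"
      using Pc[OF r] Y(2)[OF r] by auto
    then show "?F r = ((\<Phi> t r)\<^sup>T)\<^sup>T * (Y r * (Y r)\<^sup>T) * (\<Phi> t r)\<^sup>T" by (simp add: dim_assoc_mult)
  qed
  have "z t \<bullet> (mat_integral n {s..t} ?F *\<^sub>v z t) = integral {s..t} (\<lambda>r. z t \<bullet> (?F r *\<^sub>v z t))"
    by (rule mat_integral_form[OF F zc]) (use I in simp)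
  also have "\<dots> = integral {s..t} (\<lambda>r. z r \<bullet> (Y r * (Y r)\<^sup>T *\<^sub>v z r))"
  proof (rule integral_cong)
    fix r assume r: "r \<in> {s..t}"
    have sub: "{r..t} \<subseteq> {s..t}" "r \<le> t" using r by auto
    have zr: "z r = (\<Phi> t r)\<^sup>T *\<^sub>v z t"
      by (rule transition_adjoint[OF \<Phi> subset_trans[OF sub(1) I(1)] sub(2) _ vec_deriv_on_subset[OF z sub(1)]])
        (use sub mat_cont_on_carrier[OF X] in blast)
    have "dim_row (\<Phi> t r) = n" "dim_col (\<Phi> t r) = n" "dim_row (Y r) = n" "dim_col (Y r) = m" "dim_vec (z t) = n"
      using Pc[OF r] Y(2)[OF r] zc[of t] sub r by auto
    then show "z t \<bullet> (?F r *\<^sub>v z t) = z r \<bullet> (Y r * (Y r)\<^sup>T *\<^sub>v z r)"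
      unfolding zr by (simp add: dim_assoc_mult_vec sp_transpose)
  qed
  finally show ?thesis .
qed

lemma loewner_le_form:
  assumes le: "loewner_le n (\<mu> \<cdot>\<^sub>m 1\<^sub>m n) W" and W: "W \<in> carrier_mat n n" and x: "x \<in> carrier_vec n"
  shows "\<mu> * (x \<bullet> x) \<le> x \<bullet> (W *\<^sub>v x)"
proof -
  have d: "dim_row W = n" "dim_col W = n" "dim_vec x = n" using W x by auto
  have "0 \<le> x \<bullet> ((W - \<mu> \<cdot>\<^sub>m 1\<^sub>m n) *\<^sub>v x)" using le x by (simp add: loewner_le_def psd_def)
  also have "(W - \<mu> \<cdot>\<^sub>m 1\<^sub>m n) *\<^sub>v x = W *\<^sub>v x - \<mu> \<cdot>\<^sub>v x"
  proof -
    have "(\<mu> \<cdot>\<^sub>m 1\<^sub>m n) *\<^sub>v x = \<mu> \<cdot>\<^sub>v x"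
      using d x by (intro eq_vecI) (auto simp: scalar_prod_smult_left)
    then show ?thesis using d by (simp add: dim_minus_mult_vec)
  qed
  also have "x \<bullet> (W *\<^sub>v x - \<mu> \<cdot>\<^sub>v x) = x \<bullet> (W *\<^sub>v x) - \<mu> * (x \<bullet> x)"
    using d by (simp add: sp_minus_right sp_smult_right)
  finally show ?thesis by simp
qed

text \<open>Controllability, without transition matrix: the energy \<open>\<integral> z \<bullet> Y Y\<^sup>T z\<close> collected by an adjoint solution
  over a window dominates its final value.\<close>

lemma ucc_form:
  assumes ucc: "ucc n T X Y" and X: "mat_cont_on T X n n"
    and Y: "mat_cont_on T (\<lambda>r. Y r * (Y r)\<^sup>T) n n" "\<forall>r\<in>T. Y r \<in> carrier_mat n m"
  shows "\<exists>\<epsilon> \<mu>. 0 < \<epsilon> \<and> 0 < \<mu> \<and> (\<forall>t z. {t - \<epsilon>..t} \<subseteq> T \<longrightarrow>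
      vec_deriv_on {t - \<epsilon>..t} n z (\<lambda>r. (0\<^sub>m n n - (X r)\<^sup>T) *\<^sub>v z r) \<longrightarrow>
      \<mu> * (z t \<bullet> z t) \<le> integral {t - \<epsilon>..t} (\<lambda>r. z r \<bullet> (Y r * (Y r)\<^sup>T *\<^sub>v z r)))"
proof -
  obtain \<Phi> where \<Phi>e: "is_transition n T X \<Phi> \<and> (\<exists>\<epsilon>>0. \<exists>\<mu>1>0. \<exists>\<mu>2>0. \<forall>t. {t - \<epsilon>..t} \<subseteq> T \<longrightarrow>
        (let W = mat_integral n {t - \<epsilon>..t} (\<lambda>s. \<Phi> t s * Y s * (Y s)\<^sup>T * (\<Phi> t s)\<^sup>T)
         in loewner_le n (\<mu>1 \<cdot>\<^sub>m 1\<^sub>m n) W \<and> loewner_le n W (\<mu>2 \<cdot>\<^sub>m 1\<^sub>m n)))"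
    using ucc[unfolded ucc_def] by (rule exE)
  note \<Phi> = conjunct1[OF \<Phi>e]
  from conjunct2[OF \<Phi>e] obtain \<epsilon> \<mu> where eps: "0 < \<epsilon>" and mu: "0 < \<mu>"
    and W: "\<And>t. {t - \<epsilon>..t} \<subseteq> T \<Longrightarrow> loewner_le n (\<mu> \<cdot>\<^sub>m 1\<^sub>m n)
      (mat_integral n {t - \<epsilon>..t} (\<lambda>s. \<Phi> t s * Y s * (Y s)\<^sup>T * (\<Phi> t s)\<^sup>T))"
    unfolding Let_def by blast
  show ?thesis
  proof (intro exI conjI allI impI)
    show "0 < \<epsilon>" "0 < \<mu>" by fact+
    fix t z assume I: "{t - \<epsilon>..t} \<subseteq> T" and z: "vec_deriv_on {t - \<epsilon>..t} n z (\<lambda>r. (0\<^sub>m n n - (X r)\<^sup>T) *\<^sub>v z r)"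
    have le: "t - \<epsilon> \<le> t" using eps by simp
    have zt: "z t \<in> carrier_vec n" using z le by (simp add: vec_deriv_on_def)
    have "\<mu> * (z t \<bullet> z t) \<le> z t \<bullet> (mat_integral n {t - \<epsilon>..t} (\<lambda>s. \<Phi> t s * Y s * (Y s)\<^sup>T * (\<Phi> t s)\<^sup>T) *\<^sub>v z t)"
      by (rule loewner_le_form[OF W[OF I] _ zt]) (simp add: mat_integral_def)
    also have "\<dots> = integral {t - \<epsilon>..t} (\<lambda>r. z r \<bullet> (Y r * (Y r)\<^sup>T *\<^sub>v z r))"
      by (rule gramian_form[OF \<Phi> I le mat_cont_on_subset[OF X I] mat_cont_on_subset[OF Y(1) I] _ z]) (use I Y(2) in blast)
    finally show "\<mu> * (z t \<bullet> z t) \<le> integral {t - \<epsilon>..t} (\<lambda>r. z r \<bullet> (Y r * (Y r)\<^sup>T *\<^sub>v z r))" .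
  qed
qed

lemma mat_cont_on_reflect:
  assumes F: "mat_cont_on T F a b"
  shows "mat_cont_on (uminus ` T) (\<lambda>t. F (- t)) a b"
  unfolding mat_cont_on_def
proof (intro conjI ballI allI impI)
  fix t :: real assume "t \<in> uminus ` T"
  then show "F (- t) \<in> carrier_mat a b" using mat_cont_on_carrier[OF F] by auto
next
  fix i j assume "i < a" "j < b"
  then have "continuous_on T (\<lambda>t. F t $$ (i, j))" using F by (simp add: mat_cont_on_def)
  then show "continuous_on (uminus ` T) (\<lambda>t. F (- t) $$ (i, j))"
    by (rule continuous_on_compose2) (auto intro: continuous_intros)
qed

text \<open>Observability is controllability of the dual pair, with time reflected.  Reflection turns adjoint
  solutions of the dual pair into solutions of the state equation.\<close>

lemma uco_form:
  assumes uco: "uco n T X Z" and X: "mat_cont_on T X n n" and Z: "mat_cont_on T Z m n"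
  shows "\<exists>\<epsilon> \<mu>. 0 < \<epsilon> \<and> 0 < \<mu> \<and> (\<forall>s x. {s..s + \<epsilon>} \<subseteq> T \<longrightarrow>
      vec_deriv_on {s..s + \<epsilon>} n x (\<lambda>r. X r *\<^sub>v x r) \<longrightarrow>
      \<mu> * (x s \<bullet> x s) \<le> integral {s..s + \<epsilon>} (\<lambda>r. (Z r *\<^sub>v x r) \<bullet> (Z r *\<^sub>v x r)))"
proof -
  let ?T = "uminus ` T" and ?X = "\<lambda>\<tau>. (X (- \<tau>))\<^sup>T" and ?Y = "\<lambda>\<tau>. (Z (- \<tau>))\<^sup>T"
  have ZR: "mat_cont_on ?T (\<lambda>\<tau>. Z (- \<tau>)) m n" by (rule mat_cont_on_reflect[OF Z])
  have Xc: "mat_cont_on ?T ?X n n" by (rule mat_cont_on_transpose[OF mat_cont_on_reflect[OF X]])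
  have Yc: "mat_cont_on ?T (\<lambda>\<tau>. ?Y \<tau> * (?Y \<tau>)\<^sup>T) n n"
    by (rule mat_cont_on_mult[OF mat_cont_on_transpose[OF ZR] mat_cont_on_transpose[OF mat_cont_on_transpose[OF ZR]]])
  have Yd: "\<forall>\<tau>\<in>?T. ?Y \<tau> \<in> carrier_mat n m" using mat_cont_on_carrier[OF ZR] by (intro ballI) (rule transpose_carrier_mat[THEN iffD2])
  obtain \<epsilon> \<mu> where em: "0 < \<epsilon> \<and> 0 < \<mu> \<and> (\<forall>t z. {t - \<epsilon>..t} \<subseteq> ?T \<longrightarrow>
      vec_deriv_on {t - \<epsilon>..t} n z (\<lambda>r. (0\<^sub>m n n - (?X r)\<^sup>T) *\<^sub>v z r) \<longrightarrow>
      \<mu> * (z t \<bullet> z t) \<le> integral {t - \<epsilon>..t} (\<lambda>r. z r \<bullet> (?Y r * (?Y r)\<^sup>T *\<^sub>v z r)))"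
    using ucc_form[OF uco[unfolded uco_def] Xc Yc Yd] by (elim exE)
  note g = em[THEN conjunct2, THEN conjunct2, rule_format]
  show ?thesis
  proof (intro exI conjI allI impI)
    show "0 < \<epsilon>" "0 < \<mu>" using em by simp_all
    fix s x assume I: "{s..s + \<epsilon>} \<subseteq> T" and x: "vec_deriv_on {s..s + \<epsilon>} n x (\<lambda>r. X r *\<^sub>v x r)"
    have win: "{- s - \<epsilon>..- s} = uminus ` {s..s + \<epsilon>}" by simp
    have J: "{- s - \<epsilon>..- s} \<subseteq> ?T" unfolding win using I by (rule image_mono)
    have xc: "x r \<in> carrier_vec n" if "r \<in> {s..s + \<epsilon>}" for r using x that by (simp add: vec_deriv_on_def)
    have neg: "- r \<in> {s..s + \<epsilon>}" if "r \<in> {- s - \<epsilon>..- s}" for r using that by auto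
    have dims: "dim_row (X (- r)) = n" "dim_col (X (- r)) = n" "dim_row (Z (- r)) = m" "dim_col (Z (- r)) = n" "dim_vec (x (- r)) = n"
      if "r \<in> {- s - \<epsilon>..- s}" for r
    proof -
      have "- r \<in> T" using neg[OF that] I by blast
      then show "dim_row (X (- r)) = n" "dim_col (X (- r)) = n" "dim_row (Z (- r)) = m" "dim_col (Z (- r)) = n"
        using mat_cont_on_carrier[OF X] mat_cont_on_carrier[OF Z] by blast+
      show "dim_vec (x (- r)) = n" using xc[OF neg[OF that]] by simp
    qed
    have z: "vec_deriv_on {- s - \<epsilon>..- s} n (\<lambda>r. x (- r)) (\<lambda>r. (0\<^sub>m n n - (?X r)\<^sup>T) *\<^sub>v x (- r))"
      unfolding vec_deriv_on_def
    proof (intro ballI conjI allI impI)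
      fix r assume r: "r \<in> {- s - \<epsilon>..- s}"
      note d = dims[OF r]
      show "x (- r) \<in> carrier_vec n" by (rule xc[OF neg[OF r]])
      show "(0\<^sub>m n n - (?X r)\<^sup>T) *\<^sub>v x (- r) \<in> carrier_vec n" by (rule carrier_vecI) (simp add: d)
      fix i assume i: "i < n"
      have "((\<lambda>q. x q $ i) has_real_derivative (X (- r) *\<^sub>v x (- r)) $ i) (at (- r) within uminus ` {- s - \<epsilon>..- s})"
      proof -
        have "uminus ` {- s - \<epsilon>..- s} = {s..s + \<epsilon>}" by simp
        then show ?thesis using x neg[OF r] i unfolding vec_deriv_on_def by metis
      qed
      moreover have "(uminus has_real_derivative - 1) (at r within {- s - \<epsilon>..- s})"
        by (auto intro!: derivative_eq_intros)
      ultimately have "((\<lambda>q. x q $ i) \<circ> uminus has_real_derivative (X (- r) *\<^sub>v x (- r)) $ i * - 1) (at r within {- s - \<epsilon>..- s})"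
        by (rule DERIV_image_chain)
      moreover have "((0\<^sub>m n n - (?X r)\<^sup>T) *\<^sub>v x (- r)) $ i = - (X (- r) *\<^sub>v x (- r)) $ i"
        using d i by (simp add: scalar_prod_def sum_negf)
      ultimately show "((\<lambda>q. x (- q) $ i) has_real_derivative ((0\<^sub>m n n - (?X r)\<^sup>T) *\<^sub>v x (- r)) $ i) (at r within {- s - \<epsilon>..- s})"
        by (simp add: o_def)
    qed
    have "\<mu> * (x (- (- s)) \<bullet> x (- (- s))) \<le> integral {- s - \<epsilon>..- s} (\<lambda>r. x (- r) \<bullet> (?Y r * (?Y r)\<^sup>T *\<^sub>v x (- r)))"
      by (rule g[OF J z])
    also have "\<dots> = integral {- s - \<epsilon>..- s} (\<lambda>r. (Z (- r) *\<^sub>v x (- r)) \<bullet> (Z (- r) *\<^sub>v x (- r)))"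
    proof (rule integral_cong)
      fix r assume r: "r \<in> {- s - \<epsilon>..- s}"
      note d = dims[OF r]
      show "x (- r) \<bullet> (?Y r * (?Y r)\<^sup>T *\<^sub>v x (- r)) = (Z (- r) *\<^sub>v x (- r)) \<bullet> (Z (- r) *\<^sub>v x (- r))"
        using d sp_mult_left[of "x (- r)" "Z (- r)" "Z (- r) *\<^sub>v x (- r)"] by (simp add: dim_assoc_mult_vec)
    qed
    also have "\<dots> = integral {s..s + \<epsilon>} (\<lambda>r. (Z r *\<^sub>v x r) \<bullet> (Z r *\<^sub>v x r))"
      using Henstock_Kurzweil_Integration.integral_reflect_real[of "s + \<epsilon>" s "\<lambda>r. (Z r *\<^sub>v x r) \<bullet> (Z r *\<^sub>v x r)"]
      by simp
    finally show "\<mu> * (x s \<bullet> x s) \<le> integral {s..s + \<epsilon>} (\<lambda>r. (Z r *\<^sub>v x r) \<bullet> (Z r *\<^sub>v x r))" by simp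
  qed
qed

section \<open>The variance equation as a Riccati equation\<close>

text \<open>The form of \<open>N\<close> is constant along pairs of solutions of the adjoint equation, which reach every pair
  of vectors at time \<open>t\<close>.\<close>

lemma linear_lyapunov_zero:
  assumes A: "mat_cont_on {s..} A n n" and N: "mat_deriv_on {s..} n n N (\<lambda>t. A t * N t + N t * (A t)\<^sup>T)"
    and N0: "N s = 0\<^sub>m n n" and t: "s \<le> t"
  shows "N t = 0\<^sub>m n n"
proof (rule mat_eq_0_if_form_0)
  show "N t \<in> carrier_mat n n" using N t by (simp add: mat_deriv_on_def)
  fix x y :: "real vec" assume x: "x \<in> carrier_vec n" and y: "y \<in> carrier_vec n"
  have sub: "{s..t} \<subseteq> {s..}" by auto
  note AS = mat_cont_on_subset[OF A sub]
  have F: "mat_cont_on {s..t} (\<lambda>r. 0\<^sub>m n n - (A r)\<^sup>T) n n"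
    by (rule mat_cont_on_minus[OF mat_cont_on_const mat_cont_on_transpose[OF AS]]) simp
  obtain z where zz: "z t = x \<and> vec_deriv_on {s..t} n z (\<lambda>r. (0\<^sub>m n n - (A r)\<^sup>T) *\<^sub>v z r)"
    using linear_ode_backward[OF t F x] by (rule exE)
  obtain w where ww: "w t = y \<and> vec_deriv_on {s..t} n w (\<lambda>r. (0\<^sub>m n n - (A r)\<^sup>T) *\<^sub>v w r)"
    using linear_ode_backward[OF t F y] by (rule exE)
  note z = conjunct2[OF zz] and w = conjunct2[OF ww]
  note Nw = vec_deriv_on_mult[OF mat_deriv_on_subset[OF N sub] w]
  have "z s \<bullet> (N s *\<^sub>v w s) = z t \<bullet> (N t *\<^sub>v w t)"
  proof (rule derivative_zero_imp_equal[OF t])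
    fix r assume r: "r \<in> {s..t}"
    have c: "A r \<in> carrier_mat n n" "N r \<in> carrier_mat n n" "z r \<in> carrier_vec n" "w r \<in> carrier_vec n"
      using mat_cont_on_carrier[OF AS r] N z w r by (simp_all add: mat_deriv_on_def vec_deriv_on_def)
    then have d: "dim_row (A r) = n" "dim_col (A r) = n" "dim_row (N r) = n" "dim_col (N r) = n"
      "dim_vec (z r) = n" "dim_vec (w r) = n" by auto
    have "0\<^sub>m n n *\<^sub>v z r = 0\<^sub>v n" "0\<^sub>m n n *\<^sub>v w r = 0\<^sub>v n" using c by auto
    then have "((0\<^sub>m n n - (A r)\<^sup>T) *\<^sub>v z r) \<bullet> (N r *\<^sub>v w r)
        + z r \<bullet> ((A r * N r + N r * (A r)\<^sup>T) *\<^sub>v w r + N r *\<^sub>v ((0\<^sub>m n n - (A r)\<^sup>T) *\<^sub>v w r)) = 0"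
      using d by (simp add: dim_vec_algebra sp_algebra sp_transpose mult_zero_vec sp_zero)
    then show "((\<lambda>q. z q \<bullet> (N q *\<^sub>v w q)) has_real_derivative 0) (at r within {s..t})"
      using has_real_derivative_scalar_prod[OF z Nw r] by simp
  qed
  moreover have "z s \<bullet> (N s *\<^sub>v w s) = 0"
  proof -
    have "z s \<in> carrier_vec n" "w s \<in> carrier_vec n" using z w t by (simp_all add: vec_deriv_on_def)
    moreover from this have "0\<^sub>m n n *\<^sub>v w s = 0\<^sub>v n" by auto
    ultimately show ?thesis by (simp add: N0)
  qed
  ultimately show "x \<bullet> (N t *\<^sub>v y) = 0" using zz ww by simp
qed

lemma uas_cong:
  assumes "uas n s F" "\<And>t. s \<le> t \<Longrightarrow> F t = G t"
  shows "uas n s G"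
proof -
  have "lin_solution n F r x = lin_solution n G r x" if "s \<le> r" for r x
    using assms(2) that by (auto simp: lin_solution_def)
  then show ?thesis using assms(1) unfolding uas_def by simp
qed

text \<open>The form of \<open>P\<close> at \<open>x\<close> is the second moment of \<open>x \<bullet> e\<close>.\<close>

lemma covariance_psd:
  assumes P: "P \<in> carrier_mat n n"
    and i: "\<And>i j. i < n \<Longrightarrow> j < n \<Longrightarrow> integrable M (\<lambda>\<omega>. e \<omega> $ i * e \<omega> $ j)"
      "\<And>i j. i < n \<Longrightarrow> j < n \<Longrightarrow> (\<integral>\<omega>. e \<omega> $ i * e \<omega> $ j \<partial>M) = (P $$ (i, j) :: real)"
  shows "psd n P"
  unfolding psd_def
proof (intro conjI ballI)
  show "P \<in> carrier_mat n n" by fact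
  show "P\<^sup>T = P"
  proof (rule eq_matI)
    fix k l assume "k < dim_row P" "l < dim_col P"
    then have kl: "k < n" "l < n" using P by auto
    have "P $$ (l, k) = P $$ (k, l)"
      unfolding i(2)[OF kl(2) kl(1), symmetric] i(2)[OF kl, symmetric] by (simp add: mult.commute)
    then show "P\<^sup>T $$ (k, l) = P $$ (k, l)" using P kl by simp
  qed (use P in auto)
  fix x :: "real vec" assume x: "x \<in> carrier_vec n"
  have "x \<bullet> (P *\<^sub>v x) = (\<Sum>k<n. \<Sum>l<n. x $ k * x $ l * P $$ (k, l))"
    using P x by (simp add: scalar_prod_def lessThan_atLeast0 sum_distrib_left mult_ac)
  also have "\<dots> = (\<Sum>k<n. \<Sum>l<n. \<integral>\<omega>. x $ k * x $ l * (e \<omega> $ k * e \<omega> $ l) \<partial>M)"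
    by (intro sum.cong refl) (simp add: i(2))
  also have "\<dots> = (\<integral>\<omega>. (\<Sum>k<n. \<Sum>l<n. x $ k * x $ l * (e \<omega> $ k * e \<omega> $ l)) \<partial>M)"
  proof -
    have ii: "integrable M (\<lambda>\<omega>. x $ k * x $ l * (e \<omega> $ k * e \<omega> $ l))" if "k < n" "l < n" for k l
      by (rule integrable_mult_right) (rule i(1)[OF that])
    have "(\<integral>\<omega>. (\<Sum>k<n. \<Sum>l<n. x $ k * x $ l * (e \<omega> $ k * e \<omega> $ l)) \<partial>M)
        = (\<Sum>k<n. \<integral>\<omega>. (\<Sum>l<n. x $ k * x $ l * (e \<omega> $ k * e \<omega> $ l)) \<partial>M)"
      by (rule Bochner_Integration.integral_sum, rule Bochner_Integration.integrable_sum, rule ii) simp_all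
    also have "\<dots> = (\<Sum>k<n. \<Sum>l<n. \<integral>\<omega>. x $ k * x $ l * (e \<omega> $ k * e \<omega> $ l) \<partial>M)"
      by (rule sum.cong[OF refl], rule Bochner_Integration.integral_sum, rule ii) simp_all
    finally show ?thesis by simp
  qed
  also have "\<dots> = (\<integral>\<omega>. (\<Sum>k<n. x $ k * e \<omega> $ k)\<^sup>2 \<partial>M)"
    by (rule Bochner_Integration.integral_cong[OF refl])
      (simp add: power2_eq_square sum_product mult_ac)
  also have "0 \<le> \<dots>" by (rule Bochner_Integration.integral_nonneg) simp
  finally show "0 \<le> x \<bullet> (P *\<^sub>v x)" .
qed

context elise
begin

text \<open>The information rate of the output, the matrix of the quadratic term of the Riccati equation.\<close>

definition information where "information t = (C2 E t)\<^sup>T * minv (R2 E t) * C2 E t"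

lemma information_dims [simp]: "dim_row (information t) = nx E" "dim_col (information t) = nx E"
  by (simp_all add: information_def)

lemma information_cont: "mat_cont_on (horizon E) information (nx E) (nx E)"
  unfolding information_def[abs_def] by (rule filter_cont_intros cont_R2_inv)+

lemma gain_split:
  assumes "dim_row (P t) = nx E" "dim_col (P t) = nx E"
  shows "gain E Px P t = P t * (C2 E t)\<^sup>T * minv (R2 E t) - decor E Px t"
  using assms by (simp add: gain_def decor_def dim_algebra)

text \<open>The variance equation is a Riccati equation in the usual form only for symmetric \<open>P\<close>.
  Symmetry propagates because the skew part obeys a linear homogeneous equation.\<close>

lemma riccati_symmetric:
  assumes P: "solves_riccati E Px P" and s: "(P (t0 E))\<^sup>T = P (t0 E)" and t: "t0 E \<le> t"
  shows "(P t)\<^sup>T = P t"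
proof -
  note D = riccati_deriv[OF P]
  have Pd: "dim_row (P r) = nx E" "dim_col (P r) = nx E" if "t0 E \<le> r" for r
    using P that by (auto simp: solves_riccati_def)
  have "P t - (P t)\<^sup>T = 0\<^sub>m (nx E) (nx E)"
  proof (rule linear_lyapunov_zero[OF cont_bar(2) _ _ t])
    show "mat_deriv_on (horizon E) (nx E) (nx E) (\<lambda>r. P r - (P r)\<^sup>T)
      (\<lambda>r. Abar E Px r * (P r - (P r)\<^sup>T) + (P r - (P r)\<^sup>T) * (Abar E Px r)\<^sup>T)"
    proof (rule mat_deriv_on_cong[OF mat_deriv_on_minus[OF D mat_deriv_on_transpose[OF D]]])
      fix r assume "r \<in> horizon E"
      then have r: "t0 E \<le> r" by simp
      have Q: "(Qbar E Px r)\<^sup>T = Qbar E Px r"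
        by (simp add: Qbar_def Qhat_def dim_algebra noise_sym[OF r] R_sym[OF r])
      let ?g = "gain E Px P r * R2 E r * (gain E Px P r)\<^sup>T"
      have g: "?g\<^sup>T = ?g" by (simp add: dim_algebra R2_sym[OF r])
      have T: "(Abar E Px r * P r + P r * (Abar E Px r)\<^sup>T + Qbar E Px r - ?g)\<^sup>T
          = (P r)\<^sup>T * (Abar E Px r)\<^sup>T + Abar E Px r * (P r)\<^sup>T + Qbar E Px r - ?g"
        using Pd[OF r] by (simp add: dim_transpose_minus[of _ ?g] dim_transpose_add g Q dim_transpose_mult[of "Abar E Px r"]
            dim_transpose_mult[of "P r"])
      show "(Abar E Px r * P r + P r * (Abar E Px r)\<^sup>T + Qbar E Px r - ?g)
          - (Abar E Px r * P r + P r * (Abar E Px r)\<^sup>T + Qbar E Px r - ?g)\<^sup>T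
        = Abar E Px r * (P r - (P r)\<^sup>T) + (P r - (P r)\<^sup>T) * (Abar E Px r)\<^sup>T"
        unfolding T using Pd[OF r]
        by (simp add: dim_mult_minus dim_minus_mult) (rule eq_matI, simp_all del: index_mult_mat(1))
    qed
    show "P (t0 E) - (P (t0 E))\<^sup>T = 0\<^sub>m (nx E) (nx E)"
      unfolding s using Pd[of "t0 E"] by (intro eq_matI) simp_all
  qed
  then have *: "(P t - (P t)\<^sup>T) $$ (i, j) = 0\<^sub>m (nx E) (nx E) $$ (i, j)" for i j by simp
  show ?thesis
  proof (rule eq_matI)
    fix i j assume "i < dim_row (P t)" "j < dim_col (P t)"
    then show "(P t)\<^sup>T $$ (i, j) = P t $$ (i, j)" using *[of i j] Pd[OF t] by simp
  qed (simp_all add: Pd[OF t])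
qed

text \<open>Since \<open>L = P C2\<^sup>T R2\<^sup>-\<^sup>1 - decor\<close>, expanding \<open>L R2 L\<^sup>T\<close> gives the quadratic term, two mixed terms that
  turn \<open>Abar\<close> into \<open>Ae\<close>, and the term that turns \<open>Qbar\<close> into \<open>Qe\<close>.\<close>

lemma riccati_standard_form:
  assumes P: "solves_riccati E Px P" and s: "(P (t0 E))\<^sup>T = P (t0 E)"
  shows "mat_deriv_on (horizon E) (nx E) (nx E) P
    (\<lambda>t. Ae E Px t * P t + P t * (Ae E Px t)\<^sup>T + Qe E Px t - P t * information t * P t)"
proof (rule mat_deriv_on_cong[OF riccati_deriv[OF P]])
  fix t assume "t \<in> horizon E"
  then have t: "t0 E \<le> t" by simp
  have Pd: "dim_row (P t) = nx E" "dim_col (P t) = nx E"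
    using P t by (auto simp: solves_riccati_def)
  note PT = riccati_symmetric[OF P s t]
  let ?R = "minv (R2 E t)" and ?S = "G2 E t * (M2 E Px t * (Rg2 E t)\<^sup>T)"
  have g: "gain E Px P t * R2 E t * (gain E Px P t)\<^sup>T
    = P t * (information t * P t) - P t * ((C2 E t)\<^sup>T * (decor E Px t)\<^sup>T) - decor E Px t * (C2 E t * P t)
      + decor E Px t * (R2 E t * (decor E Px t)\<^sup>T)"
  proof -
    have "decor E Px t * R2 E t = ?S"
      by (simp add: decor_def dim_algebra R2_inverse(2)[OF t])
    moreover have "R2 E t * (decor E Px t)\<^sup>T = ?S\<^sup>T"
      by (simp add: decor_def dim_algebra R2_sym[OF t] dim_mult_cancel[OF R2_inverse(1)[OF t]] dim_one_mult)
    ultimately show ?thesis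
      unfolding gain_split[where P = P and t = t, OF Pd]
      by (simp add: Pd PT dim_algebra information_def decor_def R2_sym[OF t] R2_inverse[OF t]
          dim_mult_cancel[OF R2_inverse(1)[OF t]] dim_mult_cancel[OF R2_inverse(2)[OF t]])
        (rule eq_matI, simp_all add: Pd del: index_mult_mat(1))
  qed
  have q: "Qe E Px t = Qbar E Px t - decor E Px t * (R2 E t * (decor E Px t)\<^sup>T)"
    unfolding Qe_def decor_form(3)[OF t] decor_form(1)[OF t] ..
  show "Abar E Px t * P t + P t * (Abar E Px t)\<^sup>T + Qbar E Px t - gain E Px P t * R2 E t * (gain E Px P t)\<^sup>T
    = Ae E Px t * P t + P t * (Ae E Px t)\<^sup>T + Qe E Px t - P t * information t * P t"
    unfolding g q Ae_def
    by (simp add: Pd dim_algebra) (rule eq_matI, simp_all add: Pd del: index_mult_mat(1))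
qed

text \<open>\<open>C2 = U2\<^sup>T C\<close>, where \<open>C\<close> is bounded and \<open>U2\<close> has orthonormal columns.\<close>

lemma C2_bounded: "\<exists>c\<ge>0. \<forall>t\<ge>t0 E. \<forall>x\<in>carrier_vec (nx E). vnorm (C2 E t *\<^sub>v x) \<le> c * vnorm x"
proof -
  obtain k where k: "\<forall>t\<in>horizon E. mnorm (Cm E t) \<le> k"
    using standing by (auto simp: standing_assms_def msmooth_bounded_def)
  have "vnorm (C2 E t *\<^sub>v x) \<le> max 0 k * vnorm x" if t: "t0 E \<le> t" and x: "x \<in> carrier_vec (nx E)" for t x
  proof -
    have dx: "dim_vec x = nx E" using x by simp
    have U: "vnorm ((U2 E t)\<^sup>T *\<^sub>v y) \<le> 1 * vnorm y" if y: "y \<in> carrier_vec (ny E)" for y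
    proof (rule transpose_norm_bound[OF _ _ _ y])
      show "U2 E t \<in> carrier_mat (ny E) (ny E - rH E)" by (rule carrier_matI) simp_all
      fix u :: "real vec" assume "u \<in> carrier_vec (ny E - rH E)"
      then have u: "dim_vec u = ny E - rH E" by simp
      have "(U2 E t *\<^sub>v u) \<bullet> (U2 E t *\<^sub>v u) = u \<bullet> (((U2 E t)\<^sup>T * U2 E t) *\<^sub>v u)"
        using u by (simp add: sp_mult_left dim_assoc_mult_vec)
      also have "\<dots> = u \<bullet> u" using u by (simp add: U_blocks(4)[OF t] dim_one_mult_vec)
      finally show "vnorm (U2 E t *\<^sub>v u) \<le> 1 * vnorm u" by (simp add: vnorm_def)
    qed simp
    have "C2 E t *\<^sub>v x = (U2 E t)\<^sup>T *\<^sub>v (Cm E t *\<^sub>v x)"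
      using dx by (simp add: C2_def T2_def dim_assoc_mult_vec)
    then have "vnorm (C2 E t *\<^sub>v x) \<le> vnorm (Cm E t *\<^sub>v x)"
      using U[OF carrier_vecI[of "Cm E t *\<^sub>v x" "ny E"]] by simp
    also have "\<dots> \<le> mnorm (Cm E t) * vnorm x" using dx by (intro vnorm_mult_le_mnorm) simp
    also have "\<dots> \<le> max 0 k * vnorm x" using k t by (intro mult_right_mono max.coboundedI2) auto
    finally show ?thesis .
  qed
  then show ?thesis by (intro exI[of _ "max 0 k"]) auto
qed

text \<open>The assumptions on the equivalent system are those of the abstract Riccati equation with \<open>Q = Qe\<close>
  and \<open>K = C2\<^sup>T R2\<^sup>-\<^sup>1 C2\<close>: the two bounds on \<open>R2\<close> give an upper bound for \<open>K\<close> and let the output energy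
  be measured by \<open>K\<close>, at the price of a factor \<open>\<beta>\<close> in the observability constant.\<close>

theorem filter_stability:
  assumes P0: "psd (nx E) (Px (t0 E))"
    and obs: "uco (nx E) (horizon E) (Ae E Px) (C2 E)"
    and root: "\<forall>t\<ge>t0 E. is_psd_sqrt (nx E) (Qe E Px t) (Qh t)"
    and ctrl: "ucc (nx E) (horizon E) (Ae E Px) Qh"
    and Qb: "norm_bounded_below_above (horizon E) (Qe E Px)"
    and Rb: "norm_bounded_below_above (horizon E) (R2 E)"
    and Rp: "uniformly_pd (ny E - rH E) (horizon E) (R2 E)"
    and bounded: "\<forall>t\<ge>t0 E. mnorm (Ae E Px t) \<le> \<alpha>"
  shows "filter_uas E Px"
    and "\<And>P. solves_riccati E Px P \<Longrightarrow> psd (nx E) (P (t0 E)) \<Longrightarrow> approaches P Px"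
proof -
  let ?n = "nx E" and ?l = "ny E - rH E"
  note Qh = root[rule_format] and Ab = bounded[rule_format]
  obtain q where q: "\<And>t. t0 E \<le> t \<Longrightarrow> mnorm (Qe E Px t) \<le> q"
    using Qb unfolding norm_bounded_below_above_def by auto
  obtain \<beta> where b: "0 < \<beta>" "\<And>t. t0 E \<le> t \<Longrightarrow> mnorm (R2 E t) \<le> \<beta>"
    using Rb unfolding norm_bounded_below_above_def by auto
  obtain \<rho> where r0: "0 < \<rho>" and rle: "\<And>t. t0 E \<le> t \<Longrightarrow> loewner_le ?l (\<rho> \<cdot>\<^sub>m 1\<^sub>m ?l) (R2 E t)"
    using Rp unfolding uniformly_pd_def by auto
  obtain c where c': "c \<ge> 0 \<and> (\<forall>t\<ge>t0 E. \<forall>x\<in>carrier_vec ?n. vnorm (C2 E t *\<^sub>v x) \<le> c * vnorm x)"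
    using C2_bounded by (rule exE)
  note c = conjunct1[OF c'] conjunct2[OF c', rule_format]
  have Qpsd: "psd ?n (Qe E Px t)" and QhT: "Qh t * (Qh t)\<^sup>T = Qe E Px t" and Qhc: "Qh t \<in> carrier_mat ?n ?n"
    if t: "t0 E \<le> t" for t
  proof -
    have h: "Qh t \<in> carrier_mat ?n ?n" "(Qh t)\<^sup>T = Qh t" "Qh t * Qh t = Qe E Px t"
      using Qh[OF t] by (simp_all add: is_psd_sqrt_def psd_def)
    show "Qh t * (Qh t)\<^sup>T = Qe E Px t" "Qh t \<in> carrier_mat ?n ?n" using h by simp_all
    have d: "dim_row (Qh t) = ?n" "dim_col (Qh t) = ?n" using h by auto
    show "psd ?n (Qe E Px t)"
      unfolding psd_def
    proof (intro conjI ballI)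
      show "Qe E Px t \<in> carrier_mat ?n ?n" by (rule carrier_matI) simp_all
      show "(Qe E Px t)\<^sup>T = Qe E Px t" unfolding h(3)[symmetric] using d h(2) by (simp add: dim_transpose_mult)
      fix x :: "real vec" assume "x \<in> carrier_vec ?n"
      then have dx: "dim_vec x = ?n" by simp
      have "x \<bullet> (Qe E Px t *\<^sub>v x) = (Qh t *\<^sub>v x) \<bullet> (Qh t *\<^sub>v x)"
        unfolding h(3)[symmetric] using d dx h(2) by (simp add: dim_assoc_mult_vec sp_mult_left)
      then show "0 \<le> x \<bullet> (Qe E Px t *\<^sub>v x)" by (simp add: sp_self_nonneg)
    qed
  qed
  have Rinv: "vnorm (minv (R2 E t) *\<^sub>v y) \<le> 1 / \<rho> * vnorm y" "y \<bullet> y \<le> \<beta> * (y \<bullet> (minv (R2 E t) *\<^sub>v y))"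
    if t: "t0 E \<le> t" and y: "y \<in> carrier_vec ?l" for t y
  proof -
    have dy: "dim_vec y = ?l" using y by simp
    let ?u = "minv (R2 E t) *\<^sub>v y"
    have u: "?u \<in> carrier_vec ?l" by (rule carrier_vecI) simp
    have Rc: "R2 E t \<in> carrier_mat ?l ?l" by (rule carrier_matI) simp_all
    have Ru: "R2 E t *\<^sub>v ?u = y"
      using dy by (simp add: dim_assoc_mult_vec[symmetric] R2_inverse[OF t] dim_one_mult_vec)
    have "\<rho> * (?u \<bullet> ?u) \<le> ?u \<bullet> y" using loewner_le_form[OF rle[OF t] Rc u] by (simp add: Ru)
    also have "\<dots> \<le> vnorm ?u * vnorm y" using Cauchy_Schwarz_vec[of ?u y] dy by simp
    finally have "\<rho> * vnorm ?u * vnorm ?u \<le> vnorm y * vnorm ?u"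
      by (simp add: vnorm_sq[symmetric] power2_eq_square mult_ac)
    then have "\<rho> * vnorm ?u \<le> vnorm y"
      by (cases "vnorm ?u = 0") (auto simp: less_le)
    then show "vnorm ?u \<le> 1 / \<rho> * vnorm y" using r0 by (simp add: field_simps)
    have "(vnorm (R2 E t *\<^sub>v ?u))\<^sup>2 \<le> \<beta> * (?u \<bullet> (R2 E t *\<^sub>v ?u))"
    proof (rule psd_norm_sq_le_form[OF pd_imp_psd[OF R2_pd[OF t]] u])
      fix x :: "real vec" assume x: "x \<in> carrier_vec ?l"
      have "vnorm (R2 E t *\<^sub>v x) \<le> mnorm (R2 E t) * vnorm x" using x by (intro vnorm_mult_le_mnorm) simp
      also have "\<dots> \<le> \<beta> * vnorm x" using b(2)[OF t] by (intro mult_right_mono) simp_all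
      finally show "vnorm (R2 E t *\<^sub>v x) \<le> \<beta> * vnorm x" .
    qed
    then show "y \<bullet> y \<le> \<beta> * (y \<bullet> ?u)" using dy sp_comm[of ?u y] by (simp add: Ru vnorm_sq)
  qed
  have Kform: "x \<bullet> (information t *\<^sub>v x) = (C2 E t *\<^sub>v x) \<bullet> (minv (R2 E t) *\<^sub>v (C2 E t *\<^sub>v x))"
    if "dim_vec x = ?n" for t x
    using that sp_mult_left[of x "C2 E t" "minv (R2 E t) *\<^sub>v (C2 E t *\<^sub>v x)"]
    by (simp add: information_def dim_assoc_mult_vec)
  have bnd: "vnorm (B *\<^sub>v x) \<le> max 0 k * vnorm x" if "mnorm B \<le> k" "dim_vec x = dim_col B" for B x k
  proof -
    have "vnorm (B *\<^sub>v x) \<le> mnorm B * vnorm x" by (rule vnorm_mult_le_mnorm[OF that(2)])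
    also have "\<dots> \<le> max 0 k * vnorm x" using that(1) by (intro mult_right_mono) auto
    finally show ?thesis .
  qed
  interpret R: riccati ?n "t0 E" "Ae E Px" "Qe E Px" information "max 0 \<alpha>" "max 0 q" "c * (1 / \<rho> * c)"
  proof
    show "mat_cont_on {t0 E..} (Ae E Px) ?n ?n" "mat_cont_on {t0 E..} (Qe E Px) ?n ?n" by (rule cont_equivalent)+
    show "mat_cont_on {t0 E..} information ?n ?n" by (rule information_cont)
    show "0 \<le> max 0 \<alpha>" "0 \<le> max 0 q" "0 \<le> c * (1 / \<rho> * c)" using c r0 by auto
    fix t assume t: "t0 E \<le> t"
    show "psd ?n (Qe E Px t)" by (rule Qpsd[OF t])
    show "psd ?n (information t)"
      unfolding psd_def
    proof (intro conjI ballI)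
      show "information t \<in> carrier_mat ?n ?n" by (rule carrier_matI) simp_all
      show "(information t)\<^sup>T = information t" by (simp add: information_def dim_algebra R2_sym[OF t])
      fix x :: "real vec" assume "x \<in> carrier_vec ?n"
      then have dx: "dim_vec x = ?n" by simp
      have "C2 E t *\<^sub>v x \<in> carrier_vec ?l" by (rule carrier_vecI) simp
      then show "0 \<le> x \<bullet> (information t *\<^sub>v x)"
        unfolding Kform[OF dx] using pd_imp_psd[OF pd_minv[OF R2_pd[OF t]]] by (simp add: psd_def)
    qed
    fix x :: "real vec" assume x: "x \<in> carrier_vec ?n"
    then have dx: "dim_vec x = ?n" by simp
    show "vnorm (Ae E Px t *\<^sub>v x) \<le> max 0 \<alpha> * vnorm x" by (rule bnd[OF Ab[OF t]]) (simp add: dx)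
    show "vnorm (Qe E Px t *\<^sub>v x) \<le> max 0 q * vnorm x" by (rule bnd[OF q[OF t]]) (simp add: dx)
    have Cc: "C2 E t \<in> carrier_mat ?l ?n" by (rule carrier_matI) simp_all
    have Cx: "C2 E t *\<^sub>v x \<in> carrier_vec ?l" by (rule carrier_vecI) simp
    let ?u = "minv (R2 E t) *\<^sub>v (C2 E t *\<^sub>v x)"
    have u: "?u \<in> carrier_vec ?l" by (rule carrier_vecI) simp
    have "information t *\<^sub>v x = (C2 E t)\<^sup>T *\<^sub>v ?u" using dx by (simp add: information_def dim_assoc_mult_vec)
    then have "vnorm (information t *\<^sub>v x) \<le> c * vnorm ?u"
      using transpose_norm_bound[OF Cc c(1) c(2)[OF t] u] by simp
    also have "\<dots> \<le> c * (1 / \<rho> * (c * vnorm x))"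
      using Rinv(1)[OF t Cx] c(2)[OF t x] r0 c(1)
      by (intro mult_left_mono) (auto intro: order_trans[OF _ divide_right_mono])
    finally show "vnorm (information t *\<^sub>v x) \<le> c * (1 / \<rho> * c) * vnorm x" by (simp add: mult.assoc)
  qed
  have Qcont: "mat_cont_on (horizon E) (\<lambda>t. Qh t * (Qh t)\<^sup>T) ?n ?n"
    by (rule mat_cont_on_cong[OF cont_equivalent(2)]) (simp add: QhT)
  have Qhc': "\<forall>t\<in>horizon E. Qh t \<in> carrier_mat ?n ?n" using Qhc by simp
  obtain \<epsilon> \<mu> where em': "0 < \<epsilon> \<and> 0 < \<mu> \<and> (\<forall>t z. {t - \<epsilon>..t} \<subseteq> horizon E \<longrightarrow>
      vec_deriv_on {t - \<epsilon>..t} ?n z (\<lambda>r. (0\<^sub>m ?n ?n - (Ae E Px r)\<^sup>T) *\<^sub>v z r) \<longrightarrow>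
      \<mu> * (z t \<bullet> z t) \<le> integral {t - \<epsilon>..t} (\<lambda>r. z r \<bullet> (Qh r * (Qh r)\<^sup>T *\<^sub>v z r)))"
    using ucc_form[OF ctrl cont_equivalent(1) Qcont Qhc'] by (elim exE)
  note em = conjunct1[OF em'] conjunct1[OF conjunct2[OF em']] and cf = em'[THEN conjunct2, THEN conjunct2, rule_format]
  have C: "R.controllable \<epsilon> \<mu>"
    unfolding R.controllable_def
  proof (intro conjI allI impI)
    fix t z assume t: "t0 E \<le> t - \<epsilon>" and z: "R.forced_adjoint {t - \<epsilon>..t} (\<lambda>_. 0\<^sub>v ?n) z"
    have I: "{t - \<epsilon>..t} \<subseteq> horizon E" using t by auto
    have "vec_deriv_on {t - \<epsilon>..t} ?n z (\<lambda>r. (0\<^sub>m ?n ?n - (Ae E Px r)\<^sup>T) *\<^sub>v z r)"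
    proof (rule vec_deriv_on_cong)
      show "vec_deriv_on {t - \<epsilon>..t} ?n z (\<lambda>r. information r *\<^sub>v 0\<^sub>v ?n - (Ae E Px r)\<^sup>T *\<^sub>v z r)"
        using z by (simp add: R.forced_adjoint_def)
      fix r assume r: "r \<in> {t - \<epsilon>..t}"
      have zc: "z r \<in> carrier_vec ?n" by (rule R.forced_adjoint_carrier(1)[OF z r])
      then have "0\<^sub>m ?n ?n *\<^sub>v z r = 0\<^sub>v ?n" and "dim_vec (z r) = ?n" by auto
      then show "information r *\<^sub>v 0\<^sub>v ?n - (Ae E Px r)\<^sup>T *\<^sub>v z r = (0\<^sub>m ?n ?n - (Ae E Px r)\<^sup>T) *\<^sub>v z r"
        by (simp add: mult_zero_vec dim_minus_mult_vec)
    qed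
    then have "\<mu> * (z t \<bullet> z t) \<le> integral {t - \<epsilon>..t} (\<lambda>r. z r \<bullet> (Qh r * (Qh r)\<^sup>T *\<^sub>v z r))" by (rule cf[OF I])
    also have "\<dots> = integral {t - \<epsilon>..t} (\<lambda>r. z r \<bullet> (Qe E Px r *\<^sub>v z r))"
      by (rule integral_cong) (use I in \<open>simp add: QhT subset_iff\<close>)
    finally show "\<mu> * (z t \<bullet> z t) \<le> integral {t - \<epsilon>..t} (\<lambda>r. z r \<bullet> (Qe E Px r *\<^sub>v z r))" .
  qed (fact em)+
  obtain \<epsilon>' \<mu>' where eo: "0 < \<epsilon>' \<and> 0 < \<mu>' \<and> (\<forall>s x. {s..s + \<epsilon>'} \<subseteq> horizon E \<longrightarrow>
      vec_deriv_on {s..s + \<epsilon>'} ?n x (\<lambda>r. Ae E Px r *\<^sub>v x r) \<longrightarrow>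
      \<mu>' * (x s \<bullet> x s) \<le> integral {s..s + \<epsilon>'} (\<lambda>r. (C2 E r *\<^sub>v x r) \<bullet> (C2 E r *\<^sub>v x r)))"
    using uco_form[OF obs cont_equivalent(1) cont_decoupled_2(1)] by (elim exE)
  note ofm = eo[THEN conjunct2, THEN conjunct2, rule_format]
  have O: "R.observable \<epsilon>' (\<mu>' / \<beta>)"
    unfolding R.observable_def
  proof (intro conjI allI impI)
    show "0 < \<epsilon>'" "0 < \<mu>' / \<beta>" using eo b by simp_all
    fix s x assume s: "t0 E \<le> s" and x: "vec_deriv_on {s..s + \<epsilon>'} ?n x (\<lambda>r. Ae E Px r *\<^sub>v x r)"
    have I: "{s..s + \<epsilon>'} \<subseteq> horizon E" using s by auto
    note xcont = vec_deriv_on_cont[OF x]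
    have C2c: "mat_cont_on {s..s + \<epsilon>'} (C2 E) ?l ?n" and Kc: "mat_cont_on {s..s + \<epsilon>'} information ?n ?n"
      using mat_cont_on_subset[OF _ I] cont_decoupled_2(1) information_cont by blast+
    have "\<mu>' * (x s \<bullet> x s) \<le> integral {s..s + \<epsilon>'} (\<lambda>r. (C2 E r *\<^sub>v x r) \<bullet> (C2 E r *\<^sub>v x r))"
      by (rule ofm[OF I x])
    also have "\<dots> \<le> integral {s..s + \<epsilon>'} (\<lambda>r. \<beta> * (x r \<bullet> (information r *\<^sub>v x r)))"
    proof (rule integral_le)
      show "(\<lambda>r. (C2 E r *\<^sub>v x r) \<bullet> (C2 E r *\<^sub>v x r)) integrable_on {s..s + \<epsilon>'}"
        by (rule integrable_continuous_real continuous_on_scalar_prod vec_cont_on_mult C2c xcont)+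
      show "(\<lambda>r. \<beta> * (x r \<bullet> (information r *\<^sub>v x r))) integrable_on {s..s + \<epsilon>'}"
        by (rule integrable_on_mult_right integrable_continuous_real continuous_on_scalar_prod vec_cont_on_mult Kc xcont)+
      fix r assume r: "r \<in> {s..s + \<epsilon>'}"
      have r0: "t0 E \<le> r" using r s by simp
      have dx: "dim_vec (x r) = ?n" using vec_cont_on_carrier[OF xcont r] by simp
      have "C2 E r *\<^sub>v x r \<in> carrier_vec ?l" by (rule carrier_vecI) simp
      then show "(C2 E r *\<^sub>v x r) \<bullet> (C2 E r *\<^sub>v x r) \<le> \<beta> * (x r \<bullet> (information r *\<^sub>v x r))"
        unfolding Kform[OF dx] by (rule Rinv(2)[OF r0])
    qed
    also have "\<dots> = \<beta> * integral {s..s + \<epsilon>'} (\<lambda>r. x r \<bullet> (information r *\<^sub>v x r))" by simp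
    finally show "\<mu>' / \<beta> * (x s \<bullet> x s) \<le> integral {s..s + \<epsilon>'} (\<lambda>r. x r \<bullet> (information r *\<^sub>v x r))"
      using b by (simp add: field_simps)
  qed
  have sol: "R.psd_solution P" if P: "solves_riccati E Px P" "psd ?n (P (t0 E))" for P
    unfolding R.psd_solution_def R.solution_def
    using riccati_standard_form[OF P(1)] P(2) by (simp add: psd_def)
  have Ps: "R.psd_solution Px" by (rule sol[OF riccati_Px P0])
  show "filter_uas E Px"
    unfolding filter_uas_def
  proof (rule uas_cong[OF R.closed_loop_uas[OF O C Ps]])
    fix t assume t: "t0 E \<le> t"
    have Pd: "dim_row (Px t) = ?n" "dim_col (Px t) = ?n"
      using mat_cont_on_carrier[OF cont_Px, of t] t by auto
    show "Ae E Px t - Px t * information t = Abar E Px t - gain E Px Px t * C2 E t"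
      unfolding gain_split[where P = Px and t = t, OF Pd]
      by (simp add: Pd Ae_def information_def dim_algebra) (rule eq_matI, simp_all add: Pd del: index_mult_mat(1))
  qed
  show "approaches P Px" if "solves_riccati E Px P" "psd ?n (P (t0 E))" for P
    by (rule R.solutions_approach[OF O C sol[OF that] Ps])
qed

end

theorem theorem3:
  fixes E :: elise_model
    and M :: "'w measure"
    and w v vb x dx u du d dd y yb xh dh1 dh2 dh :: "'w gproc"
    and x\<^sub>0 xh\<^sub>0 :: "'w \<Rightarrow> real vec"
    and P\<^sub>0 :: "real mat"
    and Px :: "real \<Rightarrow> real mat"
  assumes "prob_space M"
    and "standing_assms E"
    and A1_model: "noise_and_measurement_assms E"
    and A1_noise: "noise_processes E M w v vb"
    and "initial_state E M w v x\<^sub>0 xh\<^sub>0 P\<^sub>0"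
    and "plant E M w v vb x x\<^sub>0 dx u du d dd y yb"
    and "elise_filter E M Px P\<^sub>0 u du y yb xh xh\<^sub>0 dh1 dh2 dh"
  shows
    "error_dynamics E M Px w v vb (x - xh) (\<lambda>\<omega>. x\<^sub>0 \<omega> - xh\<^sub>0 \<omega>) \<and>
     (\<forall>xe xe\<^sub>0 ye ue xhe xhe\<^sub>0.
        virtual_system E M Px w v vb xe xe\<^sub>0 ye ue \<and> kalman_bucy_filter E M Px ye ue xhe xhe\<^sub>0 \<longrightarrow>
        error_dynamics E M Px w v vb (xe - xhe) (\<lambda>\<omega>. xe\<^sub>0 \<omega> - xhe\<^sub>0 \<omega>)) \<and>
     delta_cov M (t0 E) (nx E) (nx E) (wbar E Px w v vb) (wbar E Px w v vb)
       (\<lambda>t. Qbar E Px t + (cross E Px t + (cross E Px t)\<^sup>T)) \<and>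
     delta_cov M (t0 E) (nx E) (nx E) (we E Px w v vb) (we E Px w v vb)
       (\<lambda>t. Qe E Px t + (cross E Px t + (cross E Px t)\<^sup>T)) \<and>
     ((\<forall>t\<ge>t0 E. cross E Px t + (cross E Px t)\<^sup>T = 0\<^sub>m (nx E) (nx E)) \<longrightarrow>
        delta_cov M (t0 E) (nx E) (nx E) (wbar E Px w v vb) (wbar E Px w v vb) (Qbar E Px) \<and>
        delta_cov M (t0 E) (nx E) (nx E) (we E Px w v vb) (we E Px w v vb) (Qe E Px)) \<and>
     (uco (nx E) (horizon E) (Ae E Px) (C2 E) \<and>
      (\<exists>Qh. (\<forall>t\<ge>t0 E. is_psd_sqrt (nx E) (Qe E Px t) (Qh t)) \<and> ucc (nx E) (horizon E) (Ae E Px) Qh) \<and>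
      norm_bounded_below_above (horizon E) (Qe E Px) \<and>
      norm_bounded_below_above (horizon E) (R2 E) \<and>
      uniformly_pd (ny E - rH E) (horizon E) (R2 E) \<and>
      (\<exists>\<alpha>. \<forall>t\<ge>t0 E. mnorm (Ae E Px t) \<le> \<alpha>)
      \<longrightarrow>
      filter_uas E Px \<and>
      (\<forall>P. solves_riccati E Px P \<and> pd (nx E) (P (t0 E)) \<longrightarrow>
         approaches P Px \<and>
         (\<forall>P'. (\<forall>t\<ge>t0 E. P' t \<in> carrier_mat (nx E) (nx E)) \<and> approaches P P' \<longrightarrow>
            approaches P' Px)))"
proof -
  note filt = assms(7)[unfolded elise_filter_def] and pl = assms(6)[unfolded plant_def]
    and init = assms(5)[unfolded initial_state_def] and noise = A1_noise[unfolded noise_processes_def]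
  interpret elise E Px
    by unfold_locales (use assms(2) A1_model filt in auto)
  have gx: "gproc M (t0 E) (nx E) x" "gproc M (t0 E) (nx E) xh" "gproc M (t0 E) (nd E) d" "gproc M (t0 E) (nd E) dd"
      "gproc M (t0 E) (nw E) w" "gproc M (t0 E) (ny E) v"
    using pl filt noise by simp_all
  have rv: "random_vec M (nx E) x\<^sub>0" "random_vec M (nx E) xh\<^sub>0" using init by simp_all
  have 1: "error_dynamics E M Px w v vb (x - xh) (\<lambda>\<omega>. x\<^sub>0 \<omega> - xh\<^sub>0 \<omega>)"
    unfolding error_dynamics_def
  proof (rule gp_deriv_diff[OF _ _ rv])
    show "gp_deriv M (t0 E) (nx E) x x\<^sub>0 dx" using pl by simp
    show "gp_deriv M (t0 E) (nx E) xh xh\<^sub>0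
       (Am E *\<^sub>g xh + Bm E *\<^sub>g u + G1 E *\<^sub>g dh1 + G2 E *\<^sub>g dh2
        + gain E Px Px *\<^sub>g (T2 E *\<^sub>g y - C2 E *\<^sub>g xh - D2 E *\<^sub>g u))" using filt by simp
    show "gp_eq M (t0 E) (nx E)
      (dx - (Am E *\<^sub>g xh + Bm E *\<^sub>g u + G1 E *\<^sub>g dh1 + G2 E *\<^sub>g dh2
        + gain E Px Px *\<^sub>g (T2 E *\<^sub>g y - C2 E *\<^sub>g xh - D2 E *\<^sub>g u)))
      ((\<lambda>t. Abar E Px t - gain E Px Px t * C2 E t) *\<^sub>g (x - xh)
        + wbar E Px w v vb - gain E Px Px *\<^sub>g (T2 E *\<^sub>g v))"
      by (rule filter_error[OF gx, where yb = yb and du = du]) (insert pl filt, (elim conjE, assumption)+)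
  qed
  have 2: "error_dynamics E M Px w v vb (xe - xhe) (\<lambda>\<omega>. xe\<^sub>0 \<omega> - xhe\<^sub>0 \<omega>)"
    if "virtual_system E M Px w v vb xe xe\<^sub>0 ye ue" "kalman_bucy_filter E M Px ye ue xhe xhe\<^sub>0"
    for xe xe\<^sub>0 ye ue xhe xhe\<^sub>0
  proof -
    note vs = that(1)[unfolded virtual_system_def] and kb = that(2)[unfolded kalman_bucy_filter_def]
    show ?thesis
      unfolding error_dynamics_def
    proof (rule gp_deriv_diff)
      show "gp_deriv M (t0 E) (nx E) xe xe\<^sub>0 (Ae E Px *\<^sub>g xe + ue + we E Px w v vb)" using vs by simp
      show "gp_deriv M (t0 E) (nx E) xhe xhe\<^sub>0
       (Ae E Px *\<^sub>g xhe + ue + (\<lambda>t. Px t * (C2 E t)\<^sup>T * minv (R2 E t)) *\<^sub>g (ye - C2 E *\<^sub>g xhe))" using kb by simp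
      show "random_vec M (nx E) xe\<^sub>0" "random_vec M (nx E) xhe\<^sub>0" using vs kb by simp_all
      show "gp_eq M (t0 E) (nx E)
      ((Ae E Px *\<^sub>g xe + ue + we E Px w v vb)
        - (Ae E Px *\<^sub>g xhe + ue + (\<lambda>t. Px t * (C2 E t)\<^sup>T * minv (R2 E t)) *\<^sub>g (ye - C2 E *\<^sub>g xhe)))
      ((\<lambda>t. Abar E Px t - gain E Px Px t * C2 E t) *\<^sub>g (xe - xhe)
        + wbar E Px w v vb - gain E Px Px *\<^sub>g (T2 E *\<^sub>g v))"
        by (rule virtual_error) (use vs kb noise in simp_all)
    qed
  qed
  note 3 = noise_intensities[OF A1_noise]
  have 4: "delta_cov M (t0 E) (nx E) (nx E) (wbar E Px w v vb) (wbar E Px w v vb) (Qbar E Px)"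
    "delta_cov M (t0 E) (nx E) (nx E) (we E Px w v vb) (we E Px w v vb) (Qe E Px)"
    if z: "\<forall>t\<ge>t0 E. cross E Px t + (cross E Px t)\<^sup>T = 0\<^sub>m (nx E) (nx E)"
    by (rule delta_cov_cong[OF 3(1)] delta_cov_cong[OF 3(2)]; simp add: z dim_add_zero)+
  have P0: "psd (nx E) (Px (t0 E))"
  proof -
    have "psd (nx E) P\<^sub>0"
      by (rule covariance_psd[where e = "\<lambda>\<omega>. x\<^sub>0 \<omega> - xh\<^sub>0 \<omega>" and M = M]) (use init in simp_all)
    then show ?thesis using filt by simp
  qed
  have 5: "filter_uas E Px \<and>
      (\<forall>P. solves_riccati E Px P \<and> pd (nx E) (P (t0 E)) \<longrightarrow>
         approaches P Px \<and>
         (\<forall>P'. (\<forall>t\<ge>t0 E. P' t \<in> carrier_mat (nx E) (nx E)) \<and> approaches P P' \<longrightarrow>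
            approaches P' Px))"
    if obs: "uco (nx E) (horizon E) (Ae E Px) (C2 E)"
      and ctrl: "\<exists>Qh. (\<forall>t\<ge>t0 E. is_psd_sqrt (nx E) (Qe E Px t) (Qh t)) \<and> ucc (nx E) (horizon E) (Ae E Px) Qh"
      and Qb: "norm_bounded_below_above (horizon E) (Qe E Px)"
      and Rb: "norm_bounded_below_above (horizon E) (R2 E)"
      and Rp: "uniformly_pd (ny E - rH E) (horizon E) (R2 E)"
      and Ab: "\<exists>\<alpha>. \<forall>t\<ge>t0 E. mnorm (Ae E Px t) \<le> \<alpha>"
  proof -
    obtain Qh where Qh: "(\<forall>t\<ge>t0 E. is_psd_sqrt (nx E) (Qe E Px t) (Qh t)) \<and> ucc (nx E) (horizon E) (Ae E Px) Qh"
      using ctrl by (rule exE)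
    obtain \<alpha> where \<alpha>: "\<forall>t\<ge>t0 E. mnorm (Ae E Px t) \<le> \<alpha>" using Ab by (rule exE)
    note fs = filter_stability[OF P0 obs conjunct1[OF Qh] conjunct2[OF Qh] Qb Rb Rp \<alpha>]
    show ?thesis
    proof (intro conjI allI impI; (elim conjE)?)
      show "filter_uas E Px" by (rule fs(1))
      fix P assume P: "solves_riccati E Px P" "pd (nx E) (P (t0 E))"
      show ap: "approaches P Px" by (rule fs(2)[OF P(1) pd_imp_psd[OF P(2)]])
      fix P' assume P': "\<forall>t\<ge>t0 E. P' t \<in> carrier_mat (nx E) (nx E)" "approaches P P'"
      show "approaches P' Px"
        by (rule approaches_sandwich[OF ap P'(2), of "t0 E" "nx E"])
          (use P(1) P'(1) riccati_Px in \<open>simp_all add: solves_riccati_def\<close>)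
    qed
  qed
  show ?thesis
    by (rule conjI[OF 1 conjI[OF _ conjI[OF 3(1) conjI[OF 3(2) conjI]]]])
      ((intro allI impI, elim conjE, rule 2, assumption+),
      (intro impI conjI, (rule 4, assumption)+), (intro impI, elim conjE, rule 5, assumption+))
qed

end
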